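(* The equivalence $K\colon\mathrm{ShMulti}_{lr}\to\mathrm{SkMon}_{ln}$ between left representable short multicategories and left normal skew monoidal categories (defined in the context) restricts to an equivalence $K^{cl}_{lr}\colon\mathrm{ShMulti}^{cl}_{lr}\to\mathrm{SkMon}^{cl}_{ln}$ between left representable closed short multicategories and left normal closed skew monoidal categories, which fits in a commutative triangle of equivalences $T^{cl}_{lr}=K^{cl}_{lr}\circ U^{cl}_{lr}$, where $U^{cl}_{lr}\colon\mathrm{Multi}^{cl}_{lr}\to\mathrm{ShMulti}^{cl}_{lr}$ is the forgetful functor and $T^{cl}_{lr}\colon\mathrm{Multi}^{cl}_{lr}\to\mathrm{SkMon}^{cl}_{ln}$ is the known equivalence between left representable closed multicategories and left normal closed skew monoidal categories.
   Context: **Short multicategories.** A short multicategory $\mathbb C$ consists of a category $\mathcal C$; for $0\le n\le 4$ a functor $\mathbb C_n(-;-)\colon(\mathcal C^n)^{op}\times\mathcal C\to\mathrm{Set}$ (elements of $\mathbb C_n(a_1,\dots,a_n;b)$ are called $n$-ary maps), with $\mathbb C_1(-;-)=\mathcal C(-,-)$; one writes $q\circ f$ and $f\circ_i p$ for the functorial action of a unary map $q$ on the codomain and of a unary map $p$ on the $i$-th input. Furthermore there are substitution functions $\circ_i\colon\mathbb C_n(\bar b;c)\times\mathbb C_m(\bar a;b_i)\to\mathbb C_{n+m-1}(\bar b_{<i},\bar a,\bar b_{>i};c)$ for $1\le i\le n$ and $(n,m)\in\{(2,2),(3,2),(2,3),(2,0),(3,0)\}$, natural in all $a_k$, all $b_k$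 with $k\ne i$, and $c$, and dinatural in $b_i$. For $f$ binary, $g$ $n$-ary and $h$ $p$-ary, one requires: (A) $f\circ_i(g\circ_j h)=(f\circ_i g)\circ_{j+i-1}h$ for $1\le i\le 2$, $1\le j\le n$, when $(n,p)\in\{(2,2),(2,0)\}$; (B) $(f\circ_1 g)\circ_{n+1}h=(f\circ_2 h)\circ_1 g$ when $(n,p)\in\{(2,2),(2,0),(0,2),(0,0)\}$. A morphism $F\colon\mathbb C\to\mathbb D$ is a functor $F\colon\mathcal C\to\mathcal D$ with natural families $F_n\colon\mathbb C_n(\bar a;b)\to\mathbb D_n(F\bar a;Fb)$, $0\le n\le4$, $F_1$ being the functor action, commuting with all substitutions $\circ_i$. **Left representability and closedness (short).** A short multicategory is left representable if there are binary maps $\theta_{a,b}\colon a,b\to ab$ (for all $a,b$) and a nullary map $u\in\mathbb C_0(\,;i)$ such that $-\circ_1\theta_{a,b}\colon\mathbb C_n(ab,\bar x;d)\to\mathbb C_{n+1}(a,b,\bar x;d)$ is bijective for $n=1,2,3$ and $-\circ_1u\colon\mathbb C_{n+1}(i,\bar x;d)\to\mathbb C_n(\bar x;d)$ is bijective for $n=0,1,2$. It is closed if for all $b,c$ there are an object $[b,c]$ and a binary map $e_{b,c}\colon[b,c],b\to c$ such that $e_{b,c}\circ_1-\colon\mathbb C_n(\bar x;[b,c])\to\mathbb C_{n+1}(\bar x,b;c)$ is bijective for $n=0,1,2,3$. $\mathrm{ShMulti}_{lr}$ and $\mathrm{ShMulti}^{cl}_{lr}$ are the full subcategories of short multicategories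 that are left representable, resp. left representable and closed. **Multicategories.** $\mathrm{Multi}^{cl}_{lr}$ is the category of left representable closed multicategories (non-symmetric) and multifunctors. Left representable: for every list $\bar a$ of length $n\ge0$ there is a multimap $\theta_{\bar a}\colon\bar a\to m\bar a$ such that $-\circ_1\theta_{\bar a}\colon\mathbb C_{1+r}(m\bar a,\bar y;d)\to\mathbb C_{n+r}(\bar a,\bar y;d)$ is bijective for all $\bar y$ of any length $r\ge0$ and all $d$. Closed: for all $b,c$ there are an object $[b,c]$ and a binary map $e_{b,c}\colon[b,c],b\to c$ such that $e_{b,c}\circ_1-\colon\mathbb C_n(\bar x;[b,c])\to\mathbb C_{n+1}(\bar x,b;c)$ is bijective for all $n\ge0$. $U^{cl}_{lr}$ keeps the category of unary maps, the $n$-ary maps for $n\le4$, and the substitutions of $m$-ary maps into $n$-ary maps for $(n,m)\in\{(2,2),(3,2),(2,3),(2,0),(3,0)\}$, and forgets the rest. **Skew monoidal categories.** A (left) skew monoidal category is a category $\mathcal C$ with a functor $(a,b)\mapsto ab$, $\mathcal C\times\mathcal C\to\mathcal C$, an object $i$, and natural families $\alpha_{a,b,c}\colon(ab)c\to a(bc)$, $\lambda_a\colon ia\to a$, $\rho_a\colon a\to ai$ (not necessarily invertible) satisfying $\alpha_{a,b,cd}\alpha_{ab,c,d}=(a\,\alpha_{b,c,d})\alpha_{a,bc,d}(\alpha_{a,b,c}\,d)$, $\lambda_{ab}\alpha_{i,a,b}=\lambda_a b$, $\alpha_{a,b,i}\rho_{ab}=a\rho_b$, $(a\lambda_b)\alpha_{a,i,b}(\rho_a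 b)=1_{ab}$, $\lambda_i\rho_i=1_i$. It is left normal if $\lambda$ is invertible, and closed if each functor $-\otimes b\colon a\mapsto ab$ has a right adjoint $[b,-]$. A lax monoidal functor is a functor $F$ with a map $f_0\colon i\to Fi$ and a natural family $f_2\colon FaFb\to F(ab)$ such that $F\alpha\circ f_2\circ(f_2\cdot Fc)=f_2\circ(Fa\cdot f_2)\circ\alpha$, $F\lambda\circ f_2\circ(f_0\cdot Fa)=\lambda$, $f_2\circ(Fa\cdot f_0)\circ\rho=F\rho$. $\mathrm{SkMon}_{ln}$ (resp. $\mathrm{SkMon}^{cl}_{ln}$) is the category of left normal (resp. left normal closed) skew monoidal categories and lax monoidal functors. **The functors $K$ and $T^{cl}_{lr}$.** For each left representable short multicategory fix a choice of binary maps $\theta_{a,b}\colon a,b\to ab$ (for all $a,b$) and of a nullary map $u\in\mathbb C_0(\,;i)$ such that $-\circ_1\theta_{a,b}\colon\mathbb C_n(ab,\bar x;d)\to\mathbb C_{n+1}(a,b,\bar x;d)$ is bijective for $n=1,2,3$ and $-\circ_1u\colon\mathbb C_{n+1}(i,\bar x;d)\to\mathbb C_n(\bar x;d)$ is bijective for $n=0,1,2$. $K\mathbb C$ has underlying category $\mathcal C$, tensor $ab$, unit $i$; for $f\colon a\to b$, $g\colon c\to d$, $fg\colon ac\to bd$ is the unique map with $(fg)\circ\theta_{a,c}=(\theta_{b,d}\circ_1f)\circ_2g$; $\alpha$ is the unique map with $(\alpha\circ\theta_{ab,c})\circ_1\theta_{a,b}=\theta_{a,bc}\circ_2\theta_{b,c}$;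 $\lambda_a$ is the unique map with $(\lambda_a\circ\theta_{i,a})\circ_1u=1_a$; $\rho_a=\theta_{a,i}\circ_2u$. On a morphism $F$, $KF=(F,f_0,f_2)$ where $f_2$ is the unique map with $f_2\circ\theta_{Fa,Fb}=F_2(\theta_{a,b})$ and $f_0$ the unique map with $f_0\circ u=F_0(u)$. $T^{cl}_{lr}$ is given by the same formulas in a left representable closed multicategory (with the same choices of binary and nullary classifiers); it is known to be an equivalence. *)

theory Defs
  imports "HOL-Library.FuncSet"
begin

section \<open>Categories, functors, equivalences\<close>

text \<open>
  Hom-sets are families of sets and need not be disjoint; hence composition and the action of a
  functor on arrows carry the objects involved as arguments. \<open>Comp C a b c g f\<close> is the composite
  of \<open>f : a \<rightarrow> b\<close> and \<open>g : b \<rightarrow> c\<close>. The ambient HOL types play the role of the universe of small sets.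
\<close>

record ('o, 'm) category =
  Obj :: "'o set"
  Hom :: "'o \<Rightarrow> 'o \<Rightarrow> 'm set"
  Id :: "'o \<Rightarrow> 'm"
  Comp :: "'o \<Rightarrow> 'o \<Rightarrow> 'o \<Rightarrow> 'm \<Rightarrow> 'm \<Rightarrow> 'm"

locale is_category =
  fixes C :: "('o, 'm, 'x) category_scheme"
  assumes Id_in_Hom: "a \<in> Obj C \<Longrightarrow> Id C a \<in> Hom C a a"
    and Comp_in_Hom: "\<lbrakk>a \<in> Obj C; b \<in> Obj C; c \<in> Obj C; f \<in> Hom C a b; g \<in> Hom C b c\<rbrakk>
      \<Longrightarrow> Comp C a b c g f \<in> Hom C a c"
    and Comp_Id_right: "\<lbrakk>a \<in> Obj C; b \<in> Obj C; f \<in> Hom C a b\<rbrakk> \<Longrightarrow> Comp C a a b f (Id C a) = f"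
    and Comp_Id_left: "\<lbrakk>a \<in> Obj C; b \<in> Obj C; f \<in> Hom C a b\<rbrakk> \<Longrightarrow> Comp C a b b (Id C b) f = f"
    and Comp_assoc: "\<lbrakk>a \<in> Obj C; b \<in> Obj C; c \<in> Obj C; d \<in> Obj C;
        f \<in> Hom C a b; g \<in> Hom C b c; h \<in> Hom C c d\<rbrakk>
      \<Longrightarrow> Comp C a c d h (Comp C a b c g f) = Comp C a b d (Comp C b c d h g) f"

definition is_iso :: "('o, 'm, 'x) category_scheme \<Rightarrow> 'o \<Rightarrow> 'o \<Rightarrow> 'm \<Rightarrow> bool" where
  "is_iso C a b f \<longleftrightarrow> f \<in> Hom C a b \<and>
     (\<exists>g \<in> Hom C b a. Comp C a b a g f = Id C a \<and> Comp C b a b f g = Id C b)"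

definition full_subcat :: "('o, 'm) category \<Rightarrow> ('o \<Rightarrow> bool) \<Rightarrow> ('o, 'm) category" where
  "full_subcat C P = C\<lparr>Obj := {a \<in> Obj C. P a}\<rparr>"

text \<open>
  Functors are required to be \<open>undefined\<close> outside their domain, so that equality of functors is
  equality in HOL.
\<close>

record ('o, 'm, 'p, 'n) cat_functor =
  fobj :: "'o \<Rightarrow> 'p"
  farr :: "'o \<Rightarrow> 'o \<Rightarrow> 'm \<Rightarrow> 'n"

definition mk_functor ::
  "('o, 'm, 'x) category_scheme \<Rightarrow> ('o \<Rightarrow> 'p) \<Rightarrow> ('o \<Rightarrow> 'o \<Rightarrow> 'm \<Rightarrow> 'n) \<Rightarrow> ('o, 'm, 'p, 'n) cat_functor" where
  "mk_functor C F0 F1 =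
    \<lparr>fobj = restrict F0 (Obj C),
     farr = (\<lambda>a b f. if a \<in> Obj C \<and> b \<in> Obj C \<and> f \<in> Hom C a b then F1 a b f else undefined)\<rparr>"

locale is_functor =
  dom: is_category C + cod: is_category D
  for C :: "('o, 'm, 'x) category_scheme" and D :: "('p, 'n, 'y) category_scheme" +
  fixes F :: "('o, 'm, 'p, 'n) cat_functor"
  assumes extensional: "F = mk_functor C (fobj F) (farr F)"
    and fobj_in_Obj: "a \<in> Obj C \<Longrightarrow> fobj F a \<in> Obj D"
    and farr_in_Hom: "\<lbrakk>a \<in> Obj C; b \<in> Obj C; f \<in> Hom C a b\<rbrakk>
      \<Longrightarrow> farr F a b f \<in> Hom D (fobj F a) (fobj F b)"
    and farr_Id: "a \<in> Obj C \<Longrightarrow> farr F a a (Id C a) = Id D (fobj F a)"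
    and farr_Comp: "\<lbrakk>a \<in> Obj C; b \<in> Obj C; c \<in> Obj C; f \<in> Hom C a b; g \<in> Hom C b c\<rbrakk>
      \<Longrightarrow> farr F a c (Comp C a b c g f)
        = Comp D (fobj F a) (fobj F b) (fobj F c) (farr F b c g) (farr F a b f)"

definition id_functor :: "('o, 'm, 'x) category_scheme \<Rightarrow> ('o, 'm, 'o, 'm) cat_functor" where
  "id_functor C = mk_functor C (\<lambda>a. a) (\<lambda>a b f. f)"

definition comp_functor ::
  "('o, 'm, 'x) category_scheme \<Rightarrow> ('p, 'n, 'q, 'k) cat_functor \<Rightarrow> ('o, 'm, 'p, 'n) cat_functor
    \<Rightarrow> ('o, 'm, 'q, 'k) cat_functor" where
  "comp_functor C G F =
    mk_functor C (\<lambda>a. fobj G (fobj F a)) (\<lambda>a b f. farr G (fobj F a) (fobj F b) (farr F a b f))"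

text \<open>\<open>restrict_functor S F\<close> restricts \<open>F\<close> to a subcategory \<open>S\<close> of its domain.\<close>

definition restrict_functor ::
  "('o, 'm, 'x) category_scheme \<Rightarrow> ('o, 'm, 'p, 'n) cat_functor \<Rightarrow> ('o, 'm, 'p, 'n) cat_functor" where
  "restrict_functor S F = mk_functor S (fobj F) (farr F)"

definition nat_iso ::
  "('o, 'm, 'x) category_scheme \<Rightarrow> ('p, 'n, 'y) category_scheme \<Rightarrow> ('o, 'm, 'p, 'n) cat_functor
    \<Rightarrow> ('o, 'm, 'p, 'n) cat_functor \<Rightarrow> ('o \<Rightarrow> 'n) \<Rightarrow> bool" where
  "nat_iso C D F G \<eta> \<longleftrightarrow>
    (\<forall>a \<in> Obj C. is_iso D (fobj F a) (fobj G a) (\<eta> a)) \<and>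
    (\<forall>a \<in> Obj C. \<forall>b \<in> Obj C. \<forall>f \<in> Hom C a b.
       Comp D (fobj F a) (fobj F b) (fobj G b) (\<eta> b) (farr F a b f)
     = Comp D (fobj F a) (fobj G a) (fobj G b) (farr G a b f) (\<eta> a))"

definition is_equivalence ::
  "('o, 'm, 'x) category_scheme \<Rightarrow> ('p, 'n, 'y) category_scheme \<Rightarrow> ('o, 'm, 'p, 'n) cat_functor \<Rightarrow> bool" where
  "is_equivalence C D F \<longleftrightarrow> is_functor C D F \<and>
    (\<exists>G \<eta> \<epsilon>. is_functor D C G \<and>
       nat_iso C C (id_functor C) (comp_functor C G F) \<eta> \<and>
       nat_iso D D (comp_functor D F G) (id_functor D) \<epsilon>)"

definition has_right_adjoint ::
  "('o, 'm, 'x) category_scheme \<Rightarrow> ('p, 'n, 'y) category_scheme \<Rightarrow> ('o, 'm, 'p, 'n) cat_functor \<Rightarrow> bool" where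
  "has_right_adjoint C D F \<longleftrightarrow> is_functor C D F \<and>
    (\<exists>G \<phi>. is_functor D C G \<and>
      (\<forall>a \<in> Obj C. \<forall>b \<in> Obj D. bij_betw (\<phi> a b) (Hom D (fobj F a) b) (Hom C a (fobj G b))) \<and>
      (\<forall>a \<in> Obj C. \<forall>a' \<in> Obj C. \<forall>b \<in> Obj D. \<forall>h \<in> Hom C a' a. \<forall>k \<in> Hom D (fobj F a) b.
         \<phi> a' b (Comp D (fobj F a') (fobj F a) b k (farr F a' a h))
       = Comp C a' a (fobj G b) (\<phi> a b k) h) \<and>
      (\<forall>a \<in> Obj C. \<forall>b \<in> Obj D. \<forall>b' \<in> Obj D. \<forall>q \<in> Hom D b b'. \<forall>k \<in> Hom D (fobj F a) b.
         \<phi> a b' (Comp D (fobj F a) b b' q k)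
       = Comp C a (fobj G b) (fobj G b') (farr G b b' q) (\<phi> a b k)))"


section \<open>Skew monoidal categories\<close>

text \<open>
  For \<open>f : a \<rightarrow> b\<close> and \<open>g : c \<rightarrow> d\<close>, \<open>tarr V a b c d f g : ac \<rightarrow> bd\<close> is the tensor \<open>fg\<close>;
  \<open>assr\<close>, \<open>lunit\<close>, \<open>runit\<close> are the families \<open>\<alpha>\<close>, \<open>\<lambda>\<close>, \<open>\<rho>\<close>.
\<close>

record ('o, 'm) skew_mon = "('o, 'm) category" +
  tobj :: "'o \<Rightarrow> 'o \<Rightarrow> 'o" (infixl "\<otimes>\<index>" 70)
  tarr :: "'o \<Rightarrow> 'o \<Rightarrow> 'o \<Rightarrow> 'o \<Rightarrow> 'm \<Rightarrow> 'm \<Rightarrow> 'm"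
  tunit :: "'o" ("\<one>\<index>")
  assr :: "'o \<Rightarrow> 'o \<Rightarrow> 'o \<Rightarrow> 'm"
  lunit :: "'o \<Rightarrow> 'm"
  runit :: "'o \<Rightarrow> 'm"

locale skew_monoidal = is_category V
  for V :: "('o, 'm) skew_mon" (structure) +
  assumes tobj_in_Obj: "\<lbrakk>a \<in> Obj V; b \<in> Obj V\<rbrakk> \<Longrightarrow> a \<otimes> b \<in> Obj V"
    and tunit_in_Obj: "\<one> \<in> Obj V"
    and tarr_in_Hom: "\<lbrakk>a \<in> Obj V; b \<in> Obj V; c \<in> Obj V; d \<in> Obj V; f \<in> Hom V a b; g \<in> Hom V c d\<rbrakk>
      \<Longrightarrow> tarr V a b c d f g \<in> Hom V (a \<otimes> c) (b \<otimes> d)"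
    and tarr_Id: "\<lbrakk>a \<in> Obj V; b \<in> Obj V\<rbrakk> \<Longrightarrow> tarr V a a b b (Id V a) (Id V b) = Id V (a \<otimes> b)"
    and tarr_Comp: "\<lbrakk>a \<in> Obj V; b \<in> Obj V; c \<in> Obj V; a' \<in> Obj V; b' \<in> Obj V; c' \<in> Obj V;
        f \<in> Hom V a b; g \<in> Hom V b c; f' \<in> Hom V a' b'; g' \<in> Hom V b' c'\<rbrakk>
      \<Longrightarrow> tarr V a c a' c' (Comp V a b c g f) (Comp V a' b' c' g' f')
        = Comp V (a \<otimes> a') (b \<otimes> b') (c \<otimes> c') (tarr V b c b' c' g g') (tarr V a b a' b' f f')"
    and assr_in_Hom: "\<lbrakk>a \<in> Obj V; b \<in> Obj V; c \<in> Obj V\<rbrakk>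
      \<Longrightarrow> assr V a b c \<in> Hom V ((a \<otimes> b) \<otimes> c) (a \<otimes> (b \<otimes> c))"
    and lunit_in_Hom: "a \<in> Obj V \<Longrightarrow> lunit V a \<in> Hom V (\<one> \<otimes> a) a"
    and runit_in_Hom: "a \<in> Obj V \<Longrightarrow> runit V a \<in> Hom V a (a \<otimes> \<one>)"
    and assr_natural: "\<lbrakk>a \<in> Obj V; b \<in> Obj V; c \<in> Obj V; a' \<in> Obj V; b' \<in> Obj V; c' \<in> Obj V;
        f \<in> Hom V a a'; g \<in> Hom V b b'; h \<in> Hom V c c'\<rbrakk>
      \<Longrightarrow> Comp V ((a \<otimes> b) \<otimes> c) (a \<otimes> (b \<otimes> c)) (a' \<otimes> (b' \<otimes> c'))
            (tarr V a a' (b \<otimes> c) (b' \<otimes> c') f (tarr V b b' c c' g h)) (assr V a b c)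
        = Comp V ((a \<otimes> b) \<otimes> c) ((a' \<otimes> b') \<otimes> c') (a' \<otimes> (b' \<otimes> c'))
            (assr V a' b' c') (tarr V (a \<otimes> b) (a' \<otimes> b') c c' (tarr V a a' b b' f g) h)"
    and lunit_natural: "\<lbrakk>a \<in> Obj V; b \<in> Obj V; f \<in> Hom V a b\<rbrakk>
      \<Longrightarrow> Comp V (\<one> \<otimes> a) a b f (lunit V a)
        = Comp V (\<one> \<otimes> a) (\<one> \<otimes> b) b (lunit V b) (tarr V \<one> \<one> a b (Id V \<one>) f)"
    and runit_natural: "\<lbrakk>a \<in> Obj V; b \<in> Obj V; f \<in> Hom V a b\<rbrakk>
      \<Longrightarrow> Comp V a b (b \<otimes> \<one>) (runit V b) f
        = Comp V a (a \<otimes> \<one>) (b \<otimes> \<one>) (tarr V a b \<one> \<one> f (Id V \<one>)) (runit V a)"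
    and pentagon: "\<lbrakk>a \<in> Obj V; b \<in> Obj V; c \<in> Obj V; d \<in> Obj V\<rbrakk>
      \<Longrightarrow> Comp V (((a \<otimes> b) \<otimes> c) \<otimes> d) ((a \<otimes> b) \<otimes> (c \<otimes> d)) (a \<otimes> (b \<otimes> (c \<otimes> d)))
            (assr V a b (c \<otimes> d)) (assr V (a \<otimes> b) c d)
        = Comp V (((a \<otimes> b) \<otimes> c) \<otimes> d) (a \<otimes> ((b \<otimes> c) \<otimes> d)) (a \<otimes> (b \<otimes> (c \<otimes> d)))
            (tarr V a a ((b \<otimes> c) \<otimes> d) (b \<otimes> (c \<otimes> d)) (Id V a) (assr V b c d))
            (Comp V (((a \<otimes> b) \<otimes> c) \<otimes> d) ((a \<otimes> (b \<otimes> c)) \<otimes> d) (a \<otimes> ((b \<otimes> c) \<otimes> d))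
              (assr V a (b \<otimes> c) d)
              (tarr V ((a \<otimes> b) \<otimes> c) (a \<otimes> (b \<otimes> c)) d d (assr V a b c) (Id V d)))"
    and lunit_assr: "\<lbrakk>a \<in> Obj V; b \<in> Obj V\<rbrakk>
      \<Longrightarrow> Comp V ((\<one> \<otimes> a) \<otimes> b) (\<one> \<otimes> (a \<otimes> b)) (a \<otimes> b) (lunit V (a \<otimes> b)) (assr V \<one> a b)
        = tarr V (\<one> \<otimes> a) a b b (lunit V a) (Id V b)"
    and assr_runit: "\<lbrakk>a \<in> Obj V; b \<in> Obj V\<rbrakk>
      \<Longrightarrow> Comp V (a \<otimes> b) ((a \<otimes> b) \<otimes> \<one>) (a \<otimes> (b \<otimes> \<one>)) (assr V a b \<one>) (runit V (a \<otimes> b))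
        = tarr V a a b (b \<otimes> \<one>) (Id V a) (runit V b)"
    and lunit_assr_runit: "\<lbrakk>a \<in> Obj V; b \<in> Obj V\<rbrakk>
      \<Longrightarrow> Comp V (a \<otimes> b) (a \<otimes> (\<one> \<otimes> b)) (a \<otimes> b)
            (tarr V a a (\<one> \<otimes> b) b (Id V a) (lunit V b))
            (Comp V (a \<otimes> b) ((a \<otimes> \<one>) \<otimes> b) (a \<otimes> (\<one> \<otimes> b))
              (assr V a \<one> b) (tarr V a (a \<otimes> \<one>) b b (runit V a) (Id V b)))
        = Id V (a \<otimes> b)"
    and lunit_runit: "Comp V \<one> (\<one> \<otimes> \<one>) \<one> (lunit V \<one>) (runit V \<one>) = Id V \<one>"

definition left_normal :: "('o, 'm) skew_mon \<Rightarrow> bool" where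
  "left_normal V \<longleftrightarrow> (\<forall>a \<in> Obj V. is_iso V (tobj V (tunit V) a) a (lunit V a))"

definition right_tensor :: "('o, 'm) skew_mon \<Rightarrow> 'o \<Rightarrow> ('o, 'm, 'o, 'm) cat_functor" where
  "right_tensor V b = mk_functor V (\<lambda>a. tobj V a b) (\<lambda>a a' f. tarr V a a' b b f (Id V b))"

definition closed_skew_mon :: "('o, 'm) skew_mon \<Rightarrow> bool" where
  "closed_skew_mon V \<longleftrightarrow> (\<forall>b \<in> Obj V. has_right_adjoint V V (right_tensor V b))"

record ('o, 'm) lax_mon =
  lfun :: "('o, 'm, 'o, 'm) cat_functor"
  lax0 :: "'m"
  lax2 :: "'o \<Rightarrow> 'o \<Rightarrow> 'm"

abbreviation lobj :: "('o, 'm) lax_mon \<Rightarrow> 'o \<Rightarrow> 'o" where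
  "lobj F \<equiv> fobj (lfun F)"

abbreviation larr :: "('o, 'm) lax_mon \<Rightarrow> 'o \<Rightarrow> 'o \<Rightarrow> 'm \<Rightarrow> 'm" where
  "larr F \<equiv> farr (lfun F)"

locale lax_monoidal =
  src: skew_monoidal V + tgt: skew_monoidal W
  for V :: "('o, 'm) skew_mon" (structure) and W :: "('o, 'm) skew_mon" +
  fixes F :: "('o, 'm) lax_mon"
  assumes underlying_functor: "is_functor V W (lfun F)"
    and lax2_extensional: "\<not> (a \<in> Obj V \<and> b \<in> Obj V) \<Longrightarrow> lax2 F a b = undefined"
    and lax0_in_Hom: "lax0 F \<in> Hom W \<one>\<^bsub>W\<^esub> (lobj F \<one>)"
    and lax2_in_Hom: "\<lbrakk>a \<in> Obj V; b \<in> Obj V\<rbrakk>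
      \<Longrightarrow> lax2 F a b \<in> Hom W (lobj F a \<otimes>\<^bsub>W\<^esub> lobj F b) (lobj F (a \<otimes> b))"
    and lax2_natural: "\<lbrakk>a \<in> Obj V; b \<in> Obj V; a' \<in> Obj V; b' \<in> Obj V; f \<in> Hom V a a'; g \<in> Hom V b b'\<rbrakk>
      \<Longrightarrow> Comp W (lobj F a \<otimes>\<^bsub>W\<^esub> lobj F b) (lobj F (a \<otimes> b)) (lobj F (a' \<otimes> b'))
            (larr F (a \<otimes> b) (a' \<otimes> b') (tarr V a a' b b' f g)) (lax2 F a b)
        = Comp W (lobj F a \<otimes>\<^bsub>W\<^esub> lobj F b) (lobj F a' \<otimes>\<^bsub>W\<^esub> lobj F b') (lobj F (a' \<otimes> b'))
            (lax2 F a' b')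
            (tarr W (lobj F a) (lobj F a') (lobj F b) (lobj F b') (larr F a a' f) (larr F b b' g))"
    and lax_assr: "\<lbrakk>a \<in> Obj V; b \<in> Obj V; c \<in> Obj V\<rbrakk>
      \<Longrightarrow> Comp W ((lobj F a \<otimes>\<^bsub>W\<^esub> lobj F b) \<otimes>\<^bsub>W\<^esub> lobj F c)
            (lobj F ((a \<otimes> b) \<otimes> c)) (lobj F (a \<otimes> (b \<otimes> c)))
            (larr F ((a \<otimes> b) \<otimes> c) (a \<otimes> (b \<otimes> c)) (assr V a b c))
            (Comp W ((lobj F a \<otimes>\<^bsub>W\<^esub> lobj F b) \<otimes>\<^bsub>W\<^esub> lobj F c)
              (lobj F (a \<otimes> b) \<otimes>\<^bsub>W\<^esub> lobj F c) (lobj F ((a \<otimes> b) \<otimes> c))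
              (lax2 F (a \<otimes> b) c)
              (tarr W (lobj F a \<otimes>\<^bsub>W\<^esub> lobj F b) (lobj F (a \<otimes> b)) (lobj F c) (lobj F c)
                (lax2 F a b) (Id W (lobj F c))))
        = Comp W ((lobj F a \<otimes>\<^bsub>W\<^esub> lobj F b) \<otimes>\<^bsub>W\<^esub> lobj F c)
            (lobj F a \<otimes>\<^bsub>W\<^esub> lobj F (b \<otimes> c)) (lobj F (a \<otimes> (b \<otimes> c)))
            (lax2 F a (b \<otimes> c))
            (Comp W ((lobj F a \<otimes>\<^bsub>W\<^esub> lobj F b) \<otimes>\<^bsub>W\<^esub> lobj F c)
              (lobj F a \<otimes>\<^bsub>W\<^esub> (lobj F b \<otimes>\<^bsub>W\<^esub> lobj F c)) (lobj F a \<otimes>\<^bsub>W\<^esub> lobj F (b \<otimes> c))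
              (tarr W (lobj F a) (lobj F a) (lobj F b \<otimes>\<^bsub>W\<^esub> lobj F c) (lobj F (b \<otimes> c))
                (Id W (lobj F a)) (lax2 F b c))
              (assr W (lobj F a) (lobj F b) (lobj F c)))"
    and lax_lunit: "a \<in> Obj V
      \<Longrightarrow> Comp W (\<one>\<^bsub>W\<^esub> \<otimes>\<^bsub>W\<^esub> lobj F a) (lobj F (\<one> \<otimes> a)) (lobj F a)
            (larr F (\<one> \<otimes> a) a (lunit V a))
            (Comp W (\<one>\<^bsub>W\<^esub> \<otimes>\<^bsub>W\<^esub> lobj F a) (lobj F \<one> \<otimes>\<^bsub>W\<^esub> lobj F a) (lobj F (\<one> \<otimes> a))
              (lax2 F \<one> a)
              (tarr W \<one>\<^bsub>W\<^esub> (lobj F \<one>) (lobj F a) (lobj F a) (lax0 F) (Id W (lobj F a))))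
        = lunit W (lobj F a)"
    and lax_runit: "a \<in> Obj V
      \<Longrightarrow> Comp W (lobj F a) (lobj F a \<otimes>\<^bsub>W\<^esub> lobj F \<one>) (lobj F (a \<otimes> \<one>))
            (lax2 F a \<one>)
            (Comp W (lobj F a) (lobj F a \<otimes>\<^bsub>W\<^esub> \<one>\<^bsub>W\<^esub>) (lobj F a \<otimes>\<^bsub>W\<^esub> lobj F \<one>)
              (tarr W (lobj F a) (lobj F a) \<one>\<^bsub>W\<^esub> (lobj F \<one>) (Id W (lobj F a)) (lax0 F))
              (runit W (lobj F a)))
        = larr F a (a \<otimes> \<one>) (runit V a)"

definition id_lax :: "('o, 'm) skew_mon \<Rightarrow> ('o, 'm) lax_mon" where
  "id_lax V =
    \<lparr>lfun = id_functor V,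
     lax0 = Id V (tunit V),
     lax2 = (\<lambda>a b. if a \<in> Obj V \<and> b \<in> Obj V then Id V (tobj V a b) else undefined)\<rparr>"

definition comp_lax ::
  "('o, 'm) skew_mon \<Rightarrow> ('o, 'm) skew_mon \<Rightarrow> ('o, 'm) skew_mon
    \<Rightarrow> ('o, 'm) lax_mon \<Rightarrow> ('o, 'm) lax_mon \<Rightarrow> ('o, 'm) lax_mon" where
  "comp_lax V W X G F =
    \<lparr>lfun = comp_functor V (lfun G) (lfun F),
     lax0 = Comp X (tunit X) (lobj G (tunit W)) (lobj G (lobj F (tunit V)))
       (larr G (tunit W) (lobj F (tunit V)) (lax0 F)) (lax0 G),
     lax2 = (\<lambda>a b. if a \<in> Obj V \<and> b \<in> Obj V then
         Comp X (tobj X (lobj G (lobj F a)) (lobj G (lobj F b)))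
           (lobj G (tobj W (lobj F a) (lobj F b))) (lobj G (lobj F (tobj V a b)))
           (larr G (tobj W (lobj F a) (lobj F b)) (lobj F (tobj V a b)) (lax2 F a b))
           (lax2 G (lobj F a) (lobj F b))
       else undefined)\<rparr>"

definition SkMon_ln :: "(('o, 'm) skew_mon, ('o, 'm) lax_mon) category" where
  "SkMon_ln =
    \<lparr>Obj = {V. skew_monoidal V \<and> left_normal V},
     Hom = (\<lambda>V W. {F. lax_monoidal V W F}),
     Id = id_lax,
     Comp = comp_lax\<rparr>"

definition SkMon_ln_cl :: "(('o, 'm) skew_mon, ('o, 'm) lax_mon) category" where
  "SkMon_ln_cl = full_subcat SkMon_ln closed_skew_mon"


section \<open>Multicategories and short multicategories\<close>

text \<open>
  \<open>mhom C as b\<close> is the set of multimaps \<open>as \<rightarrow> b\<close>. For \<open>g : p @ [b] @ s \<rightarrow> c\<close> and \<open>f : as \<rightarrow> b\<close>,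
  \<open>msub C p b s as c g f : p @ as @ s \<rightarrow> c\<close> is the substitution \<open>g \<circ>\<^sub>i f\<close> where \<open>i = length p + 1\<close>.
  Composition of unary maps and the functorial actions \<open>q \<circ> f\<close> and \<open>f \<circ>\<^sub>i p\<close> of unary maps on
  multimaps are the instances of \<open>msub\<close> where the outer, resp. the inner, map is unary.
\<close>

record ('o, 'm) multi =
  mobj :: "'o set"
  mhom :: "'o list \<Rightarrow> 'o \<Rightarrow> 'm set"
  mid :: "'o \<Rightarrow> 'm"
  msub :: "'o list \<Rightarrow> 'o \<Rightarrow> 'o list \<Rightarrow> 'o list \<Rightarrow> 'o \<Rightarrow> 'm \<Rightarrow> 'm \<Rightarrow> 'm"

text \<open>
  The data exist in the arities \<open>n\<close> with \<open>A n\<close>, and substitution of \<open>m\<close>-ary into \<open>n\<close>-ary maps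
  exists for \<open>S n m\<close>.
\<close>

locale multi_data =
  fixes A :: "nat \<Rightarrow> bool" and S :: "nat \<Rightarrow> nat \<Rightarrow> bool" and C :: "('o, 'm) multi"
  assumes mid_in_mhom: "a \<in> mobj C \<Longrightarrow> mid C a \<in> mhom C [a] a"
    and msub_in_mhom: "\<lbrakk>S (length (p @ [b] @ s)) (length as);
        set (p @ [b] @ s) \<subseteq> mobj C; set as \<subseteq> mobj C; c \<in> mobj C;
        g \<in> mhom C (p @ [b] @ s) c; f \<in> mhom C as b\<rbrakk>
      \<Longrightarrow> msub C p b s as c g f \<in> mhom C (p @ as @ s) c"
    and msub_mid_inner: "\<lbrakk>A (length (p @ [b] @ s)); set (p @ [b] @ s) \<subseteq> mobj C; c \<in> mobj C;
        g \<in> mhom C (p @ [b] @ s) c\<rbrakk>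
      \<Longrightarrow> msub C p b s [b] c g (mid C b) = g"
    and msub_mid_outer: "\<lbrakk>A (length as); set as \<subseteq> mobj C; b \<in> mobj C; f \<in> mhom C as b\<rbrakk>
      \<Longrightarrow> msub C [] b [] as b (mid C b) f = f"

text \<open>
  \<open>seq_assoc C n m k\<close>: \<open>f \<circ>\<^sub>i (g \<circ>\<^sub>j h) = (f \<circ>\<^sub>i g) \<circ>\<^bsub>i+j-1\<^esub> h\<close> for \<open>f\<close>, \<open>g\<close>, \<open>h\<close> of arity
  \<open>n\<close>, \<open>m\<close>, \<open>k\<close>.
\<close>

definition seq_assoc :: "('o, 'm) multi \<Rightarrow> nat \<Rightarrow> nat \<Rightarrow> nat \<Rightarrow> bool" where
  "seq_assoc C n m k \<longleftrightarrow>
    (\<forall>p b s q c r as d f g h.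
       length (p @ [b] @ s) = n \<and> length (q @ [c] @ r) = m \<and> length as = k \<and>
       set (p @ [b] @ s) \<subseteq> mobj C \<and> set (q @ [c] @ r) \<subseteq> mobj C \<and> set as \<subseteq> mobj C \<and> d \<in> mobj C \<and>
       f \<in> mhom C (p @ [b] @ s) d \<and> g \<in> mhom C (q @ [c] @ r) b \<and> h \<in> mhom C as c \<longrightarrow>
       msub C p b s (q @ as @ r) d f (msub C q c r as b g h)
     = msub C (p @ q) c (r @ s) as d (msub C p b s (q @ [c] @ r) d f g) h)"

text \<open>
  \<open>par_assoc C n m k\<close>: substituting an \<open>m\<close>-ary \<open>g\<close> at an earlier and a \<open>k\<close>-ary \<open>h\<close> at a later
  input of an \<open>n\<close>-ary \<open>f\<close> does not depend on the order.
\<close>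

definition par_assoc :: "('o, 'm) multi \<Rightarrow> nat \<Rightarrow> nat \<Rightarrow> nat \<Rightarrow> bool" where
  "par_assoc C n m k \<longleftrightarrow>
    (\<forall>p b q c r as bs d f g h.
       length (p @ [b] @ q @ [c] @ r) = n \<and> length as = m \<and> length bs = k \<and>
       set (p @ [b] @ q @ [c] @ r) \<subseteq> mobj C \<and> set as \<subseteq> mobj C \<and> set bs \<subseteq> mobj C \<and> d \<in> mobj C \<and>
       f \<in> mhom C (p @ [b] @ q @ [c] @ r) d \<and> g \<in> mhom C as b \<and> h \<in> mhom C bs c \<longrightarrow>
       msub C (p @ as @ q) c r bs d (msub C p b (q @ [c] @ r) as d f g) h
     = msub C p b (q @ bs @ r) as d (msub C (p @ [b] @ q) c r bs d f h) g)"

definition proper_subst :: "(nat \<times> nat) set" where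
  "proper_subst = {(2,2), (3,2), (2,3), (2,0), (3,0)}"

definition short_subst :: "nat \<Rightarrow> nat \<Rightarrow> bool" where
  "short_subst n m \<longleftrightarrow> n = 1 \<and> m \<le> 4 \<or> n \<le> 4 \<and> m = 1 \<or> (n, m) \<in> proper_subst"

text \<open>
  \<open>functor_laws\<close>, together with the unit laws in \<open>multi_data\<close>, says that unary maps form a category
  and that \<open>n\<close>-ary maps form a functor: each input and the output carries a functorial action, and
  actions in different variables commute. In \<open>subst_natural\<close>, the five conditions express
  naturality of \<open>\<circ>\<^sub>i\<close> in the inputs of the inner map, in the codomain, dinaturality in \<open>b\<^sub>i\<close>, and
  naturality in \<open>b\<^sub>k\<close> for \<open>k > i\<close> and for \<open>k < i\<close>.
\<close>

locale short_multicategory = multi_data "\<lambda>n. n \<le> 4" short_subst C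
  for C :: "('o, 'm) multi" +
  assumes functor_laws: "n \<le> 4 \<Longrightarrow>
      seq_assoc C n 1 1 \<and> seq_assoc C 1 1 n \<and> seq_assoc C 1 n 1 \<and> par_assoc C n 1 1"
    and subst_natural: "(n, m) \<in> proper_subst \<Longrightarrow>
      seq_assoc C n m 1 \<and> seq_assoc C 1 n m \<and> seq_assoc C n 1 m \<and>
      par_assoc C n m 1 \<and> par_assoc C n 1 m"
    and axiom_A: "(n, k) \<in> {(2,2), (2,0)} \<Longrightarrow> seq_assoc C 2 n k"
    and axiom_B: "(n, k) \<in> {(2,2), (2,0), (0,2), (0,0)} \<Longrightarrow> par_assoc C 2 n k"

locale multicategory = multi_data "\<lambda>_. True" "\<lambda>_ _. True" C
  for C :: "('o, 'm) multi" +
  assumes seq_assoc: "seq_assoc C n m k"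
    and par_assoc: "par_assoc C n m k"

text \<open>
  Morphisms are the same in both cases, up to the arities involved; \<open>mmap F as b\<close> is the component
  \<open>mhom C as b \<rightarrow> mhom D (F as) (F b)\<close>. The action on unary maps is that of the underlying functor.
  As for functors, values outside the domain are \<open>undefined\<close>. Naturality in all variables is
  preservation of \<open>msub\<close> when one of the maps is unary.
\<close>

record ('o, 'm) multi_mor =
  mfun :: "'o \<Rightarrow> 'o"
  mmap :: "'o list \<Rightarrow> 'o \<Rightarrow> 'm \<Rightarrow> 'm"

definition mk_multi_mor ::
  "(nat \<Rightarrow> bool) \<Rightarrow> ('o, 'm) multi \<Rightarrow> ('o \<Rightarrow> 'o) \<Rightarrow> ('o list \<Rightarrow> 'o \<Rightarrow> 'm \<Rightarrow> 'm) \<Rightarrow> ('o, 'm) multi_mor" where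
  "mk_multi_mor A C F0 F1 =
    \<lparr>mfun = restrict F0 (mobj C),
     mmap = (\<lambda>as b f. if A (length as) \<and> set as \<subseteq> mobj C \<and> b \<in> mobj C \<and> f \<in> mhom C as b
       then F1 as b f else undefined)\<rparr>"

locale multi_morphism =
  fixes A :: "nat \<Rightarrow> bool" and S :: "nat \<Rightarrow> nat \<Rightarrow> bool"
    and C D :: "('o, 'm) multi" and F :: "('o, 'm) multi_mor"
  assumes extensional: "F = mk_multi_mor A C (mfun F) (mmap F)"
    and mfun_in_mobj: "a \<in> mobj C \<Longrightarrow> mfun F a \<in> mobj D"
    and mmap_in_mhom: "\<lbrakk>A (length as); set as \<subseteq> mobj C; b \<in> mobj C; f \<in> mhom C as b\<rbrakk>
      \<Longrightarrow> mmap F as b f \<in> mhom D (map (mfun F) as) (mfun F b)"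
    and mmap_mid: "a \<in> mobj C \<Longrightarrow> mmap F [a] a (mid C a) = mid D (mfun F a)"
    and mmap_msub: "\<lbrakk>S (length (p @ [b] @ s)) (length as);
        set (p @ [b] @ s) \<subseteq> mobj C; set as \<subseteq> mobj C; c \<in> mobj C;
        g \<in> mhom C (p @ [b] @ s) c; f \<in> mhom C as b\<rbrakk>
      \<Longrightarrow> mmap F (p @ as @ s) c (msub C p b s as c g f)
        = msub D (map (mfun F) p) (mfun F b) (map (mfun F) s) (map (mfun F) as) (mfun F c)
            (mmap F (p @ [b] @ s) c g) (mmap F as b f)"

definition id_multi_mor :: "(nat \<Rightarrow> bool) \<Rightarrow> ('o, 'm) multi \<Rightarrow> ('o, 'm) multi_mor" where
  "id_multi_mor A C = mk_multi_mor A C (\<lambda>a. a) (\<lambda>as b f. f)"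

definition comp_multi_mor ::
  "(nat \<Rightarrow> bool) \<Rightarrow> ('o, 'm) multi \<Rightarrow> ('o, 'm) multi_mor \<Rightarrow> ('o, 'm) multi_mor \<Rightarrow> ('o, 'm) multi_mor" where
  "comp_multi_mor A C G F =
    mk_multi_mor A C (\<lambda>a. mfun G (mfun F a))
      (\<lambda>as b f. mmap G (map (mfun F) as) (mfun F b) (mmap F as b f))"

definition ShMulti :: "(('o, 'm) multi, ('o, 'm) multi_mor) category" where
  "ShMulti =
    \<lparr>Obj = {C. short_multicategory C},
     Hom = (\<lambda>C D. {F. multi_morphism (\<lambda>n. n \<le> 4) short_subst C D F}),
     Id = id_multi_mor (\<lambda>n. n \<le> 4),
     Comp = (\<lambda>C D E. comp_multi_mor (\<lambda>n. n \<le> 4) C)\<rparr>"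

definition Multi :: "(('o, 'm) multi, ('o, 'm) multi_mor) category" where
  "Multi =
    \<lparr>Obj = {C. multicategory C},
     Hom = (\<lambda>C D. {F. multi_morphism (\<lambda>_. True) (\<lambda>_ _. True) C D F}),
     Id = id_multi_mor (\<lambda>_. True),
     Comp = (\<lambda>C D E. comp_multi_mor (\<lambda>_. True) C)\<rparr>"


section \<open>Left representability and closedness\<close>

record ('o, 'm) classifiers =
  ctens :: "'o \<Rightarrow> 'o \<Rightarrow> 'o"
  ctheta :: "'o \<Rightarrow> 'o \<Rightarrow> 'm"
  cunit :: "'o"
  cu :: "'m"

locale is_classifiers =
  fixes C :: "('o, 'm) multi" and t :: "('o, 'm) classifiers"
  assumes ctens_in_mobj: "\<lbrakk>a \<in> mobj C; b \<in> mobj C\<rbrakk> \<Longrightarrow> ctens t a b \<in> mobj C"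
    and ctheta_in_mhom: "\<lbrakk>a \<in> mobj C; b \<in> mobj C\<rbrakk> \<Longrightarrow> ctheta t a b \<in> mhom C [a, b] (ctens t a b)"
    and cunit_in_mobj: "cunit t \<in> mobj C"
    and cu_in_mhom: "cu t \<in> mhom C [] (cunit t)"
    and ctheta_bij: "\<lbrakk>a \<in> mobj C; b \<in> mobj C; set xs \<subseteq> mobj C; length xs \<le> 2; d \<in> mobj C\<rbrakk>
      \<Longrightarrow> bij_betw (\<lambda>g. msub C [] (ctens t a b) xs [a, b] d g (ctheta t a b))
            (mhom C (ctens t a b # xs) d) (mhom C (a # b # xs) d)"
    and cu_bij: "\<lbrakk>set xs \<subseteq> mobj C; length xs \<le> 2; d \<in> mobj C\<rbrakk>
      \<Longrightarrow> bij_betw (\<lambda>g. msub C [] (cunit t) xs [] d g (cu t))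
            (mhom C (cunit t # xs) d) (mhom C xs d)"

definition short_left_representable :: "('o, 'm) multi \<Rightarrow> bool" where
  "short_left_representable C \<longleftrightarrow> (\<exists>t. is_classifiers C t)"

definition short_closed :: "('o, 'm) multi \<Rightarrow> bool" where
  "short_closed C \<longleftrightarrow>
    (\<forall>b \<in> mobj C. \<forall>c \<in> mobj C. \<exists>h \<in> mobj C. \<exists>e \<in> mhom C [h, b] c.
       \<forall>xs. set xs \<subseteq> mobj C \<and> length xs \<le> 3 \<longrightarrow>
         bij_betw (\<lambda>f. msub C [] h [b] xs c e f) (mhom C xs h) (mhom C (xs @ [b]) c))"

definition left_representable :: "('o, 'm) multi \<Rightarrow> bool" where
  "left_representable C \<longleftrightarrow>
    (\<forall>as. set as \<subseteq> mobj C \<longrightarrow>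
      (\<exists>m \<in> mobj C. \<exists>\<theta> \<in> mhom C as m.
         \<forall>ys d. set ys \<subseteq> mobj C \<and> d \<in> mobj C \<longrightarrow>
           bij_betw (\<lambda>g. msub C [] m ys as d g \<theta>) (mhom C (m # ys) d) (mhom C (as @ ys) d)))"

definition closed_multi :: "('o, 'm) multi \<Rightarrow> bool" where
  "closed_multi C \<longleftrightarrow>
    (\<forall>b \<in> mobj C. \<forall>c \<in> mobj C. \<exists>h \<in> mobj C. \<exists>e \<in> mhom C [h, b] c.
       \<forall>xs. set xs \<subseteq> mobj C \<longrightarrow>
         bij_betw (\<lambda>f. msub C [] h [b] xs c e f) (mhom C xs h) (mhom C (xs @ [b]) c))"

definition ShMulti_lr :: "(('o, 'm) multi, ('o, 'm) multi_mor) category" where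
  "ShMulti_lr = full_subcat ShMulti short_left_representable"

definition ShMulti_lr_cl :: "(('o, 'm) multi, ('o, 'm) multi_mor) category" where
  "ShMulti_lr_cl = full_subcat ShMulti (\<lambda>C. short_left_representable C \<and> short_closed C)"

definition Multi_lr_cl :: "(('o, 'm) multi, ('o, 'm) multi_mor) category" where
  "Multi_lr_cl = full_subcat Multi (\<lambda>C. left_representable C \<and> closed_multi C)"


section \<open>The functors \<open>U\<close>, \<open>K\<close> and \<open>T\<close>\<close>

definition U_obj :: "('o, 'm) multi \<Rightarrow> ('o, 'm) multi" where
  "U_obj C =
    \<lparr>mobj = mobj C,
     mhom = (\<lambda>as b. if length as \<le> 4 then mhom C as b else {}),
     mid = mid C,
     msub = (\<lambda>p b s as c. if short_subst (length (p @ [b] @ s)) (length as)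
       then msub C p b s as c else undefined)\<rparr>"

definition U_lr_cl ::
  "(('o, 'm) multi, ('o, 'm) multi_mor, ('o, 'm) multi, ('o, 'm) multi_mor) cat_functor" where
  "U_lr_cl = mk_functor Multi_lr_cl U_obj (\<lambda>C D F. mk_multi_mor (\<lambda>n. n \<le> 4) C (mfun F) (mmap F))"

text \<open>
  The formulas shared by \<open>K\<close> and \<open>T\<close>: the skew monoidal category obtained from a (short)
  multicategory with chosen classifiers, and the lax monoidal functor obtained from a morphism.
\<close>

definition skew_of :: "('o, 'm) multi \<Rightarrow> ('o, 'm) classifiers \<Rightarrow> ('o, 'm) skew_mon" where
  "skew_of C t = (let ten = ctens t; \<theta> = ctheta t; i = cunit t; u = cu t in
    \<lparr>Obj = mobj C,
     Hom = (\<lambda>a b. mhom C [a] b),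
     Id = mid C,
     Comp = (\<lambda>a b c. msub C [] b [] [a] c),
     tobj = ten,
     tarr = (\<lambda>a b c d f g. THE k. k \<in> mhom C [ten a c] (ten b d) \<and>
       msub C [] (ten a c) [] [a, c] (ten b d) k (\<theta> a c)
     = msub C [a] d [] [c] (ten b d) (msub C [] b [d] [a] (ten b d) (\<theta> b d) f) g),
     tunit = i,
     assr = (\<lambda>a b c. THE k. k \<in> mhom C [ten (ten a b) c] (ten a (ten b c)) \<and>
       msub C [] (ten a b) [c] [a, b] (ten a (ten b c))
         (msub C [] (ten (ten a b) c) [] [ten a b, c] (ten a (ten b c)) k (\<theta> (ten a b) c)) (\<theta> a b)
     = msub C [a] (ten b c) [] [b, c] (ten a (ten b c)) (\<theta> a (ten b c)) (\<theta> b c)),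
     lunit = (\<lambda>a. THE k. k \<in> mhom C [ten i a] a \<and>
       msub C [] i [a] [] a (msub C [] (ten i a) [] [i, a] a k (\<theta> i a)) u = mid C a),
     runit = (\<lambda>a. msub C [a] i [] [] (ten a i) (\<theta> a i) u)\<rparr>)"

definition lax_of ::
  "('o, 'm) multi \<Rightarrow> ('o, 'm) classifiers \<Rightarrow> ('o, 'm) multi \<Rightarrow> ('o, 'm) classifiers
    \<Rightarrow> ('o, 'm) multi_mor \<Rightarrow> ('o, 'm) lax_mon" where
  "lax_of C t D t' F =
    \<lparr>lfun = mk_functor (skew_of C t) (mfun F) (\<lambda>a b f. mmap F [a] b f),
     lax0 = (THE k. k \<in> mhom D [cunit t'] (mfun F (cunit t)) \<and>
       msub D [] (cunit t') [] [] (mfun F (cunit t)) k (cu t') = mmap F [] (cunit t) (cu t)),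
     lax2 = (\<lambda>a b. if a \<in> mobj C \<and> b \<in> mobj C then
       (THE k. k \<in> mhom D [ctens t' (mfun F a) (mfun F b)] (mfun F (ctens t a b)) \<and>
          msub D [] (ctens t' (mfun F a) (mfun F b)) [] [mfun F a, mfun F b] (mfun F (ctens t a b))
            k (ctheta t' (mfun F a) (mfun F b))
        = mmap F [a, b] (ctens t a b) (ctheta t a b))
       else undefined)\<rparr>"

text \<open>
  \<open>ch\<close> is the choice of classifiers for each left representable short multicategory. For a
  multicategory \<open>C\<close>, \<open>T\<close> uses the same classifiers as \<open>K\<close> uses for \<open>U_obj C\<close>.
\<close>

definition K_lr :: "(('o, 'm) multi \<Rightarrow> ('o, 'm) classifiers)
    \<Rightarrow> (('o, 'm) multi, ('o, 'm) multi_mor, ('o, 'm) skew_mon, ('o, 'm) lax_mon) cat_functor" where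
  "K_lr ch = mk_functor ShMulti_lr (\<lambda>C. skew_of C (ch C)) (\<lambda>C D. lax_of C (ch C) D (ch D))"

definition K_lr_cl :: "(('o, 'm) multi \<Rightarrow> ('o, 'm) classifiers)
    \<Rightarrow> (('o, 'm) multi, ('o, 'm) multi_mor, ('o, 'm) skew_mon, ('o, 'm) lax_mon) cat_functor" where
  "K_lr_cl ch = restrict_functor ShMulti_lr_cl (K_lr ch)"

definition T_lr_cl :: "(('o, 'm) multi \<Rightarrow> ('o, 'm) classifiers)
    \<Rightarrow> (('o, 'm) multi, ('o, 'm) multi_mor, ('o, 'm) skew_mon, ('o, 'm) lax_mon) cat_functor" where
  "T_lr_cl ch = mk_functor Multi_lr_cl (\<lambda>C. skew_of C (ch (U_obj C)))
    (\<lambda>C D. lax_of C (ch (U_obj C)) D (ch (U_obj D)))"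

end

theory Submission
  imports Defs
begin

text \<open>
  All the functors in question have the same quasi-inverse. For a skew monoidal category \<open>V\<close> let
  a multimap \<open>a\<^sub>1, \<dots>, a\<^sub>n \<rightarrow> b\<close> be an arrow \<open>((\<one>
  a\<^sub>1) \<dots>) a\<^sub>n \<rightarrow> b\<close>. As in the Yoneda lemma, such arrows are the same as
  families \<open>((x a\<^sub>1) \<dots>) a\<^sub>n \<rightarrow> x b\<close> that are natural in
  \<open>x\<close> and compatible with \<open>\<alpha>\<close> (\<open>la_ext\<close>,
  \<open>ext_la_linear\<close>). Families can be substituted into each other by whiskering and composition,
  and so the laws of a multicategory in all arities amount to functoriality and naturality. The multicategory
  \<open>multi_of V\<close> so obtained is closed if \<open>V\<close> is, and left representable if
  \<open>\<lambda>\<close> is invertible, because then the linear family of an invertible arrow is invertible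
  at \<open>\<one>\<close>. A lax monoidal functor acts on linear families, hence on multimaps
  (\<open>lax_mmap_sbs\<close>).

  Conversely, let \<open>C\<close> be a left representable multicategory, short or not, and \<open>V\<close>
  the skew monoidal category that its classifiers define. The axioms of \<open>V\<close> hold because arrows
  out of iterated tensors are determined by the multimaps that they induce. Iterating \<open>\<theta>\<close>
  and \<open>u\<close> gives classifiers \<open>a\<^sub>1, \<dots>, a\<^sub>n \<rightarrow> ((\<one>
  a\<^sub>1) \<dots>) a\<^sub>n\<close>, and precomposition with them is a bijection from the multimaps of
  \<open>multi_of V\<close> to those of \<open>C\<close> that preserves substitution (\<open>sbs_Th0\<close>).
  The crucial point is that the linear family of an arrow \<open>f\<close> corresponds to substituting the
  multimap of \<open>f\<close> into the second input of \<open>\<theta>\<close> (\<open>ext_th\<close>). For a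
  short multicategory the arities at hand are just enough for this.

  The bijection makes \<open>C \<mapsto> V\<close> fully faithful: a morphism is determined by its values on
  unary maps, \<open>\<theta>\<close> and \<open>u\<close>, and a lax monoidal functor acts on the multimaps
  of \<open>C\<close> through those of \<open>multi_of V\<close> (\<open>lax_of_faithful\<close>,
  \<open>lax_of_F\<close>). It is essentially surjective since \<open>V\<close> is isomorphic to the skew
  monoidal category that \<open>multi_of V\<close> defines (\<open>multi_of_ess\<close>). This applies to
  \<open>K\<close> and to \<open>T\<close>, with and without closedness; \<open>T = K U\<close> since both are
  given by the same formulas, and thus \<open>U\<close> is an equivalence as well.
\<close>

section \<open>Equivalences of categories\<close>

definition fully_faithful ::
  "('o, 'm, 'x) category_scheme \<Rightarrow> ('p, 'n, 'y) category_scheme \<Rightarrow> ('o, 'm, 'p, 'n) cat_functor \<Rightarrow> bool" where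
  "fully_faithful C D F \<longleftrightarrow>
    (\<forall>a \<in> Obj C. \<forall>b \<in> Obj C. bij_betw (farr F a b) (Hom C a b) (Hom D (fobj F a) (fobj F b)))"

definition ess_surjective ::
  "('o, 'm, 'x) category_scheme \<Rightarrow> ('p, 'n, 'y) category_scheme \<Rightarrow> ('o, 'm, 'p, 'n) cat_functor \<Rightarrow> bool" where
  "ess_surjective C D F \<longleftrightarrow> (\<forall>d \<in> Obj D. \<exists>c \<in> Obj C. \<exists>f. is_iso D (fobj F c) d f)"

lemma fobj_mk_functor [simp]: "a \<in> Obj C \<Longrightarrow> fobj (mk_functor C F0 F1) a = F0 a"
  by (simp add: mk_functor_def)

lemma farr_mk_functor [simp]:
  "\<lbrakk>a \<in> Obj C; b \<in> Obj C; f \<in> Hom C a b\<rbrakk> \<Longrightarrow> farr (mk_functor C F0 F1) a b f = F1 a b f"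
  by (simp add: mk_functor_def)

lemma mk_functor_cong:
  assumes "\<And>a. a \<in> Obj C \<Longrightarrow> F0 a = G0 a"
    and "\<And>a b f. \<lbrakk>a \<in> Obj C; b \<in> Obj C; f \<in> Hom C a b\<rbrakk> \<Longrightarrow> F1 a b f = G1 a b f"
  shows "mk_functor C F0 F1 = mk_functor C G0 G1"
  using assms by (auto simp: mk_functor_def restrict_def fun_eq_iff)

lemma mk_functor_idem: "mk_functor C (fobj (mk_functor C F0 F1)) (farr (mk_functor C F0 F1)) = mk_functor C F0 F1"
  by (rule mk_functor_cong) simp_all

lemma is_functor_mk_functor:
  assumes "is_category C" "is_category D"
    and "\<And>a. a \<in> Obj C \<Longrightarrow> F0 a \<in> Obj D"
    and "\<And>a b f. \<lbrakk>a \<in> Obj C; b \<in> Obj C; f \<in> Hom C a b\<rbrakk> \<Longrightarrow> F1 a b f \<in> Hom D (F0 a) (F0 b)"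
    and "\<And>a. a \<in> Obj C \<Longrightarrow> F1 a a (Id C a) = Id D (F0 a)"
    and "\<And>a b c f g. \<lbrakk>a \<in> Obj C; b \<in> Obj C; c \<in> Obj C; f \<in> Hom C a b; g \<in> Hom C b c\<rbrakk>
      \<Longrightarrow> F1 a c (Comp C a b c g f) = Comp D (F0 a) (F0 b) (F0 c) (F1 b c g) (F1 a b f)"
  shows "is_functor C D (mk_functor C F0 F1)"
proof -
  interpret C: is_category C by fact
  interpret D: is_category D by fact
  show ?thesis
    by unfold_locales (simp_all add: mk_functor_idem assms C.Id_in_Hom C.Comp_in_Hom)
qed

text \<open>
  The quasi-inverse sends \<open>d\<close> to a chosen \<open>g d\<close> with \<open>e d : F (g d) \<cong> d\<close>, and \<open>h : d \<rightarrow> d'\<close> to the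
  unique arrow over the conjugate of \<open>h\<close> by the chosen isomorphisms; all its laws are checked after
  applying the faithful functor \<open>F\<close>.
\<close>

lemma is_equivalenceI:
  assumes F: "is_functor C D F" and ff: "fully_faithful C D F" and es: "ess_surjective C D F"
  shows "is_equivalence C D F"
proof -
  interpret F: is_functor C D F by fact
  have "\<forall>d \<in> Obj D. \<exists>c e e'. c \<in> Obj C \<and> e \<in> Hom D (fobj F c) d \<and> e' \<in> Hom D d (fobj F c) \<and>
      Comp D (fobj F c) d (fobj F c) e' e = Id D (fobj F c) \<and> Comp D d (fobj F c) d e e' = Id D d"
    using es unfolding ess_surjective_def is_iso_def by blast
  then obtain g e e' where g [simp]: "\<And>d. d \<in> Obj D \<Longrightarrow> g d \<in> Obj C"
    and e [simp]: "\<And>d. d \<in> Obj D \<Longrightarrow> e d \<in> Hom D (fobj F (g d)) d"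
    and e' [simp]: "\<And>d. d \<in> Obj D \<Longrightarrow> e' d \<in> Hom D d (fobj F (g d))"
    and e'e [simp]: "\<And>d. d \<in> Obj D \<Longrightarrow> Comp D (fobj F (g d)) d (fobj F (g d)) (e' d) (e d) = Id D (fobj F (g d))"
    and ee' [simp]: "\<And>d. d \<in> Obj D \<Longrightarrow> Comp D d (fobj F (g d)) d (e d) (e' d) = Id D d"
    by metis
  define lift where "lift a b h = the_inv_into (Hom C a b) (farr F a b) h" for a b h
  note [simp] = F.fobj_in_Obj F.cod.Comp_in_Hom F.dom.Comp_in_Hom F.cod.Id_in_Hom F.dom.Id_in_Hom
    F.farr_in_Hom F.farr_Id F.farr_Comp F.cod.Comp_Id_left F.cod.Comp_Id_right
  have bij: "bij_betw (farr F a b) (Hom C a b) (Hom D (fobj F a) (fobj F b))"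
    if "a \<in> Obj C" "b \<in> Obj C" for a b
    using ff that by (simp add: fully_faithful_def)
  have lift_in [simp]: "lift a b h \<in> Hom C a b"
    if "a \<in> Obj C" "b \<in> Obj C" "h \<in> Hom D (fobj F a) (fobj F b)" for a b h
    using bij[OF that(1,2)] that(3) unfolding lift_def
    by (metis bij_betw_def the_inv_into_into subset_refl)
  have F_lift [simp]: "farr F a b (lift a b h) = h"
    if "a \<in> Obj C" "b \<in> Obj C" "h \<in> Hom D (fobj F a) (fobj F b)" for a b h
    using bij[OF that(1,2)] that(3) unfolding lift_def
    by (metis bij_betw_def f_the_inv_into_f)
  have eqI: "k = k'" if "farr F a b k = farr F a b k'" "a \<in> Obj C" "b \<in> Obj C"
    "k \<in> Hom C a b" "k' \<in> Hom C a b" for a b k k'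
    using bij[OF that(2,3)] that by (auto simp: bij_betw_def inj_on_def)
  define G1 where "G1 d d' h = lift (g d) (g d')
      (Comp D (fobj F (g d)) d' (fobj F (g d')) (e' d') (Comp D (fobj F (g d)) d d' h (e d)))" for d d' h
  have G1_in [simp]: "G1 d d' h \<in> Hom C (g d) (g d')"
    if "d \<in> Obj D" "d' \<in> Obj D" "h \<in> Hom D d d'" for d d' h
    using that by (simp add: G1_def)
  have F_G1 [simp]: "farr F (g d) (g d') (G1 d d' h) =
      Comp D (fobj F (g d)) d' (fobj F (g d')) (e' d') (Comp D (fobj F (g d)) d d' h (e d))"
    if "d \<in> Obj D" "d' \<in> Obj D" "h \<in> Hom D d d'" for d d' h
    using that by (simp add: G1_def)
  have cancel [simp]: "Comp D a (fobj F (g d)) d (e d) (Comp D a d (fobj F (g d)) (e' d) k) = k"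
    if "a \<in> Obj D" "d \<in> Obj D" "k \<in> Hom D a d" for a d k
    using that by (simp add: F.cod.Comp_assoc)
  let ?G = "mk_functor D g G1"
  have G: "is_functor D C ?G"
  proof (rule is_functor_mk_functor)
    fix a assume "a \<in> Obj D"
    then show "G1 a a (Id D a) = Id C (g a)" by (intro eqI[of "g a" "g a"]) simp_all
  next
    fix a b c f h
    assume a: "a \<in> Obj D" "b \<in> Obj D" "c \<in> Obj D" "f \<in> Hom D a b" "h \<in> Hom D b c"
    have "Comp D (fobj F (g a)) c (fobj F (g c)) (e' c)
            (Comp D (fobj F (g a)) b c h (Comp D (fobj F (g a)) a b f (e a)))
        = Comp D (fobj F (g a)) (fobj F (g b)) (fobj F (g c)) (Comp D (fobj F (g b)) c (fobj F (g c)) (e' c)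
            (Comp D (fobj F (g b)) b c h (e b)))
           (Comp D (fobj F (g a)) b (fobj F (g b)) (e' b) (Comp D (fobj F (g a)) a b f (e a)))"
      using a by (simp add: F.cod.Comp_assoc[symmetric] del: F.farr_Comp)
    with a show "G1 a c (Comp D a b c h f) = Comp C (g a) (g b) (g c) (G1 b c h) (G1 a b f)"
      by (intro eqI[of "g a" "g c"]) (simp_all add: F.cod.Comp_assoc)
  qed (simp_all add: F.dom.is_category_axioms F.cod.is_category_axioms)
  define \<eta> where "\<eta> a = lift a (g (fobj F a)) (e' (fobj F a))" for a
  have "nat_iso C C (id_functor C) (comp_functor C ?G F) \<eta>"
    unfolding nat_iso_def
  proof (intro conjI ballI)
    fix a assume a: "a \<in> Obj C"
    show "is_iso C (fobj (id_functor C) a) (fobj (comp_functor C ?G F) a) (\<eta> a)"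
    proof -
      let ?x = "lift (g (fobj F a)) a (e (fobj F a))"
      have "Comp C a (g (fobj F a)) a ?x (\<eta> a) = Id C a"
        using a by (intro eqI[of a a]) (simp_all add: \<eta>_def)
      moreover have "Comp C (g (fobj F a)) a (g (fobj F a)) (\<eta> a) ?x = Id C (g (fobj F a))"
        using a by (intro eqI[of "g (fobj F a)" "g (fobj F a)"]) (simp_all add: \<eta>_def)
      moreover have "\<eta> a \<in> Hom C a (g (fobj F a))" "?x \<in> Hom C (g (fobj F a)) a"
        using a by (simp_all add: \<eta>_def)
      ultimately show ?thesis
        using a by (auto simp: is_iso_def id_functor_def comp_functor_def intro!: bexI[of _ ?x])
    qed
  next
    fix a b f assume a: "a \<in> Obj C" "b \<in> Obj C" "f \<in> Hom C a b"
    have "Comp C a b (g (fobj F b)) (\<eta> b) f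
        = Comp C a (g (fobj F a)) (g (fobj F b)) (G1 (fobj F a) (fobj F b) (farr F a b f)) (\<eta> a)"
      using a by (intro eqI[of a "g (fobj F b)"]) (simp_all add: \<eta>_def F.cod.Comp_assoc[symmetric])
    then show "Comp C (fobj (id_functor C) a) (fobj (id_functor C) b) (fobj (comp_functor C ?G F) b) (\<eta> b)
          (farr (id_functor C) a b f)
      = Comp C (fobj (id_functor C) a) (fobj (comp_functor C ?G F) a) (fobj (comp_functor C ?G F) b)
          (farr (comp_functor C ?G F) a b f) (\<eta> a)"
      using a by (simp add: id_functor_def comp_functor_def)
  qed
  moreover have "nat_iso D D (comp_functor D F ?G) (id_functor D) e"
    unfolding nat_iso_def
  proof (intro conjI ballI)
    fix d assume "d \<in> Obj D"
    then show "is_iso D (fobj (comp_functor D F ?G) d) (fobj (id_functor D) d) (e d)"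
      by (auto simp: id_functor_def comp_functor_def is_iso_def intro!: bexI[of _ "e' d"])
  qed (simp add: id_functor_def comp_functor_def)
  ultimately show ?thesis
    unfolding is_equivalence_def using F G by blast
qed

lemma fully_faithful_reflects_iso:
  assumes F: "is_functor C D F" and ff: "fully_faithful C D F"
    and a: "a \<in> Obj C" "b \<in> Obj C" and iso: "is_iso D (fobj F a) (fobj F b) h"
  shows "\<exists>f. is_iso C a b f"
proof -
  interpret F: is_functor C D F by fact
  have bij: "bij_betw (farr F a b) (Hom C a b) (Hom D (fobj F a) (fobj F b))"
    if "a \<in> Obj C" "b \<in> Obj C" for a b
    using ff that by (simp add: fully_faithful_def)
  have eqI: "k = k'" if "farr F a b k = farr F a b k'" "a \<in> Obj C" "b \<in> Obj C"
    "k \<in> Hom C a b" "k' \<in> Hom C a b" for a b k k'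
    using bij[OF that(2,3)] that by (auto simp: bij_betw_def inj_on_def)
  obtain h' where h: "h \<in> Hom D (fobj F a) (fobj F b)" "h' \<in> Hom D (fobj F b) (fobj F a)"
    "Comp D (fobj F a) (fobj F b) (fobj F a) h' h = Id D (fobj F a)"
    "Comp D (fobj F b) (fobj F a) (fobj F b) h h' = Id D (fobj F b)"
    using iso unfolding is_iso_def by blast
  obtain f where f: "f \<in> Hom C a b" "farr F a b f = h"
    using bij_betw_imp_surj_on[OF bij[OF a]] h(1) by (metis imageE)
  obtain f' where f': "f' \<in> Hom C b a" "farr F b a f' = h'"
    using bij_betw_imp_surj_on[OF bij[OF a(2,1)]] h(2) by (metis imageE)
  have "Comp C a b a f' f = Id C a"
    using a f f' h by (intro eqI[of a a])
      (simp_all add: F.farr_Comp F.farr_Id F.dom.Comp_in_Hom F.dom.Id_in_Hom)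
  moreover have "Comp C b a b f f' = Id C b"
    using a f f' h by (intro eqI[of b b])
      (simp_all add: F.farr_Comp F.farr_Id F.dom.Comp_in_Hom F.dom.Id_in_Hom)
  ultimately show ?thesis using f f' unfolding is_iso_def by blast
qed

lemma fobj_comp_functor [simp]: "a \<in> Obj C \<Longrightarrow> fobj (comp_functor C G F) a = fobj G (fobj F a)"
  by (simp add: comp_functor_def)

lemma farr_comp_functor [simp]: "\<lbrakk>a \<in> Obj C; b \<in> Obj C; f \<in> Hom C a b\<rbrakk>
  \<Longrightarrow> farr (comp_functor C G F) a b f = farr G (fobj F a) (fobj F b) (farr F a b f)"
  by (simp add: comp_functor_def)

text \<open>
  Since \<open>G\<close> is bijective on hom-sets, \<open>F\<close> is as soon as \<open>G \<circ> F\<close> is; and as \<open>G\<close> reflects isomorphisms,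
  an object that \<open>G \<circ> F\<close> hits up to isomorphism after applying \<open>G\<close> is hit by \<open>F\<close>.
\<close>

lemma is_equivalence_cancel_left:
  assumes F: "is_functor C D F" and G: "is_functor D E G"
    and ffG: "fully_faithful D E G" and ffGF: "fully_faithful C E (comp_functor C G F)"
    and es: "ess_surjective C E (comp_functor C G F)"
  shows "is_equivalence C D F"
proof (rule is_equivalenceI[OF F])
  interpret F: is_functor C D F by fact
  interpret G: is_functor D E G by fact
  show "fully_faithful C D F"
    unfolding fully_faithful_def
  proof (intro ballI)
    fix a b assume a: "a \<in> Obj C" "b \<in> Obj C"
    have "bij_betw (farr (comp_functor C G F) a b) (Hom C a b) (Hom E (fobj G (fobj F a)) (fobj G (fobj F b)))"
      using ffGF a by (simp add: fully_faithful_def)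
    moreover have "farr (comp_functor C G F) a b f = (farr G (fobj F a) (fobj F b) \<circ> farr F a b) f" if "f \<in> Hom C a b" for f
      using a that by simp
    ultimately have "bij_betw (farr G (fobj F a) (fobj F b) \<circ> farr F a b) (Hom C a b)
        (Hom E (fobj G (fobj F a)) (fobj G (fobj F b)))"
      by (subst bij_betw_cong[symmetric]) auto
    moreover have "bij_betw (farr G (fobj F a) (fobj F b)) (Hom D (fobj F a) (fobj F b))
        (Hom E (fobj G (fobj F a)) (fobj G (fobj F b)))"
      using ffG a by (simp add: fully_faithful_def F.fobj_in_Obj)
    moreover have "farr F a b ` Hom C a b \<subseteq> Hom D (fobj F a) (fobj F b)"
      using a by (auto simp: F.farr_in_Hom)
    ultimately show "bij_betw (farr F a b) (Hom C a b) (Hom D (fobj F a) (fobj F b))"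
      using bij_betw_comp_iff2 by blast
  qed
  show "ess_surjective C D F"
    unfolding ess_surjective_def
  proof
    fix d assume d: "d \<in> Obj D"
    then obtain c f where c: "c \<in> Obj C" "is_iso E (fobj G (fobj F c)) (fobj G d) f"
      using es G.fobj_in_Obj[OF d] unfolding ess_surjective_def by force
    then show "\<exists>c \<in> Obj C. \<exists>f. is_iso D (fobj F c) d f"
      using fully_faithful_reflects_iso[OF G ffG] d F.fobj_in_Obj by blast
  qed
qed

lemma full_subcat_simps [simp]:
  "Obj (full_subcat C P) = {a \<in> Obj C. P a}" "Hom (full_subcat C P) = Hom C"
  "Id (full_subcat C P) = Id C" "Comp (full_subcat C P) = Comp C"
  by (simp_all add: full_subcat_def)

lemma is_category_full_subcat: "is_category C \<Longrightarrow> is_category (full_subcat C P)"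
  by (auto simp: is_category_def)

text \<open>
  The transposition \<open>\<phi>\<close> is inverse to \<open>k \<mapsto> \<epsilon> \<circ> F k\<close>, and the action of the adjoint on arrows is forced
  by naturality; all laws are checked after applying an injective map.
\<close>

lemma has_right_adjointI:
  assumes F: "is_functor C D F"
    and g [simp]: "\<And>b. b \<in> Obj D \<Longrightarrow> g b \<in> Obj C"
    and \<epsilon> [simp]: "\<And>b. b \<in> Obj D \<Longrightarrow> \<epsilon> b \<in> Hom D (fobj F (g b)) b"
    and bij: "\<And>a b. \<lbrakk>a \<in> Obj C; b \<in> Obj D\<rbrakk>
      \<Longrightarrow> bij_betw (\<lambda>k. Comp D (fobj F a) (fobj F (g b)) b (\<epsilon> b) (farr F a (g b) k)) (Hom C a (g b)) (Hom D (fobj F a) b)"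
  shows "has_right_adjoint C D F"
proof -
  interpret F: is_functor C D F by fact
  note [simp] = F.fobj_in_Obj F.cod.Comp_in_Hom F.dom.Comp_in_Hom F.cod.Id_in_Hom F.dom.Id_in_Hom
    F.farr_in_Hom F.farr_Id F.farr_Comp F.cod.Comp_Id_left F.cod.Comp_Id_right
  let ?E = "\<lambda>a b k. Comp D (fobj F a) (fobj F (g b)) b (\<epsilon> b) (farr F a (g b) k)"
  define \<phi> where "\<phi> a b = the_inv_into (Hom C a (g b)) (?E a b)" for a b
  have \<phi>_bij: "bij_betw (\<phi> a b) (Hom D (fobj F a) b) (Hom C a (g b))" if "a \<in> Obj C" "b \<in> Obj D" for a b
    unfolding \<phi>_def by (rule bij_betw_the_inv_into[OF bij[OF that]])
  have \<phi>_in [simp]: "\<phi> a b k \<in> Hom C a (g b)"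
    if "a \<in> Obj C" "b \<in> Obj D" "k \<in> Hom D (fobj F a) b" for a b k
    using \<phi>_bij that by (auto simp: bij_betw_def)
  have \<phi>_eq [simp]: "?E a b (\<phi> a b k) = k" if "a \<in> Obj C" "b \<in> Obj D" "k \<in> Hom D (fobj F a) b" for a b k
    using bij[OF that(1,2)] that(3) unfolding \<phi>_def bij_betw_def by (metis (no_types, lifting) f_the_inv_into_f)
  have eqI: "k = k'" if "?E a b k = ?E a b k'" "a \<in> Obj C" "b \<in> Obj D"
    "k \<in> Hom C a (g b)" "k' \<in> Hom C a (g b)" for a b k k'
    using bij[OF that(2,3)] that by (auto simp: bij_betw_def inj_on_def)
  define G1 where "G1 b b' q = \<phi> (g b) b' (Comp D (fobj F (g b)) b b' q (\<epsilon> b))" for b b' q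
  have G1_in [simp]: "G1 b b' q \<in> Hom C (g b) (g b')"
    if "b \<in> Obj D" "b' \<in> Obj D" "q \<in> Hom D b b'" for b b' q
    using that by (simp add: G1_def)
  have G1_eq [simp]: "?E (g b) b' (G1 b b' q) = Comp D (fobj F (g b)) b b' q (\<epsilon> b)"
    if "b \<in> Obj D" "b' \<in> Obj D" "q \<in> Hom D b b'" for b b' q
    using that by (simp add: G1_def)
  have G1_eq' [simp]: "Comp D a (fobj F (g b')) b' (\<epsilon> b') (Comp D a (fobj F (g b)) (fobj F (g b')) (farr F (g b) (g b') (G1 b b' q)) x)
      = Comp D a b b' q (Comp D a (fobj F (g b)) b (\<epsilon> b) x)"
    if "a \<in> Obj D" "b \<in> Obj D" "b' \<in> Obj D" "q \<in> Hom D b b'" "x \<in> Hom D a (fobj F (g b))" for a b b' q x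
    using that by (simp add: F.cod.Comp_assoc)
  have G: "is_functor D C (mk_functor D g G1)"
  proof (rule is_functor_mk_functor)
    fix b assume "b \<in> Obj D"
    then show "G1 b b (Id D b) = Id C (g b)" by (intro eqI[of "g b" b]) simp_all
  next
    fix a b c f h assume a: "a \<in> Obj D" "b \<in> Obj D" "c \<in> Obj D" "f \<in> Hom D a b" "h \<in> Hom D b c"
    then show "G1 a c (Comp D a b c h f) = Comp C (g a) (g b) (g c) (G1 b c h) (G1 a b f)"
      by (intro eqI[of "g a" c]) (simp_all add: F.cod.Comp_assoc[symmetric])
  qed (simp_all add: F.dom.is_category_axioms F.cod.is_category_axioms)
  show ?thesis
    unfolding has_right_adjoint_def
  proof (intro conjI exI[of _ "mk_functor D g G1"] exI[of _ \<phi>] ballI)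
    fix a a' b h k
    assume a: "a \<in> Obj C" "a' \<in> Obj C" "b \<in> Obj D" "h \<in> Hom C a' a" "k \<in> Hom D (fobj F a) b"
    then have "\<phi> a' b (Comp D (fobj F a') (fobj F a) b k (farr F a' a h)) = Comp C a' a (g b) (\<phi> a b k) h"
      by (intro eqI[of a' b]) (simp_all add: F.cod.Comp_assoc)
    with a show "\<phi> a' b (Comp D (fobj F a') (fobj F a) b k (farr F a' a h))
        = Comp C a' a (fobj (mk_functor D g G1) b) (\<phi> a b k) h" by simp
  next
    fix a b b' q k
    assume a: "a \<in> Obj C" "b \<in> Obj D" "b' \<in> Obj D" "q \<in> Hom D b b'" "k \<in> Hom D (fobj F a) b"
    then have "\<phi> a b' (Comp D (fobj F a) b b' q k) = Comp C a (g b) (g b') (G1 b b' q) (\<phi> a b k)"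
      by (intro eqI[of a b']) simp_all
    with a show "\<phi> a b' (Comp D (fobj F a) b b' q k) = Comp C a (fobj (mk_functor D g G1) b)
        (fobj (mk_functor D g G1) b') (farr (mk_functor D g G1) b b' q) (\<phi> a b k)" by simp
  qed (simp_all add: F G \<phi>_bij)
qed

text \<open>
  The counit \<open>\<epsilon>\<close> is the arrow with \<open>\<phi> \<epsilon> = 1\<close>; naturality of \<open>\<phi>\<close> in its first variable says that \<open>\<phi>\<close> is
  inverse to \<open>k \<mapsto> \<epsilon> \<circ> F k\<close>.
\<close>

lemma right_adjoint_universal:
  assumes "has_right_adjoint C D F" and b: "b \<in> Obj D"
  obtains h \<epsilon> where "h \<in> Obj C" "\<epsilon> \<in> Hom D (fobj F h) b"
    "\<And>a. a \<in> Obj C \<Longrightarrow> bij_betw (\<lambda>k. Comp D (fobj F a) (fobj F h) b \<epsilon> (farr F a h k)) (Hom C a h) (Hom D (fobj F a) b)"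
proof -
  interpret F: is_functor C D F using assms by (simp add: has_right_adjoint_def)
  obtain G \<phi> where G: "is_functor D C G"
    and bij': "\<forall>a \<in> Obj C. \<forall>b \<in> Obj D. bij_betw (\<phi> a b) (Hom D (fobj F a) b) (Hom C a (fobj G b))"
    and nat': "\<forall>a \<in> Obj C. \<forall>a' \<in> Obj C. \<forall>b \<in> Obj D. \<forall>h \<in> Hom C a' a. \<forall>k \<in> Hom D (fobj F a) b.
         \<phi> a' b (Comp D (fobj F a') (fobj F a) b k (farr F a' a h)) = Comp C a' a (fobj G b) (\<phi> a b k) h"
    using assms(1) unfolding has_right_adjoint_def by (elim conjE exE) (rule that)
  note bij = bij'[rule_format] and nat = nat'[rule_format]
  interpret G: is_functor D C G by fact
  let ?h = "fobj G b"
  have h: "?h \<in> Obj C" using b by (rule G.fobj_in_Obj)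
  obtain \<epsilon> where \<epsilon>: "\<epsilon> \<in> Hom D (fobj F ?h) b" "\<phi> ?h b \<epsilon> = Id C ?h"
    using bij_betw_imp_surj_on[OF bij[OF h b]] F.dom.Id_in_Hom[OF h] by (metis imageE)
  show thesis
  proof
    fix a assume a: "a \<in> Obj C"
    let ?E = "\<lambda>k. Comp D (fobj F a) (fobj F ?h) b \<epsilon> (farr F a ?h k)"
    have E: "?E k \<in> Hom D (fobj F a) b" "\<phi> a b (?E k) = k" if "k \<in> Hom C a ?h" for k
      using that a b h \<epsilon> by (simp_all add: F.cod.Comp_in_Hom F.fobj_in_Obj F.farr_in_Hom nat F.dom.Comp_Id_left)
    have "?E (\<phi> a b k) = k" if k: "k \<in> Hom D (fobj F a) b" for k
    proof (rule inj_onD[OF bij_betw_imp_inj_on[OF bij[OF a b]] _ _ k])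
      have "\<phi> a b k \<in> Hom C a ?h" using bij[OF a b] k by (auto simp: bij_betw_def)
      then show "\<phi> a b (?E (\<phi> a b k)) = \<phi> a b k" "?E (\<phi> a b k) \<in> Hom D (fobj F a) b" by (simp_all add: E)
    qed
    moreover have "\<phi> a b k \<in> Hom C a ?h" if "k \<in> Hom D (fobj F a) b" for k
      using bij[OF a b] that by (auto simp: bij_betw_def)
    ultimately show "bij_betw ?E (Hom C a ?h) (Hom D (fobj F a) b)"
      using E by (intro bij_betw_byWitness[where f' = "\<phi> a b"]) auto
  qed (use h \<epsilon> in auto)
qed

section \<open>Arrows that carry their source and target\<close>

text \<open>
  Equational reasoning is done with arrows that know their source and target, so that composition
  needs no further arguments. The source is an object for categories and a list for multicategories.
\<close>

datatype ('d, 'o, 'm) arrow = Arrow (src: 'd) (tgt: 'o) (mor: 'm)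

definition arr :: "('o, 'm, 'x) category_scheme \<Rightarrow> ('o, 'o, 'm) arrow \<Rightarrow> bool" where
  "arr C f \<longleftrightarrow> src f \<in> Obj C \<and> tgt f \<in> Obj C \<and> mor f \<in> Hom C (src f) (tgt f)"

definition cmp :: "('o, 'm, 'x) category_scheme \<Rightarrow> ('o, 'o, 'm) arrow \<Rightarrow> ('o, 'o, 'm) arrow \<Rightarrow> ('o, 'o, 'm) arrow"
  (infixr "\<cdot>\<index>" 55) where
  "cmp C g f = Arrow (src f) (tgt g) (Comp C (src f) (src g) (tgt g) (mor g) (mor f))"

definition ide :: "('o, 'm, 'x) category_scheme \<Rightarrow> 'o \<Rightarrow> ('o, 'o, 'm) arrow" where
  "ide C a = Arrow a a (Id C a)"

lemma src_cmp [simp]: "src (cmp C g f) = src f"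
  and tgt_cmp [simp]: "tgt (cmp C g f) = tgt g"
  and src_ide [simp]: "src (ide C a) = a"
  and tgt_ide [simp]: "tgt (ide C a) = a"
  by (simp_all add: cmp_def ide_def)

lemma arr_Arrow [simp]: "arr C (Arrow a b f) \<longleftrightarrow> a \<in> Obj C \<and> b \<in> Obj C \<and> f \<in> Hom C a b"
  by (simp add: arr_def)

lemma arr_mor: "arr C f \<Longrightarrow> mor f \<in> Hom C (src f) (tgt f)"
  by (simp add: arr_def)

lemma arr_ends: "arr C f \<Longrightarrow> src f \<in> Obj C" "arr C f \<Longrightarrow> tgt f \<in> Obj C"
  by (simp_all add: arr_def)

context is_category
begin

lemma arr_cmp [simp]: "\<lbrakk>arr C f; arr C g; tgt f = src g\<rbrakk> \<Longrightarrow> arr C (cmp C g f)"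
  by (simp add: arr_def cmp_def Comp_in_Hom)

lemma arr_ide [simp]: "arr C (ide C a) \<longleftrightarrow> a \<in> Obj C"
  by (auto simp: arr_def ide_def Id_in_Hom)

lemma cmp_assoc [simp]: "\<lbrakk>arr C f; arr C g; arr C h; tgt f = src g; tgt g = src h\<rbrakk>
  \<Longrightarrow> cmp C (cmp C h g) f = cmp C h (cmp C g f)"
  by (simp add: arr_def cmp_def Comp_assoc)

lemma cmp_ide_left [simp]: "\<lbrakk>arr C f; tgt f = b\<rbrakk> \<Longrightarrow> cmp C (ide C b) f = f"
  by (cases f) (auto simp add: arr_def cmp_def ide_def Comp_Id_left)

lemma cmp_ide_right [simp]: "\<lbrakk>arr C f; src f = a\<rbrakk> \<Longrightarrow> cmp C f (ide C a) = f"
  by (cases f) (auto simp add: arr_def cmp_def ide_def Comp_Id_right)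

text \<open>
  Composites are kept right-associated, so that an equation between composites of two arrows
  has to be applied in this form when more arrows follow.
\<close>

lemma cmp_reassoc:
  "\<lbrakk>cmp C g f = cmp C g' f'; arr C f; arr C g; tgt f = src g; arr C f'; arr C g'; tgt f' = src g';
    arr C h; tgt h = src f\<rbrakk> \<Longrightarrow> cmp C g (cmp C f h) = cmp C g' (cmp C f' h)"
  by (metis cmp_assoc src_cmp)

lemma cmp_reassoc1:
  "\<lbrakk>cmp C g f = k; arr C f; arr C g; tgt f = src g; arr C h; tgt h = src f\<rbrakk>
    \<Longrightarrow> cmp C g (cmp C f h) = cmp C k h"
  by (metis cmp_assoc)

end

section \<open>Iterated tensors in a skew monoidal category\<close>

text \<open>
  The structure of \<open>V\<close> on such arrows: \<open>f \<odot> g\<close> is the tensor, and \<open>al\<close>, \<open>la\<close>, \<open>ra\<close> are \<open>\<alpha>\<close>, \<open>\<lambda>\<close>, \<open>\<rho>\<close>.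
\<close>

definition tns :: "('o, 'm) skew_mon \<Rightarrow> ('o, 'o, 'm) arrow \<Rightarrow> ('o, 'o, 'm) arrow \<Rightarrow> ('o, 'o, 'm) arrow"
  (infixl "\<odot>\<index>" 70) where
  "tns V f g = Arrow (tobj V (src f) (src g)) (tobj V (tgt f) (tgt g))
    (tarr V (src f) (tgt f) (src g) (tgt g) (mor f) (mor g))"

definition al :: "('o, 'm) skew_mon \<Rightarrow> 'o \<Rightarrow> 'o \<Rightarrow> 'o \<Rightarrow> ('o, 'o, 'm) arrow" where
  "al V a b c = Arrow (tobj V (tobj V a b) c) (tobj V a (tobj V b c)) (assr V a b c)"

definition la :: "('o, 'm) skew_mon \<Rightarrow> 'o \<Rightarrow> ('o, 'o, 'm) arrow" where
  "la V a = Arrow (tobj V (tunit V) a) a (lunit V a)"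

definition ra :: "('o, 'm) skew_mon \<Rightarrow> 'o \<Rightarrow> ('o, 'o, 'm) arrow" where
  "ra V a = Arrow a (tobj V a (tunit V)) (runit V a)"

text \<open>\<open>x \<lhd> [a, b, c]\<close> is the left-bracketed tensor \<open>((x a) b) c\<close>, functorial in \<open>x\<close>.\<close>

definition act :: "('o, 'm) skew_mon \<Rightarrow> 'o \<Rightarrow> 'o list \<Rightarrow> 'o" (infixl "\<lhd>\<index>" 65) where
  "act V = foldl (tobj V)"

definition act_arr :: "('o, 'm) skew_mon \<Rightarrow> ('o, 'o, 'm) arrow \<Rightarrow> 'o list \<Rightarrow> ('o, 'o, 'm) arrow"
  (infixl "\<unlhd>\<index>" 65) where
  "act_arr V = foldl (\<lambda>f a. tns V f (ide V a))"

text \<open>The iterated associativity \<open>(y x) \<lhd> as \<rightarrow> y (x \<lhd> as)\<close>.\<close>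

primrec als :: "('o, 'm) skew_mon \<Rightarrow> 'o list \<Rightarrow> 'o \<Rightarrow> 'o \<Rightarrow> ('o, 'o, 'm) arrow" where
  "als V [] y x = ide V (tobj V y x)"
| "als V (a # as) y x = cmp V (als V as y (tobj V x a)) (act_arr V (al V y x a) as)"

lemma act_simps [simp]: "act V x [] = x" "act V x (a # as) = act V (tobj V x a) as"
  and act_append [simp]: "act V x (as @ bs) = act V (act V x as) bs"
  and act_arr_simps [simp]: "act_arr V f [] = f" "act_arr V f (a # as) = act_arr V (tns V f (ide V a)) as"
  and act_arr_append [simp]: "act_arr V f (as @ bs) = act_arr V (act_arr V f as) bs"
  by (simp_all add: act_def act_arr_def)

lemma ends_simps [simp]:
  "src (tns V f g) = tobj V (src f) (src g)" "tgt (tns V f g) = tobj V (tgt f) (tgt g)"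
  "src (al V a b c) = tobj V (tobj V a b) c" "tgt (al V a b c) = tobj V a (tobj V b c)"
  "src (la V a) = tobj V (tunit V) a" "tgt (la V a) = a"
  "src (ra V a) = a" "tgt (ra V a) = tobj V a (tunit V)"
  by (simp_all add: tns_def al_def la_def ra_def)

lemma ends_act_arr [simp]:
  "src (act_arr V f as) = act V (src f) as" "tgt (act_arr V f as) = act V (tgt f) as"
  by (induction as arbitrary: f) auto

lemma src_als [simp]: "src (als V as y x) = act V (tobj V y x) as"
  by (induction as arbitrary: x) auto

lemma tgt_als [simp]: "tgt (als V as y x) = tobj V y (act V x as)"
  by (induction as arbitrary: x) auto

context skew_monoidal
begin

lemmas [simp] = tobj_in_Obj tunit_in_Obj

lemma arr_simps [simp]:
  "\<lbrakk>arr V f; arr V g\<rbrakk> \<Longrightarrow> arr V (f \<odot> g)"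
  "\<lbrakk>a \<in> Obj V; b \<in> Obj V; c \<in> Obj V\<rbrakk> \<Longrightarrow> arr V (al V a b c)"
  "a \<in> Obj V \<Longrightarrow> arr V (la V a)"
  "a \<in> Obj V \<Longrightarrow> arr V (ra V a)"
  by (simp_all add: arr_def tns_def al_def la_def ra_def tarr_in_Hom assr_in_Hom lunit_in_Hom runit_in_Hom)

lemma tns_ide [simp]: "\<lbrakk>a \<in> Obj V; b \<in> Obj V\<rbrakk> \<Longrightarrow> ide V a \<odot> ide V b = ide V (a \<otimes> b)"
  by (simp add: ide_def tns_def tarr_Id)

lemma tns_cmp: "\<lbrakk>arr V f; arr V g; arr V f'; arr V g'; tgt f = src g; tgt f' = src g'\<rbrakk>
  \<Longrightarrow> (g \<odot> g') \<cdot> (f \<odot> f') = (g \<cdot> f) \<odot> (g' \<cdot> f')"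
  by (simp add: arr_def cmp_def tns_def tarr_Comp)

lemma al_nat: "\<lbrakk>arr V f; arr V g; arr V h\<rbrakk>
  \<Longrightarrow> (f \<odot> (g \<odot> h)) \<cdot> al V (src f) (src g) (src h) = al V (tgt f) (tgt g) (tgt h) \<cdot> ((f \<odot> g) \<odot> h)"
  by (simp add: arr_def cmp_def tns_def al_def assr_natural)

lemma la_nat: "arr V f \<Longrightarrow> f \<cdot> la V (src f) = la V (tgt f) \<cdot> (ide V \<one> \<odot> f)"
  by (simp add: arr_def cmp_def tns_def la_def ide_def lunit_natural)

lemma ra_nat: "arr V f \<Longrightarrow> ra V (tgt f) \<cdot> f = (f \<odot> ide V \<one>) \<cdot> ra V (src f)"
  by (simp add: arr_def cmp_def tns_def ra_def ide_def runit_natural)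

lemma al_pentagon: "\<lbrakk>a \<in> Obj V; b \<in> Obj V; c \<in> Obj V; d \<in> Obj V\<rbrakk>
  \<Longrightarrow> al V a b (c \<otimes> d) \<cdot> al V (a \<otimes> b) c d
    = (ide V a \<odot> al V b c d) \<cdot> al V a (b \<otimes> c) d \<cdot> (al V a b c \<odot> ide V d)"
  by (simp add: cmp_def tns_def al_def ide_def pentagon)

lemma la_al: "\<lbrakk>a \<in> Obj V; b \<in> Obj V\<rbrakk> \<Longrightarrow> la V (a \<otimes> b) \<cdot> al V \<one> a b = la V a \<odot> ide V b"
  by (simp add: cmp_def tns_def al_def ide_def la_def lunit_assr)

lemma al_ra: "\<lbrakk>a \<in> Obj V; b \<in> Obj V\<rbrakk> \<Longrightarrow> al V a b \<one> \<cdot> ra V (a \<otimes> b) = ide V a \<odot> ra V b"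
  by (simp add: cmp_def tns_def al_def ide_def ra_def assr_runit)

lemma la_al_ra: "\<lbrakk>a \<in> Obj V; b \<in> Obj V\<rbrakk>
  \<Longrightarrow> (ide V a \<odot> la V b) \<cdot> al V a \<one> b \<cdot> (ra V a \<odot> ide V b) = ide V (a \<otimes> b)"
  by (simp add: cmp_def tns_def al_def ide_def ra_def la_def lunit_assr_runit)

lemma la_ra: "la V \<one> \<cdot> ra V \<one> = ide V \<one>"
  by (simp add: cmp_def la_def ra_def ide_def lunit_runit)

declare arr_ends [simp]

lemma act_in_Obj [simp]: "\<lbrakk>x \<in> Obj V; set as \<subseteq> Obj V\<rbrakk> \<Longrightarrow> x \<lhd> as \<in> Obj V"
  by (induction as arbitrary: x) auto

lemma arr_act_arr [simp]: "\<lbrakk>arr V f; set as \<subseteq> Obj V\<rbrakk> \<Longrightarrow> arr V (f \<unlhd> as)"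
  by (induction as arbitrary: f) auto

lemma act_arr_ide [simp]: "\<lbrakk>x \<in> Obj V; set as \<subseteq> Obj V\<rbrakk> \<Longrightarrow> ide V x \<unlhd> as = ide V (x \<lhd> as)"
  by (induction as arbitrary: x) auto

lemma act_arr_cmp: "\<lbrakk>arr V f; arr V g; tgt f = src g; set as \<subseteq> Obj V\<rbrakk>
  \<Longrightarrow> (g \<cdot> f) \<unlhd> as = (g \<unlhd> as) \<cdot> (f \<unlhd> as)"
proof (induction as arbitrary: f g)
  case (Cons a as)
  then show ?case
    using Cons.IH[of "f \<odot> ide V a" "g \<odot> ide V a"] by (simp add: tns_cmp)
qed simp

lemma arr_als [simp]: "\<lbrakk>x \<in> Obj V; y \<in> Obj V; set as \<subseteq> Obj V\<rbrakk> \<Longrightarrow> arr V (als V as y x)"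
  by (induction as arbitrary: x) auto

lemma ide_tns_cmp: "\<lbrakk>arr V f; arr V g; tgt f = src g; y \<in> Obj V\<rbrakk>
  \<Longrightarrow> ide V y \<odot> (g \<cdot> f) = (ide V y \<odot> g) \<cdot> (ide V y \<odot> f)"
  by (simp add: tns_cmp)

lemma tns_ide_cmp: "\<lbrakk>arr V f; arr V g; tgt f = src g; y \<in> Obj V\<rbrakk>
  \<Longrightarrow> (g \<cdot> f) \<odot> ide V y = (g \<odot> ide V y) \<cdot> (f \<odot> ide V y)"
  by (simp add: tns_cmp)

lemma als_nat: "\<lbrakk>arr V f; arr V g; set as \<subseteq> Obj V\<rbrakk>
  \<Longrightarrow> (g \<odot> (f \<unlhd> as)) \<cdot> als V as (src g) (src f) = als V as (tgt g) (tgt f) \<cdot> ((g \<odot> f) \<unlhd> as)"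
proof (induction as arbitrary: f)
  case (Cons a as)
  let ?f = "f \<odot> ide V a"
  have "(g \<odot> (f \<unlhd> (a # as))) \<cdot> als V (a # as) (src g) (src f)
      = ((g \<odot> (?f \<unlhd> as)) \<cdot> als V as (src g) (src ?f)) \<cdot> (al V (src g) (src f) a \<unlhd> as)"
    using Cons.prems by simp
  also have "\<dots> = als V as (tgt g) (tgt ?f) \<cdot> ((g \<odot> ?f) \<unlhd> as) \<cdot> (al V (src g) (src f) a \<unlhd> as)"
    using Cons.prems by (subst Cons.IH) simp_all
  also have "\<dots> = als V as (tgt g) (tgt ?f) \<cdot> (((g \<odot> ?f) \<cdot> al V (src g) (src f) a) \<unlhd> as)"
    using Cons.prems by (simp add: act_arr_cmp)
  also have "(g \<odot> ?f) \<cdot> al V (src g) (src f) a = al V (tgt g) (tgt f) a \<cdot> ((g \<odot> f) \<odot> ide V a)"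
    using Cons.prems al_nat[of g f "ide V a"] by simp
  finally show ?case using Cons.prems by (simp add: act_arr_cmp)
qed simp

lemma als_append: "\<lbrakk>x \<in> Obj V; y \<in> Obj V; set as \<subseteq> Obj V; set bs \<subseteq> Obj V\<rbrakk>
  \<Longrightarrow> als V (as @ bs) y x = als V bs y (x \<lhd> as) \<cdot> (als V as y x \<unlhd> bs)"
  by (induction as arbitrary: x) (simp_all add: act_arr_cmp)

text \<open>
  The pentagon, iterated along \<open>as\<close>; naturality of \<open>als\<close> moves one \<open>\<alpha>\<close> past the iterated ones.
\<close>

lemma als_pentagon: "\<lbrakk>x \<in> Obj V; y \<in> Obj V; z \<in> Obj V; set as \<subseteq> Obj V\<rbrakk>
  \<Longrightarrow> (ide V z \<odot> als V as y x) \<cdot> als V as z (y \<otimes> x) \<cdot> (al V z y x \<unlhd> as)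
    = al V z y (x \<lhd> as) \<cdot> als V as (z \<otimes> y) x"
proof (induction as arbitrary: x)
  case (Cons a as)
  let ?x = "x \<otimes> a"
  have "al V z y (x \<lhd> (a # as)) \<cdot> als V (a # as) (z \<otimes> y) x
      = (al V z y (?x \<lhd> as) \<cdot> als V as (z \<otimes> y) ?x) \<cdot> (al V (z \<otimes> y) x a \<unlhd> as)"
    using Cons.prems by simp
  also have "\<dots> = ((ide V z \<odot> als V as y ?x) \<cdot> als V as z (y \<otimes> ?x) \<cdot> (al V z y ?x \<unlhd> as)) \<cdot> (al V (z \<otimes> y) x a \<unlhd> as)"
    using Cons.prems by (subst Cons.IH) simp_all
  also have "\<dots> = (ide V z \<odot> als V as y ?x) \<cdot> als V as z (y \<otimes> ?x) \<cdot> ((al V z y ?x \<cdot> al V (z \<otimes> y) x a) \<unlhd> as)"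
    using Cons.prems by (simp add: act_arr_cmp)
  also have "\<dots> = (ide V z \<odot> als V as y ?x) \<cdot> (als V as z (y \<otimes> ?x) \<cdot> ((ide V z \<odot> al V y x a) \<unlhd> as))
      \<cdot> (al V z (y \<otimes> x) a \<unlhd> as) \<cdot> ((al V z y x \<odot> ide V a) \<unlhd> as)"
    using Cons.prems by (simp add: act_arr_cmp al_pentagon)
  also have "als V as z (y \<otimes> ?x) \<cdot> ((ide V z \<odot> al V y x a) \<unlhd> as)
      = (ide V z \<odot> (al V y x a \<unlhd> as)) \<cdot> als V as z ((y \<otimes> x) \<otimes> a)"
    using Cons.prems als_nat[of "al V y x a" "ide V z" as] by simp
  finally show ?case
    using Cons.prems by (simp add: ide_tns_cmp)
qed simp

lemma la_als: "\<lbrakk>x \<in> Obj V; set as \<subseteq> Obj V\<rbrakk> \<Longrightarrow> la V (x \<lhd> as) \<cdot> als V as \<one> x = la V x \<unlhd> as"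
proof (induction as arbitrary: x)
  case (Cons a as)
  have "la V (x \<lhd> (a # as)) \<cdot> als V (a # as) \<one> x = (la V ((x \<otimes> a) \<lhd> as) \<cdot> als V as \<one> (x \<otimes> a)) \<cdot> (al V \<one> x a \<unlhd> as)"
    using Cons.prems by simp
  also have "\<dots> = (la V (x \<otimes> a) \<cdot> al V \<one> x a) \<unlhd> as"
    using Cons.prems by (subst Cons.IH) (simp_all add: act_arr_cmp)
  finally show ?case using Cons.prems by (simp add: la_al)
qed simp

end

section \<open>Linear families\<close>

text \<open>
  A multimap \<open>as \<rightarrow> b\<close> is to be a map \<open>\<one> \<lhd> as \<rightarrow> b\<close>. Such maps are the same as families
  \<open>\<tau> x : x \<lhd> as \<rightarrow> x b\<close> that are natural in \<open>x\<close> and compatible with the associativities. In the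
  latter form substitution is whiskering followed by composition, so that the
  laws of a multicategory reduce to functoriality of \<open>\<lhd>\<close> and naturality.
\<close>

definition linear :: "('o, 'm) skew_mon \<Rightarrow> 'o list \<Rightarrow> 'o \<Rightarrow> ('o \<Rightarrow> ('o, 'o, 'm) arrow) \<Rightarrow> bool" where
  "linear V as b \<tau> \<longleftrightarrow>
    (\<forall>x \<in> Obj V. arr V (\<tau> x) \<and> src (\<tau> x) = act V x as \<and> tgt (\<tau> x) = tobj V x b) \<and>
    (\<forall>f. arr V f \<longrightarrow> cmp V (tns V f (ide V b)) (\<tau> (src f)) = cmp V (\<tau> (tgt f)) (act_arr V f as)) \<and>
    (\<forall>x \<in> Obj V. \<forall>y \<in> Obj V.
      cmp V (al V y x b) (\<tau> (tobj V y x)) = cmp V (tns V (ide V y) (\<tau> x)) (als V as y x))"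

text \<open>
  The linear family generated by \<open>g : \<one> \<lhd> as \<rightarrow> b\<close>: insert a unit on the right of \<open>x\<close>, move \<open>x\<close> out of the
  iterated tensor, and apply \<open>g\<close> to what remains.
\<close>

definition ext :: "('o, 'm) skew_mon \<Rightarrow> 'o list \<Rightarrow> ('o, 'o, 'm) arrow \<Rightarrow> 'o \<Rightarrow> ('o, 'o, 'm) arrow" where
  "ext V as g x = cmp V (tns V (ide V x) g) (cmp V (als V as x (tunit V)) (act_arr V (ra V x) as))"

context skew_monoidal
begin

lemma linearD:
  assumes "linear V as b \<tau>"
  shows "x \<in> Obj V \<Longrightarrow> arr V (\<tau> x)" "x \<in> Obj V \<Longrightarrow> src (\<tau> x) = x \<lhd> as" "x \<in> Obj V \<Longrightarrow> tgt (\<tau> x) = x \<otimes> b"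
    and "arr V f \<Longrightarrow> (f \<odot> ide V b) \<cdot> \<tau> (src f) = \<tau> (tgt f) \<cdot> (f \<unlhd> as)"
    and "\<lbrakk>x \<in> Obj V; y \<in> Obj V\<rbrakk> \<Longrightarrow> al V y x b \<cdot> \<tau> (y \<otimes> x) = (ide V y \<odot> \<tau> x) \<cdot> als V as y x"
  using assms by (auto simp: linear_def)

lemma ext_arr [simp]:
  assumes "arr V g" "src g = \<one> \<lhd> as" "set as \<subseteq> Obj V" "x \<in> Obj V"
  shows "arr V (ext V as g x)" "src (ext V as g x) = x \<lhd> as" "tgt (ext V as g x) = x \<otimes> tgt g"
  using assms by (simp_all add: ext_def)

text \<open>
  Naturality of \<open>ext as g\<close> is that of \<open>\<rho>\<close> and \<open>als\<close>; compatibility with \<open>\<alpha>\<close> is the iterated pentagon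
  together with \<open>\<alpha> \<rho> = a \<rho>\<close>.
\<close>

lemma linear_ext:
  assumes g: "arr V g" "src g = \<one> \<lhd> as" and as: "set as \<subseteq> Obj V"
  shows "linear V as (tgt g) (ext V as g)"
  unfolding linear_def
proof (intro conjI allI ballI impI)
  fix f assume f: "arr V f"
  have "(f \<odot> ide V (tgt g)) \<cdot> ext V as g (src f)
      = (ide V (tgt f) \<odot> g) \<cdot> ((f \<odot> (ide V \<one> \<unlhd> as)) \<cdot> als V as (src f) \<one>) \<cdot> (ra V (src f) \<unlhd> as)"
    using f g as by (simp add: ext_def cmp_reassoc[of "f \<odot> ide V (tgt g)" "ide V (src f) \<odot> g" "ide V (tgt f) \<odot> g" "f \<odot> ide V (src g)"] tns_cmp)
  also have "(f \<odot> (ide V \<one> \<unlhd> as)) \<cdot> als V as (src f) \<one> = als V as (tgt f) \<one> \<cdot> ((f \<odot> ide V \<one>) \<unlhd> as)"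
    using f as als_nat[of "ide V \<one>" f as] by simp
  also have "(ide V (tgt f) \<odot> g) \<cdot> (als V as (tgt f) \<one> \<cdot> ((f \<odot> ide V \<one>) \<unlhd> as)) \<cdot> (ra V (src f) \<unlhd> as)
      = (ide V (tgt f) \<odot> g) \<cdot> als V as (tgt f) \<one> \<cdot> (((f \<odot> ide V \<one>) \<cdot> ra V (src f)) \<unlhd> as)"
    using f g as by (simp add: act_arr_cmp)
  also have "\<dots> = ext V as g (tgt f) \<cdot> (f \<unlhd> as)"
    using f g as by (simp add: ra_nat[symmetric] act_arr_cmp ext_def)
  finally show "(f \<odot> ide V (tgt g)) \<cdot> ext V as g (src f) = ext V as g (tgt f) \<cdot> (f \<unlhd> as)" .
next
  fix x y assume x: "x \<in> Obj V" and y: "y \<in> Obj V"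
  have "al V y x (tgt g) \<cdot> ext V as g (y \<otimes> x)
      = (al V y x (tgt g) \<cdot> ((ide V y \<odot> ide V x) \<odot> g)) \<cdot> als V as (y \<otimes> x) \<one> \<cdot> (ra V (y \<otimes> x) \<unlhd> as)"
    using x y g as by (simp add: ext_def)
  also have "al V y x (tgt g) \<cdot> ((ide V y \<odot> ide V x) \<odot> g) = (ide V y \<odot> (ide V x \<odot> g)) \<cdot> al V y x (\<one> \<lhd> as)"
    using x y g as al_nat[of "ide V y" "ide V x" g] by simp
  also have "((ide V y \<odot> (ide V x \<odot> g)) \<cdot> al V y x (\<one> \<lhd> as)) \<cdot> als V as (y \<otimes> x) \<one> \<cdot> (ra V (y \<otimes> x) \<unlhd> as)
      = (ide V y \<odot> (ide V x \<odot> g)) \<cdot> (al V y x (\<one> \<lhd> as) \<cdot> als V as (y \<otimes> x) \<one>) \<cdot> (ra V (y \<otimes> x) \<unlhd> as)"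
    using x y g as by simp
  also have "al V y x (\<one> \<lhd> as) \<cdot> als V as (y \<otimes> x) \<one>
      = (ide V y \<odot> als V as x \<one>) \<cdot> als V as y (x \<otimes> \<one>) \<cdot> (al V y x \<one> \<unlhd> as)"
    using x y as by (simp add: als_pentagon)
  also have "(ide V y \<odot> (ide V x \<odot> g)) \<cdot> ((ide V y \<odot> als V as x \<one>) \<cdot> als V as y (x \<otimes> \<one>) \<cdot> (al V y x \<one> \<unlhd> as)) \<cdot> (ra V (y \<otimes> x) \<unlhd> as)
      = (ide V y \<odot> (ide V x \<odot> g)) \<cdot> (ide V y \<odot> als V as x \<one>) \<cdot> als V as y (x \<otimes> \<one>) \<cdot> ((al V y x \<one> \<cdot> ra V (y \<otimes> x)) \<unlhd> as)"
    using x y g as by (simp add: act_arr_cmp)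
  also have "\<dots> = (ide V y \<odot> (ide V x \<odot> g)) \<cdot> (ide V y \<odot> als V as x \<one>) \<cdot> (als V as y (x \<otimes> \<one>) \<cdot> ((ide V y \<odot> ra V x) \<unlhd> as))"
    using x y g as by (simp add: al_ra)
  also have "als V as y (x \<otimes> \<one>) \<cdot> ((ide V y \<odot> ra V x) \<unlhd> as) = (ide V y \<odot> (ra V x \<unlhd> as)) \<cdot> als V as y x"
    using x y as als_nat[of "ra V x" "ide V y" as] by simp
  finally show "al V y x (tgt g) \<cdot> ext V as g (y \<otimes> x) = (ide V y \<odot> ext V as g x) \<cdot> als V as y x"
    using x y g as by (simp add: ext_def ide_tns_cmp)
qed (use g as in simp_all)

text \<open>
  At \<open>x = \<one>\<close>, \<open>\<lambda>\<close> absorbs \<open>als\<close>, and \<open>\<lambda> \<rho> = 1\<close> cancels the unit that \<open>ext\<close> has inserted.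
\<close>

lemma la_ext:
  assumes g: "arr V g" "src g = \<one> \<lhd> as" and as: "set as \<subseteq> Obj V"
  shows "la V (tgt g) \<cdot> ext V as g \<one> = g"
proof -
  have "la V (tgt g) \<cdot> ext V as g \<one> = (la V (tgt g) \<cdot> (ide V \<one> \<odot> g)) \<cdot> als V as \<one> \<one> \<cdot> (ra V \<one> \<unlhd> as)"
    using g as by (simp add: ext_def)
  also have "\<dots> = g \<cdot> (la V (\<one> \<lhd> as) \<cdot> als V as \<one> \<one>) \<cdot> (ra V \<one> \<unlhd> as)"
    using g as by (simp add: la_nat[symmetric])
  also have "\<dots> = g \<cdot> ((la V \<one> \<cdot> ra V \<one>) \<unlhd> as)"
    using g as by (simp add: la_als act_arr_cmp)
  finally show ?thesis using g as by (simp add: la_ra)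
qed

text \<open>
  By compatibility with \<open>\<alpha>\<close>, \<open>x \<tau>\<^sub>1\<close> is \<open>\<tau>\<close> at \<open>x \<one>\<close> up to \<open>\<alpha>\<close>; restricting along \<open>\<rho>\<close> gives back \<open>\<tau> x\<close>,
  because what is left over is \<open>(x \<lambda>) \<alpha> (\<rho> b) = 1\<close>. So a linear family is determined by its component at the unit.
\<close>

lemma ext_la_linear:
  assumes t: "linear V as b \<tau>" and as: "set as \<subseteq> Obj V" "b \<in> Obj V" and x: "x \<in> Obj V"
  shows "ext V as (la V b \<cdot> \<tau> \<one>) x = \<tau> x"
proof -
  note [simp] = linearD(1-3)[OF t]
  have "ext V as (la V b \<cdot> \<tau> \<one>) x = (ide V x \<odot> la V b) \<cdot> ((ide V x \<odot> \<tau> \<one>) \<cdot> als V as x \<one>) \<cdot> (ra V x \<unlhd> as)"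
    using as x by (simp add: ext_def ide_tns_cmp)
  also have "(ide V x \<odot> \<tau> \<one>) \<cdot> als V as x \<one> = al V x \<one> b \<cdot> \<tau> (x \<otimes> \<one>)"
    using as x by (simp add: linearD(5)[OF t])
  also have "(ide V x \<odot> la V b) \<cdot> (al V x \<one> b \<cdot> \<tau> (x \<otimes> \<one>)) \<cdot> (ra V x \<unlhd> as)
      = (ide V x \<odot> la V b) \<cdot> al V x \<one> b \<cdot> (\<tau> (x \<otimes> \<one>) \<cdot> (ra V x \<unlhd> as))"
    using as x by simp
  also have "\<tau> (x \<otimes> \<one>) \<cdot> (ra V x \<unlhd> as) = (ra V x \<odot> ide V b) \<cdot> \<tau> x"
    using as x linearD(4)[OF t, of "ra V x"] by simp
  also have "(ide V x \<odot> la V b) \<cdot> al V x \<one> b \<cdot> (ra V x \<odot> ide V b) \<cdot> \<tau> x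
      = ((ide V x \<odot> la V b) \<cdot> al V x \<one> b \<cdot> (ra V x \<odot> ide V b)) \<cdot> \<tau> x"
    using as x by simp
  finally show ?thesis using as x by (simp only: la_al_ra) simp
qed

lemma linear_ide: "b \<in> Obj V \<Longrightarrow> linear V [b] b (\<lambda>x. ide V (x \<otimes> b))"
  by (auto simp: linear_def)

text \<open>
  Whiskering \<open>\<tau>\<close> by \<open>p\<close> on the inside and by \<open>s\<close> on the outside, and then composing with \<open>\<sigma>\<close>.
\<close>

lemma linear_subst:
  assumes g: "linear V (p @ [b] @ s) c \<sigma>" and f: "linear V as b \<tau>"
    and objs: "set (p @ [b] @ s) \<subseteq> Obj V" "set as \<subseteq> Obj V" "c \<in> Obj V"
  shows "linear V (p @ as @ s) c (\<lambda>x. \<sigma> x \<cdot> (\<tau> (x \<lhd> p) \<unlhd> s))"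
  unfolding linear_def
proof (intro conjI allI ballI impI)
  note [simp] = linearD(1-3)[OF g] linearD(1-3)[OF f]
  { fix k assume k: "arr V k"
    have "(k \<odot> ide V c) \<cdot> \<sigma> (src k) \<cdot> (\<tau> (src k \<lhd> p) \<unlhd> s)
       = \<sigma> (tgt k) \<cdot> (((k \<unlhd> p) \<odot> ide V b) \<unlhd> s) \<cdot> (\<tau> (src k \<lhd> p) \<unlhd> s)"
      using k objs by (simp add: cmp_reassoc[OF linearD(4)[OF g]])
    also have "\<dots> = \<sigma> (tgt k) \<cdot> ((((k \<unlhd> p) \<odot> ide V b) \<cdot> \<tau> (src k \<lhd> p)) \<unlhd> s)"
      using k objs by (simp add: act_arr_cmp)
    also have "((k \<unlhd> p) \<odot> ide V b) \<cdot> \<tau> (src k \<lhd> p) = \<tau> (tgt k \<lhd> p) \<cdot> (k \<unlhd> p \<unlhd> as)"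
      using k objs linearD(4)[OF f, of "k \<unlhd> p"] by simp
    finally show "(k \<odot> ide V c) \<cdot> \<sigma> (src k) \<cdot> (\<tau> (src k \<lhd> p) \<unlhd> s)
       = (\<sigma> (tgt k) \<cdot> (\<tau> (tgt k \<lhd> p) \<unlhd> s)) \<cdot> (k \<unlhd> (p @ as @ s))"
      using k objs by (simp add: act_arr_cmp)
  next
    fix x y assume x: "x \<in> Obj V" and y: "y \<in> Obj V"
    let ?x = "x \<lhd> p"
    have "al V y x c \<cdot> \<sigma> (y \<otimes> x) \<cdot> (\<tau> ((y \<otimes> x) \<lhd> p) \<unlhd> s)
       = (ide V y \<odot> \<sigma> x) \<cdot> als V (p @ [b] @ s) y x \<cdot> (\<tau> ((y \<otimes> x) \<lhd> p) \<unlhd> s)"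
      using x y objs by (simp add: cmp_reassoc[OF linearD(5)[OF g]] del: als.simps)
    also have "\<dots> = (ide V y \<odot> \<sigma> x) \<cdot> als V s y (?x \<otimes> b) \<cdot> ((al V y ?x b \<cdot> ((als V p y x \<odot> ide V b) \<cdot> \<tau> ((y \<otimes> x) \<lhd> p))) \<unlhd> s)"
      using x y objs by (simp add: als_append act_arr_cmp)
    also have "(als V p y x \<odot> ide V b) \<cdot> \<tau> ((y \<otimes> x) \<lhd> p) = \<tau> (y \<otimes> ?x) \<cdot> (als V p y x \<unlhd> as)"
      using x y objs linearD(4)[OF f, of "als V p y x"] by simp
    also have "al V y ?x b \<cdot> \<tau> (y \<otimes> ?x) \<cdot> (als V p y x \<unlhd> as) = (ide V y \<odot> \<tau> ?x) \<cdot> als V as y ?x \<cdot> (als V p y x \<unlhd> as)"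
      using x y objs by (simp add: cmp_reassoc[OF linearD(5)[OF f]])
    also have "(ide V y \<odot> \<sigma> x) \<cdot> als V s y (?x \<otimes> b) \<cdot> (((ide V y \<odot> \<tau> ?x) \<cdot> als V as y ?x \<cdot> (als V p y x \<unlhd> as)) \<unlhd> s)
      = (ide V y \<odot> \<sigma> x) \<cdot> (als V s y (?x \<otimes> b) \<cdot> ((ide V y \<odot> \<tau> ?x) \<unlhd> s)) \<cdot> (als V as y ?x \<unlhd> s) \<cdot> (als V p y x \<unlhd> as \<unlhd> s)"
      using x y objs by (simp add: act_arr_cmp)
    also have "als V s y (?x \<otimes> b) \<cdot> ((ide V y \<odot> \<tau> ?x) \<unlhd> s) = (ide V y \<odot> (\<tau> ?x \<unlhd> s)) \<cdot> als V s y (?x \<lhd> as)"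
      using x y objs als_nat[of "\<tau> ?x" "ide V y" s] by simp
    finally show "al V y x c \<cdot> \<sigma> (y \<otimes> x) \<cdot> (\<tau> ((y \<otimes> x) \<lhd> p) \<unlhd> s)
      = (ide V y \<odot> (\<sigma> x \<cdot> (\<tau> (x \<lhd> p) \<unlhd> s))) \<cdot> als V (p @ as @ s) y x"
      using x y objs by (simp add: als_append act_arr_cmp ide_tns_cmp)
  }
qed (use objs in \<open>simp_all add: linearD(1-3)[OF g] linearD(1-3)[OF f]\<close>)

end

section \<open>The multicategory of a skew monoidal category\<close>

lemma mor_in_Hom: "\<lbrakk>arr C f; src f = a; tgt f = b\<rbrakk> \<Longrightarrow> mor f \<in> Hom C a b"
  using arr_mor by blast

text \<open>
  Substitution of \<open>f\<close> into \<open>g\<close> after \<open>p\<close> and before \<open>s\<close>: only the component of the linear family of \<open>f\<close> at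
  \<open>\<one> \<lhd> p\<close> is involved.
\<close>

definition sbs :: "('o, 'm) skew_mon \<Rightarrow> 'o list \<Rightarrow> 'o list \<Rightarrow> 'o list \<Rightarrow> ('o, 'o, 'm) arrow \<Rightarrow> ('o, 'o, 'm) arrow \<Rightarrow> ('o, 'o, 'm) arrow" where
  "sbs V p s as g f = cmp V g (act_arr V (ext V as f (act V (tunit V) p)) s)"

text \<open>
  Unary maps \<open>a \<rightarrow> b\<close> are arrows \<open>\<one> a \<rightarrow> b\<close>, whence \<open>\<lambda>\<close> as the identity.
\<close>

definition multi_of :: "('o, 'm) skew_mon \<Rightarrow> ('o, 'm) multi" where
  "multi_of V =
    \<lparr>mobj = Obj V,
     mhom = (\<lambda>as b. Hom V (act V (tunit V) as) b),
     mid = lunit V,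
     msub = (\<lambda>p b s as c g f.
       mor (sbs V p s as (Arrow (act V (tunit V) (p @ [b] @ s)) c g) (Arrow (act V (tunit V) as) b f)))\<rparr>"

lemma multi_of_simps [simp]:
  "mobj (multi_of V) = Obj V" "mhom (multi_of V) as b = Hom V (act V (tunit V) as) b" "mid (multi_of V) = lunit V"
  "msub (multi_of V) p b s as c g f =
    mor (sbs V p s as (Arrow (act V (tunit V) (p @ [b] @ s)) c g) (Arrow (act V (tunit V) as) b f))"
  by (simp_all add: multi_of_def)

lemma ends_sbs [simp]: "src (sbs V p s as g f) = act V (src (ext V as f (act V (tunit V) p))) s" "tgt (sbs V p s as g f) = tgt g"
  by (simp_all add: sbs_def)

context is_category
begin

lemma bij_betw_precomp_iso:
  assumes e: "arr C e" "arr C e'" "src e' = tgt e" "tgt e' = src e" "cmp C e' e = ide C (src e)" "cmp C e e' = ide C (tgt e)"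
    and d: "d \<in> Obj C"
  shows "bij_betw (\<lambda>g. mor (cmp C (Arrow (tgt e) d g) e)) (Hom C (tgt e) d) (Hom C (src e) d)"
proof (rule bij_betw_byWitness[where f' = "\<lambda>g. mor (cmp C (Arrow (src e) d g) e')"])
  have eta: "Arrow a b (mor f) = f" if "src f = a" "tgt f = b" for a b and f :: "('a, 'a, 'b) arrow"
    using that by (cases f) auto
  show "\<forall>g\<in>Hom C (tgt e) d. mor (cmp C (Arrow (src e) d (mor (cmp C (Arrow (tgt e) d g) e))) e') = g"
    "\<forall>g\<in>Hom C (src e) d. mor (cmp C (Arrow (tgt e) d (mor (cmp C (Arrow (src e) d g) e'))) e) = g"
    using e d by (simp_all add: eta arr_ends)
  show "(\<lambda>g. mor (cmp C (Arrow (tgt e) d g) e)) ` Hom C (tgt e) d \<subseteq> Hom C (src e) d"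
    "(\<lambda>g. mor (cmp C (Arrow (src e) d g) e')) ` Hom C (src e) d \<subseteq> Hom C (tgt e) d"
    using e d by (auto simp: arr_ends intro!: mor_in_Hom)
qed

end

lemma Arrow_mor [simp]: "\<lbrakk>src f = a; tgt f = b\<rbrakk> \<Longrightarrow> Arrow a b (mor f) = f"
  by (cases f) auto

context skew_monoidal
begin

lemma arr_sbs [simp]:
  assumes "arr V g" "arr V f" "src g = \<one> \<lhd> (p @ [tgt f] @ s)" "src f = \<one> \<lhd> as" "set p \<subseteq> Obj V" "set s \<subseteq> Obj V" "set as \<subseteq> Obj V"
  shows "arr V (sbs V p s as g f)"
  using assms by (simp add: sbs_def)

text \<open>
  Both sides are linear families with the same component at the unit.
\<close>

lemma ext_sbs:
  assumes g: "arr V g" "src g = \<one> \<lhd> (p @ [tgt f] @ s)" and f: "arr V f" "src f = \<one> \<lhd> as"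
    and objs: "set p \<subseteq> Obj V" "set s \<subseteq> Obj V" "set as \<subseteq> Obj V" "x \<in> Obj V"
  shows "ext V (p @ as @ s) (sbs V p s as g f) x = ext V (p @ [tgt f] @ s) g x \<cdot> (ext V as f (x \<lhd> p) \<unlhd> s)"
proof -
  have g': "linear V (p @ [tgt f] @ s) (tgt g) (ext V (p @ [tgt f] @ s) g)"
    using g f objs by (intro linear_ext) auto
  have f': "linear V as (tgt f) (ext V as f)"
    using f objs by (intro linear_ext) auto
  have "sbs V p s as g f = la V (tgt g) \<cdot> ext V (p @ [tgt f] @ s) g \<one> \<cdot> (ext V as f (\<one> \<lhd> p) \<unlhd> s)"
    unfolding sbs_def using g f objs
    by (subst cmp_reassoc1[OF la_ext]) simp_all
  then show ?thesis
    using ext_la_linear[OF linear_subst[OF g' f']] g f objs by simp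
qed

lemma ext_la [simp]: "\<lbrakk>b \<in> Obj V; x \<in> Obj V\<rbrakk> \<Longrightarrow> ext V [b] (la V b) x = ide V (x \<otimes> b)"
  using ext_la_linear[OF linear_ide, of b x] by simp

lemma ext_nat:
  assumes "arr V f" "src f = \<one> \<lhd> as" "set as \<subseteq> Obj V" "arr V k"
  shows "(k \<odot> ide V (tgt f)) \<cdot> ext V as f (src k) = ext V as f (tgt k) \<cdot> (k \<unlhd> as)"
  using linearD(4)[OF linear_ext] assms by simp

lemma sbs_assoc:
  assumes "arr V f" "arr V g" "arr V h" "src f = \<one> \<lhd> (p @ [tgt g] @ s)" "src g = \<one> \<lhd> (q @ [tgt h] @ r)" "src h = \<one> \<lhd> as"
    and "set p \<subseteq> Obj V" "set q \<subseteq> Obj V" "set r \<subseteq> Obj V" "set s \<subseteq> Obj V" "set as \<subseteq> Obj V"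
  shows "sbs V p s (q @ as @ r) f (sbs V q r as g h) = sbs V (p @ q) (r @ s) as (sbs V p s (q @ [tgt h] @ r) f g) h"
proof -
  have "sbs V p s (q @ as @ r) f (sbs V q r as g h)
      = f \<cdot> ((ext V (q @ [tgt h] @ r) g (\<one> \<lhd> p) \<cdot> (ext V as h (\<one> \<lhd> p \<lhd> q) \<unlhd> r)) \<unlhd> s)"
    unfolding sbs_def[of V p] using assms by (subst ext_sbs) simp_all
  also have "\<dots> = sbs V (p @ q) (r @ s) as (sbs V p s (q @ [tgt h] @ r) f g) h"
    using assms by (simp add: sbs_def act_arr_cmp)
  finally show ?thesis .
qed

lemma sbs_commute:
  assumes "arr V f" "arr V g" "arr V h" "src f = \<one> \<lhd> (p @ [tgt g] @ q @ [tgt h] @ r)" "src g = \<one> \<lhd> as" "src h = \<one> \<lhd> bs"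
    and "set p \<subseteq> Obj V" "set q \<subseteq> Obj V" "set r \<subseteq> Obj V" "set as \<subseteq> Obj V" "set bs \<subseteq> Obj V"
  shows "sbs V (p @ as @ q) r bs (sbs V p (q @ [tgt h] @ r) as f g) h = sbs V p (q @ bs @ r) as (sbs V (p @ [tgt g] @ q) r bs f h) g"
proof -
  let ?k = "ext V as g (\<one> \<lhd> p) \<unlhd> q"
  have "sbs V (p @ as @ q) r bs (sbs V p (q @ [tgt h] @ r) as f g) h
      = f \<cdot> (((?k \<odot> ide V (tgt h)) \<cdot> ext V bs h (\<one> \<lhd> p \<lhd> as \<lhd> q)) \<unlhd> r)"
    using assms by (simp add: sbs_def act_arr_cmp)
  also have "(?k \<odot> ide V (tgt h)) \<cdot> ext V bs h (\<one> \<lhd> p \<lhd> as \<lhd> q) = ext V bs h (\<one> \<lhd> p \<lhd> [tgt g] \<lhd> q) \<cdot> (?k \<unlhd> bs)"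
    using assms ext_nat[of h bs ?k] by simp
  finally show ?thesis using assms by (simp add: sbs_def act_arr_cmp)
qed

lemma multicategory_multi_of: "multicategory (multi_of V)"
proof
  show "seq_assoc (multi_of V) n m k" for n m k
    unfolding seq_assoc_def
  proof (intro allI impI, elim conjE)
    fix p b s q c r as d f g h
    assume "set (p @ [b] @ s) \<subseteq> mobj (multi_of V)" "set (q @ [c] @ r) \<subseteq> mobj (multi_of V)" "set as \<subseteq> mobj (multi_of V)"
      "d \<in> mobj (multi_of V)" "f \<in> mhom (multi_of V) (p @ [b] @ s) d" "g \<in> mhom (multi_of V) (q @ [c] @ r) b"
      "h \<in> mhom (multi_of V) as c"
    then show "msub (multi_of V) p b s (q @ as @ r) d f (msub (multi_of V) q c r as b g h)
      = msub (multi_of V) (p @ q) c (r @ s) as d (msub (multi_of V) p b s (q @ [c] @ r) d f g) h"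
      using sbs_assoc[of "Arrow (\<one> \<lhd> (p @ [b] @ s)) d f" "Arrow (\<one> \<lhd> (q @ [c] @ r)) b g" "Arrow (\<one> \<lhd> as) c h" p s q r as]
      by simp
  qed
  show "par_assoc (multi_of V) n m k" for n m k
    unfolding par_assoc_def
  proof (intro allI impI, elim conjE)
    fix p b q c r as bs d f g h
    assume "set (p @ [b] @ q @ [c] @ r) \<subseteq> mobj (multi_of V)" "set as \<subseteq> mobj (multi_of V)" "set bs \<subseteq> mobj (multi_of V)"
      "d \<in> mobj (multi_of V)" "f \<in> mhom (multi_of V) (p @ [b] @ q @ [c] @ r) d" "g \<in> mhom (multi_of V) as b"
      "h \<in> mhom (multi_of V) bs c"
    then show "msub (multi_of V) (p @ as @ q) c r bs d (msub (multi_of V) p b (q @ [c] @ r) as d f g) h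
      = msub (multi_of V) p b (q @ bs @ r) as d (msub (multi_of V) (p @ [b] @ q) c r bs d f h) g"
      using sbs_commute[of "Arrow (\<one> \<lhd> (p @ [b] @ q @ [c] @ r)) d f" "Arrow (\<one> \<lhd> as) b g" "Arrow (\<one> \<lhd> bs) c h" p q r as bs]
      by simp
  qed
next
  fix p b s as c g f
  assume "set (p @ [b] @ s) \<subseteq> mobj (multi_of V)" "set as \<subseteq> mobj (multi_of V)" "c \<in> mobj (multi_of V)"
    "g \<in> mhom (multi_of V) (p @ [b] @ s) c" "f \<in> mhom (multi_of V) as b"
  then have "arr V (sbs V p s as (Arrow (\<one> \<lhd> (p @ [b] @ s)) c g) (Arrow (\<one> \<lhd> as) b f))"
    "src (sbs V p s as (Arrow (\<one> \<lhd> (p @ [b] @ s)) c g) (Arrow (\<one> \<lhd> as) b f)) = \<one> \<lhd> (p @ as @ s)"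
    by simp_all
  then show "msub (multi_of V) p b s as c g f \<in> mhom (multi_of V) (p @ as @ s) c"
    using arr_mor by fastforce
next
  show "\<And>p b s c g. \<lbrakk>True; set (p @ [b] @ s) \<subseteq> mobj (multi_of V); c \<in> mobj (multi_of V); g \<in> mhom (multi_of V) (p @ [b] @ s) c\<rbrakk>
      \<Longrightarrow> msub (multi_of V) p b s [b] c g (mid (multi_of V) b) = g"
    by (simp add: sbs_def la_def[symmetric])
  show "\<And>as b f. \<lbrakk>True; set as \<subseteq> mobj (multi_of V); b \<in> mobj (multi_of V); f \<in> mhom (multi_of V) as b\<rbrakk>
      \<Longrightarrow> msub (multi_of V) [] b [] as b (mid (multi_of V) b) f = f"
  proof -
    fix as b f assume "set as \<subseteq> mobj (multi_of V)" "b \<in> mobj (multi_of V)" "f \<in> mhom (multi_of V) as b"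
    then show "msub (multi_of V) [] b [] as b (mid (multi_of V) b) f = f"
      using la_ext[of "Arrow (\<one> \<lhd> as) b f" as] by (simp add: sbs_def la_def[symmetric])
  qed
qed (simp add: lunit_in_Hom)

text \<open>
  With \<open>e = \<epsilon> (\<lambda> b)\<close>, substituting \<open>f : xs \<rightarrow> h\<close> into \<open>e\<close> gives \<open>\<epsilon> (f b)\<close>, the transpose of \<open>f\<close>, since
  \<open>\<lambda>\<close> cancels the linear family of \<open>f\<close> at \<open>\<one>\<close>.
\<close>

lemma closed_multi_of:
  assumes "closed_skew_mon V"
  shows "closed_multi (multi_of V)"
  unfolding closed_multi_def
proof (intro ballI)
  fix b c assume "b \<in> mobj (multi_of V)" "c \<in> mobj (multi_of V)"
  then have b: "b \<in> Obj V" and c: "c \<in> Obj V" by simp_all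
  have "has_right_adjoint V V (right_tensor V b)" using assms b by (simp add: closed_skew_mon_def)
  then obtain h \<epsilon> where h: "h \<in> Obj V" and "\<epsilon> \<in> Hom V (fobj (right_tensor V b) h) c"
    and bij: "\<And>a. a \<in> Obj V \<Longrightarrow> bij_betw (\<lambda>k. Comp V (fobj (right_tensor V b) a) (fobj (right_tensor V b) h) c \<epsilon>
        (farr (right_tensor V b) a h k)) (Hom V a h) (Hom V (fobj (right_tensor V b) a) c)"
    using right_adjoint_universal[OF _ c] by metis
  then have \<epsilon>: "\<epsilon> \<in> Hom V (h \<otimes> b) c" by (simp add: right_tensor_def)
  let ?\<epsilon> = "Arrow (h \<otimes> b) c \<epsilon>"
  let ?e = "?\<epsilon> \<cdot> (la V h \<odot> ide V b)"
  have arrs: "arr V ?\<epsilon>" "arr V ?e" using b c h \<epsilon> by simp_all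
  have bij': "bij_betw (\<lambda>f. msub (multi_of V) [] h [b] xs c (mor ?e) f) (mhom (multi_of V) xs h) (mhom (multi_of V) (xs @ [b]) c)"
    if "set xs \<subseteq> mobj (multi_of V)" for xs
  proof -
    have xs: "\<one> \<lhd> xs \<in> Obj V" "set xs \<subseteq> Obj V" using that by simp_all
    have eq: "msub (multi_of V) [] h [b] xs c (mor ?e) f = Comp V (fobj (right_tensor V b) (\<one> \<lhd> xs)) (fobj (right_tensor V b) h) c \<epsilon>
        (farr (right_tensor V b) (\<one> \<lhd> xs) h f)" if "f \<in> mhom (multi_of V) xs h" for f
    proof -
      let ?f = "Arrow (\<one> \<lhd> xs) h f"
      have f: "arr V ?f" using that h xs by simp
      have "?e \<cdot> (ext V xs ?f \<one> \<odot> ide V b) = ?\<epsilon> \<cdot> ((la V (tgt ?f) \<cdot> ext V xs ?f \<one>) \<odot> ide V b)"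
        using arrs f b h xs by (simp add: tns_cmp)
      also have "la V (tgt ?f) \<cdot> ext V xs ?f \<one> = ?f"
        using f xs by (intro la_ext) simp_all
      finally have "mor (?e \<cdot> (ext V xs ?f \<one> \<odot> ide V b)) = mor (?\<epsilon> \<cdot> (?f \<odot> ide V b))" by simp
      then show ?thesis
        using that xs h b by (simp add: sbs_def right_tensor_def) (simp add: cmp_def tns_def ide_def)
    qed
    have "bij_betw (\<lambda>k. Comp V (fobj (right_tensor V b) (\<one> \<lhd> xs)) (fobj (right_tensor V b) h) c \<epsilon>
        (farr (right_tensor V b) (\<one> \<lhd> xs) h k)) (mhom (multi_of V) xs h) (mhom (multi_of V) (xs @ [b]) c)"
      using bij[OF xs(1)] xs by (simp add: right_tensor_def)
    then show ?thesis by (rule bij_betw_cong[THEN iffD2, rotated]) (rule eq)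
  qed
  show "\<exists>h\<in>mobj (multi_of V). \<exists>e\<in>mhom (multi_of V) [h, b] c. \<forall>xs. set xs \<subseteq> mobj (multi_of V) \<longrightarrow>
      bij_betw (msub (multi_of V) [] h [b] xs c e) (mhom (multi_of V) xs h) (mhom (multi_of V) (xs @ [b]) c)"
  proof (intro bexI allI impI)
    show "mor ?e \<in> mhom (multi_of V) [h, b] c" using arr_mor[OF arrs(2)] by simp
  qed (use h bij' in \<open>simp_all only: multi_of_simps(1)\<close>)
qed

end

definition la_inv :: "('o, 'm) skew_mon \<Rightarrow> 'o \<Rightarrow> ('o, 'o, 'm) arrow" where
  "la_inv V a = (SOME g. arr V g \<and> src g = a \<and> tgt g = tobj V (tunit V) a \<and>
    cmp V g (la V a) = ide V (tobj V (tunit V) a) \<and> cmp V (la V a) g = ide V a)"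

locale left_normal_skew = skew_monoidal +
  assumes left_normal: "left_normal V"
begin

lemma la_inv:
  assumes "a \<in> Obj V"
  shows "arr V (la_inv V a) \<and> src (la_inv V a) = a \<and> tgt (la_inv V a) = \<one> \<otimes> a \<and>
    la_inv V a \<cdot> la V a = ide V (\<one> \<otimes> a) \<and> la V a \<cdot> la_inv V a = ide V a"
proof -
  obtain g where "g \<in> Hom V a (\<one> \<otimes> a)" "Comp V (\<one> \<otimes> a) a (\<one> \<otimes> a) g (lunit V a) = Id V (\<one> \<otimes> a)"
    "Comp V a (\<one> \<otimes> a) a (lunit V a) g = Id V a"
    using left_normal assms unfolding left_normal_def is_iso_def by blast
  moreover define P where "P = (\<lambda>g. arr V g \<and> src g = a \<and> tgt g = \<one> \<otimes> a \<and>
    g \<cdot> la V a = ide V (\<one> \<otimes> a) \<and> la V a \<cdot> g = ide V a)"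
  ultimately have "P (Arrow a (\<one> \<otimes> a) g)"
    using assms by (simp add: cmp_def ide_def la_def)
  then have "P (la_inv V a)"
    unfolding la_inv_def P_def[symmetric] by (rule someI[of P])
  then show ?thesis
    by (simp only: P_def)
qed

lemma la_inv_simps [simp]:
  assumes "a \<in> Obj V"
  shows "arr V (la_inv V a)" "src (la_inv V a) = a" "tgt (la_inv V a) = \<one> \<otimes> a"
    "la_inv V a \<cdot> la V a = ide V (\<one> \<otimes> a)" "la V a \<cdot> la_inv V a = ide V a"
  using la_inv[OF assms] by blast+

lemma la_inv_cancel [simp]:
  assumes "arr V f"
  shows "tgt f = \<one> \<otimes> a \<Longrightarrow> a \<in> Obj V \<Longrightarrow> la_inv V a \<cdot> la V a \<cdot> f = f"
    and "tgt f = a \<Longrightarrow> la V a \<cdot> la_inv V a \<cdot> f = f"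
proof -
  show "la_inv V a \<cdot> la V a \<cdot> f = f" if "tgt f = \<one> \<otimes> a" "a \<in> Obj V"
    using that assms cmp_reassoc1[OF la_inv_simps(4)[OF that(2)], of f] by simp
  show "la V a \<cdot> la_inv V a \<cdot> f = f" if "tgt f = a"
  proof -
    have "a \<in> Obj V" using that assms by auto
    then show ?thesis using that assms cmp_reassoc1[OF la_inv_simps(5), of a f] by simp
  qed
qed

lemma ext_one: "\<lbrakk>arr V g; src g = \<one> \<lhd> as; set as \<subseteq> Obj V\<rbrakk> \<Longrightarrow> ext V as g \<one> = la_inv V (tgt g) \<cdot> g"
  using la_inv_cancel(1)[of "ext V as g \<one>" "tgt g"] by (simp add: la_ext)

text \<open>
  Substitution of \<open>k\<close> at the first input is precomposition with
  \<open>(la_inv V m \<cdot> k) \<unlhd> ys\<close>, which is invertible if \<open>k\<close> is.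
\<close>

lemma iso_classifies:
  assumes k: "arr V k" "src k = \<one> \<lhd> as" "tgt k = m" "arr V k'" "src k' = m" "tgt k' = \<one> \<lhd> as"
    "k' \<cdot> k = ide V (src k)" "k \<cdot> k' = ide V m"
    and objs: "set as \<subseteq> Obj V" "set ys \<subseteq> Obj V" "d \<in> Obj V"
  shows "bij_betw (\<lambda>g. msub (multi_of V) [] m ys as d g (mor k)) (mhom (multi_of V) (m # ys) d) (mhom (multi_of V) (as @ ys) d)"
proof -
  have m: "m \<in> Obj V" using k by auto
  let ?e = "(la_inv V m \<cdot> k) \<unlhd> ys" and ?e' = "(k' \<cdot> la V m) \<unlhd> ys"
  have "k' \<cdot> la V m \<cdot> la_inv V m \<cdot> k = ide V (\<one> \<lhd> as)"
    using k objs m by simp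
  moreover have "la_inv V m \<cdot> k \<cdot> k' \<cdot> la V m = ide V (\<one> \<otimes> m)"
    using k objs m by (simp add: cmp_reassoc1[OF k(8)])
  ultimately have "?e' \<cdot> ?e = ide V (src ?e)" "?e \<cdot> ?e' = ide V (tgt ?e)"
    using k objs m by (simp_all add: act_arr_cmp[symmetric])
  then have "bij_betw (\<lambda>g. mor (Arrow (tgt ?e) d g \<cdot> ?e)) (Hom V (tgt ?e) d) (Hom V (src ?e) d)"
    using k objs m by (intro bij_betw_precomp_iso[where e' = ?e']) simp_all
  moreover have "msub (multi_of V) [] m ys as d g (mor k) = mor (Arrow (tgt ?e) d g \<cdot> ?e)" for g
    using k objs m by (simp add: sbs_def ext_one)
  ultimately show ?thesis using k m by simp
qed

lemma left_representable_multi_of: "left_representable (multi_of V)"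
  unfolding left_representable_def
proof (intro allI impI)
  fix as assume "set as \<subseteq> mobj (multi_of V)"
  then show "\<exists>m\<in>mobj (multi_of V). \<exists>\<theta>\<in>mhom (multi_of V) as m. \<forall>ys d. set ys \<subseteq> mobj (multi_of V) \<and> d \<in> mobj (multi_of V) \<longrightarrow>
      bij_betw (\<lambda>g. msub (multi_of V) [] m ys as d g \<theta>) (mhom (multi_of V) (m # ys) d) (mhom (multi_of V) (as @ ys) d)"
    using iso_classifies[of "ide V (\<one> \<lhd> as)" as "\<one> \<lhd> as" "ide V (\<one> \<lhd> as)"] arr_mor[of V "ide V (\<one> \<lhd> as)"]
    by (intro bexI[of _ "\<one> \<lhd> as"] bexI[of _ "mor (ide V (\<one> \<lhd> as))"]) simp_all
qed

end

text \<open>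
  Since the input \<open>a, b\<close> stands for \<open>(\<one> a) b\<close>, the map \<open>a, b \<rightarrow> ab\<close> that corresponds to the identity
  is \<open>\<lambda> b\<close>. With it, the tensor of objects is literally that of \<open>V\<close>.
\<close>

definition std_classifiers :: "('o, 'm) skew_mon \<Rightarrow> ('o, 'm) classifiers" where
  "std_classifiers V = \<lparr>ctens = tobj V, ctheta = (\<lambda>a b. mor (tns V (la V a) (ide V b))), cunit = tunit V, cu = Id V (tunit V)\<rparr>"

lemma (in left_normal_skew) is_classifiers_std: "is_classifiers (multi_of V) (std_classifiers V)"
proof
  fix a b assume ab: "a \<in> mobj (multi_of V)" "b \<in> mobj (multi_of V)"
  then show "ctheta (std_classifiers V) a b \<in> mhom (multi_of V) [a, b] (ctens (std_classifiers V) a b)"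
    using arr_mor[of V "la V a \<odot> ide V b"] by (simp add: std_classifiers_def)
  fix xs d assume xs: "set xs \<subseteq> mobj (multi_of V)" "d \<in> mobj (multi_of V)"
  show "bij_betw (\<lambda>g. msub (multi_of V) [] (ctens (std_classifiers V) a b) xs [a, b] d g (ctheta (std_classifiers V) a b))
      (mhom (multi_of V) (ctens (std_classifiers V) a b # xs) d) (mhom (multi_of V) (a # b # xs) d)"
    using iso_classifies[of "la V a \<odot> ide V b" "[a, b]" "a \<otimes> b" "la_inv V a \<odot> ide V b" xs d] ab xs
    by (simp add: std_classifiers_def tns_cmp)
next
  fix xs d assume xs: "set xs \<subseteq> mobj (multi_of V)" "d \<in> mobj (multi_of V)"
  then show "bij_betw (\<lambda>g. msub (multi_of V) [] (cunit (std_classifiers V)) xs [] d g (cu (std_classifiers V)))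
      (mhom (multi_of V) (cunit (std_classifiers V) # xs) d) (mhom (multi_of V) xs d)"
    using iso_classifies[of "ide V \<one>" "[]" "\<one>" "ide V \<one>" xs d]
    by (simp add: std_classifiers_def) (simp add: ide_def)
qed (simp_all add: std_classifiers_def Id_in_Hom)

section \<open>Lax monoidal functors act on multimaps\<close>

definition app_arr :: "('o, 'm, 'p, 'n) cat_functor \<Rightarrow> ('o, 'o, 'm) arrow \<Rightarrow> ('p, 'p, 'n) arrow" where
  "app_arr F f = Arrow (fobj F (src f)) (fobj F (tgt f)) (farr F (src f) (tgt f) (mor f))"

definition lx2 :: "('o, 'm) skew_mon \<Rightarrow> ('o, 'm) skew_mon \<Rightarrow> ('o, 'm) lax_mon \<Rightarrow> 'o \<Rightarrow> 'o \<Rightarrow> ('o, 'o, 'm) arrow" where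
  "lx2 V W F a b = Arrow (tobj W (lobj F a) (lobj F b)) (lobj F (tobj V a b)) (lax2 F a b)"

definition lx0 :: "('o, 'm) skew_mon \<Rightarrow> ('o, 'm) skew_mon \<Rightarrow> ('o, 'm) lax_mon \<Rightarrow> ('o, 'o, 'm) arrow" where
  "lx0 V W F = Arrow (tunit W) (lobj F (tunit V)) (lax0 F)"

text \<open>The comparison \<open>F x \<lhd> map F as \<rightarrow> F (x \<lhd> as)\<close>.\<close>

primrec lxs :: "('o, 'm) skew_mon \<Rightarrow> ('o, 'm) skew_mon \<Rightarrow> ('o, 'm) lax_mon \<Rightarrow> 'o list \<Rightarrow> 'o \<Rightarrow> ('o, 'o, 'm) arrow" where
  "lxs V W F [] x = ide W (lobj F x)"
| "lxs V W F (a # as) x = cmp W (lxs V W F as (tobj V x a)) (act_arr W (lx2 V W F x a) (map (lobj F) as))"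

text \<open>
  \<open>\<one> \<lhd> map F as \<rightarrow> F \<one> \<lhd> map F as \<rightarrow> F (\<one> \<lhd> as) \<rightarrow> F b\<close> for \<open>g : \<one> \<lhd> as \<rightarrow> b\<close>.
\<close>

definition lax_mmap :: "('o, 'm) skew_mon \<Rightarrow> ('o, 'm) skew_mon \<Rightarrow> ('o, 'm) lax_mon \<Rightarrow> 'o list \<Rightarrow> ('o, 'o, 'm) arrow \<Rightarrow> ('o, 'o, 'm) arrow" where
  "lax_mmap V W F as g = cmp W (app_arr (lfun F) g) (cmp W (lxs V W F as (tunit V)) (act_arr W (lx0 V W F) (map (lobj F) as)))"

lemma ends_lax [simp]:
  "src (app_arr F' f) = fobj F' (src f)" "tgt (app_arr F' f) = fobj F' (tgt f)"
  "src (lx2 V W F a b) = tobj W (lobj F a) (lobj F b)" "tgt (lx2 V W F a b) = lobj F (tobj V a b)"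
  "src (lx0 V W F) = tunit W" "tgt (lx0 V W F) = lobj F (tunit V)"
  by (simp_all add: app_arr_def lx2_def lx0_def)

lemma src_lxs [simp]: "src (lxs V W F as x) = act W (lobj F x) (map (lobj F) as)"
  by (induction as arbitrary: x) auto

lemma tgt_lxs [simp]: "tgt (lxs V W F as x) = lobj F (act V x as)"
  by (induction as arbitrary: x) auto

lemma ends_lax_mmap [simp]:
  "src (lax_mmap V W F as g) = act W (tunit W) (map (lobj F) as)" "tgt (lax_mmap V W F as g) = lobj F (tgt g)"
  by (simp_all add: lax_mmap_def)

context is_functor
begin

lemma arr_app_arr [simp]: "arr C f \<Longrightarrow> arr D (app_arr F f)"
  using arr_ends[of C f] arr_mor[of C f] by (simp add: app_arr_def fobj_in_Obj farr_in_Hom)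

lemma app_arr_cmp: "\<lbrakk>arr C f; arr C g; tgt f = src g\<rbrakk> \<Longrightarrow> app_arr F (cmp C g f) = cmp D (app_arr F g) (app_arr F f)"
  using arr_ends[of C f] arr_ends[of C g] arr_mor[of C f] arr_mor[of C g] by (simp add: app_arr_def cmp_def farr_Comp)

lemma app_arr_ide [simp]: "a \<in> Obj C \<Longrightarrow> app_arr F (ide C a) = ide D (fobj F a)"
  by (simp add: app_arr_def ide_def farr_Id)

end

context lax_monoidal
begin

sublocale fn: is_functor V W "lfun F"
  by (rule underlying_functor)

abbreviation (input) "F2 \<equiv> lx2 V W F"
abbreviation (input) "F0 \<equiv> lx0 V W F"
abbreviation (input) "Fs \<equiv> lxs V W F"
abbreviation (input) "FL \<equiv> map (lobj F)"
abbreviation (input) "Fa \<equiv> app_arr (lfun F)"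

lemma lobj_in_Obj [simp]: "a \<in> Obj V \<Longrightarrow> lobj F a \<in> Obj W"
  by (rule fn.fobj_in_Obj)

lemma lobj_list [simp]: "set as \<subseteq> Obj V \<Longrightarrow> lobj F ` set as \<subseteq> Obj W"
  by auto

lemma arr_lx [simp]: "\<lbrakk>a \<in> Obj V; b \<in> Obj V\<rbrakk> \<Longrightarrow> arr W (F2 a b)" "arr W F0"
  by (simp_all add: lx2_def lx0_def lax2_in_Hom lax0_in_Hom)

lemma arr_lxs [simp]: "\<lbrakk>x \<in> Obj V; set as \<subseteq> Obj V\<rbrakk> \<Longrightarrow> arr W (Fs as x)"
  by (induction as arbitrary: x) simp_all

lemma lx2_nat: "\<lbrakk>arr V f; arr V g\<rbrakk>
  \<Longrightarrow> Fa (f \<odot> g) \<cdot>\<^bsub>W\<^esub> F2 (src f) (src g) = F2 (tgt f) (tgt g) \<cdot>\<^bsub>W\<^esub> (Fa f \<odot>\<^bsub>W\<^esub> Fa g)"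
  using arr_ends[of V f] arr_ends[of V g] arr_mor[of V f] arr_mor[of V g]
  by (simp add: cmp_def tns_def lx2_def app_arr_def lax2_natural)

lemma lx2_al: "\<lbrakk>a \<in> Obj V; b \<in> Obj V; c \<in> Obj V\<rbrakk>
  \<Longrightarrow> Fa (al V a b c) \<cdot>\<^bsub>W\<^esub> F2 (a \<otimes> b) c \<cdot>\<^bsub>W\<^esub> (F2 a b \<odot>\<^bsub>W\<^esub> ide W (lobj F c))
    = F2 a (b \<otimes> c) \<cdot>\<^bsub>W\<^esub> (ide W (lobj F a) \<odot>\<^bsub>W\<^esub> F2 b c) \<cdot>\<^bsub>W\<^esub> al W (lobj F a) (lobj F b) (lobj F c)"
  by (simp add: cmp_def tns_def lx2_def al_def app_arr_def ide_def lax_assr)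

lemma lx_la: "a \<in> Obj V \<Longrightarrow> Fa (la V a) \<cdot>\<^bsub>W\<^esub> F2 \<one> a \<cdot>\<^bsub>W\<^esub> (F0 \<odot>\<^bsub>W\<^esub> ide W (lobj F a)) = la W (lobj F a)"
  by (simp add: cmp_def tns_def lx2_def lx0_def la_def app_arr_def ide_def lax_lunit)

lemma lx_ra: "a \<in> Obj V \<Longrightarrow> F2 a \<one> \<cdot>\<^bsub>W\<^esub> (ide W (lobj F a) \<odot>\<^bsub>W\<^esub> F0) \<cdot>\<^bsub>W\<^esub> ra W (lobj F a) = Fa (ra V a)"
  by (simp add: cmp_def tns_def lx2_def lx0_def ra_def app_arr_def ide_def lax_runit)

lemma lxs_nat: "\<lbrakk>arr V f; set as \<subseteq> Obj V\<rbrakk>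
  \<Longrightarrow> Fa (f \<unlhd> as) \<cdot>\<^bsub>W\<^esub> Fs as (src f) = Fs as (tgt f) \<cdot>\<^bsub>W\<^esub> (Fa f \<unlhd>\<^bsub>W\<^esub> FL as)"
proof (induction as arbitrary: f)
  case (Cons a as)
  let ?f = "f \<odot> ide V a"
  have "Fa (f \<unlhd> (a # as)) \<cdot>\<^bsub>W\<^esub> Fs (a # as) (src f) = (Fa (?f \<unlhd> as) \<cdot>\<^bsub>W\<^esub> Fs as (src ?f)) \<cdot>\<^bsub>W\<^esub> (F2 (src f) a \<unlhd>\<^bsub>W\<^esub> FL as)"
    using Cons.prems by simp
  also have "\<dots> = Fs as (tgt ?f) \<cdot>\<^bsub>W\<^esub> ((Fa ?f \<cdot>\<^bsub>W\<^esub> F2 (src f) a) \<unlhd>\<^bsub>W\<^esub> FL as)"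
    using Cons.prems by (subst Cons.IH) (simp_all add: tgt.act_arr_cmp)
  also have "Fa ?f \<cdot>\<^bsub>W\<^esub> F2 (src f) a = F2 (tgt f) a \<cdot>\<^bsub>W\<^esub> (Fa f \<odot>\<^bsub>W\<^esub> ide W (lobj F a))"
    using Cons.prems lx2_nat[of f "ide V a"] by simp
  finally show ?case using Cons.prems by (simp add: tgt.act_arr_cmp)
qed simp

lemma lxs_append: "\<lbrakk>x \<in> Obj V; set as \<subseteq> Obj V; set bs \<subseteq> Obj V\<rbrakk>
  \<Longrightarrow> Fs (as @ bs) x = Fs bs (x \<lhd> as) \<cdot>\<^bsub>W\<^esub> (Fs as x \<unlhd>\<^bsub>W\<^esub> FL bs)"
  by (induction as arbitrary: x) (simp_all add: tgt.act_arr_cmp)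

text \<open>
  The iterated form of the axiom for \<open>\<alpha>\<close> of a lax monoidal functor.
\<close>

lemma lxs_als: "\<lbrakk>x \<in> Obj V; y \<in> Obj V; set as \<subseteq> Obj V\<rbrakk>
  \<Longrightarrow> Fa (als V as y x) \<cdot>\<^bsub>W\<^esub> Fs as (y \<otimes> x) \<cdot>\<^bsub>W\<^esub> (F2 y x \<unlhd>\<^bsub>W\<^esub> FL as)
    = F2 y (x \<lhd> as) \<cdot>\<^bsub>W\<^esub> (ide W (lobj F y) \<odot>\<^bsub>W\<^esub> Fs as x) \<cdot>\<^bsub>W\<^esub> als W (FL as) (lobj F y) (lobj F x)"
proof (induction as arbitrary: x)
  case (Cons a as)
  let ?x = "x \<otimes> a"
  have "Fa (als V (a # as) y x) \<cdot>\<^bsub>W\<^esub> Fs (a # as) (y \<otimes> x) \<cdot>\<^bsub>W\<^esub> (F2 y x \<unlhd>\<^bsub>W\<^esub> FL (a # as))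
      = Fa (als V as y ?x) \<cdot>\<^bsub>W\<^esub> (Fa (al V y x a \<unlhd> as) \<cdot>\<^bsub>W\<^esub> Fs as ((y \<otimes> x) \<otimes> a))
        \<cdot>\<^bsub>W\<^esub> (F2 (y \<otimes> x) a \<unlhd>\<^bsub>W\<^esub> FL as) \<cdot>\<^bsub>W\<^esub> ((F2 y x \<odot>\<^bsub>W\<^esub> ide W (lobj F a)) \<unlhd>\<^bsub>W\<^esub> FL as)"
    using Cons.prems by (simp add: fn.app_arr_cmp)
  also have "Fa (al V y x a \<unlhd> as) \<cdot>\<^bsub>W\<^esub> Fs as ((y \<otimes> x) \<otimes> a) = Fs as (y \<otimes> ?x) \<cdot>\<^bsub>W\<^esub> (Fa (al V y x a) \<unlhd>\<^bsub>W\<^esub> FL as)"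
    using Cons.prems lxs_nat[of "al V y x a" as] by simp
  also have "Fa (als V as y ?x) \<cdot>\<^bsub>W\<^esub> (Fs as (y \<otimes> ?x) \<cdot>\<^bsub>W\<^esub> (Fa (al V y x a) \<unlhd>\<^bsub>W\<^esub> FL as))
        \<cdot>\<^bsub>W\<^esub> (F2 (y \<otimes> x) a \<unlhd>\<^bsub>W\<^esub> FL as) \<cdot>\<^bsub>W\<^esub> ((F2 y x \<odot>\<^bsub>W\<^esub> ide W (lobj F a)) \<unlhd>\<^bsub>W\<^esub> FL as)
      = Fa (als V as y ?x) \<cdot>\<^bsub>W\<^esub> Fs as (y \<otimes> ?x) \<cdot>\<^bsub>W\<^esub>
        ((Fa (al V y x a) \<cdot>\<^bsub>W\<^esub> F2 (y \<otimes> x) a \<cdot>\<^bsub>W\<^esub> (F2 y x \<odot>\<^bsub>W\<^esub> ide W (lobj F a))) \<unlhd>\<^bsub>W\<^esub> FL as)"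
    using Cons.prems by (simp add: tgt.act_arr_cmp)
  also have "\<dots> = (Fa (als V as y ?x) \<cdot>\<^bsub>W\<^esub> Fs as (y \<otimes> ?x) \<cdot>\<^bsub>W\<^esub> (F2 y ?x \<unlhd>\<^bsub>W\<^esub> FL as)) \<cdot>\<^bsub>W\<^esub>
        ((ide W (lobj F y) \<odot>\<^bsub>W\<^esub> F2 x a) \<unlhd>\<^bsub>W\<^esub> FL as) \<cdot>\<^bsub>W\<^esub> (al W (lobj F y) (lobj F x) (lobj F a) \<unlhd>\<^bsub>W\<^esub> FL as)"
    using Cons.prems by (simp add: lx2_al tgt.act_arr_cmp)
  also have "Fa (als V as y ?x) \<cdot>\<^bsub>W\<^esub> Fs as (y \<otimes> ?x) \<cdot>\<^bsub>W\<^esub> (F2 y ?x \<unlhd>\<^bsub>W\<^esub> FL as)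
      = F2 y (?x \<lhd> as) \<cdot>\<^bsub>W\<^esub> (ide W (lobj F y) \<odot>\<^bsub>W\<^esub> Fs as ?x) \<cdot>\<^bsub>W\<^esub> als W (FL as) (lobj F y) (lobj F ?x)"
    using Cons.prems by (intro Cons.IH) simp_all
  also have "(F2 y (?x \<lhd> as) \<cdot>\<^bsub>W\<^esub> (ide W (lobj F y) \<odot>\<^bsub>W\<^esub> Fs as ?x) \<cdot>\<^bsub>W\<^esub> als W (FL as) (lobj F y) (lobj F ?x)) \<cdot>\<^bsub>W\<^esub>
        ((ide W (lobj F y) \<odot>\<^bsub>W\<^esub> F2 x a) \<unlhd>\<^bsub>W\<^esub> FL as) \<cdot>\<^bsub>W\<^esub> (al W (lobj F y) (lobj F x) (lobj F a) \<unlhd>\<^bsub>W\<^esub> FL as)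
      = F2 y (?x \<lhd> as) \<cdot>\<^bsub>W\<^esub> (ide W (lobj F y) \<odot>\<^bsub>W\<^esub> Fs as ?x) \<cdot>\<^bsub>W\<^esub> (als W (FL as) (lobj F y) (lobj F ?x) \<cdot>\<^bsub>W\<^esub>
        ((ide W (lobj F y) \<odot>\<^bsub>W\<^esub> F2 x a) \<unlhd>\<^bsub>W\<^esub> FL as)) \<cdot>\<^bsub>W\<^esub> (al W (lobj F y) (lobj F x) (lobj F a) \<unlhd>\<^bsub>W\<^esub> FL as)"
    using Cons.prems by simp
  also have "als W (FL as) (lobj F y) (lobj F ?x) \<cdot>\<^bsub>W\<^esub> ((ide W (lobj F y) \<odot>\<^bsub>W\<^esub> F2 x a) \<unlhd>\<^bsub>W\<^esub> FL as)
      = (ide W (lobj F y) \<odot>\<^bsub>W\<^esub> (F2 x a \<unlhd>\<^bsub>W\<^esub> FL as)) \<cdot>\<^bsub>W\<^esub> als W (FL as) (lobj F y) (lobj F x \<otimes>\<^bsub>W\<^esub> lobj F a)"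
    using Cons.prems tgt.als_nat[of "F2 x a" "ide W (lobj F y)" "FL as"] by simp
  finally show ?case
    using Cons.prems by (simp add: tgt.ide_tns_cmp)
qed simp

lemma arr_lax_mmap [simp]: "\<lbrakk>arr V g; src g = \<one> \<lhd> as; set as \<subseteq> Obj V\<rbrakk> \<Longrightarrow> arr W (lax_mmap V W F as g)"
  by (simp add: lax_mmap_def)

text \<open>
  In terms of linear families, the action of \<open>F\<close> on multimaps is that of \<open>F\<close> on components: the axioms for
  \<open>\<alpha>\<close> and \<open>\<rho>\<close> carry the comparison maps past those of \<open>ext\<close>.
\<close>

lemma ext_lax_mmap:
  assumes g: "arr V g" "src g = \<one> \<lhd> as" and objs: "set as \<subseteq> Obj V" "x \<in> Obj V"
  shows "F2 x (tgt g) \<cdot>\<^bsub>W\<^esub> ext W (FL as) (lax_mmap V W F as g) (lobj F x) = Fa (ext V as g x) \<cdot>\<^bsub>W\<^esub> Fs as x"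
proof -
  let ?i = "ide W (lobj F x)"
  have "F2 x (tgt g) \<cdot>\<^bsub>W\<^esub> ext W (FL as) (lax_mmap V W F as g) (lobj F x)
      = (F2 x (tgt g) \<cdot>\<^bsub>W\<^esub> (?i \<odot>\<^bsub>W\<^esub> Fa g)) \<cdot>\<^bsub>W\<^esub> (?i \<odot>\<^bsub>W\<^esub> Fs as \<one>) \<cdot>\<^bsub>W\<^esub>
        ((?i \<odot>\<^bsub>W\<^esub> (F0 \<unlhd>\<^bsub>W\<^esub> FL as)) \<cdot>\<^bsub>W\<^esub> als W (FL as) (lobj F x) \<one>\<^bsub>W\<^esub>) \<cdot>\<^bsub>W\<^esub> (ra W (lobj F x) \<unlhd>\<^bsub>W\<^esub> FL as)"
    using g objs by (simp add: ext_def lax_mmap_def tgt.ide_tns_cmp)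
  also have "(?i \<odot>\<^bsub>W\<^esub> (F0 \<unlhd>\<^bsub>W\<^esub> FL as)) \<cdot>\<^bsub>W\<^esub> als W (FL as) (lobj F x) \<one>\<^bsub>W\<^esub>
      = als W (FL as) (lobj F x) (lobj F \<one>) \<cdot>\<^bsub>W\<^esub> ((?i \<odot>\<^bsub>W\<^esub> F0) \<unlhd>\<^bsub>W\<^esub> FL as)"
    using objs tgt.als_nat[of F0 ?i "FL as"] by simp
  also have "F2 x (tgt g) \<cdot>\<^bsub>W\<^esub> (?i \<odot>\<^bsub>W\<^esub> Fa g) = Fa (ide V x \<odot> g) \<cdot>\<^bsub>W\<^esub> F2 x (\<one> \<lhd> as)"
    using g objs lx2_nat[of "ide V x" g] by simp
  also have "(Fa (ide V x \<odot> g) \<cdot>\<^bsub>W\<^esub> F2 x (\<one> \<lhd> as)) \<cdot>\<^bsub>W\<^esub> (?i \<odot>\<^bsub>W\<^esub> Fs as \<one>) \<cdot>\<^bsub>W\<^esub>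
        (als W (FL as) (lobj F x) (lobj F \<one>) \<cdot>\<^bsub>W\<^esub> ((?i \<odot>\<^bsub>W\<^esub> F0) \<unlhd>\<^bsub>W\<^esub> FL as)) \<cdot>\<^bsub>W\<^esub> (ra W (lobj F x) \<unlhd>\<^bsub>W\<^esub> FL as)
      = Fa (ide V x \<odot> g) \<cdot>\<^bsub>W\<^esub> (F2 x (\<one> \<lhd> as) \<cdot>\<^bsub>W\<^esub> (?i \<odot>\<^bsub>W\<^esub> Fs as \<one>) \<cdot>\<^bsub>W\<^esub>
        als W (FL as) (lobj F x) (lobj F \<one>)) \<cdot>\<^bsub>W\<^esub> ((?i \<odot>\<^bsub>W\<^esub> F0) \<unlhd>\<^bsub>W\<^esub> FL as) \<cdot>\<^bsub>W\<^esub> (ra W (lobj F x) \<unlhd>\<^bsub>W\<^esub> FL as)"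
    using g objs by simp
  also have "F2 x (\<one> \<lhd> as) \<cdot>\<^bsub>W\<^esub> (?i \<odot>\<^bsub>W\<^esub> Fs as \<one>) \<cdot>\<^bsub>W\<^esub> als W (FL as) (lobj F x) (lobj F \<one>)
      = Fa (als V as x \<one>) \<cdot>\<^bsub>W\<^esub> Fs as (x \<otimes> \<one>) \<cdot>\<^bsub>W\<^esub> (F2 x \<one> \<unlhd>\<^bsub>W\<^esub> FL as)"
    using objs by (simp add: lxs_als)
  also have "Fa (ide V x \<odot> g) \<cdot>\<^bsub>W\<^esub> (Fa (als V as x \<one>) \<cdot>\<^bsub>W\<^esub> Fs as (x \<otimes> \<one>) \<cdot>\<^bsub>W\<^esub> (F2 x \<one> \<unlhd>\<^bsub>W\<^esub> FL as)) \<cdot>\<^bsub>W\<^esub>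
        ((?i \<odot>\<^bsub>W\<^esub> F0) \<unlhd>\<^bsub>W\<^esub> FL as) \<cdot>\<^bsub>W\<^esub> (ra W (lobj F x) \<unlhd>\<^bsub>W\<^esub> FL as)
      = Fa (ide V x \<odot> g) \<cdot>\<^bsub>W\<^esub> Fa (als V as x \<one>) \<cdot>\<^bsub>W\<^esub> Fs as (x \<otimes> \<one>) \<cdot>\<^bsub>W\<^esub>
        ((F2 x \<one> \<cdot>\<^bsub>W\<^esub> (?i \<odot>\<^bsub>W\<^esub> F0) \<cdot>\<^bsub>W\<^esub> ra W (lobj F x)) \<unlhd>\<^bsub>W\<^esub> FL as)"
    using g objs by (simp add: tgt.act_arr_cmp)
  also have "\<dots> = Fa (ide V x \<odot> g) \<cdot>\<^bsub>W\<^esub> Fa (als V as x \<one>) \<cdot>\<^bsub>W\<^esub> (Fs as (x \<otimes> \<one>) \<cdot>\<^bsub>W\<^esub> (Fa (ra V x) \<unlhd>\<^bsub>W\<^esub> FL as))"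
    using objs by (simp add: lx_ra)
  also have "Fs as (x \<otimes> \<one>) \<cdot>\<^bsub>W\<^esub> (Fa (ra V x) \<unlhd>\<^bsub>W\<^esub> FL as) = Fa (ra V x \<unlhd> as) \<cdot>\<^bsub>W\<^esub> Fs as x"
    using objs lxs_nat[of "ra V x" as] by simp
  finally show ?thesis
    using g objs by (simp add: ext_def fn.app_arr_cmp)
qed

lemma lax_mmap_la: "b \<in> Obj V \<Longrightarrow> lax_mmap V W F [b] (la V b) = la W (lobj F b)"
  by (simp add: lax_mmap_def lx_la)

text \<open>
  Both sides compose \<open>F g\<close> with a component of the linear family of \<open>f\<close>, before or after applying \<open>F\<close>;
  \<open>ext_lax_mmap\<close> exchanges them, and naturality in \<open>x\<close> moves the comparison \<open>\<one> \<lhd> map F p \<rightarrow> F (\<one> \<lhd> p)\<close> across.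
\<close>

lemma lax_mmap_sbs:
  assumes g: "arr V g" "src g = \<one> \<lhd> (p @ [tgt f] @ s)" and f: "arr V f" "src f = \<one> \<lhd> as"
    and objs: "set p \<subseteq> Obj V" "set s \<subseteq> Obj V" "set as \<subseteq> Obj V"
  shows "lax_mmap V W F (p @ as @ s) (sbs V p s as g f)
    = sbs W (FL p) (FL s) (FL as) (lax_mmap V W F (p @ [tgt f] @ s) g) (lax_mmap V W F as f)"
proof -
  let ?x = "\<one> \<lhd> p" and ?b = "tgt f"
  let ?k = "Fs p \<one> \<cdot>\<^bsub>W\<^esub> (F0 \<unlhd>\<^bsub>W\<^esub> FL p)" and ?f = "lax_mmap V W F as f"
  have "lax_mmap V W F (p @ as @ s) (sbs V p s as g f)
      = Fa g \<cdot>\<^bsub>W\<^esub> (Fa (ext V as f ?x \<unlhd> s) \<cdot>\<^bsub>W\<^esub> Fs s (?x \<lhd> as)) \<cdot>\<^bsub>W\<^esub> (Fs as ?x \<unlhd>\<^bsub>W\<^esub> FL s) \<cdot>\<^bsub>W\<^esub> (?k \<unlhd>\<^bsub>W\<^esub> FL as \<unlhd>\<^bsub>W\<^esub> FL s)"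
    using g f objs by (simp add: lax_mmap_def sbs_def fn.app_arr_cmp lxs_append tgt.act_arr_cmp)
  also have "Fa (ext V as f ?x \<unlhd> s) \<cdot>\<^bsub>W\<^esub> Fs s (?x \<lhd> as) = Fs s (?x \<otimes> ?b) \<cdot>\<^bsub>W\<^esub> (Fa (ext V as f ?x) \<unlhd>\<^bsub>W\<^esub> FL s)"
    using f objs lxs_nat[of "ext V as f ?x" s] by simp
  also have "Fa g \<cdot>\<^bsub>W\<^esub> (Fs s (?x \<otimes> ?b) \<cdot>\<^bsub>W\<^esub> (Fa (ext V as f ?x) \<unlhd>\<^bsub>W\<^esub> FL s)) \<cdot>\<^bsub>W\<^esub> (Fs as ?x \<unlhd>\<^bsub>W\<^esub> FL s) \<cdot>\<^bsub>W\<^esub> (?k \<unlhd>\<^bsub>W\<^esub> FL as \<unlhd>\<^bsub>W\<^esub> FL s)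
      = Fa g \<cdot>\<^bsub>W\<^esub> Fs s (?x \<otimes> ?b) \<cdot>\<^bsub>W\<^esub> ((Fa (ext V as f ?x) \<cdot>\<^bsub>W\<^esub> Fs as ?x) \<unlhd>\<^bsub>W\<^esub> FL s) \<cdot>\<^bsub>W\<^esub> (?k \<unlhd>\<^bsub>W\<^esub> FL as \<unlhd>\<^bsub>W\<^esub> FL s)"
    using g f objs by (simp add: tgt.act_arr_cmp)
  also have "Fa (ext V as f ?x) \<cdot>\<^bsub>W\<^esub> Fs as ?x = F2 ?x ?b \<cdot>\<^bsub>W\<^esub> ext W (FL as) ?f (lobj F ?x)"
    using f objs by (simp add: ext_lax_mmap)
  also have "Fa g \<cdot>\<^bsub>W\<^esub> Fs s (?x \<otimes> ?b) \<cdot>\<^bsub>W\<^esub> ((F2 ?x ?b \<cdot>\<^bsub>W\<^esub> ext W (FL as) ?f (lobj F ?x)) \<unlhd>\<^bsub>W\<^esub> FL s) \<cdot>\<^bsub>W\<^esub> (?k \<unlhd>\<^bsub>W\<^esub> FL as \<unlhd>\<^bsub>W\<^esub> FL s)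
      = Fa g \<cdot>\<^bsub>W\<^esub> Fs s (?x \<otimes> ?b) \<cdot>\<^bsub>W\<^esub> (F2 ?x ?b \<unlhd>\<^bsub>W\<^esub> FL s) \<cdot>\<^bsub>W\<^esub> ((ext W (FL as) ?f (lobj F ?x) \<cdot>\<^bsub>W\<^esub> (?k \<unlhd>\<^bsub>W\<^esub> FL as)) \<unlhd>\<^bsub>W\<^esub> FL s)"
    using g f objs by (simp add: tgt.act_arr_cmp)
  also have "ext W (FL as) ?f (lobj F ?x) \<cdot>\<^bsub>W\<^esub> (?k \<unlhd>\<^bsub>W\<^esub> FL as) = (?k \<odot>\<^bsub>W\<^esub> ide W (lobj F ?b)) \<cdot>\<^bsub>W\<^esub> ext W (FL as) ?f (\<one>\<^bsub>W\<^esub> \<lhd>\<^bsub>W\<^esub> FL p)"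
    using f objs tgt.ext_nat[of ?f "FL as" ?k] by simp
  also have "Fa g \<cdot>\<^bsub>W\<^esub> Fs s (?x \<otimes> ?b) \<cdot>\<^bsub>W\<^esub> (F2 ?x ?b \<unlhd>\<^bsub>W\<^esub> FL s) \<cdot>\<^bsub>W\<^esub>
        (((?k \<odot>\<^bsub>W\<^esub> ide W (lobj F ?b)) \<cdot>\<^bsub>W\<^esub> ext W (FL as) ?f (\<one>\<^bsub>W\<^esub> \<lhd>\<^bsub>W\<^esub> FL p)) \<unlhd>\<^bsub>W\<^esub> FL s)
      = sbs W (FL p) (FL s) (FL as) (lax_mmap V W F (p @ [?b] @ s) g) ?f"
    using g f objs by (simp add: sbs_def lax_mmap_def[of _ _ _ "p @ ?b # s"] lxs_append tgt.act_arr_cmp tgt.tns_ide_cmp)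
  finally show ?thesis .
qed

end

section \<open>Left representable multicategories, short or not\<close>

text \<open>
  The flag \<open>long\<close> distinguishes multicategories from short ones. The arguments that follow use no arity
  that a short multicategory lacks, so that they are carried out for both at once.
\<close>

definition arity_ok :: "bool \<Rightarrow> nat \<Rightarrow> bool" where
  "arity_ok long n \<longleftrightarrow> long \<or> n \<le> 4"

definition subst_ok :: "bool \<Rightarrow> nat \<Rightarrow> nat \<Rightarrow> bool" where
  "subst_ok long n m \<longleftrightarrow> long \<or> short_subst n m"

text \<open>
  As linear inequalities, the admissible arities are in reach of arithmetic for lists of unknown length.
\<close>

lemma subst_ok_iff: "0 < n \<Longrightarrow> subst_ok long n m \<longleftrightarrow> long \<or> n \<le> 4 \<and> n + m \<le> 5 \<and> n \<le> m + 3"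
  unfolding subst_ok_def short_subst_def proper_subst_def by simp arith

definition multimap :: "('o, 'm) multi \<Rightarrow> ('o list, 'o, 'm) arrow \<Rightarrow> bool" where
  "multimap C f \<longleftrightarrow> set (src f) \<subseteq> mobj C \<and> tgt f \<in> mobj C \<and> mor f \<in> mhom C (src f) (tgt f)"

definition sub :: "('o, 'm) multi \<Rightarrow> ('o list, 'o, 'm) arrow \<Rightarrow> nat \<Rightarrow> ('o list, 'o, 'm) arrow \<Rightarrow> ('o list, 'o, 'm) arrow" where
  "sub C g i f = Arrow (take i (src g) @ src f @ drop (Suc i) (src g)) (tgt g)
    (msub C (take i (src g)) (tgt f) (drop (Suc i) (src g)) (src f) (tgt g) (mor g) (mor f))"

definition idm :: "('o, 'm) multi \<Rightarrow> 'o \<Rightarrow> ('o list, 'o, 'm) arrow" where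
  "idm C a = Arrow [a] a (mid C a)"

definition unary :: "('o, 'o, 'm) arrow \<Rightarrow> ('o list, 'o, 'm) arrow" where
  "unary f = Arrow [src f] (tgt f) (mor f)"

lemma ends_multi [simp]:
  "src (sub C g i f) = take i (src g) @ src f @ drop (Suc i) (src g)" "tgt (sub C g i f) = tgt g"
  "src (idm C a) = [a]" "tgt (idm C a) = a" "src (unary h) = [src h]" "tgt (unary h) = tgt h"
  by (simp_all add: sub_def idm_def unary_def)

lemma multimap_Arrow [simp]: "multimap C (Arrow as b f) \<longleftrightarrow> set as \<subseteq> mobj C \<and> b \<in> mobj C \<and> f \<in> mhom C as b"
  by (simp add: multimap_def)

lemma multimap_mor: "multimap C f \<Longrightarrow> mor f \<in> mhom C (src f) (tgt f)"
  by (simp add: multimap_def)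

lemma multimap_ends: "multimap C f \<Longrightarrow> set (src f) \<subseteq> mobj C" "multimap C f \<Longrightarrow> tgt f \<in> mobj C"
  by (simp_all add: multimap_def)

lemma unary_inject: "unary f = unary g \<longleftrightarrow> f = g"
  by (cases f; cases g) (simp add: unary_def)

lemma split_at:
  assumes "i < length xs"
  obtains p s where "xs = p @ [xs ! i] @ s" "length p = i"
proof
  show "xs = take i xs @ [xs ! i] @ drop (Suc i) xs" using id_take_nth_drop[OF assms] by simp
  show "length (take i xs) = i" using assms by simp
qed

text \<open>
  Both laws of associativity are required whenever all four substitutions that they mention exist. In the
  law for two inputs, \<open>0 < m \<or> n = 2\<close> leaves out two nullary maps in a ternary one, for which a short
  multicategory has no axiom.
\<close>

locale partial_multi = multi_data "arity_ok long" "subst_ok long" C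
  for long :: bool and C :: "('o, 'm) multi" +
  assumes seq_law: "\<lbrakk>subst_ok long n m; subst_ok long m k; subst_ok long (n + m - 1) k; subst_ok long n (m + k - 1);
      0 < n; 0 < m\<rbrakk> \<Longrightarrow> seq_assoc C n m k"
    and par_law: "\<lbrakk>subst_ok long n m; subst_ok long n k; subst_ok long (n + m - 1) k; subst_ok long (n + k - 1) m;
      0 < m \<or> n = 2; 2 \<le> n\<rbrakk> \<Longrightarrow> par_assoc C n m k"
begin

abbreviation sb ("(_ \<bullet>[_] _)" [65, 0, 66] 65) where
  "g \<bullet>[i] f \<equiv> sub C g i f"

lemma multimap_sub:
  assumes g: "multimap C g" and f: "multimap C f" "i < length (src g)" "src g ! i = tgt f"
    "subst_ok long (length (src g)) (length (src f))"
  shows "multimap C (g \<bullet>[i] f)"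
proof -
  obtain p s where ps: "src g = p @ [tgt f] @ s" "length p = i" using split_at[OF f(2)] f(3) by metis
  then show ?thesis
    using g f multimap_mor[OF g] multimap_mor[OF f(1)] multimap_ends[OF g] multimap_ends[OF f(1)]
      msub_in_mhom[of p "tgt f" s "src f" "tgt g" "mor g" "mor f"]
    by (auto simp: sub_def)
qed

lemma multimap_idm: "a \<in> mobj C \<Longrightarrow> multimap C (idm C a)"
  by (simp add: idm_def mid_in_mhom)

lemma sub_idm:
  assumes g: "multimap C g" "i < length (src g)" "src g ! i = a" "arity_ok long (length (src g))"
  shows "g \<bullet>[i] idm C a = g"
proof -
  obtain p s where ps: "src g = p @ [a] @ s" "length p = i" using split_at[OF g(2)] g(3) by metis
  then show ?thesis
    using g multimap_mor[OF g(1)] multimap_ends[OF g(1)] msub_mid_inner[of p a s "tgt g" "mor g"]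
    by (cases g) (auto simp: sub_def idm_def)
qed

lemma idm_sub:
  assumes f: "multimap C f" "tgt f = b" "arity_ok long (length (src f))"
  shows "idm C b \<bullet>[0] f = f"
  using f multimap_mor[OF f(1)] multimap_ends[OF f(1)] msub_mid_outer[of "src f" "tgt f" "mor f"]
  by (cases f) (auto simp: sub_def idm_def)

text \<open>
  As rewrite rules, the two laws bring an iterated substitution into a normal form: the
  multimaps are substituted one at a time, from the root and from left to right.
\<close>

lemma sub_seq:
  assumes f: "multimap C f" and g: "multimap C g" "i < length (src f)" "src f ! i = tgt g"
    and h: "multimap C h" "j < length (src g)" "src g ! j = tgt h"
    and ok: "subst_ok long (length (src f)) (length (src g))" "subst_ok long (length (src g)) (length (src h))"
      "subst_ok long (length (src f) + length (src g) - 1) (length (src h))"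
      "subst_ok long (length (src f)) (length (src g) + length (src h) - 1)"
  shows "f \<bullet>[i] (g \<bullet>[j] h) = f \<bullet>[i] g \<bullet>[i + j] h"
proof -
  obtain p s where ps: "src f = p @ [tgt g] @ s" "length p = i" using split_at[OF g(2)] g(3) by metis
  obtain q r where qr: "src g = q @ [tgt h] @ r" "length q = j" using split_at[OF h(2)] h(3) by metis
  have "0 < length (src f)" "0 < length (src g)" using g h by auto
  then have "seq_assoc C (length (src f)) (length (src g)) (length (src h))"
    using seq_law ok by blast
  then have "msub C p (tgt g) s (q @ src h @ r) (tgt f) (mor f) (msub C q (tgt h) r (src h) (tgt g) (mor g) (mor h))
     = msub C (p @ q) (tgt h) (r @ s) (src h) (tgt f) (msub C p (tgt g) s (q @ [tgt h] @ r) (tgt f) (mor f) (mor g)) (mor h)"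
    unfolding seq_assoc_def
    using ps qr multimap_mor[OF f] multimap_mor[OF g(1)] multimap_mor[OF h(1)] multimap_ends[OF f] multimap_ends[OF g(1)] multimap_ends[OF h(1)]
    by (elim allE impE) auto
  then show ?thesis
    using ps qr by (simp add: sub_def flip: ps(2) qr(2))
qed

lemma sub_par:
  assumes f: "multimap C f" and g: "multimap C g" "i < j" "src f ! i = tgt g"
    and h: "multimap C h" "j < length (src f)" "src f ! j = tgt h"
    and ok: "subst_ok long (length (src f)) (length (src g))" "subst_ok long (length (src f)) (length (src h))"
      "subst_ok long (length (src f) + length (src g) - 1) (length (src h))"
      "subst_ok long (length (src f) + length (src h) - 1) (length (src g))"
      "0 < length (src g) \<or> length (src f) = 2"
  shows "f \<bullet>[j] h \<bullet>[i] g = f \<bullet>[i] g \<bullet>[j + length (src g) - 1] h"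
proof -
  obtain p s where ps: "src f = p @ [tgt g] @ s" "length p = i" using split_at[of i "src f"] g h by auto
  then have "j - Suc i < length s" "s ! (j - Suc i) = tgt h" using g h by (auto simp: nth_append split: if_splits)
  then obtain q r where qr: "s = q @ [tgt h] @ r" "length q = j - Suc i" using split_at by metis
  have j: "j = Suc (length p + length q)" using ps qr g by simp
  have "2 \<le> length (src f)" using g h by auto
  then have "par_assoc C (length (src f)) (length (src g)) (length (src h))"
    using par_law ok by blast
  then have "msub C (p @ src g @ q) (tgt h) r (src h) (tgt f) (msub C p (tgt g) (q @ [tgt h] @ r) (src g) (tgt f) (mor f) (mor g)) (mor h)
    = msub C p (tgt g) (q @ src h @ r) (src g) (tgt f) (msub C (p @ [tgt g] @ q) (tgt h) r (src h) (tgt f) (mor f) (mor h)) (mor g)"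
    unfolding par_assoc_def
    using ps qr multimap_mor[OF f] multimap_mor[OF g(1)] multimap_mor[OF h(1)] multimap_ends[OF f] multimap_ends[OF g(1)] multimap_ends[OF h(1)]
    by (elim allE impE) auto
  then show ?thesis
    using ps qr j by (simp add: sub_def add.commute)
qed

text \<open>
  In normal form the root comes first, so that an equation between substitutions has to be applied
  below an input of another multimap \<open>x\<close>.
\<close>

lemma sub_cong_prefix:
  assumes eq: "f \<bullet>[0] g = k"
    and "multimap C x" "i < length (src x)" "src x ! i = tgt f"
    and "multimap C f" "multimap C g" "src f \<noteq> []" "src f ! 0 = tgt g"
    and ok: "subst_ok long (length (src x)) (length (src f))" "subst_ok long (length (src f)) (length (src g))"
      "subst_ok long (length (src x) + length (src f) - 1) (length (src g))"
      "subst_ok long (length (src x)) (length (src f) + length (src g) - 1)"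
  shows "x \<bullet>[i] f \<bullet>[i] g = x \<bullet>[i] k"
  using sub_seq[of x f i g 0] assms by simp

end

section \<open>The skew monoidal category of a left representable multicategory\<close>

text \<open>
  \<open>V\<close> is the skew monoidal category to be obtained from \<open>C\<close>; as a parameter of its own it allows
  for the usual notation.
\<close>

locale lr_multi = partial_multi long C + cl: is_classifiers C t
  for long :: bool and C :: "('o, 'm) multi" and t :: "('o, 'm) classifiers" +
  fixes V :: "('o, 'm) skew_mon" (structure)
  assumes V_def: "V = skew_of C t"
    and theta_bij: "\<lbrakk>a \<in> mobj C; b \<in> mobj C; set xs \<subseteq> mobj C; long \<or> length xs \<le> 2; d \<in> mobj C\<rbrakk>
      \<Longrightarrow> bij_betw (\<lambda>g. msub C [] (ctens t a b) xs [a, b] d g (ctheta t a b))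
            (mhom C (ctens t a b # xs) d) (mhom C (a # b # xs) d)"
    and u_bij: "\<lbrakk>set xs \<subseteq> mobj C; long \<or> length xs \<le> 2; d \<in> mobj C\<rbrakk>
      \<Longrightarrow> bij_betw (\<lambda>g. msub C [] (cunit t) xs [] d g (cu t))
            (mhom C (cunit t # xs) d) (mhom C xs d)"
begin

text \<open>
  The classifiers \<open>\<theta> : a, b \<rightarrow> ab\<close> and \<open>u : () \<rightarrow> \<one>\<close>.
\<close>

definition th :: "'o \<Rightarrow> 'o \<Rightarrow> ('o list, 'o, 'm) arrow" where
  "th a b = Arrow [a, b] (ctens t a b) (ctheta t a b)"

definition uu :: "('o list, 'o, 'm) arrow" where
  "uu = Arrow [] (cunit t) (cu t)"

lemma V_simps: "Obj V = mobj C" "Hom V a b = mhom C [a] b" "Id V a = mid C a"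
  "Comp V a b c = msub C [] b [] [a] c" "a \<otimes> b = ctens t a b" "\<one> = cunit t"
  by (simp_all add: V_def skew_of_def Let_def)

lemma ends_th [simp]: "src (th a b) = [a, b]" "tgt (th a b) = a \<otimes> b" "src uu = []" "tgt uu = \<one>"
  by (simp_all add: th_def uu_def V_simps)

lemma Obj_V [simp]: "Obj V = mobj C"
  by (rule V_simps)

lemma obj_closed [simp]: "\<lbrakk>a \<in> mobj C; b \<in> mobj C\<rbrakk> \<Longrightarrow> a \<otimes> b \<in> mobj C" "\<one> \<in> mobj C"
  by (simp_all add: V_simps cl.ctens_in_mobj cl.cunit_in_mobj)

lemma multimap_th [simp]: "\<lbrakk>a \<in> mobj C; b \<in> mobj C\<rbrakk> \<Longrightarrow> multimap C (th a b)" "multimap C uu"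
  by (simp_all add: th_def uu_def cl.ctens_in_mobj cl.ctheta_in_mhom cl.cunit_in_mobj cl.cu_in_mhom)

lemma multimap_unary [simp]: "multimap C (unary f) \<longleftrightarrow> arr V f"
  by (simp add: arr_def unary_def V_simps)

lemma unary_ide [simp]: "unary (ide V a) = idm C a"
  by (simp add: unary_def ide_def idm_def V_simps)

lemma unary_cmp: "tgt f = src g \<Longrightarrow> unary (g \<cdot> f) = unary g \<bullet>[0] unary f"
  by (simp add: unary_def cmp_def sub_def V_simps)

lemma th_cancel:
  assumes "k \<bullet>[0] th a b = k' \<bullet>[0] th a b" "multimap C k" "multimap C k'" "src k = a \<otimes> b # xs" "src k' = a \<otimes> b # xs"
    "tgt k = tgt k'" "a \<in> mobj C" "b \<in> mobj C" "long \<or> length xs \<le> 2"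
  shows "k = k'"
proof -
  have "mor k = mor k'"
    using bij_betw_imp_inj_on[OF theta_bij[of a b xs "tgt k"]] assms multimap_mor[OF assms(2)] multimap_mor[OF assms(3)] multimap_ends[OF assms(2)]
    by (auto simp: V_simps sub_def th_def inj_on_def)
  then show ?thesis using assms by (cases k; cases k') auto
qed

lemma uu_cancel:
  assumes "k \<bullet>[0] uu = k' \<bullet>[0] uu" "multimap C k" "multimap C k'" "src k = \<one> # xs" "src k' = \<one> # xs"
    "tgt k = tgt k'" "long \<or> length xs \<le> 2"
  shows "k = k'"
proof -
  have "mor k = mor k'"
    using bij_betw_imp_inj_on[OF u_bij[of xs "tgt k"]] assms multimap_mor[OF assms(2)] multimap_mor[OF assms(3)] multimap_ends[OF assms(2)]
    by (auto simp: V_simps sub_def uu_def inj_on_def)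
  then show ?thesis using assms by (cases k; cases k') auto
qed

lemma th_ex:
  assumes h: "multimap C h" "src h = a # b # xs" "long \<or> length xs \<le> 2"
  obtains k where "multimap C k" "src k = a \<otimes> b # xs" "tgt k = tgt h" "k \<bullet>[0] th a b = h"
proof -
  have o: "a \<in> mobj C" "b \<in> mobj C" "set xs \<subseteq> mobj C" "tgt h \<in> mobj C" using h multimap_ends[OF h(1)] by auto
  obtain k where k: "k \<in> mhom C (ctens t a b # xs) (tgt h)" "msub C [] (ctens t a b) xs [a, b] (tgt h) k (ctheta t a b) = mor h"
    using bij_betw_imp_surj_on[OF theta_bij[OF o(1-3) h(3) o(4)]] multimap_mor[OF h(1)] h(2) by (metis (no_types, lifting) imageE)
  show thesis
    using that[of "Arrow (a \<otimes> b # xs) (tgt h) k"] k o h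
    by (cases h) (simp add: V_simps cl.ctens_in_mobj sub_def th_def)
qed

lemma uu_ex:
  assumes h: "multimap C h" "long \<or> length (src h) \<le> 2"
  obtains k where "multimap C k" "src k = \<one> # src h" "tgt k = tgt h" "k \<bullet>[0] uu = h"
proof -
  have o: "set (src h) \<subseteq> mobj C" "tgt h \<in> mobj C" using multimap_ends[OF h(1)] by auto
  obtain k where k: "k \<in> mhom C (cunit t # src h) (tgt h)" "msub C [] (cunit t) (src h) [] (tgt h) k (cu t) = mor h"
    using bij_betw_imp_surj_on[OF u_bij[OF o(1) h(2) o(2)]] multimap_mor[OF h(1)] by (metis (no_types, lifting) imageE)
  show thesis
    using that[of "Arrow (\<one> # src h) (tgt h) k"] k o h
    by (cases h) (simp add: V_simps cl.cunit_in_mobj sub_def uu_def)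
qed

text \<open>
  The structure of \<open>V\<close> is defined by descriptions whose existence and uniqueness come from
  the universal properties of \<open>\<theta>\<close> and \<open>u\<close>; they are recast as the defining equations \<open>tns_th\<close>, \<open>al_th\<close>, \<open>la_th\<close>, \<open>ra_th\<close>.
\<close>

lemma the_multimap:
  assumes ex: "multimap C k0" "src k0 = as" "tgt k0 = b" "P (mor k0)"
    and uniq: "\<And>k. \<lbrakk>multimap C k; src k = as; tgt k = b; P (mor k)\<rbrakk> \<Longrightarrow> k = k0"
  shows "(THE k. k \<in> mhom C as b \<and> P k) = mor k0"
proof (rule the_equality)
  show "mor k0 \<in> mhom C as b \<and> P (mor k0)" using ex multimap_mor[OF ex(1)] by auto
  fix k assume "k \<in> mhom C as b \<and> P k"
  then show "k = mor k0" using uniq[of "Arrow as b k"] ex multimap_ends[OF ex(1)] by auto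
qed

lemmas ok_simps = subst_ok_iff arity_ok_def
lemmas objs = arr_ends[of V, simplified]

lemma objs' [simp]: "arr V f \<Longrightarrow> src f \<in> mobj C" "arr V f \<Longrightarrow> tgt f \<in> mobj C"
  by (simp_all add: objs)

lemma tns_th:
  assumes f: "arr V f" and g: "arr V g"
  shows "arr V (f \<odot> g)" and "unary (f \<odot> g) \<bullet>[0] th (src f) (src g) = th (tgt f) (tgt g) \<bullet>[0] unary f \<bullet>[1] unary g"
proof -
  let ?h = "th (tgt f) (tgt g) \<bullet>[0] unary f \<bullet>[1] unary g"
  have h: "multimap C ?h" using f g by (simp add: multimap_sub ok_simps)
  obtain k where k: "multimap C k" "src k = [src f \<otimes> src g]" "tgt k = tgt f \<otimes> tgt g" "k \<bullet>[0] th (src f) (src g) = ?h"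
    by (rule th_ex[OF h]) auto
  have "tarr V (src f) (tgt f) (src g) (tgt g) (mor f) (mor g) = mor k"
    unfolding V_def skew_of_def Let_def
  proof (simp, rule the_multimap)
    have "mor (k \<bullet>[0] th (src f) (src g)) = mor ?h" using k by simp
    then show "msub C [] (ctens t (src f) (src g)) [] [src f, src g] (ctens t (tgt f) (tgt g)) (mor k) (ctheta t (src f) (src g)) =
      msub C [src f] (tgt g) [] [src g] (ctens t (tgt f) (tgt g)) (msub C [] (tgt f) [tgt g] [src f] (ctens t (tgt f) (tgt g)) (ctheta t (tgt f) (tgt g)) (mor f)) (mor g)"
      using k by (simp add: sub_def th_def unary_def V_simps)
    fix k' assume k': "multimap C k'" "src k' = [ctens t (src f) (src g)]" "tgt k' = ctens t (tgt f) (tgt g)"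
      "msub C [] (ctens t (src f) (src g)) [] [src f, src g] (ctens t (tgt f) (tgt g)) (mor k') (ctheta t (src f) (src g)) =
      msub C [src f] (tgt g) [] [src g] (ctens t (tgt f) (tgt g)) (msub C [] (tgt f) [tgt g] [src f] (ctens t (tgt f) (tgt g)) (ctheta t (tgt f) (tgt g)) (mor f)) (mor g)"
    then have "k' \<bullet>[0] th (src f) (src g) = ?h"
      by (simp add: sub_def th_def unary_def V_simps)
    then show "k' = k" using k(1-4) k'(1-3) f g by (intro th_cancel[of k' "src f" "src g" k "[]"]) (simp_all add: V_simps(5))
  qed (use k in \<open>simp_all add: V_simps\<close>)
  then have "unary (f \<odot> g) = k" using k by (cases k) (simp add: unary_def tns_def)
  then show "arr V (f \<odot> g)" "unary (f \<odot> g) \<bullet>[0] th (src f) (src g) = ?h" using k by (auto simp flip: multimap_unary)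
qed

lemma al_th:
  assumes o: "a \<in> mobj C" "b \<in> mobj C" "c \<in> mobj C"
  shows "arr V (al V a b c)" and "unary (al V a b c) \<bullet>[0] th (a \<otimes> b) c \<bullet>[0] th a b = th a (b \<otimes> c) \<bullet>[1] th b c"
proof -
  let ?h = "th a (b \<otimes> c) \<bullet>[1] th b c"
  have h: "multimap C ?h" using o by (simp add: multimap_sub ok_simps)
  obtain l where l: "multimap C l" "src l = [a \<otimes> b, c]" "tgt l = a \<otimes> (b \<otimes> c)" "l \<bullet>[0] th a b = ?h"
    by (rule th_ex[OF h]) auto
  obtain k where k: "multimap C k" "src k = [(a \<otimes> b) \<otimes> c]" "tgt k = tgt l" "k \<bullet>[0] th (a \<otimes> b) c = l"
    by (rule th_ex[OF l(1,2)]) auto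
  have "assr V a b c = mor k"
    unfolding V_def skew_of_def Let_def
  proof (simp, rule the_multimap)
    have "mor (k \<bullet>[0] th (a \<otimes> b) c \<bullet>[0] th a b) = mor ?h" using k l by simp
    then show "msub C [] (ctens t a b) [c] [a, b] (ctens t a (ctens t b c))
         (msub C [] (ctens t (ctens t a b) c) [] [ctens t a b, c] (ctens t a (ctens t b c)) (mor k) (ctheta t (ctens t a b) c)) (ctheta t a b)
     = msub C [a] (ctens t b c) [] [b, c] (ctens t a (ctens t b c)) (ctheta t a (ctens t b c)) (ctheta t b c)"
      using k l by (simp add: sub_def th_def V_simps)
    fix k' assume k': "multimap C k'" "src k' = [ctens t (ctens t a b) c]" "tgt k' = ctens t a (ctens t b c)"
      "msub C [] (ctens t a b) [c] [a, b] (ctens t a (ctens t b c))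
         (msub C [] (ctens t (ctens t a b) c) [] [ctens t a b, c] (ctens t a (ctens t b c)) (mor k') (ctheta t (ctens t a b) c)) (ctheta t a b)
     = msub C [a] (ctens t b c) [] [b, c] (ctens t a (ctens t b c)) (ctheta t a (ctens t b c)) (ctheta t b c)"
    then have e: "k' \<bullet>[0] th (a \<otimes> b) c \<bullet>[0] th a b = k \<bullet>[0] th (a \<otimes> b) c \<bullet>[0] th a b"
      using k l by (simp add: sub_def th_def V_simps)
    have ends: "src k' = [(a \<otimes> b) \<otimes> c]" "tgt k' = a \<otimes> (b \<otimes> c)" using k' by (simp_all add: V_simps)
    have e': "k' \<bullet>[0] th (a \<otimes> b) c = k \<bullet>[0] th (a \<otimes> b) c"
      using k(1-3) l(1-3) k'(1) ends o by (intro th_cancel[OF e, of "[c]"]) (simp_all add: multimap_sub ok_simps)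
    show "k' = k" using k(1-3) l(1-3) k'(1) ends o by (intro th_cancel[OF e', of "[]"]) simp_all
  qed (use k l in \<open>simp_all add: V_simps\<close>)
  then have "unary (al V a b c) = k" using k l by (cases k) (simp add: unary_def al_def)
  then show "arr V (al V a b c)" "unary (al V a b c) \<bullet>[0] th (a \<otimes> b) c \<bullet>[0] th a b = ?h" using k l by (auto simp flip: multimap_unary)
qed

lemma la_th:
  assumes o: "a \<in> mobj C"
  shows "arr V (la V a)" and "unary (la V a) \<bullet>[0] th \<one> a \<bullet>[0] uu = idm C a"
proof -
  obtain l where l: "multimap C l" "src l = [\<one>, a]" "tgt l = a" "l \<bullet>[0] uu = idm C a"
    by (rule uu_ex[OF multimap_idm[OF o]]) auto
  obtain k where k: "multimap C k" "src k = [\<one> \<otimes> a]" "tgt k = tgt l" "k \<bullet>[0] th \<one> a = l"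
    by (rule th_ex[OF l(1,2)]) auto
  have "lunit V a = mor k"
    unfolding V_def skew_of_def Let_def
  proof (simp, rule the_multimap)
    have "mor (k \<bullet>[0] th \<one> a \<bullet>[0] uu) = mor (idm C a)" using k l by simp
    then show "msub C [] (cunit t) [a] [] a (msub C [] (ctens t (cunit t) a) [] [cunit t, a] a (mor k) (ctheta t (cunit t) a)) (cu t) = mid C a"
      using k l by (simp add: sub_def th_def uu_def idm_def V_simps)
    fix k' assume k': "multimap C k'" "src k' = [ctens t (cunit t) a]" "tgt k' = a"
      "msub C [] (cunit t) [a] [] a (msub C [] (ctens t (cunit t) a) [] [cunit t, a] a (mor k') (ctheta t (cunit t) a)) (cu t) = mid C a"
    then have e: "k' \<bullet>[0] th \<one> a \<bullet>[0] uu = k \<bullet>[0] th \<one> a \<bullet>[0] uu"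
      using k l by (simp add: sub_def th_def uu_def idm_def V_simps)
    have ends: "src k' = [\<one> \<otimes> a]" "tgt k' = a" using k' by (simp_all add: V_simps)
    have e': "k' \<bullet>[0] th \<one> a = k \<bullet>[0] th \<one> a"
      using k(1-3) l(1-3) k'(1) ends o by (intro uu_cancel[OF e, of "[a]"]) (simp_all add: multimap_sub ok_simps)
    show "k' = k" using k(1-3) l(1-3) k'(1) ends o by (intro th_cancel[OF e', of "[]"]) simp_all
  qed (use k l in \<open>simp_all add: V_simps\<close>)
  then have "unary (la V a) = k" using k l by (cases k) (simp add: unary_def la_def)
  then show "arr V (la V a)" "unary (la V a) \<bullet>[0] th \<one> a \<bullet>[0] uu = idm C a" using k l by (auto simp flip: multimap_unary)
qed

lemma ra_th:
  assumes o: "a \<in> mobj C"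
  shows "arr V (ra V a)" and "unary (ra V a) = th a \<one> \<bullet>[1] uu"
proof -
  show eq: "unary (ra V a) = th a \<one> \<bullet>[1] uu"
    by (simp add: unary_def ra_def sub_def th_def uu_def V_simps) (simp add: V_def skew_of_def Let_def)
  show "arr V (ra V a)"
    using o by (subst multimap_unary[symmetric], subst eq) (simp add: multimap_sub ok_simps)
qed

declare al_th(1) [simp] la_th(1) [simp] ra_th(1) [simp] tns_th(1) [simp] multimap_sub [simp] multimap_idm [simp]

lemma is_category_V: "is_category V"
proof
  fix a b c d f g h
  { assume "a \<in> Obj V" then show "Id V a \<in> Hom V a a" by (simp add: V_simps mid_in_mhom) }
  { assume "a \<in> Obj V" "b \<in> Obj V" "c \<in> Obj V" "f \<in> Hom V a b" "g \<in> Hom V b c"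
    then show "Comp V a b c g f \<in> Hom V a c"
      using msub_in_mhom[of "[]" b "[]" "[a]" c g f] by (simp add: V_simps ok_simps) }
  { assume "a \<in> Obj V" "b \<in> Obj V" "f \<in> Hom V a b"
    then show "Comp V a a b f (Id V a) = f" "Comp V a b b (Id V b) f = f"
      using msub_mid_inner[of "[]" a "[]" b f] msub_mid_outer[of "[a]" b f] by (simp_all add: V_simps ok_simps) }
  { assume *: "a \<in> Obj V" "b \<in> Obj V" "c \<in> Obj V" "d \<in> Obj V" "f \<in> Hom V a b" "g \<in> Hom V b c" "h \<in> Hom V c d"
    then have "unary (Arrow c d h) \<bullet>[0] (unary (Arrow b c g) \<bullet>[0] unary (Arrow a b f)) = unary (Arrow c d h) \<bullet>[0] unary (Arrow b c g) \<bullet>[0] unary (Arrow a b f)"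
      by (subst sub_seq) (simp_all add: ok_simps)
    then show "Comp V a c d h (Comp V a b c g f) = Comp V a b d (Comp V b c d h g) f"
      by (simp add: unary_def sub_def V_simps) }
qed

sublocale Vc: is_category V
  by (rule is_category_V)

lemma tns_th_ide [simp]:
  assumes f: "arr V f" and c: "c \<in> mobj C"
  shows "unary (f \<odot> ide V c) \<bullet>[0] th (src f) c = th (tgt f) c \<bullet>[0] unary f"
    and "unary (ide V c \<odot> f) \<bullet>[0] th c (src f) = th c (tgt f) \<bullet>[1] unary f"
  using tns_th(2)[of f "ide V c"] tns_th(2)[of "ide V c" f] f c
  by (simp_all add: sub_idm ok_simps)

text \<open>
  The universal properties, applied once for each tensor in the source.
\<close>

lemma cancel2:
  assumes "unary f \<bullet>[0] th a b = unary g \<bullet>[0] th a b" "arr V f" "arr V g" "src f = a \<otimes> b" "src g = a \<otimes> b" "tgt f = tgt g"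
    "a \<in> mobj C" "b \<in> mobj C"
  shows "f = g"
  using th_cancel[OF assms(1), of "[]"] assms by (simp add: unary_inject)

lemma cancel3:
  assumes "unary f \<bullet>[0] th (a \<otimes> b) c \<bullet>[0] th a b = unary g \<bullet>[0] th (a \<otimes> b) c \<bullet>[0] th a b" "arr V f" "arr V g"
    "src f = (a \<otimes> b) \<otimes> c" "src g = (a \<otimes> b) \<otimes> c" "tgt f = tgt g" "a \<in> mobj C" "b \<in> mobj C" "c \<in> mobj C"
  shows "f = g"
proof -
  have "unary f \<bullet>[0] th (a \<otimes> b) c = unary g \<bullet>[0] th (a \<otimes> b) c"
    using assms by (intro th_cancel[OF assms(1), of "[c]"]) (simp_all add: ok_simps)
  then show ?thesis by (rule cancel2) (use assms in auto)
qed

lemma cancel4: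
  assumes "unary f \<bullet>[0] th ((a \<otimes> b) \<otimes> c) d \<bullet>[0] th (a \<otimes> b) c \<bullet>[0] th a b = unary g \<bullet>[0] th ((a \<otimes> b) \<otimes> c) d \<bullet>[0] th (a \<otimes> b) c \<bullet>[0] th a b"
    "arr V f" "arr V g" "src f = ((a \<otimes> b) \<otimes> c) \<otimes> d" "src g = ((a \<otimes> b) \<otimes> c) \<otimes> d" "tgt f = tgt g"
    "a \<in> mobj C" "b \<in> mobj C" "c \<in> mobj C" "d \<in> mobj C"
  shows "f = g"
proof -
  have "unary f \<bullet>[0] th ((a \<otimes> b) \<otimes> c) d \<bullet>[0] th (a \<otimes> b) c = unary g \<bullet>[0] th ((a \<otimes> b) \<otimes> c) d \<bullet>[0] th (a \<otimes> b) c"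
    using assms by (intro th_cancel[OF assms(1), of "[c, d]"]) (simp_all add: ok_simps)
  then show ?thesis by (rule cancel3) (use assms in auto)
qed

lemma cancel_uu2:
  assumes "unary f \<bullet>[0] th \<one> a \<bullet>[0] uu = unary g \<bullet>[0] th \<one> a \<bullet>[0] uu" "arr V f" "arr V g"
    "src f = \<one> \<otimes> a" "src g = \<one> \<otimes> a" "tgt f = tgt g" "a \<in> mobj C"
  shows "f = g"
proof -
  have "unary f \<bullet>[0] th \<one> a = unary g \<bullet>[0] th \<one> a"
    using assms by (intro uu_cancel[OF assms(1), of "[a]"]) (simp_all add: ok_simps)
  then show ?thesis by (rule cancel2) (use assms in auto)
qed

lemma cancel_uu3:
  assumes "unary f \<bullet>[0] th (\<one> \<otimes> a) b \<bullet>[0] th \<one> a \<bullet>[0] uu = unary g \<bullet>[0] th (\<one> \<otimes> a) b \<bullet>[0] th \<one> a \<bullet>[0] uu" "arr V f" "arr V g"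
    "src f = (\<one> \<otimes> a) \<otimes> b" "src g = (\<one> \<otimes> a) \<otimes> b" "tgt f = tgt g" "a \<in> mobj C" "b \<in> mobj C"
  shows "f = g"
proof -
  have "unary f \<bullet>[0] th (\<one> \<otimes> a) b \<bullet>[0] th \<one> a = unary g \<bullet>[0] th (\<one> \<otimes> a) b \<bullet>[0] th \<one> a"
    using assms by (intro uu_cancel[OF assms(1), of "[a, b]"]) (simp_all add: ok_simps)
  then show ?thesis by (rule cancel3) (use assms in auto)
qed

text \<open>The defining equations of tensors, \<open>\<alpha>\<close> and \<open>\<lambda>\<close> in the form in which normalised substitutions contain them.\<close>

lemma tns_th_pre:
  assumes x: "multimap C x" "i < length (src x)" "src x ! i = tgt f \<otimes> tgt g" "long \<or> length (src x) \<le> 3"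
    and f: "arr V f" and g: "arr V g"
  shows "x \<bullet>[i] unary (f \<odot> g) \<bullet>[i] th (src f) (src g) = x \<bullet>[i] th (tgt f) (tgt g) \<bullet>[i] unary f \<bullet>[Suc i] unary g"
proof -
  have n: "src x \<noteq> []" using x by auto
  have "x \<bullet>[i] unary (f \<odot> g) \<bullet>[i] th (src f) (src g) = x \<bullet>[i] (th (tgt f) (tgt g) \<bullet>[0] unary f \<bullet>[1] unary g)"
    using x n f g by (intro sub_cong_prefix tns_th) (auto simp: ok_simps)
  also have "\<dots> = x \<bullet>[i] th (tgt f) (tgt g) \<bullet>[i] unary f \<bullet>[Suc i] unary g"
    using x n f g by (auto simp: ok_simps sub_seq)
  finally show ?thesis .
qed

lemma al_th_pre:
  assumes x: "multimap C x" "i < length (src x)" "src x ! i = a \<otimes> (b \<otimes> c)" "long \<or> length (src x) \<le> 2"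
    and o: "a \<in> mobj C" "b \<in> mobj C" "c \<in> mobj C"
  shows "x \<bullet>[i] unary (al V a b c) \<bullet>[i] th (a \<otimes> b) c \<bullet>[i] th a b = x \<bullet>[i] th a (b \<otimes> c) \<bullet>[Suc i] th b c"
proof -
  have n: "src x \<noteq> []" using x by auto
  have "x \<bullet>[i] unary (al V a b c) \<bullet>[i] th (a \<otimes> b) c \<bullet>[i] th a b = x \<bullet>[i] (unary (al V a b c) \<bullet>[0] th (a \<otimes> b) c) \<bullet>[i] th a b"
    using x n o by (auto simp: ok_simps sub_seq)
  also have "\<dots> = x \<bullet>[i] (th a (b \<otimes> c) \<bullet>[1] th b c)"
    using x n o by (intro sub_cong_prefix al_th) (auto simp: ok_simps)
  also have "\<dots> = x \<bullet>[i] th a (b \<otimes> c) \<bullet>[Suc i] th b c"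
    using x n o by (auto simp: ok_simps sub_seq)
  finally show ?thesis .
qed

lemma la_th_pre:
  assumes x: "multimap C x" "i < length (src x)" "src x ! i = a" "long \<or> length (src x) \<le> 2" and o: "a \<in> mobj C"
  shows "x \<bullet>[i] unary (la V a) \<bullet>[i] th \<one> a \<bullet>[i] uu = x"
proof -
  have n: "src x \<noteq> []" using x by auto
  have "x \<bullet>[i] unary (la V a) \<bullet>[i] th \<one> a \<bullet>[i] uu = x \<bullet>[i] (unary (la V a) \<bullet>[0] th \<one> a) \<bullet>[i] uu"
    using x n o by (auto simp: ok_simps sub_seq)
  also have "\<dots> = x \<bullet>[i] idm C a"
    using x n o by (intro sub_cong_prefix la_th) (auto simp: ok_simps)
  also have "\<dots> = x"
    using x n o by (auto simp: ok_simps sub_idm)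
  finally show ?thesis .
qed


text \<open>
  For each axiom of a skew monoidal category, both sides become the same iterated
  substitution of \<open>\<theta>\<close>, \<open>u\<close> and the arrows involved. For example, both sides of the pentagon become
  \<open>\<theta> \<circ>\<^sub>2 (\<theta> \<circ>\<^sub>2 \<theta>)\<close>.
\<close>

lemma V_tarr_Id: "\<lbrakk>a \<in> mobj C; b \<in> mobj C\<rbrakk> \<Longrightarrow> ide V a \<odot> ide V b = ide V (a \<otimes> b)"
  by (rule cancel2[of _ a b]) (simp_all add: tns_th_ide(1)[of "ide V a", simplified] sub_idm idm_sub ok_simps)

lemma V_tarr_Comp:
  assumes "arr V f" "arr V g" "arr V f'" "arr V g'" "tgt f = src g" "tgt f' = src g'"
  shows "(g \<cdot> f) \<odot> (g' \<cdot> f') = (g \<odot> g') \<cdot> (f \<odot> f')"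
proof (rule cancel2[of _ "src f" "src f'"])
  have "unary ((g \<cdot> f) \<odot> (g' \<cdot> f')) \<bullet>[0] th (src f) (src f') = th (tgt g) (tgt g') \<bullet>[0] unary g \<bullet>[0] unary f \<bullet>[1] unary g' \<bullet>[1] unary f'"
    using assms tns_th(2)[of "g \<cdot> f" "g' \<cdot> f'"] by (simp add: unary_cmp sub_seq ok_simps)
  also have "\<dots> = th (tgt g) (tgt g') \<bullet>[0] unary g \<bullet>[1] unary g' \<bullet>[0] unary f \<bullet>[1] unary f'"
    using assms by (simp add: sub_par ok_simps)
  also have "\<dots> = unary ((g \<odot> g') \<cdot> (f \<odot> f')) \<bullet>[0] th (src f) (src f')"
    using assms tns_th(2)[of f f'] tns_th(2)[of g g'] tns_th_pre[of "unary (g \<odot> g')" 0 f f'] by (simp add: unary_cmp)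
  finally show "unary ((g \<cdot> f) \<odot> (g' \<cdot> f')) \<bullet>[0] th (src f) (src f') = unary ((g \<odot> g') \<cdot> (f \<odot> f')) \<bullet>[0] th (src f) (src f')" .
qed (use assms in simp_all)

lemma V_al_nat:
  assumes "arr V f" "arr V g" "arr V h"
  shows "(f \<odot> (g \<odot> h)) \<cdot> al V (src f) (src g) (src h) = al V (tgt f) (tgt g) (tgt h) \<cdot> ((f \<odot> g) \<odot> h)"
proof (rule cancel3[of _ "src f" "src g" "src h"])
  have "unary ((f \<odot> (g \<odot> h)) \<cdot> al V (src f) (src g) (src h)) \<bullet>[0] th (src f \<otimes> src g) (src h) \<bullet>[0] th (src f) (src g)
      = unary (f \<odot> (g \<odot> h)) \<bullet>[0] th (src f) (src (g \<odot> h)) \<bullet>[1] th (src g) (src h)"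
    using assms by (simp add: unary_cmp al_th_pre)
  also have "\<dots> = th (tgt f) (tgt g \<otimes> tgt h) \<bullet>[0] unary f \<bullet>[1] th (tgt g) (tgt h) \<bullet>[1] unary g \<bullet>[2] unary h"
    using assms by (subst tns_th) (simp_all add: tns_th_pre[where i = "Suc 0"] numeral_2_eq_2 ok_simps)
  also have "\<dots> = th (tgt f) (tgt g \<otimes> tgt h) \<bullet>[1] th (tgt g) (tgt h) \<bullet>[0] unary f \<bullet>[1] unary g \<bullet>[2] unary h"
    using assms by (simp add: sub_par ok_simps)
  also have "\<dots> = unary (al V (tgt f) (tgt g) (tgt h)) \<bullet>[0] th (tgt (f \<odot> g)) (tgt h) \<bullet>[0] th (tgt f) (tgt g) \<bullet>[0] unary f \<bullet>[1] unary g \<bullet>[2] unary h"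
    using assms by (simp add: al_th)
  also have "\<dots> = unary (al V (tgt f) (tgt g) (tgt h)) \<bullet>[0] th (tgt (f \<odot> g)) (tgt h) \<bullet>[0] unary (f \<odot> g) \<bullet>[0] th (src f) (src g) \<bullet>[2] unary h"
    using assms by (simp add: tns_th_pre ok_simps)
  also have "\<dots> = unary (al V (tgt f) (tgt g) (tgt h) \<cdot> ((f \<odot> g) \<odot> h)) \<bullet>[0] th (src f \<otimes> src g) (src h) \<bullet>[0] th (src f) (src g)"
    using assms tns_th_pre[of "unary (al V (tgt f) (tgt g) (tgt h))" 0 "f \<odot> g" h] by (simp add: unary_cmp sub_par ok_simps numeral_2_eq_2)
  finally show "unary ((f \<odot> (g \<odot> h)) \<cdot> al V (src f) (src g) (src h)) \<bullet>[0] th (src f \<otimes> src g) (src h) \<bullet>[0] th (src f) (src g)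
      = unary (al V (tgt f) (tgt g) (tgt h) \<cdot> ((f \<odot> g) \<odot> h)) \<bullet>[0] th (src f \<otimes> src g) (src h) \<bullet>[0] th (src f) (src g)" .
qed (use assms in simp_all)

lemma V_la_nat:
  assumes "arr V f"
  shows "f \<cdot> la V (src f) = la V (tgt f) \<cdot> (ide V \<one> \<odot> f)"
proof (rule cancel_uu2[of _ "src f"])
  have "unary (la V (tgt f) \<cdot> (ide V \<one> \<odot> f)) \<bullet>[0] th \<one> (src f) \<bullet>[0] uu
      = unary (la V (tgt f)) \<bullet>[0] th \<one> (tgt f) \<bullet>[1] unary f \<bullet>[0] uu"
    using assms tns_th_pre[of "unary (la V (tgt f))" 0 "ide V \<one>" f] by (simp add: unary_cmp sub_idm ok_simps)
  also have "\<dots> = idm C (tgt f) \<bullet>[0] unary f"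
    using assms by (simp add: sub_par ok_simps la_th)
  also have "\<dots> = unary (f \<cdot> la V (src f)) \<bullet>[0] th \<one> (src f) \<bullet>[0] uu"
    using assms by (simp add: idm_sub unary_cmp la_th_pre ok_simps)
  finally show "unary (f \<cdot> la V (src f)) \<bullet>[0] th \<one> (src f) \<bullet>[0] uu
    = unary (la V (tgt f) \<cdot> (ide V \<one> \<odot> f)) \<bullet>[0] th \<one> (src f) \<bullet>[0] uu" ..
qed (use assms in simp_all)

lemma V_ra_nat:
  assumes "arr V f"
  shows "ra V (tgt f) \<cdot> f = (f \<odot> ide V \<one>) \<cdot> ra V (src f)"
proof -
  have "unary (ra V (tgt f) \<cdot> f) = unary ((f \<odot> ide V \<one>) \<cdot> ra V (src f))"
    using assms by (simp add: unary_cmp ra_th sub_par sub_seq ok_simps)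
  then show ?thesis by (simp add: unary_inject)
qed

lemma V_pentagon:
  assumes "a \<in> mobj C" "b \<in> mobj C" "c \<in> mobj C" "d \<in> mobj C"
  shows "al V a b (c \<otimes> d) \<cdot> al V (a \<otimes> b) c d = (ide V a \<odot> al V b c d) \<cdot> al V a (b \<otimes> c) d \<cdot> (al V a b c \<odot> ide V d)"
proof (rule cancel4[of _ a b c d])
  have "unary (al V a b (c \<otimes> d) \<cdot> al V (a \<otimes> b) c d) \<bullet>[0] th ((a \<otimes> b) \<otimes> c) d \<bullet>[0] th (a \<otimes> b) c \<bullet>[0] th a b
      = unary (al V a b (c \<otimes> d)) \<bullet>[0] th (a \<otimes> b) (c \<otimes> d) \<bullet>[0] th a b \<bullet>[2] th c d"
    using assms by (simp add: unary_cmp al_th_pre sub_par ok_simps numeral_2_eq_2)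
  also have "\<dots> = th a (b \<otimes> (c \<otimes> d)) \<bullet>[1] th b (c \<otimes> d) \<bullet>[2] th c d"
    using assms by (simp add: al_th)
  finally have lhs: "unary (al V a b (c \<otimes> d) \<cdot> al V (a \<otimes> b) c d) \<bullet>[0] th ((a \<otimes> b) \<otimes> c) d \<bullet>[0] th (a \<otimes> b) c \<bullet>[0] th a b
      = th a (b \<otimes> (c \<otimes> d)) \<bullet>[1] th b (c \<otimes> d) \<bullet>[2] th c d" .
  let ?x = "unary (ide V a \<odot> al V b c d) \<bullet>[0] unary (al V a (b \<otimes> c) d)"
  have "?x \<bullet>[0] unary (al V a b c \<odot> ide V d) \<bullet>[0] th ((a \<otimes> b) \<otimes> c) d = ?x \<bullet>[0] th (a \<otimes> (b \<otimes> c)) d \<bullet>[0] unary (al V a b c)"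
    using assms tns_th_pre[of ?x 0 "al V a b c" "ide V d"] by (simp add: sub_idm ok_simps)
  then have "unary ((ide V a \<odot> al V b c d) \<cdot> al V a (b \<otimes> c) d \<cdot> (al V a b c \<odot> ide V d)) \<bullet>[0] th ((a \<otimes> b) \<otimes> c) d \<bullet>[0] th (a \<otimes> b) c \<bullet>[0] th a b
      = ?x \<bullet>[0] th (a \<otimes> (b \<otimes> c)) d \<bullet>[0] th a (b \<otimes> c) \<bullet>[1] th b c"
    using assms by (simp add: unary_cmp sub_seq ok_simps al_th_pre)
  also have "\<dots> = unary (ide V a \<odot> al V b c d) \<bullet>[0] th a (src (al V b c d)) \<bullet>[1] th (b \<otimes> c) d \<bullet>[1] th b c"
    using assms by (simp add: al_th_pre)
  also have "\<dots> = th a (b \<otimes> (c \<otimes> d)) \<bullet>[1] th b (c \<otimes> d) \<bullet>[2] th c d"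
    using assms by (subst tns_th_ide) (simp_all add: al_th_pre numeral_2_eq_2)
  finally show "unary (al V a b (c \<otimes> d) \<cdot> al V (a \<otimes> b) c d) \<bullet>[0] th ((a \<otimes> b) \<otimes> c) d \<bullet>[0] th (a \<otimes> b) c \<bullet>[0] th a b
    = unary ((ide V a \<odot> al V b c d) \<cdot> al V a (b \<otimes> c) d \<cdot> (al V a b c \<odot> ide V d)) \<bullet>[0] th ((a \<otimes> b) \<otimes> c) d \<bullet>[0] th (a \<otimes> b) c \<bullet>[0] th a b"
    using lhs by simp
qed (use assms in simp_all)

lemma V_la_al:
  assumes "a \<in> mobj C" "b \<in> mobj C"
  shows "la V (a \<otimes> b) \<cdot> al V \<one> a b = la V a \<odot> ide V b"
proof (rule cancel_uu3[of _ a b])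
  have "unary (la V (a \<otimes> b) \<cdot> al V \<one> a b) \<bullet>[0] th (\<one> \<otimes> a) b \<bullet>[0] th \<one> a \<bullet>[0] uu
      = unary (la V (a \<otimes> b)) \<bullet>[0] th \<one> (a \<otimes> b) \<bullet>[0] uu \<bullet>[0] th a b"
    using assms by (simp add: unary_cmp al_th_pre sub_par ok_simps)
  also have "\<dots> = th a b"
    using assms by (simp add: la_th idm_sub ok_simps)
  also have "\<dots> = unary (la V a \<odot> ide V b) \<bullet>[0] th (src (la V a)) b \<bullet>[0] th \<one> a \<bullet>[0] uu"
    using assms by (subst tns_th_ide) (simp_all add: la_th_pre)
  finally show "unary (la V (a \<otimes> b) \<cdot> al V \<one> a b) \<bullet>[0] th (\<one> \<otimes> a) b \<bullet>[0] th \<one> a \<bullet>[0] uu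
    = unary (la V a \<odot> ide V b) \<bullet>[0] th (\<one> \<otimes> a) b \<bullet>[0] th \<one> a \<bullet>[0] uu" by simp
qed (use assms in simp_all)

lemma V_al_ra:
  assumes "a \<in> mobj C" "b \<in> mobj C"
  shows "al V a b \<one> \<cdot> ra V (a \<otimes> b) = ide V a \<odot> ra V b"
proof (rule cancel2[of _ a b])
  have "unary (al V a b \<one> \<cdot> ra V (a \<otimes> b)) \<bullet>[0] th a b = unary (al V a b \<one>) \<bullet>[0] th (a \<otimes> b) \<one> \<bullet>[0] th a b \<bullet>[2] uu"
    using assms by (simp add: unary_cmp ra_th sub_seq sub_par ok_simps numeral_2_eq_2)
  also have "\<dots> = unary (ide V a \<odot> ra V b) \<bullet>[0] th a (src (ra V b))"
    using assms by (subst tns_th_ide) (simp_all add: al_th ra_th sub_seq ok_simps numeral_2_eq_2)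
  finally show "unary (al V a b \<one> \<cdot> ra V (a \<otimes> b)) \<bullet>[0] th a b = unary (ide V a \<odot> ra V b) \<bullet>[0] th a b" by simp
qed (use assms in simp_all)

lemma V_la_al_ra:
  assumes "a \<in> mobj C" "b \<in> mobj C"
  shows "(ide V a \<odot> la V b) \<cdot> al V a \<one> b \<cdot> (ra V a \<odot> ide V b) = ide V (a \<otimes> b)"
proof (rule cancel2[of _ a b])
  let ?x = "unary (ide V a \<odot> la V b) \<bullet>[0] unary (al V a \<one> b)"
  have "?x \<bullet>[0] unary (ra V a \<odot> ide V b) \<bullet>[0] th a b = ?x \<bullet>[0] th (a \<otimes> \<one>) b \<bullet>[0] unary (ra V a)"
    using assms tns_th_pre[of ?x 0 "ra V a" "ide V b"] by (simp add: sub_idm ok_simps)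
  then have "unary ((ide V a \<odot> la V b) \<cdot> al V a \<one> b \<cdot> (ra V a \<odot> ide V b)) \<bullet>[0] th a b
      = ?x \<bullet>[0] th (a \<otimes> \<one>) b \<bullet>[0] th a \<one> \<bullet>[1] uu"
    using assms by (simp add: unary_cmp sub_seq ok_simps ra_th)
  also have "\<dots> = unary (ide V a \<odot> la V b) \<bullet>[0] th a (src (la V b)) \<bullet>[1] th \<one> b \<bullet>[1] uu"
    using assms by (simp add: al_th_pre)
  also have "\<dots> = th a b"
    using assms by (subst tns_th_ide) (simp_all add: la_th_pre)
  finally show "unary ((ide V a \<odot> la V b) \<cdot> al V a \<one> b \<cdot> (ra V a \<odot> ide V b)) \<bullet>[0] th a b = unary (ide V (a \<otimes> b)) \<bullet>[0] th a b"
    using assms by (simp add: idm_sub ok_simps)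
qed (use assms in simp_all)

lemma V_la_ra: "la V \<one> \<cdot> ra V \<one> = ide V \<one>"
proof -
  have "unary (la V \<one>) \<bullet>[0] th \<one> \<one> \<bullet>[1] uu \<bullet>[0] uu = unary (la V \<one>) \<bullet>[0] th \<one> \<one> \<bullet>[0] uu \<bullet>[0] uu"
    by (subst sub_par) (simp_all add: ok_simps)
  then have "unary (la V \<one> \<cdot> ra V \<one>) \<bullet>[0] uu = unary (ide V \<one>) \<bullet>[0] uu"
    by (simp add: unary_cmp ra_th sub_seq ok_simps la_th)
  then have "unary (la V \<one> \<cdot> ra V \<one>) = unary (ide V \<one>)"
    by (rule uu_cancel[of _ _ "[]"]) simp_all
  then show ?thesis by (simp only: unary_inject)
qed

text \<open>By the definition of \<open>\<lambda>\<close>, its inverse at \<open>a\<close> is \<open>\<theta> \<circ>\<^sub>1 u\<close>.\<close>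

lemma la_iso:
  assumes "a \<in> mobj C"
  obtains g where "arr V g" "unary g = th \<one> a \<bullet>[0] uu" "src g = a" "tgt g = \<one> \<otimes> a"
    "la V a \<cdot> g = ide V a" "g \<cdot> la V a = ide V (\<one> \<otimes> a)"
proof
  let ?g = "Arrow a (\<one> \<otimes> a) (mor (th \<one> a \<bullet>[0] uu))"
  show eq: "unary ?g = th \<one> a \<bullet>[0] uu" by (simp add: unary_def sub_def)
  show g: "arr V ?g" using assms by (subst multimap_unary[symmetric], subst eq) (simp add: ok_simps)
  have "unary (la V a \<cdot> ?g) = unary (ide V a)"
    using assms g by (subst unary_cmp, simp, subst eq) (simp add: sub_seq ok_simps la_th)
  then show "la V a \<cdot> ?g = ide V a" by (simp only: unary_inject)
  show "?g \<cdot> la V a = ide V (\<one> \<otimes> a)"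
  proof (rule cancel_uu2[of _ a])
    have "unary (?g \<cdot> la V a) \<bullet>[0] th \<one> a \<bullet>[0] uu = unary ?g"
      using assms g by (subst unary_cmp) (simp_all add: la_th_pre)
    also have "\<dots> = unary (ide V (\<one> \<otimes> a)) \<bullet>[0] th \<one> a \<bullet>[0] uu"
      using assms by (subst eq) (simp add: idm_sub ok_simps)
    finally show "unary (?g \<cdot> la V a) \<bullet>[0] th \<one> a \<bullet>[0] uu = unary (ide V (\<one> \<otimes> a)) \<bullet>[0] th \<one> a \<bullet>[0] uu" .
  qed (use assms g in simp_all)
qed simp_all

lemma left_normal_skew_V: "left_normal_skew V"
proof (intro left_normal_skew.intro skew_monoidal.intro is_category_V left_normal_skew_axioms.intro skew_monoidal_axioms.intro)
  note defs = cmp_def tns_def al_def ide_def la_def ra_def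
  fix a b c d a' b' c' f g h f' g'
  { assume "a \<in> Obj V" "b \<in> Obj V" then show "a \<otimes> b \<in> Obj V" by simp }
  { show "\<one> \<in> Obj V" by simp }
  { assume *: "a \<in> Obj V" "b \<in> Obj V" "c \<in> Obj V" "d \<in> Obj V" "f \<in> Hom V a b" "g \<in> Hom V c d"
    then have "arr V (Arrow a b f \<odot> Arrow c d g)" by (intro tns_th(1)) simp_all
    then show "tarr V a b c d f g \<in> Hom V (a \<otimes> c) (b \<otimes> d)" by (simp add: tns_def) }
  { assume "a \<in> Obj V" "b \<in> Obj V"
    then show "tarr V a a b b (Id V a) (Id V b) = Id V (a \<otimes> b)"
      using V_tarr_Id[of a b] by (simp add: defs) }
  { assume *: "a \<in> Obj V" "b \<in> Obj V" "c \<in> Obj V" "a' \<in> Obj V" "b' \<in> Obj V" "c' \<in> Obj V"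
        "f \<in> Hom V a b" "g \<in> Hom V b c" "f' \<in> Hom V a' b'" "g' \<in> Hom V b' c'"
    then show "tarr V a c a' c' (Comp V a b c g f) (Comp V a' b' c' g' f')
        = Comp V (a \<otimes> a') (b \<otimes> b') (c \<otimes> c') (tarr V b c b' c' g g') (tarr V a b a' b' f f')"
      using V_tarr_Comp[of "Arrow a b f" "Arrow b c g" "Arrow a' b' f'" "Arrow b' c' g'"] by (simp add: defs) }
  { assume "a \<in> Obj V" "b \<in> Obj V" "c \<in> Obj V"
    then show "assr V a b c \<in> Hom V ((a \<otimes> b) \<otimes> c) (a \<otimes> (b \<otimes> c))"
      using al_th(1)[of a b c] by (simp add: defs) }
  { assume "a \<in> Obj V" then show "lunit V a \<in> Hom V (\<one> \<otimes> a) a" using la_th(1)[of a] by (simp add: defs) }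
  { assume "a \<in> Obj V" then show "runit V a \<in> Hom V a (a \<otimes> \<one>)" using ra_th(1)[of a] by (simp add: defs) }
  { assume *: "a \<in> Obj V" "b \<in> Obj V" "c \<in> Obj V" "a' \<in> Obj V" "b' \<in> Obj V" "c' \<in> Obj V"
        "f \<in> Hom V a a'" "g \<in> Hom V b b'" "h \<in> Hom V c c'"
    then show "Comp V ((a \<otimes> b) \<otimes> c) (a \<otimes> (b \<otimes> c)) (a' \<otimes> (b' \<otimes> c'))
            (tarr V a a' (b \<otimes> c) (b' \<otimes> c') f (tarr V b b' c c' g h)) (assr V a b c)
        = Comp V ((a \<otimes> b) \<otimes> c) ((a' \<otimes> b') \<otimes> c') (a' \<otimes> (b' \<otimes> c'))
            (assr V a' b' c') (tarr V (a \<otimes> b) (a' \<otimes> b') c c' (tarr V a a' b b' f g) h)"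
      using V_al_nat[of "Arrow a a' f" "Arrow b b' g" "Arrow c c' h"] by (simp add: defs) }
  { assume "a \<in> Obj V" "b \<in> Obj V" "f \<in> Hom V a b"
    then show "Comp V (\<one> \<otimes> a) a b f (lunit V a) = Comp V (\<one> \<otimes> a) (\<one> \<otimes> b) b (lunit V b) (tarr V \<one> \<one> a b (Id V \<one>) f)"
      "Comp V a b (b \<otimes> \<one>) (runit V b) f = Comp V a (a \<otimes> \<one>) (b \<otimes> \<one>) (tarr V a b \<one> \<one> f (Id V \<one>)) (runit V a)"
      using V_la_nat[of "Arrow a b f"] V_ra_nat[of "Arrow a b f"] by (simp_all add: defs) }
  { assume "a \<in> Obj V" "b \<in> Obj V" "c \<in> Obj V" "d \<in> Obj V"
    then show "Comp V (((a \<otimes> b) \<otimes> c) \<otimes> d) ((a \<otimes> b) \<otimes> (c \<otimes> d)) (a \<otimes> (b \<otimes> (c \<otimes> d)))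
            (assr V a b (c \<otimes> d)) (assr V (a \<otimes> b) c d)
        = Comp V (((a \<otimes> b) \<otimes> c) \<otimes> d) (a \<otimes> ((b \<otimes> c) \<otimes> d)) (a \<otimes> (b \<otimes> (c \<otimes> d)))
            (tarr V a a ((b \<otimes> c) \<otimes> d) (b \<otimes> (c \<otimes> d)) (Id V a) (assr V b c d))
            (Comp V (((a \<otimes> b) \<otimes> c) \<otimes> d) ((a \<otimes> (b \<otimes> c)) \<otimes> d) (a \<otimes> ((b \<otimes> c) \<otimes> d))
              (assr V a (b \<otimes> c) d)
              (tarr V ((a \<otimes> b) \<otimes> c) (a \<otimes> (b \<otimes> c)) d d (assr V a b c) (Id V d)))"
      using V_pentagon[of a b c d] by (simp add: defs) }
  { assume "a \<in> Obj V" "b \<in> Obj V"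
    then show "Comp V ((\<one> \<otimes> a) \<otimes> b) (\<one> \<otimes> (a \<otimes> b)) (a \<otimes> b) (lunit V (a \<otimes> b)) (assr V \<one> a b)
        = tarr V (\<one> \<otimes> a) a b b (lunit V a) (Id V b)"
      "Comp V (a \<otimes> b) ((a \<otimes> b) \<otimes> \<one>) (a \<otimes> (b \<otimes> \<one>)) (assr V a b \<one>) (runit V (a \<otimes> b))
        = tarr V a a b (b \<otimes> \<one>) (Id V a) (runit V b)"
      "Comp V (a \<otimes> b) (a \<otimes> (\<one> \<otimes> b)) (a \<otimes> b) (tarr V a a (\<one> \<otimes> b) b (Id V a) (lunit V b))
            (Comp V (a \<otimes> b) ((a \<otimes> \<one>) \<otimes> b) (a \<otimes> (\<one> \<otimes> b)) (assr V a \<one> b) (tarr V a (a \<otimes> \<one>) b b (runit V a) (Id V b)))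
        = Id V (a \<otimes> b)"
      using V_la_al[of a b] V_al_ra[of a b] V_la_al_ra[of a b] by (simp_all add: defs) }
  { show "Comp V \<one> (\<one> \<otimes> \<one>) \<one> (lunit V \<one>) (runit V \<one>) = Id V \<one>"
      using V_la_ra by (simp add: defs) }
  show "left_normal V"
    unfolding left_normal_def is_iso_def
  proof (intro ballI conjI)
    fix a assume a: "a \<in> Obj V"
    then show "lunit V a \<in> Hom V (\<one> \<otimes> a) a" using la_th(1)[of a] by (simp add: defs)
    obtain g where "arr V g" "src g = a" "tgt g = \<one> \<otimes> a" "la V a \<cdot> g = ide V a" "g \<cdot> la V a = ide V (\<one> \<otimes> a)"
      using a la_iso[of a] by auto
    then show "\<exists>g\<in>Hom V a (\<one> \<otimes> a). Comp V (\<one> \<otimes> a) a (\<one> \<otimes> a) g (lunit V a) = Id V (\<one> \<otimes> a) \<and> Comp V a (\<one> \<otimes> a) a (lunit V a) g = Id V a"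
      by (intro bexI[of _ "mor g"]) (auto simp: defs arr_def)
  qed
qed

sublocale Vl: left_normal_skew V
  by (rule left_normal_skew_V)

end

section \<open>Reconstructing the multimaps\<close>

context lr_multi
begin

text \<open>
  The iterated classifiers \<open>Th as x : x, as \<rightarrow> x \<lhd> as\<close> and \<open>Th0 as : as \<rightarrow> \<one> \<lhd> as\<close>. The recursion is chosen
  so that \<open>Th0\<close> exists up to arity \<open>4\<close> in a short multicategory: \<open>Th as \<one>\<close> with \<open>u\<close> substituted
  would pass through arity \<open>5\<close>.
\<close>

primrec Th :: "'o list \<Rightarrow> 'o \<Rightarrow> ('o list, 'o, 'm) arrow" where
  "Th [] x = idm C x"
| "Th (a # as) x = Th as (x \<otimes> a) \<bullet>[0] th x a"

primrec Th0 :: "'o list \<Rightarrow> ('o list, 'o, 'm) arrow" where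
  "Th0 [] = uu"
| "Th0 (a # as) = Th as (\<one> \<otimes> a) \<bullet>[0] unary (la_inv V a)"

lemma act_mobj [simp]: "\<lbrakk>x \<in> mobj C; set as \<subseteq> mobj C\<rbrakk> \<Longrightarrow> x \<lhd> as \<in> mobj C"
  using Vl.act_in_Obj by simp

lemma ends_Th [simp]: "src (Th as x) = x # as" "tgt (Th as x) = x \<lhd> as"
  by (induction as arbitrary: x) auto

lemma tgt_Th0 [simp]: "tgt (Th0 as) = \<one> \<lhd> as"
  by (cases as) auto

lemma src_Th0 [simp]: "set as \<subseteq> mobj C \<Longrightarrow> src (Th0 as) = as"
  by (cases as) auto

lemma unary_la_inv:
  assumes "a \<in> mobj C"
  shows "unary (la_inv V a) = th \<one> a \<bullet>[0] uu"
proof -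
  obtain g where g: "arr V g" "unary g = th \<one> a \<bullet>[0] uu" "src g = a" "tgt g = \<one> \<otimes> a" "la V a \<cdot> g = ide V a"
    using la_iso[OF assms] by metis
  have "g = la_inv V a \<cdot> la V a \<cdot> g" using g assms by (subst Vl.la_inv_cancel) simp_all
  also have "\<dots> = la_inv V a" using g assms by simp
  finally show ?thesis using g by simp
qed

lemma multimap_Th [simp]: "\<lbrakk>x \<in> mobj C; set as \<subseteq> mobj C; long \<or> length as \<le> 3\<rbrakk> \<Longrightarrow> multimap C (Th as x)"
  by (induction as arbitrary: x) (auto simp: ok_simps)

lemma multimap_Th0 [simp]: "\<lbrakk>set as \<subseteq> mobj C; long \<or> length as \<le> 4\<rbrakk> \<Longrightarrow> multimap C (Th0 as)"
  by (cases as) (auto simp: ok_simps)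

lemma Th_nat:
  assumes "arr V f" "set as \<subseteq> mobj C" "long \<or> length as \<le> 3"
  shows "unary (f \<unlhd> as) \<bullet>[0] Th as (src f) = Th as (tgt f) \<bullet>[0] unary f"
  using assms
proof (induction as arbitrary: f)
  case Nil
  then show ?case by (simp add: sub_idm idm_sub ok_simps)
next
  case (Cons a as)
  let ?f = "f \<odot> ide V a"
  have n: "long \<or> length as \<le> 2" using Cons.prems by auto
  have "unary (f \<unlhd> (a # as)) \<bullet>[0] Th (a # as) (src f) = (unary (?f \<unlhd> as) \<bullet>[0] Th as (src ?f)) \<bullet>[0] th (src f) a"
    using Cons.prems n by (auto simp: sub_seq ok_simps)
  also have "unary (?f \<unlhd> as) \<bullet>[0] Th as (src ?f) = Th as (tgt ?f) \<bullet>[0] unary ?f"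
    using Cons.prems n by (intro Cons.IH) auto
  also have "Th as (tgt ?f) \<bullet>[0] unary ?f \<bullet>[0] th (src f) a = Th as (tgt ?f) \<bullet>[0] (th (tgt f) a \<bullet>[0] unary f)"
    using Cons.prems n by (intro sub_cong_prefix tns_th_ide) (auto simp: ok_simps)
  also have "\<dots> = Th (a # as) (tgt f) \<bullet>[0] unary f"
    using Cons.prems n by (auto simp: sub_seq ok_simps)
  finally show ?case .
qed

text \<open>
  Bijectivity of precomposition with \<open>Th\<close> and \<open>Th0\<close>, by iterating the universal property of \<open>\<theta>\<close>
  and, for \<open>Th0\<close>, by invertibility of \<open>\<lambda>\<close>.
\<close>

lemma Th_cancel:
  assumes "unary f \<bullet>[0] Th as x = unary g \<bullet>[0] Th as x" "arr V f" "arr V g" "src f = x \<lhd> as" "src g = x \<lhd> as" "tgt f = tgt g"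
    "x \<in> mobj C" "set as \<subseteq> mobj C" "long \<or> length as \<le> 3"
  shows "f = g"
  using assms
proof (induction as arbitrary: x)
  case Nil
  then show ?case by (simp add: sub_idm ok_simps unary_inject)
next
  case (Cons a as)
  have n: "long \<or> length as \<le> 2" using Cons.prems by auto
  have "unary f \<bullet>[0] Th as (x \<otimes> a) \<bullet>[0] th x a = unary g \<bullet>[0] Th as (x \<otimes> a) \<bullet>[0] th x a"
    using Cons.prems n by (auto simp: sub_seq ok_simps)
  then have "unary f \<bullet>[0] Th as (x \<otimes> a) = unary g \<bullet>[0] Th as (x \<otimes> a)"
    by (rule th_cancel[where xs = as]) (use Cons.prems(2-) n in \<open>auto simp: ok_simps\<close>)
  then show ?case by (rule Cons.IH) (use Cons.prems(2-) n in auto)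
qed

lemma Th_ex:
  assumes "multimap C h" "src h = x # as" "long \<or> length as \<le> 3"
  shows "\<exists>f. arr V f \<and> src f = x \<lhd> as \<and> tgt f = tgt h \<and> unary f \<bullet>[0] Th as x = h"
  using assms
proof (induction as arbitrary: x h)
  case Nil
  let ?f = "Arrow x (tgt h) (mor h)"
  have f: "unary ?f = h" using Nil by (cases h) (simp add: unary_def)
  with Nil(1) have "arr V ?f" using multimap_unary[of ?f] by (simp only: f)
  then show ?case using Nil f by (intro exI[of _ ?f]) (simp add: sub_idm ok_simps)
next
  case (Cons a as)
  have n: "long \<or> length as \<le> 2" using Cons.prems by auto
  then have n3: "long \<or> length as \<le> 3" by auto
  have o: "x \<in> mobj C" "a \<in> mobj C" "set as \<subseteq> mobj C" using multimap_ends(1)[OF Cons.prems(1)] Cons.prems(2) by auto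
  obtain k where k: "multimap C k" "src k = x \<otimes> a # as" "tgt k = tgt h" "k \<bullet>[0] th x a = h"
    using th_ex[OF Cons.prems(1,2) n] by metis
  obtain f where f: "arr V f" "src f = (x \<otimes> a) \<lhd> as" "tgt f = tgt k" "unary f \<bullet>[0] Th as (x \<otimes> a) = k"
    using Cons.IH[OF k(1,2) n3] by blast
  have "unary f \<bullet>[0] Th (a # as) x = k \<bullet>[0] th x a"
    using f(1,2) o n by (subst f(4)[symmetric]) (auto simp: sub_seq ok_simps)
  with f k show ?case by (intro exI[of _ f]) simp
qed

lemma Th0_cancel:
  assumes eq: "unary f \<bullet>[0] Th0 as = unary g \<bullet>[0] Th0 as" and fg: "arr V f" "arr V g" "src f = \<one> \<lhd> as" "src g = \<one> \<lhd> as" "tgt f = tgt g"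
    and as: "set as \<subseteq> mobj C" "long \<or> length as \<le> 4"
  shows "f = g"
proof (cases as)
  case Nil
  then have "unary f = unary g" using eq fg by (intro uu_cancel[of "unary f" "unary g" "[]"]) simp_all
  then show ?thesis by (simp add: unary_inject)
next
  case (Cons a as')
  have n: "long \<or> length as' \<le> 3" using as Cons by auto
  have *: "unary k \<bullet>[0] Th0 as \<bullet>[0] unary (la V a) = unary k \<bullet>[0] Th as' (\<one> \<otimes> a)" if "arr V k" "src k = \<one> \<lhd> as" for k
  proof -
    have "unary k \<bullet>[0] Th0 as \<bullet>[0] unary (la V a) = (unary k \<bullet>[0] Th as' (\<one> \<otimes> a)) \<bullet>[0] unary (la_inv V a \<cdot> la V a)"
      using that as n Cons by (subst unary_cmp) (auto simp: sub_seq ok_simps)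
    then show ?thesis using that as n Cons by (auto simp: sub_idm ok_simps)
  qed
  have "unary f \<bullet>[0] Th as' (\<one> \<otimes> a) = unary g \<bullet>[0] Th as' (\<one> \<otimes> a)"
    using *[OF fg(1,3)] *[OF fg(2,4)] eq by simp
  then show ?thesis
    by (rule Th_cancel) (use fg as n Cons in auto)
qed

lemma Th0_ex:
  assumes h: "multimap C h" "long \<or> length (src h) \<le> 4"
  shows "\<exists>f. arr V f \<and> src f = \<one> \<lhd> src h \<and> tgt f = tgt h \<and> unary f \<bullet>[0] Th0 (src h) = h"
proof (cases "src h")
  case Nil
  obtain k where k: "multimap C k" "src k = [\<one>]" "tgt k = tgt h" "k \<bullet>[0] uu = h"
    by (rule uu_ex[OF h(1)]) (use Nil in auto)
  obtain f where f: "arr V f" "src f = \<one> \<lhd> []" "tgt f = tgt k" "unary f \<bullet>[0] Th [] \<one> = k"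
    using Th_ex[OF k(1,2)] by (metis le0 list.size(3))
  then have "unary f = k" by (simp add: sub_idm ok_simps)
  with f(1-3) k(3,4) Nil show ?thesis by (intro exI[of _ f]) simp
next
  case (Cons a as')
  have n: "long \<or> length as' \<le> 3" using h Cons by auto
  have o: "a \<in> mobj C" "set as' \<subseteq> mobj C" using multimap_ends(1)[OF h(1)] Cons by auto
  let ?h = "h \<bullet>[0] unary (la V a)"
  have h': "multimap C ?h" "src ?h = \<one> \<otimes> a # as'" "tgt ?h = tgt h"
    using h(1) n o Cons by (auto simp: ok_simps)
  obtain f where f: "arr V f" "src f = (\<one> \<otimes> a) \<lhd> as'" "tgt f = tgt h" "unary f \<bullet>[0] Th as' (\<one> \<otimes> a) = ?h"
    using Th_ex[OF h'(1,2) n] unfolding h'(3) by blast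
  have "unary f \<bullet>[0] Th0 (src h) = ?h \<bullet>[0] unary (la_inv V a)"
    using f(1-3) n o Cons by (subst f(4)[symmetric]) (auto simp: sub_seq ok_simps)
  also have "\<dots> = h \<bullet>[0] unary (la V a \<cdot> la_inv V a)"
    using h(1) n o Cons by (subst unary_cmp) (auto simp: sub_seq ok_simps)
  also have "\<dots> = h"
    using h(1) n o Cons by (auto simp: sub_idm ok_simps)
  finally show ?thesis using f Cons by (intro exI[of _ f]) simp
qed

lemma Th_append:
  assumes "x \<in> mobj C" "set as \<subseteq> mobj C" "set bs \<subseteq> mobj C" "long \<or> length as + length bs \<le> 3"
  shows "Th (as @ bs) x = Th bs (x \<lhd> as) \<bullet>[0] Th as x"
  using assms
proof (induction as arbitrary: x)
  case Nil
  then show ?case by (auto simp: sub_idm ok_simps)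
next
  case (Cons a as)
  have n: "long \<or> length as + length bs \<le> 2" using Cons.prems by auto
  have "Th ((a # as) @ bs) x = Th bs ((x \<otimes> a) \<lhd> as) \<bullet>[0] Th as (x \<otimes> a) \<bullet>[0] th x a"
    using Cons.prems n by (simp, subst Cons.IH) auto
  also have "\<dots> = Th bs (x \<lhd> (a # as)) \<bullet>[0] Th (a # as) x"
    using Cons.prems n by (auto simp: sub_seq ok_simps)
  finally show ?case .
qed

lemma Th0_append:
  assumes o: "set as \<subseteq> mobj C" "set bs \<subseteq> mobj C"
    and n: "long \<or> length as + length bs \<le> 4 \<and> length bs \<le> length as + 2"
  shows "Th0 (as @ bs) = Th bs (\<one> \<lhd> as) \<bullet>[0] Th0 as"
proof (cases as)
  case Nil
  show ?thesis
  proof (cases bs)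
    case Nil
    with \<open>as = []\<close> show ?thesis by (simp add: idm_sub ok_simps)
  next
    case (Cons b bs')
    then have "long \<or> length bs' \<le> 1" using n \<open>as = []\<close> by auto
    with \<open>as = []\<close> Cons o show ?thesis by (auto simp: unary_la_inv sub_seq ok_simps)
  qed
next
  case (Cons a as')
  have n': "long \<or> length as' + length bs \<le> 3" using n Cons by auto
  then have "Th0 (as @ bs) = Th bs ((\<one> \<otimes> a) \<lhd> as') \<bullet>[0] Th as' (\<one> \<otimes> a) \<bullet>[0] unary (la_inv V a)"
    using Cons o by (simp add: Th_append)
  also have "\<dots> = Th bs (\<one> \<lhd> as) \<bullet>[0] Th0 as"
    using n' Cons o by (auto simp: sub_seq ok_simps)
  finally show ?thesis .
qed

text \<open>In terms of multimaps, \<open>als\<close> re-brackets as \<open>\<alpha>\<close> does.\<close>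

lemma als_th:
  assumes "x \<in> mobj C" "y \<in> mobj C" "set as \<subseteq> mobj C" "long \<or> length as \<le> 2"
  shows "unary (als V as y x) \<bullet>[0] Th as (y \<otimes> x) \<bullet>[0] th y x = th y (x \<lhd> as) \<bullet>[1] Th as x"
  using assms
proof (induction as arbitrary: x)
  case Nil
  then show ?case by (simp add: sub_idm idm_sub ok_simps)
next
  case (Cons a as)
  let ?X = "unary (als V as y (x \<otimes> a))" and ?al = "al V y x a"
  have n: "long \<or> length as \<le> 1" using Cons.prems by auto
  have o: "x \<in> mobj C" "a \<in> mobj C" "y \<in> mobj C" "set as \<subseteq> mobj C" using Cons.prems by auto
  have "unary (als V (a # as) y x) \<bullet>[0] Th (a # as) (y \<otimes> x) \<bullet>[0] th y x
      = (?X \<bullet>[0] unary (?al \<unlhd> as) \<bullet>[0] Th as (src ?al)) \<bullet>[0] th (y \<otimes> x) a \<bullet>[0] th y x"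
    using o n by (auto simp: unary_cmp sub_seq ok_simps)
  also have "?X \<bullet>[0] unary (?al \<unlhd> as) \<bullet>[0] Th as (src ?al) = ?X \<bullet>[0] (Th as (tgt ?al) \<bullet>[0] unary ?al)"
    using o n by (intro sub_cong_prefix Th_nat) (auto simp: ok_simps)
  also have "(?X \<bullet>[0] (Th as (tgt ?al) \<bullet>[0] unary ?al)) \<bullet>[0] th (y \<otimes> x) a \<bullet>[0] th y x
      = (?X \<bullet>[0] Th as (y \<otimes> (x \<otimes> a))) \<bullet>[0] unary ?al \<bullet>[0] th (y \<otimes> x) a \<bullet>[0] th y x"
    using o n by (auto simp: sub_seq ok_simps)
  also have "\<dots> = (?X \<bullet>[0] Th as (y \<otimes> (x \<otimes> a)) \<bullet>[0] th y (x \<otimes> a)) \<bullet>[1] th x a"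
    using o n by (subst al_th_pre) (auto simp: ok_simps)
  also have "?X \<bullet>[0] Th as (y \<otimes> (x \<otimes> a)) \<bullet>[0] th y (x \<otimes> a) = th y ((x \<otimes> a) \<lhd> as) \<bullet>[1] Th as (x \<otimes> a)"
    using o n by (intro Cons.IH) auto
  also have "\<dots> \<bullet>[1] th x a = th y (x \<lhd> (a # as)) \<bullet>[1] Th (a # as) x"
    using o n by (auto simp: sub_seq ok_simps)
  finally show ?case .
qed

text \<open>
  Hence the linear family of \<open>f\<close> is substitution of the multimap corresponding to \<open>f\<close> into the second
  input of \<open>\<theta>\<close>.
\<close>

lemma ext_th:
  assumes f: "arr V f" "src f = \<one> \<lhd> as" and o: "x \<in> mobj C" "set as \<subseteq> mobj C" and n: "long \<or> length as \<le> 3"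
  shows "unary (ext V as f x) \<bullet>[0] Th as x = th x (tgt f) \<bullet>[1] (unary f \<bullet>[0] Th0 as)"
proof (cases as)
  case Nil
  have "unary (ext V as f x) \<bullet>[0] Th as x = unary (ide V x \<odot> f) \<bullet>[0] th x (src f) \<bullet>[1] uu"
    using f o Nil by (simp add: ext_def unary_cmp ra_th sub_idm sub_seq ok_simps)
  also have "\<dots> = th x (tgt f) \<bullet>[1] (unary f \<bullet>[0] Th0 as)"
    using f o Nil by (subst tns_th_ide) (simp_all add: sub_seq ok_simps)
  finally show ?thesis .
next
  case (Cons a as')
  have n': "long \<or> length as' \<le> 2" using n Cons by auto
  have o': "a \<in> mobj C" "set as' \<subseteq> mobj C" using o Cons by auto
  let ?k = "al V x \<one> a \<cdot> (ra V x \<odot> ide V a)" and ?F = "unary (ide V x \<odot> f)" and ?X = "unary (als V as' x (\<one> \<otimes> a))"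
  \<comment> \<open>on multimaps, \<open>\<rho>\<close> followed by \<open>\<alpha>\<close> is \<open>\<lambda>\<close>-inverse in the second input, as it is \<open>\<theta> \<circ> u\<close>\<close>
  have k: "unary ?k \<bullet>[0] th x a = th x (\<one> \<otimes> a) \<bullet>[1] unary (la_inv V a)"
  proof -
    have "unary ?k \<bullet>[0] th x a = unary (al V x \<one> a) \<bullet>[0] unary (ra V x \<odot> ide V a) \<bullet>[0] th x a"
      using o o' by (simp add: unary_cmp)
    also have "\<dots> = unary (al V x \<one> a) \<bullet>[0] (th (tgt (ra V x)) a \<bullet>[0] unary (ra V x))"
      using o o' tns_th_ide(1)[of "ra V x" a] by (intro sub_cong_prefix) (simp_all add: ok_simps)
    also have "\<dots> = unary (al V x \<one> a) \<bullet>[0] th (x \<otimes> \<one>) a \<bullet>[0] th x \<one> \<bullet>[1] uu"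
      using o o' by (simp add: ra_th sub_seq ok_simps)
    also have "\<dots> = th x (\<one> \<otimes> a) \<bullet>[1] unary (la_inv V a)"
      using o o' by (simp add: al_th unary_la_inv sub_seq ok_simps)
    finally show ?thesis .
  qed
  have "als V as x \<one> \<cdot> (ra V x \<unlhd> as) = als V as' x (\<one> \<otimes> a) \<cdot> (?k \<unlhd> as')"
    using o o' Cons by (simp add: Vl.act_arr_cmp)
  then have "unary (ext V as f x) \<bullet>[0] Th as x = (?F \<bullet>[0] ?X) \<bullet>[0] unary (?k \<unlhd> as') \<bullet>[0] Th as' (src ?k) \<bullet>[0] th x a"
    using f o' o n' Cons by (auto simp: ext_def unary_cmp sub_seq ok_simps)
  also have "(?F \<bullet>[0] ?X) \<bullet>[0] unary (?k \<unlhd> as') \<bullet>[0] Th as' (src ?k) = (?F \<bullet>[0] ?X) \<bullet>[0] (Th as' (tgt ?k) \<bullet>[0] unary ?k)"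
    using f o o' n' Cons by (intro sub_cong_prefix Th_nat) (auto simp: ok_simps)
  also have "\<dots> \<bullet>[0] th x a = (?F \<bullet>[0] ?X \<bullet>[0] Th as' (tgt ?k)) \<bullet>[0] unary ?k \<bullet>[0] th x a"
    using f o o' n' Cons by (auto simp: sub_seq ok_simps)
  also have "\<dots> = (?F \<bullet>[0] ?X \<bullet>[0] Th as' (tgt ?k)) \<bullet>[0] (th x (\<one> \<otimes> a) \<bullet>[1] unary (la_inv V a))"
    using f o o' n' Cons by (intro sub_cong_prefix k) (auto simp: ok_simps)
  also have "\<dots> = ?F \<bullet>[0] (?X \<bullet>[0] Th as' (x \<otimes> (\<one> \<otimes> a)) \<bullet>[0] th x (\<one> \<otimes> a)) \<bullet>[1] unary (la_inv V a)"
    using f o o' n' Cons by (auto simp: sub_seq ok_simps)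
  also have "?X \<bullet>[0] Th as' (x \<otimes> (\<one> \<otimes> a)) \<bullet>[0] th x (\<one> \<otimes> a) = th x (src f) \<bullet>[1] Th as' (\<one> \<otimes> a)"
    using f o o' n' Cons by (subst als_th) auto
  also have "?F \<bullet>[0] (th x (src f) \<bullet>[1] Th as' (\<one> \<otimes> a)) \<bullet>[1] unary (la_inv V a) = ?F \<bullet>[0] th x (src f) \<bullet>[1] Th as' (\<one> \<otimes> a) \<bullet>[1] unary (la_inv V a)"
    using f o o' n' Cons by (auto simp: sub_seq ok_simps)
  also have "?F \<bullet>[0] th x (src f) = th x (tgt f) \<bullet>[1] unary f"
    by (rule tns_th_ide(2)[OF f(1) o(1)])
  also have "th x (tgt f) \<bullet>[1] unary f \<bullet>[1] Th as' (\<one> \<otimes> a) \<bullet>[1] unary (la_inv V a) = th x (tgt f) \<bullet>[1] (unary f \<bullet>[0] Th0 as)"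
    using f o o' n' Cons by (auto simp: sub_seq ok_simps)
  finally show ?thesis .
qed

text \<open>
  Precomposition with \<open>Th0\<close> turns the substitution of \<open>multi_of V\<close> into that of \<open>C\<close>. An empty
  prefix is treated separately, because then the linear family of \<open>f\<close> is only needed at \<open>\<one>\<close>, where it
  is \<open>\<lambda>\<close>-inverse after \<open>f\<close>, and the general argument would need arity \<open>5\<close>.
\<close>

lemma sbs_Th0:
  assumes g: "arr V g" "src g = \<one> \<lhd> (p @ [tgt f] @ s)" and f: "arr V f" "src f = \<one> \<lhd> as"
    and o: "set p \<subseteq> mobj C" "set s \<subseteq> mobj C" "set as \<subseteq> mobj C"
    and ok: "subst_ok long (length (p @ [tgt f] @ s)) (length as)"
  shows "unary (sbs V p s as g f) \<bullet>[0] Th0 (p @ as @ s)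
    = (unary g \<bullet>[0] Th0 (p @ [tgt f] @ s)) \<bullet>[length p] (unary f \<bullet>[0] Th0 as)"
proof -
  have n: "long \<or> length p + length s \<le> 3 \<and> length p + length s + length as \<le> 4 \<and> length p + length s \<le> length as + 2"
    using ok by (auto simp: ok_simps)
  let ?x = "\<one> \<lhd> p" and ?b = "tgt f" and ?F = "unary f \<bullet>[0] Th0 as"
  let ?e = "ext V as f ?x"
  have F: "multimap C ?F" "src ?F = as" "tgt ?F = ?b" using f o n by (auto simp: ok_simps)
  \<comment> \<open>the case that \<open>g\<close> is the identity of \<open>\<one> \<lhd> (p @ [b] @ s)\<close>\<close>
  have key: "unary (?e \<unlhd> s) \<bullet>[0] Th0 (p @ as @ s) = Th0 (p @ [?b] @ s) \<bullet>[length p] ?F"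
  proof (cases "p = []")
    case True
    let ?k = "la_inv V ?b \<cdot> f"
    have n': "long \<or> length s \<le> 3 \<and> length s + length as \<le> 4 \<and> length s \<le> length as + 2" using n True by auto
    have "unary (?e \<unlhd> s) \<bullet>[0] Th0 (p @ as @ s) = (unary (?k \<unlhd> s) \<bullet>[0] Th s (src ?k)) \<bullet>[0] Th0 as"
      using True f o n' by (auto simp: Vl.ext_one Th0_append sub_seq ok_simps)
    also have "unary (?k \<unlhd> s) \<bullet>[0] Th s (src ?k) = Th s (tgt ?k) \<bullet>[0] unary ?k"
      using f o n' by (intro Th_nat) auto
    also have "Th s (tgt ?k) \<bullet>[0] unary ?k \<bullet>[0] Th0 as = Th0 (p @ [?b] @ s) \<bullet>[length p] ?F"
      using True f o n' by (auto simp: unary_cmp sub_seq ok_simps)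
    finally show ?thesis .
  next
    case False
    obtain m where l: "length p = Suc m" using False by (cases p) auto
    have x: "?x \<in> mobj C" "set (as @ s) \<subseteq> mobj C" using o by (auto simp flip: Obj_V)
    have "Th0 (p @ as @ s) = Th s (src ?e) \<bullet>[0] Th as ?x \<bullet>[0] Th0 p"
      using f o x n l by (subst Th0_append) (auto simp: Th_append)
    then have "unary (?e \<unlhd> s) \<bullet>[0] Th0 (p @ as @ s) = unary (?e \<unlhd> s) \<bullet>[0] Th s (src ?e) \<bullet>[0] Th as ?x \<bullet>[0] Th0 p"
      using f o x n l by (auto simp: sub_seq ok_simps)
    also have "unary (?e \<unlhd> s) \<bullet>[0] Th s (src ?e) = Th s (tgt ?e) \<bullet>[0] unary ?e"
      using f o n x by (intro Th_nat) auto
    also have "Th s (tgt ?e) \<bullet>[0] unary ?e \<bullet>[0] Th as ?x = Th s (tgt ?e) \<bullet>[0] (th ?x ?b \<bullet>[1] ?F)"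
      using f o n l x ext_th[OF f x(1) o(3)] by (intro sub_cong_prefix) (auto simp: ok_simps)
    also have "\<dots> = Th (?b # s) ?x \<bullet>[1] ?F"
      using f o n l x F by (simp del: ends_multi(1), subst sub_seq) (auto simp: ok_simps)
    also have "Th (?b # s) ?x \<bullet>[1] ?F \<bullet>[0] Th0 p = Th (?b # s) ?x \<bullet>[0] Th0 p \<bullet>[1 + length (src (Th0 p)) - 1] ?F"
      using f o n l x F(1,3) by (intro sub_par) (auto simp: ok_simps)
    also have "Th (?b # s) ?x \<bullet>[0] Th0 p = Th0 (p @ [?b] @ s)"
      using f o n l x by (subst Th0_append) auto
    finally show ?thesis using o by simp
  qed
  have "unary (sbs V p s as g f) \<bullet>[0] Th0 (p @ as @ s) = unary g \<bullet>[0] (unary (?e \<unlhd> s) \<bullet>[0] Th0 (p @ as @ s))"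
    using g f o n by (subst sub_seq) (auto simp: sbs_def unary_cmp ok_simps)
  also have "\<dots> = unary g \<bullet>[0] (Th0 (p @ [?b] @ s) \<bullet>[length p] ?F)"
    by (simp only: key)
  also have "\<dots> = (unary g \<bullet>[0] Th0 (p @ [?b] @ s)) \<bullet>[length p] ?F"
    using g f o n F by (subst sub_seq) (auto simp: ok_simps)
  finally show ?thesis .
qed

end

section \<open>Morphisms of multicategories and lax monoidal functors\<close>

definition app_mor :: "('o, 'm) multi_mor \<Rightarrow> ('o list, 'o, 'm) arrow \<Rightarrow> ('o list, 'o, 'm) arrow" where
  "app_mor F f = Arrow (map (mfun F) (src f)) (mfun F (tgt f)) (mmap F (src f) (tgt f) (mor f))"

lemma ends_app_mor [simp]: "src (app_mor F f) = map (mfun F) (src f)" "tgt (app_mor F f) = mfun F (tgt f)"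
  by (simp_all add: app_mor_def)

lemma subst_ok_arity:
  "\<lbrakk>subst_ok long n m; 0 < n\<rbrakk> \<Longrightarrow> arity_ok long n \<and> arity_ok long m \<and> arity_ok long (n + m - 1)"
  by (auto simp: subst_ok_iff arity_ok_def)

text \<open>
  The definition of a lax monoidal functor, in terms of arrows that carry their ends.
\<close>

lemma lax_monoidalI:
  assumes V: "skew_monoidal V" and W: "skew_monoidal W" and F: "is_functor V W (lfun F)"
    and undef: "\<And>a b. \<not> (a \<in> Obj V \<and> b \<in> Obj V) \<Longrightarrow> lax2 F a b = undefined"
    and l0: "arr W (lx0 V W F)" and l2: "\<And>a b. \<lbrakk>a \<in> Obj V; b \<in> Obj V\<rbrakk> \<Longrightarrow> arr W (lx2 V W F a b)"
    and nat: "\<And>f g. \<lbrakk>arr V f; arr V g\<rbrakk> \<Longrightarrow> cmp W (app_arr (lfun F) (tns V f g)) (lx2 V W F (src f) (src g))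
      = cmp W (lx2 V W F (tgt f) (tgt g)) (tns W (app_arr (lfun F) f) (app_arr (lfun F) g))"
    and al: "\<And>a b c. \<lbrakk>a \<in> Obj V; b \<in> Obj V; c \<in> Obj V\<rbrakk> \<Longrightarrow>
      cmp W (app_arr (lfun F) (al V a b c)) (cmp W (lx2 V W F (tobj V a b) c) (tns W (lx2 V W F a b) (ide W (lobj F c))))
      = cmp W (lx2 V W F a (tobj V b c)) (cmp W (tns W (ide W (lobj F a)) (lx2 V W F b c)) (al W (lobj F a) (lobj F b) (lobj F c)))"
    and la: "\<And>a. a \<in> Obj V \<Longrightarrow>
      cmp W (app_arr (lfun F) (la V a)) (cmp W (lx2 V W F (tunit V) a) (tns W (lx0 V W F) (ide W (lobj F a)))) = la W (lobj F a)"
    and ra: "\<And>a. a \<in> Obj V \<Longrightarrow>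
      cmp W (lx2 V W F a (tunit V)) (cmp W (tns W (ide W (lobj F a)) (lx0 V W F)) (ra W (lobj F a))) = app_arr (lfun F) (ra V a)"
  shows "lax_monoidal V W F"
proof (intro lax_monoidal.intro lax_monoidal_axioms.intro V W F undef)
  note defs = cmp_def tns_def al_def ide_def la_def ra_def lx2_def lx0_def app_arr_def
  show "lax0 F \<in> Hom W (tunit W) (lobj F (tunit V))" using l0 by (simp add: lx0_def)
  fix a b c a' b' f g
  show "lax2 F a b \<in> Hom W (tobj W (lobj F a) (lobj F b)) (lobj F (tobj V a b))" if "a \<in> Obj V" "b \<in> Obj V"
    using l2[OF that] by (simp add: lx2_def)
  { assume "a \<in> Obj V" "b \<in> Obj V" "a' \<in> Obj V" "b' \<in> Obj V" "f \<in> Hom V a a'" "g \<in> Hom V b b'"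
    then show "Comp W (tobj W (lobj F a) (lobj F b)) (lobj F (tobj V a b)) (lobj F (tobj V a' b'))
            (larr F (tobj V a b) (tobj V a' b') (tarr V a a' b b' f g)) (lax2 F a b)
        = Comp W (tobj W (lobj F a) (lobj F b)) (tobj W (lobj F a') (lobj F b')) (lobj F (tobj V a' b'))
            (lax2 F a' b')
            (tarr W (lobj F a) (lobj F a') (lobj F b) (lobj F b') (larr F a a' f) (larr F b b' g))"
      using nat[of "Arrow a a' f" "Arrow b b' g"] by (simp add: defs) }
  { assume "a \<in> Obj V" "b \<in> Obj V" "c \<in> Obj V"
    then show "Comp W (tobj W (tobj W (lobj F a) (lobj F b)) (lobj F c))
            (lobj F (tobj V (tobj V a b) c)) (lobj F (tobj V a (tobj V b c)))
            (larr F (tobj V (tobj V a b) c) (tobj V a (tobj V b c)) (assr V a b c))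
            (Comp W (tobj W (tobj W (lobj F a) (lobj F b)) (lobj F c))
              (tobj W (lobj F (tobj V a b)) (lobj F c)) (lobj F (tobj V (tobj V a b) c))
              (lax2 F (tobj V a b) c)
              (tarr W (tobj W (lobj F a) (lobj F b)) (lobj F (tobj V a b)) (lobj F c) (lobj F c)
                (lax2 F a b) (Id W (lobj F c))))
        = Comp W (tobj W (tobj W (lobj F a) (lobj F b)) (lobj F c))
            (tobj W (lobj F a) (lobj F (tobj V b c))) (lobj F (tobj V a (tobj V b c)))
            (lax2 F a (tobj V b c))
            (Comp W (tobj W (tobj W (lobj F a) (lobj F b)) (lobj F c))
              (tobj W (lobj F a) (tobj W (lobj F b) (lobj F c))) (tobj W (lobj F a) (lobj F (tobj V b c)))
              (tarr W (lobj F a) (lobj F a) (tobj W (lobj F b) (lobj F c)) (lobj F (tobj V b c))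
                (Id W (lobj F a)) (lax2 F b c))
              (assr W (lobj F a) (lobj F b) (lobj F c)))"
      using al[of a b c] by (simp add: defs) }
  { assume "a \<in> Obj V"
    then show "Comp W (tobj W (tunit W) (lobj F a)) (lobj F (tobj V (tunit V) a)) (lobj F a)
            (larr F (tobj V (tunit V) a) a (lunit V a))
            (Comp W (tobj W (tunit W) (lobj F a)) (tobj W (lobj F (tunit V)) (lobj F a)) (lobj F (tobj V (tunit V) a))
              (lax2 F (tunit V) a)
              (tarr W (tunit W) (lobj F (tunit V)) (lobj F a) (lobj F a) (lax0 F) (Id W (lobj F a))))
        = lunit W (lobj F a)"
      "Comp W (lobj F a) (tobj W (lobj F a) (lobj F (tunit V))) (lobj F (tobj V a (tunit V)))
            (lax2 F a (tunit V))
            (Comp W (lobj F a) (tobj W (lobj F a) (tunit W)) (tobj W (lobj F a) (lobj F (tunit V)))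
              (tarr W (lobj F a) (lobj F a) (tunit W) (lobj F (tunit V)) (Id W (lobj F a)) (lax0 F))
              (runit W (lobj F a)))
        = larr F a (tobj V a (tunit V)) (runit V a)"
      using la[of a] ra[of a] by (simp_all add: defs) }
qed

locale lr_pair = C: lr_multi long C t V + D: lr_multi long D t' W
  for long and C :: "('o, 'm) multi" and t and V (structure) and D :: "('o, 'm) multi" and t' and W

locale lr_morphism = lr_pair + multi_morphism "arity_ok long" "subst_ok long" C D F for F
begin

lemma mfun_list [simp]: "set as \<subseteq> mobj C \<Longrightarrow> mfun F ` set as \<subseteq> mobj D"
  using mfun_in_mobj by auto

lemma multimap_app_mor [simp]: "\<lbrakk>multimap C f; arity_ok long (length (src f))\<rbrakk> \<Longrightarrow> multimap D (app_mor F f)"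
  using multimap_ends[of C f] multimap_mor[of C f] mmap_in_mhom[of "src f" "tgt f" "mor f"]
  by (simp add: app_mor_def mfun_in_mobj)

lemma app_mor_idm [simp]: "a \<in> mobj C \<Longrightarrow> app_mor F (idm C a) = idm D (mfun F a)"
  by (simp add: app_mor_def idm_def mmap_mid)

lemma app_mor_sub:
  assumes g: "multimap C g" and f: "multimap C f" "i < length (src g)" "src g ! i = tgt f" "subst_ok long (length (src g)) (length (src f))"
  shows "app_mor F (sub C g i f) = sub D (app_mor F g) i (app_mor F f)"
proof -
  obtain p s where ps: "src g = p @ [tgt f] @ s" "length p = i" using split_at[OF f(2)] f(3) by metis
  then show ?thesis
    using f mmap_msub[of p "tgt f" s "src f" "tgt g" "mor g" "mor f"] multimap_ends[OF g] multimap_ends[OF f(1)] multimap_mor[OF g] multimap_mor[OF f(1)]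
    by (auto simp: sub_def app_mor_def)
qed

abbreviation "L \<equiv> lax_of C t D t' F"

lemma lobj_L [simp]: "a \<in> mobj C \<Longrightarrow> lobj L a = mfun F a"
  by (simp add: lax_of_def flip: C.V_def)

lemma mobj_D [simp]: "a \<in> mobj C \<Longrightarrow> mfun F a \<in> mobj D"
  by (rule mfun_in_mobj)

lemma unary_app_arr: "arr V f \<Longrightarrow> unary (app_arr (lfun L) f) = app_mor F (unary f)"
  using C.objs[of f] arr_mor[of V f]
  by (simp add: unary_def app_arr_def app_mor_def lax_of_def flip: C.V_def)

lemma arr_app_arr_L [simp]: "arr V f \<Longrightarrow> arr W (app_arr (lfun L) f)"
  by (simp add: unary_app_arr arity_ok_def flip: D.multimap_unary)

text \<open>
  The structure maps of \<open>lax_of\<close>, as solutions of equations between multimaps.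
\<close>

lemma lx0_L: "arr W (lx0 V W L)" "sub D (unary (lx0 V W L)) 0 D.uu = app_mor F C.uu"
  and lx0_unique: "\<And>k. \<lbrakk>arr W k; src k = \<one>\<^bsub>W\<^esub>; tgt k = mfun F \<one>; sub D (unary k) 0 D.uu = app_mor F C.uu\<rbrakk> \<Longrightarrow> lax0 L = mor k"
proof -
  have h: "multimap D (app_mor F C.uu)" by (simp add: arity_ok_def)
  obtain k0 where k0: "multimap D k0" "src k0 = [\<one>\<^bsub>W\<^esub>]" "tgt k0 = mfun F \<one>" "sub D k0 0 D.uu = app_mor F C.uu"
    by (rule D.uu_ex[OF h]) auto
  have eq: "lax0 L = mor k0"
    unfolding lax_of_def
  proof (simp, rule D.the_multimap)
    have "mor (sub D k0 0 D.uu) = mor (app_mor F C.uu)" using k0 by simp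
    then show "msub D [] (cunit t') [] [] (mfun F (cunit t)) (mor k0) (cu t') = mmap F [] (cunit t) (cu t)"
      using k0 by (simp add: sub_def app_mor_def D.uu_def C.uu_def C.V_simps)
    fix k assume k: "multimap D k" "src k = [cunit t']" "tgt k = mfun F (cunit t)"
      "msub D [] (cunit t') [] [] (mfun F (cunit t)) (mor k) (cu t') = mmap F [] (cunit t) (cu t)"
    then have e: "sub D k 0 D.uu = sub D k0 0 D.uu"
      using k0 by (simp add: sub_def app_mor_def D.uu_def C.uu_def C.V_simps)
    show "k = k0" using k(1-3) k0(1-3) by (intro D.uu_cancel[OF e, of "[]"]) (simp_all add: C.V_simps D.V_simps)
  qed (use k0 in \<open>simp_all add: C.V_simps D.V_simps\<close>)
  then have "unary (lx0 V W L) = k0" using k0 by (cases k0) (simp add: unary_def lx0_def)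
  then show "arr W (lx0 V W L)" "sub D (unary (lx0 V W L)) 0 D.uu = app_mor F C.uu" using k0 by (auto simp flip: D.multimap_unary)
  fix k assume k: "arr W k" "src k = \<one>\<^bsub>W\<^esub>" "tgt k = mfun F \<one>" "sub D (unary k) 0 D.uu = app_mor F C.uu"
  have "unary k = k0" using k k0 by (intro D.uu_cancel[of "unary k" k0 "[]"]) simp_all
  then have "mor k0 = mor k" by (auto simp: unary_def)
  with eq show "lax0 L = mor k" by simp
qed

lemma lx2_L:
  assumes o: "a \<in> mobj C" "b \<in> mobj C"
  shows "arr W (lx2 V W L a b)" "sub D (unary (lx2 V W L a b)) 0 (D.th (mfun F a) (mfun F b)) = app_mor F (C.th a b)"
  and lx2_unique: "\<And>k. \<lbrakk>arr W k; src k = mfun F a \<otimes>\<^bsub>W\<^esub> mfun F b; tgt k = mfun F (a \<otimes> b);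
    sub D (unary k) 0 (D.th (mfun F a) (mfun F b)) = app_mor F (C.th a b)\<rbrakk> \<Longrightarrow> lax2 L a b = mor k"
proof -
  let ?th = "D.th (mfun F a) (mfun F b)"
  have h: "multimap D (app_mor F (C.th a b))" using o by (simp add: arity_ok_def)
  obtain k0 where k0: "multimap D k0" "src k0 = [mfun F a \<otimes>\<^bsub>W\<^esub> mfun F b]" "tgt k0 = mfun F (a \<otimes> b)" "sub D k0 0 ?th = app_mor F (C.th a b)"
    by (rule D.th_ex[OF h]) auto
  have "lax2 L a b = (THE k. k \<in> mhom D [ctens t' (mfun F a) (mfun F b)] (mfun F (ctens t a b)) \<and>
          msub D [] (ctens t' (mfun F a) (mfun F b)) [] [mfun F a, mfun F b] (mfun F (ctens t a b))
            k (ctheta t' (mfun F a) (mfun F b)) = mmap F [a, b] (ctens t a b) (ctheta t a b))"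
    using o by (simp add: lax_of_def)
  also have "\<dots> = mor k0"
  proof (rule D.the_multimap)
    have "mor (sub D k0 0 ?th) = mor (app_mor F (C.th a b))" using k0 by simp
    then show "msub D [] (ctens t' (mfun F a) (mfun F b)) [] [mfun F a, mfun F b] (mfun F (ctens t a b))
            (mor k0) (ctheta t' (mfun F a) (mfun F b)) = mmap F [a, b] (ctens t a b) (ctheta t a b)"
      using k0 by (simp add: sub_def app_mor_def D.th_def C.th_def C.V_simps)
    fix k assume k: "multimap D k" "src k = [ctens t' (mfun F a) (mfun F b)]" "tgt k = mfun F (ctens t a b)"
      "msub D [] (ctens t' (mfun F a) (mfun F b)) [] [mfun F a, mfun F b] (mfun F (ctens t a b))
            (mor k) (ctheta t' (mfun F a) (mfun F b)) = mmap F [a, b] (ctens t a b) (ctheta t a b)"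
    then have e: "sub D k 0 ?th = sub D k0 0 ?th"
      using k0 by (simp add: sub_def app_mor_def D.th_def C.th_def C.V_simps)
    show "k = k0" using k(1-3) k0(1-3) o by (intro D.th_cancel[OF e, of "[]"]) (simp_all add: C.V_simps D.V_simps)
  qed (use k0 in \<open>simp_all add: C.V_simps D.V_simps\<close>)
  finally have eq: "lax2 L a b = mor k0" .
  then have "unary (lx2 V W L a b) = k0" using k0 o by (cases k0) (simp add: unary_def lx2_def)
  then show "arr W (lx2 V W L a b)" "sub D (unary (lx2 V W L a b)) 0 ?th = app_mor F (C.th a b)" using k0 by (auto simp flip: D.multimap_unary)
  fix k assume k: "arr W k" "src k = mfun F a \<otimes>\<^bsub>W\<^esub> mfun F b" "tgt k = mfun F (a \<otimes> b)" "sub D (unary k) 0 ?th = app_mor F (C.th a b)"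
  have "unary k = k0" using k k0 o by (intro D.th_cancel[of "unary k" "mfun F a" "mfun F b" k0 "[]"]) simp_all
  then have "mor k0 = mor k" by (auto simp: unary_def)
  with eq show "lax2 L a b = mor k" by simp
qed

lemma lx_L_pre:
  assumes x: "multimap D x" "i < length (src x)" "long \<or> length (src x) \<le> 3"
  shows "src x ! i = mfun F \<one> \<Longrightarrow> sub D (sub D x i (unary (lx0 V W L))) i D.uu = sub D x i (app_mor F C.uu)"
    and "\<lbrakk>a \<in> mobj C; b \<in> mobj C; src x ! i = mfun F (a \<otimes> b)\<rbrakk>
      \<Longrightarrow> sub D (sub D x i (unary (lx2 V W L a b))) i (D.th (mfun F a) (mfun F b)) = sub D x i (app_mor F (C.th a b))"
proof -
  have n: "src x \<noteq> []" using x by auto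
  show "sub D (sub D x i (unary (lx0 V W L))) i D.uu = sub D x i (app_mor F C.uu)" if "src x ! i = mfun F \<one>"
    using x n that by (intro D.sub_cong_prefix lx0_L) (auto simp: lx0_L C.ok_simps)
  show "sub D (sub D x i (unary (lx2 V W L a b))) i (D.th (mfun F a) (mfun F b)) = sub D x i (app_mor F (C.th a b))"
    if "a \<in> mobj C" "b \<in> mobj C" "src x ! i = mfun F (a \<otimes> b)"
    using x n that by (intro D.sub_cong_prefix lx2_L) (auto simp: lx2_L C.ok_simps)
qed

lemma is_functor_L: "is_functor V W (lfun L)"
proof -
  have "is_functor V W (mk_functor V (mfun F) (\<lambda>a b f. mmap F [a] b f))"
  proof (rule is_functor_mk_functor)
    fix a b f assume *: "a \<in> Obj V" "b \<in> Obj V" "f \<in> Hom V a b"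
    then show "mmap F [a] b f \<in> Hom W (mfun F a) (mfun F b)"
      using mmap_in_mhom[of "[a]" b f] by (simp add: C.V_simps D.V_simps arity_ok_def)
  next
    fix a b c f g
    assume *: "a \<in> Obj V" "b \<in> Obj V" "c \<in> Obj V" "f \<in> Hom V a b" "g \<in> Hom V b c"
    then show "mmap F [a] c (Comp V a b c g f) = Comp W (mfun F a) (mfun F b) (mfun F c) (mmap F [b] c g) (mmap F [a] b f)"
      using mmap_msub[of "[]" b "[]" "[a]" c g f] by (simp add: C.V_simps D.V_simps C.ok_simps)
  qed (simp_all add: C.is_category_V D.is_category_V C.V_simps D.V_simps mmap_mid)
  then show ?thesis by (simp add: lax_of_def C.V_def)
qed

text \<open>
  Each axiom of a lax monoidal functor compares two maps out of an iterated tensor; after precomposition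
  with the classifiers both become \<open>F\<close> of the same multimap.
\<close>

lemma lax_monoidal_L: "lax_monoidal V W L"
proof (rule lax_monoidalI)
  show "skew_monoidal V" "skew_monoidal W" by unfold_locales
  note [simp] = lx0_L lx2_L
  let ?fa = "app_arr (lfun L)" and ?tw = "lx2 V W L" and ?ze = "lx0 V W L"
  fix a b c
  show "lax2 L a b = undefined" if "\<not> (a \<in> Obj V \<and> b \<in> Obj V)"
    using that by (auto simp: lax_of_def)
  { fix f g assume fg: "arr V f" "arr V g"
    let ?a = "src f" and ?b = "src g" and ?c = "tgt f" and ?d = "tgt g"
    show "?fa (f \<odot> g) \<cdot>\<^bsub>W\<^esub> ?tw ?a ?b = ?tw ?c ?d \<cdot>\<^bsub>W\<^esub> (?fa f \<odot>\<^bsub>W\<^esub> ?fa g)"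
    proof (rule D.cancel2[of _ "mfun F ?a" "mfun F ?b"])
      have "sub D (unary (?fa (f \<odot> g) \<cdot>\<^bsub>W\<^esub> ?tw ?a ?b)) 0 (D.th (mfun F ?a) (mfun F ?b)) = app_mor F (sub C (unary (f \<odot> g)) 0 (C.th ?a ?b))"
        using fg by (simp add: D.unary_cmp unary_app_arr lx_L_pre app_mor_sub C.ok_simps)
      also have "sub C (unary (f \<odot> g)) 0 (C.th ?a ?b) = sub C (sub C (C.th ?c ?d) 0 (unary f)) 1 (unary g)"
        using C.tns_th(2)[OF fg] by simp
      also have "app_mor F \<dots> = sub D (sub D (app_mor F (C.th ?c ?d)) 0 (app_mor F (unary f))) 1 (app_mor F (unary g))"
        using fg by (simp add: app_mor_sub C.ok_simps)
      also have "\<dots> = sub D (unary (?tw ?c ?d \<cdot>\<^bsub>W\<^esub> (?fa f \<odot>\<^bsub>W\<^esub> ?fa g))) 0 (D.th (mfun F ?a) (mfun F ?b))"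
        using fg D.tns_th_pre[of "unary (?tw ?c ?d)" 0 "?fa f" "?fa g"] by (simp add: D.unary_cmp unary_app_arr)
      finally show "sub D (unary (?fa (f \<odot> g) \<cdot>\<^bsub>W\<^esub> ?tw ?a ?b)) 0 (D.th (mfun F ?a) (mfun F ?b))
         = sub D (unary (?tw ?c ?d \<cdot>\<^bsub>W\<^esub> (?fa f \<odot>\<^bsub>W\<^esub> ?fa g))) 0 (D.th (mfun F ?a) (mfun F ?b))" .
    qed (use fg in simp_all) }
  { assume o: "a \<in> Obj V" "b \<in> Obj V" "c \<in> Obj V"
    let ?a = "mfun F a" and ?b = "mfun F b" and ?c = "mfun F c"
    let ?l = "?fa (al V a b c) \<cdot>\<^bsub>W\<^esub> ?tw (a \<otimes> b) c \<cdot>\<^bsub>W\<^esub> (?tw a b \<odot>\<^bsub>W\<^esub> ide W ?c)"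
      and ?r = "?tw a (b \<otimes> c) \<cdot>\<^bsub>W\<^esub> (ide W ?a \<odot>\<^bsub>W\<^esub> ?tw b c) \<cdot>\<^bsub>W\<^esub> al W ?a ?b ?c"
    have "?l = ?r"
    proof (rule D.cancel3[of _ ?a ?b ?c])
      let ?x = "sub D (unary (?fa (al V a b c))) 0 (unary (?tw (a \<otimes> b) c))"
      have "sub D (sub D ?x 0 (unary (?tw a b \<odot>\<^bsub>W\<^esub> ide W ?c))) 0 (D.th (?a \<otimes>\<^bsub>W\<^esub> ?b) ?c)
          = sub D (sub D ?x 0 (D.th (mfun F (a \<otimes> b)) ?c)) 0 (unary (?tw a b))"
        using o D.tns_th_pre[of ?x 0 "?tw a b" "ide W ?c"] by (simp add: D.sub_idm C.ok_simps)
      then have "sub D (sub D (unary ?l) 0 (D.th (?a \<otimes>\<^bsub>W\<^esub> ?b) ?c)) 0 (D.th ?a ?b)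
          = sub D (sub D (sub D ?x 0 (D.th (mfun F (a \<otimes> b)) ?c)) 0 (unary (?tw a b))) 0 (D.th ?a ?b)"
        using o by (simp add: D.unary_cmp D.sub_seq C.ok_simps)
      also have "\<dots> = app_mor F (sub C (sub C (unary (al V a b c)) 0 (C.th (a \<otimes> b) c)) 0 (C.th a b))"
        using o by (simp add: lx_L_pre unary_app_arr app_mor_sub C.ok_simps)
      also have "sub C (sub C (unary (al V a b c)) 0 (C.th (a \<otimes> b) c)) 0 (C.th a b) = sub C (C.th a (b \<otimes> c)) 1 (C.th b c)"
        using o by (simp add: C.al_th)
      also have "app_mor F \<dots> = sub D (app_mor F (C.th a (b \<otimes> c))) 1 (app_mor F (C.th b c))"
        using o by (simp add: app_mor_sub C.ok_simps)
      finally have l: "sub D (sub D (unary ?l) 0 (D.th (?a \<otimes>\<^bsub>W\<^esub> ?b) ?c)) 0 (D.th ?a ?b) = sub D (app_mor F (C.th a (b \<otimes> c))) 1 (app_mor F (C.th b c))" .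
      let ?y = "sub D (unary (?tw a (b \<otimes> c))) 0 (unary (ide W ?a \<odot>\<^bsub>W\<^esub> ?tw b c))"
      have "sub D (sub D (unary ?r) 0 (D.th (?a \<otimes>\<^bsub>W\<^esub> ?b) ?c)) 0 (D.th ?a ?b) = sub D (sub D ?y 0 (D.th ?a (?b \<otimes>\<^bsub>W\<^esub> ?c))) 1 (D.th ?b ?c)"
        using o by (simp add: D.unary_cmp D.sub_seq D.al_th_pre C.ok_simps)
      also have "sub D ?y 0 (D.th ?a (?b \<otimes>\<^bsub>W\<^esub> ?c)) = sub D (app_mor F (C.th a (b \<otimes> c))) 1 (unary (?tw b c))"
        using o D.tns_th_pre[of "unary (?tw a (b \<otimes> c))" 0 "ide W ?a" "?tw b c"] by (simp add: D.sub_idm C.ok_simps)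
      also have "sub D \<dots> 1 (D.th ?b ?c) = sub D (app_mor F (C.th a (b \<otimes> c))) 1 (app_mor F (C.th b c))"
        using o by (simp add: lx_L_pre C.ok_simps)
      finally show "sub D (sub D (unary ?l) 0 (D.th (?a \<otimes>\<^bsub>W\<^esub> ?b) ?c)) 0 (D.th ?a ?b) = sub D (sub D (unary ?r) 0 (D.th (?a \<otimes>\<^bsub>W\<^esub> ?b) ?c)) 0 (D.th ?a ?b)"
        using l by simp
    qed (use o in simp_all)
    then show "?fa (al V a b c) \<cdot>\<^bsub>W\<^esub> ?tw (a \<otimes> b) c \<cdot>\<^bsub>W\<^esub> (?tw a b \<odot>\<^bsub>W\<^esub> ide W (lobj L c))
        = ?tw a (b \<otimes> c) \<cdot>\<^bsub>W\<^esub> (ide W (lobj L a) \<odot>\<^bsub>W\<^esub> ?tw b c) \<cdot>\<^bsub>W\<^esub> al W (lobj L a) (lobj L b) (lobj L c)"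
      using o by simp }
  { assume o: "a \<in> Obj V"
    let ?a = "mfun F a"
    have "?fa (la V a) \<cdot>\<^bsub>W\<^esub> ?tw \<one> a \<cdot>\<^bsub>W\<^esub> (?ze \<odot>\<^bsub>W\<^esub> ide W ?a) = la W ?a"
    proof (rule D.cancel_uu2[of _ ?a])
      let ?x = "sub D (unary (?fa (la V a))) 0 (unary (?tw \<one> a))"
      have "sub D (sub D ?x 0 (unary (?ze \<odot>\<^bsub>W\<^esub> ide W ?a))) 0 (D.th \<one>\<^bsub>W\<^esub> ?a) = sub D (sub D ?x 0 (D.th (mfun F \<one>) ?a)) 0 (unary ?ze)"
        using o D.tns_th_pre[of ?x 0 ?ze "ide W ?a"] by (simp add: D.sub_idm C.ok_simps)
      then have "sub D (sub D (unary (?fa (la V a) \<cdot>\<^bsub>W\<^esub> ?tw \<one> a \<cdot>\<^bsub>W\<^esub> (?ze \<odot>\<^bsub>W\<^esub> ide W ?a))) 0 (D.th \<one>\<^bsub>W\<^esub> ?a)) 0 D.uu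
          = sub D (sub D (sub D ?x 0 (D.th (mfun F \<one>) ?a)) 0 (unary ?ze)) 0 D.uu"
        using o by (simp add: D.unary_cmp D.sub_seq C.ok_simps)
      also have "\<dots> = app_mor F (sub C (sub C (unary (la V a)) 0 (C.th \<one> a)) 0 C.uu)"
        using o by (simp add: lx_L_pre unary_app_arr app_mor_sub C.ok_simps)
      finally show "sub D (sub D (unary (?fa (la V a) \<cdot>\<^bsub>W\<^esub> ?tw \<one> a \<cdot>\<^bsub>W\<^esub> (?ze \<odot>\<^bsub>W\<^esub> ide W ?a))) 0 (D.th \<one>\<^bsub>W\<^esub> ?a)) 0 D.uu
        = sub D (sub D (unary (la W ?a)) 0 (D.th \<one>\<^bsub>W\<^esub> ?a)) 0 D.uu"
        using o by (simp add: C.la_th D.la_th)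
    qed (use o in simp_all)
    then show "?fa (la V a) \<cdot>\<^bsub>W\<^esub> ?tw \<one> a \<cdot>\<^bsub>W\<^esub> (?ze \<odot>\<^bsub>W\<^esub> ide W (lobj L a)) = la W (lobj L a)"
      using o by simp
    have "unary (?tw a \<one> \<cdot>\<^bsub>W\<^esub> (ide W ?a \<odot>\<^bsub>W\<^esub> ?ze) \<cdot>\<^bsub>W\<^esub> ra W ?a)
        = sub D (sub D (sub D (unary (?tw a \<one>)) 0 (unary (ide W ?a \<odot>\<^bsub>W\<^esub> ?ze))) 0 (D.th ?a \<one>\<^bsub>W\<^esub>)) 1 D.uu"
      using o by (simp add: D.unary_cmp D.ra_th D.sub_seq C.ok_simps)
    also have "sub D (sub D (unary (?tw a \<one>)) 0 (unary (ide W ?a \<odot>\<^bsub>W\<^esub> ?ze))) 0 (D.th ?a \<one>\<^bsub>W\<^esub>)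
        = sub D (app_mor F (C.th a \<one>)) 1 (unary ?ze)"
      using o D.tns_th_pre[of "unary (?tw a \<one>)" 0 "ide W ?a" ?ze] by (simp add: D.sub_idm C.ok_simps)
    also have "sub D \<dots> 1 D.uu = unary (?fa (ra V a))"
      using o by (simp add: lx_L_pre unary_app_arr C.ra_th app_mor_sub C.ok_simps)
    finally have "?tw a \<one> \<cdot>\<^bsub>W\<^esub> (ide W ?a \<odot>\<^bsub>W\<^esub> ?ze) \<cdot>\<^bsub>W\<^esub> ra W ?a = ?fa (ra V a)"
      by (simp only: unary_inject)
    then show "?tw a \<one> \<cdot>\<^bsub>W\<^esub> (ide W (lobj L a) \<odot>\<^bsub>W\<^esub> ?ze) \<cdot>\<^bsub>W\<^esub> ra W (lobj L a) = ?fa (ra V a)"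
      using o by simp }
qed (simp_all add: is_functor_L lx0_L lx2_L)

end

text \<open>
  Every multimap is a unary map after iterated classifiers, so that a morphism is determined by its
  values on unary maps, \<open>\<theta>\<close> and \<open>u\<close>, all of which can be read off from \<open>lax_of\<close>.
\<close>

lemma lax_of_faithful:
  assumes "lr_morphism long C t V D t' W F" "lr_morphism long C t V D t' W F'"
    and eq: "lax_of C t D t' F = lax_of C t D t' F'"
  shows "F = F'"
proof -
  interpret F: lr_morphism long C t V D t' W F by fact
  interpret F': lr_morphism long C t V D t' W F' by fact
  have ob: "mfun F a = mfun F' a" if "a \<in> mobj C" for a
    using that F.lobj_L[of a] F'.lobj_L[of a] eq by simp
  have unary: "app_mor F (unary f) = app_mor F' (unary f)" if "arr V f" for f
    using that F.unary_app_arr[of f] F'.unary_app_arr[of f] eq by simp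
  have th: "app_mor F (F.C.th a b) = app_mor F' (F.C.th a b)" if "a \<in> mobj C" "b \<in> mobj C" for a b
    using that F.lx2_L(2)[of a b] F'.lx2_L(2)[of a b] eq ob by simp
  have uu: "app_mor F F.C.uu = app_mor F' F.C.uu"
    using F.lx0_L(2) F'.lx0_L(2) eq by simp
  have Th: "app_mor F (F.C.Th as x) = app_mor F' (F.C.Th as x)" if "x \<in> mobj C" "set as \<subseteq> mobj C" "long \<or> length as \<le> 3" for as x
    using that
  proof (induction as arbitrary: x)
    case (Cons a as)
    have "app_mor F (F.C.Th (a # as) x) = sub D (app_mor F (F.C.Th as (tobj V x a))) 0 (app_mor F (F.C.th x a))"
      using Cons.prems by (auto simp: F.app_mor_sub F.C.ok_simps)
    also have "\<dots> = sub D (app_mor F' (F.C.Th as (tobj V x a))) 0 (app_mor F' (F.C.th x a))"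
      using Cons by (auto simp: th)
    also have "\<dots> = app_mor F' (F.C.Th (a # as) x)"
      using Cons.prems by (auto simp: F'.app_mor_sub F.C.ok_simps)
    finally show ?case .
  qed (simp add: ob)
  have Th0: "app_mor F (F.C.Th0 as) = app_mor F' (F.C.Th0 as)" if "set as \<subseteq> mobj C" "long \<or> length as \<le> 4" for as
  proof (cases as)
    case (Cons a as')
    have "app_mor F (F.C.Th0 as) = sub D (app_mor F (F.C.Th as' (tobj V (tunit V) a))) 0 (app_mor F (unary (la_inv V a)))"
      using that Cons by (auto simp: F.app_mor_sub F.C.ok_simps)
    also have "\<dots> = sub D (app_mor F' (F.C.Th as' (tobj V (tunit V) a))) 0 (app_mor F' (unary (la_inv V a)))"
      using that Cons by (auto simp: Th unary)
    also have "\<dots> = app_mor F' (F.C.Th0 as)"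
      using that Cons by (auto simp: F'.app_mor_sub F.C.ok_simps)
    finally show ?thesis .
  qed (simp add: uu)
  have multimap: "app_mor F h = app_mor F' h" if h: "multimap C h" "arity_ok long (length (src h))" for h
  proof -
    have n: "long \<or> length (src h) \<le> 4" using h by (simp add: arity_ok_def)
    obtain f where f: "arr V f" "src f = act V (tunit V) (src h)" "sub C (unary f) 0 (F.C.Th0 (src h)) = h"
      using F.C.Th0_ex[OF h(1) n] by blast
    have "app_mor F (sub C (unary f) 0 (F.C.Th0 (src h))) = app_mor F' (sub C (unary f) 0 (F.C.Th0 (src h)))"
      using f(1,2) n multimap_ends(1)[OF h(1)] by (auto simp: F.app_mor_sub F'.app_mor_sub F.C.ok_simps unary Th0)
    then show ?thesis by (simp only: f(3))
  qed
  have "mk_multi_mor (arity_ok long) C (mfun F) (mmap F) = mk_multi_mor (arity_ok long) C (mfun F') (mmap F')"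
  proof -
    have "mmap F as b h = mmap F' as b h"
      if "arity_ok long (length as)" "set as \<subseteq> mobj C" "b \<in> mobj C" "h \<in> mhom C as b" for as b h
      using multimap[of "Arrow as b h"] that by (simp add: app_mor_def)
    then show ?thesis using ob by (auto simp: mk_multi_mor_def restrict_def fun_eq_iff)
  qed
  then show ?thesis using F.extensional F'.extensional by simp
qed

text \<open>
  To see that \<open>lax_of\<close> is full, a lax monoidal functor is made to act on the multimaps of \<open>C\<close> through
  the arrows \<open>\<one> \<lhd> as \<rightarrow> b\<close> that represent them.
\<close>

context lr_multi
begin

definition rep :: "('o list, 'o, 'm) arrow \<Rightarrow> ('o, 'o, 'm) arrow" where
  "rep h = (SOME f. arr V f \<and> src f = \<one> \<lhd> src h \<and> tgt f = tgt h \<and> unary f \<bullet>[0] Th0 (src h) = h)"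

lemma rep:
  assumes "multimap C h" "long \<or> length (src h) \<le> 4"
  shows "arr V (rep h)" "src (rep h) = \<one> \<lhd> src h" "tgt (rep h) = tgt h" "unary (rep h) \<bullet>[0] Th0 (src h) = h"
  using someI_ex[OF Th0_ex[OF assms]] unfolding rep_def by blast+

lemma rep_eqI:
  assumes "multimap C h" "src h = as" "long \<or> length as \<le> 4" "arr V f" "src f = \<one> \<lhd> as" "tgt f = tgt h" "unary f \<bullet>[0] Th0 as = h"
  shows "rep h = f"
  using assms rep[of h] multimap_ends(1)[of C h] by (intro Th0_cancel[where as = as]) auto

lemma Th0_one: "a \<in> mobj C \<Longrightarrow> Th0 [a] = unary (la_inv V a)"
  by (simp add: idm_sub ok_simps)

lemma Th0_two: "\<lbrakk>a \<in> mobj C; b \<in> mobj C\<rbrakk> \<Longrightarrow> unary (la V a \<odot> ide V b) \<bullet>[0] Th0 [a, b] = th a b"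
proof -
  assume o: "a \<in> mobj C" "b \<in> mobj C"
  have "unary (la V a \<odot> ide V b) \<bullet>[0] Th0 [a, b] = unary (la V a \<odot> ide V b) \<bullet>[0] th (src (la V a)) b \<bullet>[0] unary (la_inv V a)"
    using o by (simp add: idm_sub sub_seq ok_simps)
  also have "\<dots> = th a b \<bullet>[0] (unary (la V a) \<bullet>[0] unary (la_inv V a))"
    using o by (subst tns_th_ide) (simp_all add: sub_seq ok_simps)
  also have "unary (la V a) \<bullet>[0] unary (la_inv V a) = idm C a"
    using o by (simp flip: unary_cmp)
  finally show ?thesis using o by (simp add: sub_idm ok_simps)
qed

lemma rep_idm: "a \<in> mobj C \<Longrightarrow> rep (idm C a) = la V a"
  by (rule rep_eqI[of _ "[a]"]) (simp_all add: Th0_one ok_simps flip: unary_cmp del: Th0.simps)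

lemma rep_unary: "arr V f \<Longrightarrow> rep (unary f) = f \<cdot> la V (src f)"
  by (rule rep_eqI[of _ "[src f]"]) (simp_all add: Th0_one ok_simps flip: unary_cmp del: Th0.simps)

lemma rep_uu: "rep uu = ide V \<one>"
  by (rule rep_eqI[of _ "[]"]) (simp_all add: idm_sub ok_simps)

lemma rep_th: "\<lbrakk>a \<in> mobj C; b \<in> mobj C\<rbrakk> \<Longrightarrow> rep (th a b) = la V a \<odot> ide V b"
  by (rule rep_eqI[of _ "[a, b]"]) (simp_all add: Th0_two del: Th0.simps)

text \<open>
  This is where \<open>sbs_Th0\<close> enters: representing arrows are compatible with substitution.
\<close>

lemma rep_sub:
  assumes g: "multimap C g" "src g = p @ [tgt f] @ s" and f: "multimap C f" and ok: "subst_ok long (length (src g)) (length (src f))"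
  shows "rep (g \<bullet>[length p] f) = sbs V p s (src f) (rep g) (rep f)"
proof (rule rep_eqI[of _ "p @ src f @ s"])
  have n: "long \<or> length (src g) \<le> 4" "long \<or> length (src f) \<le> 4" "long \<or> length (p @ src f @ s) \<le> 4"
    using subst_ok_arity[OF ok] g(2) by (auto simp: arity_ok_def)
  have o: "set p \<subseteq> mobj C" "set s \<subseteq> mobj C" "set (src f) \<subseteq> mobj C" using multimap_ends(1)[OF g(1)] multimap_ends(1)[OF f] g(2) by auto
  note rg = rep[OF g(1) n(1)] and rf = rep[OF f n(2)]
  show "long \<or> length (p @ src f @ s) \<le> 4" by fact
  show "multimap C (g \<bullet>[length p] f)" using g f ok by (intro multimap_sub) auto
  show "arr V (sbs V p s (src f) (rep g) (rep f))" using rg rf g(2) o by (intro Vl.arr_sbs) simp_all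
  show "src (sbs V p s (src f) (rep g) (rep f)) = \<one> \<lhd> (p @ src f @ s)" using rg rf g(2) o by simp
  show "tgt (sbs V p s (src f) (rep g) (rep f)) = tgt (g \<bullet>[length p] f)" using rg by simp
  show "unary (sbs V p s (src f) (rep g) (rep f)) \<bullet>[0] Th0 (p @ src f @ s) = g \<bullet>[length p] f"
    using sbs_Th0[of "rep g" p "rep f" s "src f"] rg rf g(2) o ok by simp
qed (use g in simp_all)

end

definition mor_of_lax :: "bool \<Rightarrow> ('o, 'm) multi \<Rightarrow> ('o, 'm) classifiers \<Rightarrow> ('o, 'm) skew_mon \<Rightarrow> ('o, 'm) multi
    \<Rightarrow> ('o, 'm) classifiers \<Rightarrow> ('o, 'm) skew_mon \<Rightarrow> ('o, 'm) lax_mon \<Rightarrow> ('o, 'm) multi_mor" where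
  "mor_of_lax long C t V D t' W L = mk_multi_mor (arity_ok long) C (lobj L)
    (\<lambda>as b h. mor (sub D (unary (lax_mmap V W L as (lr_multi.rep C t V (Arrow as b h)))) 0
      (lr_multi.Th0 D t' W (map (lobj L) as))))"

locale lr_lax = lr_pair + lax_monoidal V W L for L
begin

abbreviation "F \<equiv> mor_of_lax long C t V D t' W L"

lemma lobj_D [simp]: "a \<in> mobj C \<Longrightarrow> lobj L a \<in> mobj D" "set as \<subseteq> mobj C \<Longrightarrow> lobj L ` set as \<subseteq> mobj D"
  using lobj_in_Obj lobj_list by simp_all

lemma mfun_F [simp]: "a \<in> mobj C \<Longrightarrow> mfun F a = lobj L a"
  by (simp add: mor_of_lax_def mk_multi_mor_def)

lemma map_mfun_F [simp]: "set as \<subseteq> mobj C \<Longrightarrow> map (mfun F) as = map (lobj L) as"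
  by auto

lemma app_mor_F:
  assumes "multimap C h" "arity_ok long (length (src h))"
  shows "app_mor F h = sub D (unary (lax_mmap V W L (src h) (C.rep h))) 0 (D.Th0 (map (lobj L) (src h)))"
proof -
  have n: "long \<or> length (src h) \<le> 4" using assms by (simp add: arity_ok_def)
  note h = multimap_ends[OF assms(1)] multimap_mor[OF assms(1)]
  have r: "tgt (C.rep h) = tgt h" using C.rep[OF assms(1) n] by simp
  show ?thesis
    using h assms(2) n r
    by (auto simp: app_mor_def mor_of_lax_def mk_multi_mor_def sub_def)
qed

lemma arr_lax_rep:
  assumes "multimap C h" "arity_ok long (length (src h))"
  shows "arr W (lax_mmap V W L (src h) (C.rep h))"
proof -
  have n: "long \<or> length (src h) \<le> 4" using assms by (simp add: arity_ok_def)
  show ?thesis using C.rep[OF assms(1) n] multimap_ends(1)[OF assms(1)] by simp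
qed

lemma multi_morphism_F: "multi_morphism (arity_ok long) (subst_ok long) C D F"
proof
  show "F = mk_multi_mor (arity_ok long) C (mfun F) (mmap F)"
    by (auto simp: mor_of_lax_def mk_multi_mor_def fun_eq_iff)
  show "a \<in> mobj C \<Longrightarrow> mfun F a \<in> mobj D" for a by simp
  show "mmap F as b f \<in> mhom D (map (mfun F) as) (mfun F b)"
    if "arity_ok long (length as)" "set as \<subseteq> mobj C" "b \<in> mobj C" "f \<in> mhom C as b" for as b f
  proof -
    let ?h = "Arrow as b f"
    have h: "multimap C ?h" "arity_ok long (length (src ?h))" using that by simp_all
    have n: "long \<or> length as \<le> 4" using that by (simp add: arity_ok_def)
    have "multimap D (sub D (unary (lax_mmap V W L (src ?h) (C.rep ?h))) 0 (D.Th0 (map (lobj L) (src ?h))))"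
      using that n arr_lax_rep[OF h] C.rep[OF h(1)] by (intro D.multimap_sub) (auto simp: C.ok_simps)
    then have "multimap D (app_mor F ?h)" using app_mor_F[OF h] by simp
    then show ?thesis by (simp add: app_mor_def)
  qed
  show "mmap F [a] a (mid C a) = mid D (mfun F a)" if a: "a \<in> mobj C" for a
  proof -
    have "app_mor F (idm C a) = sub D (unary (la W (lobj L a))) 0 (D.Th0 [lobj L a])"
      using a by (subst app_mor_F) (simp_all add: C.rep_idm lax_mmap_la arity_ok_def del: D.Th0.simps)
    also have "\<dots> = idm D (lobj L a)"
      using a by (simp add: D.Th0_one del: D.Th0.simps flip: D.unary_cmp)
    finally show ?thesis using a by (simp add: app_mor_def idm_def)
  qed
  show "mmap F (p @ as @ s) c (msub C p b s as c g f)
        = msub D (map (mfun F) p) (mfun F b) (map (mfun F) s) (map (mfun F) as) (mfun F c)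
            (mmap F (p @ [b] @ s) c g) (mmap F as b f)"
    if ok: "subst_ok long (length (p @ [b] @ s)) (length as)"
      and o: "set (p @ [b] @ s) \<subseteq> mobj C" "set as \<subseteq> mobj C" "c \<in> mobj C"
      and gf: "g \<in> mhom C (p @ [b] @ s) c" "f \<in> mhom C as b" for p b s as c g f
  proof -
    let ?g = "Arrow (p @ [b] @ s) c g" and ?f = "Arrow as b f"
    have multimap: "multimap C ?g" "multimap C ?f" using o gf by simp_all
    have ar: "arity_ok long (length (src ?g))" "arity_ok long (length (src ?f))" "arity_ok long (length (p @ as @ s))"
      using subst_ok_arity[OF ok] by (simp_all add: ac_simps)
    then have n: "long \<or> length (src ?g) \<le> 4" "long \<or> length (src ?f) \<le> 4" by (simp_all add: arity_ok_def)
    note rg = C.rep[OF multimap(1) n(1)] and rf = C.rep[OF multimap(2) n(2)]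
    have s: "multimap C (sub C ?g (length p) ?f)" using multimap ok by (intro C.multimap_sub) simp_all
    have "app_mor F (sub C ?g (length p) ?f) = sub D (unary (lax_mmap V W L (p @ as @ s) (sbs V p s as (C.rep ?g) (C.rep ?f)))) 0 (D.Th0 (map (lobj L) (p @ as @ s)))"
      using s ar(3) multimap ok C.rep_sub[of ?g p ?f s] by (subst app_mor_F) simp_all
    also have "lax_mmap V W L (p @ as @ s) (sbs V p s as (C.rep ?g) (C.rep ?f))
        = sbs W (map (lobj L) p) (map (lobj L) s) (map (lobj L) as) (lax_mmap V W L (p @ [tgt (C.rep ?f)] @ s) (C.rep ?g)) (lax_mmap V W L as (C.rep ?f))"
      using rg rf o by (intro lax_mmap_sbs) simp_all
    also have "sub D (unary \<dots>) 0 (D.Th0 (map (lobj L) (p @ as @ s)))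
        = sub D (sub D (unary (lax_mmap V W L (p @ [b] @ s) (C.rep ?g))) 0 (D.Th0 (map (lobj L) (p @ [b] @ s)))) (length p)
            (sub D (unary (lax_mmap V W L as (C.rep ?f))) 0 (D.Th0 (map (lobj L) as)))"
      using rg rf o ok arr_lax_rep[OF multimap(1) ar(1)] arr_lax_rep[OF multimap(2) ar(2)]
        D.sbs_Th0[of "lax_mmap V W L (p @ [b] @ s) (C.rep ?g)" "map (lobj L) p" "lax_mmap V W L as (C.rep ?f)" "map (lobj L) s" "map (lobj L) as"]
      by simp
    also have "\<dots> = sub D (app_mor F ?g) (length p) (app_mor F ?f)"
      using multimap ar by (simp add: app_mor_F)
    finally have "mor (app_mor F (sub C ?g (length p) ?f)) = mor (sub D (app_mor F ?g) (length p) (app_mor F ?f))" by simp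
    then show ?thesis by (simp add: app_mor_def sub_def)
  qed
qed

sublocale lm: lr_morphism long C t V D t' W F
  by (intro lr_morphism.intro lr_pair_axioms multi_morphism_F)

text \<open>
  On unary maps, \<open>u\<close> and \<open>\<theta>\<close> the representing arrows are \<open>f \<lambda>\<close>, \<open>1\<close> and \<open>\<lambda> b\<close>; the unit axiom
  of \<open>L\<close> for \<open>\<lambda>\<close> turns their images into those of \<open>L\<close>.
\<close>

lemma lax_of_F: "lax_of C t D t' F = L"
proof -
  have "lax0 (lax_of C t D t' F) = mor (lx0 V W L)"
    using lm.lx0_unique[of "lx0 V W L"] app_mor_F[of C.uu]
    by (simp add: arity_ok_def C.rep_uu lax_mmap_def)
  then have l0: "lax0 (lax_of C t D t' F) = lax0 L" by (simp add: lx0_def)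
  have l2: "lax2 (lax_of C t D t' F) a b = lax2 L a b" if o: "a \<in> mobj C" "b \<in> mobj C" for a b
  proof -
    let ?a = "lobj L a" and ?b = "lobj L b"
    have "lax_mmap V W L [a, b] (la V a \<odot> ide V b)
        = (app_arr (lfun L) (la V a \<odot> ide V b) \<cdot>\<^bsub>W\<^esub> lx2 V W L (\<one> \<otimes> a) b) \<cdot>\<^bsub>W\<^esub> ((lx2 V W L \<one> a \<cdot>\<^bsub>W\<^esub> (lx0 V W L \<odot>\<^bsub>W\<^esub> ide W ?a)) \<odot>\<^bsub>W\<^esub> ide W ?b)"
      using o by (simp add: lax_mmap_def D.Vl.tns_ide_cmp)
    also have "app_arr (lfun L) (la V a \<odot> ide V b) \<cdot>\<^bsub>W\<^esub> lx2 V W L (\<one> \<otimes> a) b = lx2 V W L a b \<cdot>\<^bsub>W\<^esub> (app_arr (lfun L) (la V a) \<odot>\<^bsub>W\<^esub> ide W ?b)"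
      using o lx2_nat[of "la V a" "ide V b"] by simp
    also have "(lx2 V W L a b \<cdot>\<^bsub>W\<^esub> (app_arr (lfun L) (la V a) \<odot>\<^bsub>W\<^esub> ide W ?b)) \<cdot>\<^bsub>W\<^esub> ((lx2 V W L \<one> a \<cdot>\<^bsub>W\<^esub> (lx0 V W L \<odot>\<^bsub>W\<^esub> ide W ?a)) \<odot>\<^bsub>W\<^esub> ide W ?b)
        = lx2 V W L a b \<cdot>\<^bsub>W\<^esub> (la W ?a \<odot>\<^bsub>W\<^esub> ide W ?b)"
      using o by (simp add: lx_la flip: D.Vl.tns_ide_cmp)
    finally have "app_mor F (C.th a b) = sub D (unary (lx2 V W L a b)) 0 (sub D (unary (la W ?a \<odot>\<^bsub>W\<^esub> ide W ?b)) 0 (D.Th0 [?a, ?b]))"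
      using o by (simp add: app_mor_F arity_ok_def C.rep_th D.unary_cmp D.sub_seq C.ok_simps)
    also have "\<dots> = sub D (unary (lx2 V W L a b)) 0 (D.th ?a ?b)"
      using o by (simp add: D.Th0_two del: D.Th0.simps)
    finally have "lax2 (lax_of C t D t' F) a b = mor (lx2 V W L a b)"
      using o by (intro lm.lx2_unique) simp_all
    then show ?thesis by (simp add: lx2_def)
  qed
  have "mmap F [a] b f = larr L a b f" if "a \<in> mobj C" "b \<in> mobj C" "f \<in> Hom V a b" for a b f
  proof -
    let ?f = "Arrow a b f"
    have f: "arr V ?f" using that by simp
    have "lax_mmap V W L [a] (?f \<cdot> la V a) = app_arr (lfun L) ?f \<cdot>\<^bsub>W\<^esub> lax_mmap V W L [a] (la V a)"
      using f that by (simp add: lax_mmap_def fn.app_arr_cmp)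
    then have "lax_mmap V W L [a] (?f \<cdot> la V a) = app_arr (lfun L) ?f \<cdot>\<^bsub>W\<^esub> la W (lobj L a)"
      using that by (simp add: lax_mmap_la)
    then have "app_mor F (unary ?f) = sub D (unary (app_arr (lfun L) ?f \<cdot>\<^bsub>W\<^esub> la W (lobj L a))) 0 (unary (la_inv W (lobj L a)))"
      using f that by (simp add: app_mor_F arity_ok_def C.rep_unary D.Th0_one del: D.Th0.simps)
    also have "\<dots> = unary ((app_arr (lfun L) ?f \<cdot>\<^bsub>W\<^esub> la W (lobj L a)) \<cdot>\<^bsub>W\<^esub> la_inv W (lobj L a))"
      using that by (subst D.unary_cmp) simp_all
    also have "\<dots> = unary (app_arr (lfun L) ?f)"
      using f that by simp
    finally show ?thesis using that by (simp add: app_mor_def unary_def app_arr_def)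
  qed
  then have "mk_functor V (mfun F) (\<lambda>a b f. mmap F [a] b f) = mk_functor V (fobj (lfun L)) (farr (lfun L))"
    by (intro mk_functor_cong) simp_all
  then have l: "lfun (lax_of C t D t' F) = lfun L"
    using fn.extensional by (simp add: lax_of_def flip: C.V_def)
  have "lax2 (lax_of C t D t' F) = lax2 L"
  proof (intro ext)
    fix a b show "lax2 (lax_of C t D t' F) a b = lax2 L a b"
    proof (cases "a \<in> mobj C \<and> b \<in> mobj C")
      case False
      then have "lax2 L a b = undefined" by (intro lax2_extensional) simp
      then show ?thesis using False by (auto simp: lax_of_def)
    qed (use l2 in blast)
  qed
  with l l0 show ?thesis by simp
qed

end

text \<open>Closedness, as a statement about binary maps, transfers along \<open>C(a, b; c) \<cong> V(ab, c)\<close>.\<close>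

lemma (in lr_multi) closed_V:
  assumes cl: "\<And>b c. \<lbrakk>b \<in> mobj C; c \<in> mobj C\<rbrakk> \<Longrightarrow> \<exists>h \<in> mobj C. \<exists>e \<in> mhom C [h, b] c. \<forall>a \<in> mobj C.
      bij_betw (\<lambda>f. msub C [] h [b] [a] c e f) (mhom C [a] h) (mhom C [a, b] c)"
  shows "closed_skew_mon V"
  unfolding closed_skew_mon_def
proof
  fix b assume "b \<in> Obj V"
  then have b: "b \<in> mobj C" by simp
  have F: "is_functor V V (right_tensor V b)"
    unfolding right_tensor_def
  proof (rule is_functor_mk_functor)
    show "tarr V a a' b b f (Id V b) \<in> Hom V (a \<otimes> b) (a' \<otimes> b)" if "a \<in> Obj V" "a' \<in> Obj V" "f \<in> Hom V a a'" for a a' f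
      using that b Vl.tarr_in_Hom[of a a' b b f "Id V b"] Vc.Id_in_Hom[of b] by simp
    show "tarr V a c b b (Comp V a a' c g f) (Id V b) = Comp V (a \<otimes> b) (a' \<otimes> b) (c \<otimes> b) (tarr V a' c b b g (Id V b)) (tarr V a a' b b f (Id V b))"
      if "a \<in> Obj V" "a' \<in> Obj V" "c \<in> Obj V" "f \<in> Hom V a a'" "g \<in> Hom V a' c" for a a' c f g
      using that b Vl.tarr_Comp[of a a' c b b b f g "Id V b" "Id V b"] Vc.Id_in_Hom[of b] Vc.Comp_Id_left[of b b "Id V b"] by simp
  qed (use b Vl.tarr_Id in \<open>simp_all add: Vc.is_category_axioms\<close>)
  have "\<forall>c \<in> mobj C. \<exists>h \<epsilon>. h \<in> mobj C \<and> \<epsilon> \<in> Hom V (h \<otimes> b) c \<and>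
      (\<forall>a \<in> mobj C. bij_betw (\<lambda>k. Comp V (a \<otimes> b) (h \<otimes> b) c \<epsilon> (tarr V a h b b k (Id V b))) (Hom V a h) (Hom V (a \<otimes> b) c))"
  proof
    fix c assume c: "c \<in> mobj C"
    obtain h e where h: "h \<in> mobj C" "e \<in> mhom C [h, b] c"
      and bij: "\<And>a. a \<in> mobj C \<Longrightarrow> bij_betw (\<lambda>f. msub C [] h [b] [a] c e f) (mhom C [a] h) (mhom C [a, b] c)"
      using cl[OF b c] by blast
    let ?e = "Arrow [h, b] c e"
    have e: "multimap C ?e" using h b c by simp
    obtain k0 where k0: "multimap C k0" "src k0 = [h \<otimes> b]" "tgt k0 = c" "k0 \<bullet>[0] th h b = ?e"
      by (rule th_ex[OF e]) auto
    obtain \<epsilon> where eps: "k0 = unary \<epsilon>" "src \<epsilon> = h \<otimes> b" "tgt \<epsilon> = c"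
      using k0 by (cases k0) (auto simp: unary_def intro: that[of "Arrow (h \<otimes> b) c (mor k0)"])
    have \<epsilon>: "arr V \<epsilon>" using k0(1) eps by simp
    have "bij_betw (\<lambda>k. Comp V (a \<otimes> b) (h \<otimes> b) c (mor \<epsilon>) (tarr V a h b b k (Id V b))) (Hom V a h) (Hom V (a \<otimes> b) c)"
      if a: "a \<in> mobj C" for a
    proof -
      let ?E = "\<lambda>k. Comp V (a \<otimes> b) (h \<otimes> b) c (mor \<epsilon>) (tarr V a h b b k (Id V b))"
      let ?\<Theta> = "\<lambda>g. msub C [] (ctens t a b) [] [a, b] c g (ctheta t a b)"
      have E: "?E k \<in> Hom V (a \<otimes> b) c \<and> ?\<Theta> (?E k) = msub C [] h [b] [a] c e k" if k: "k \<in> Hom V a h" for k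
      proof -
        let ?k = "Arrow a h k"
        have k': "arr V ?k" using k a h by simp
        have "unary (\<epsilon> \<cdot> (?k \<odot> ide V b)) \<bullet>[0] th a b = unary \<epsilon> \<bullet>[0] th h b \<bullet>[0] unary ?k"
          using k' \<epsilon> eps a b h tns_th_pre[of "unary \<epsilon>" 0 ?k "ide V b"] by (simp add: unary_cmp sub_idm ok_simps)
        also have "\<dots> = ?e \<bullet>[0] unary ?k" using k0(4) eps by simp
        finally have "mor (unary (\<epsilon> \<cdot> (?k \<odot> ide V b)) \<bullet>[0] th a b) = mor (?e \<bullet>[0] unary ?k)" by simp
        moreover have "mor (\<epsilon> \<cdot> (?k \<odot> ide V b)) = ?E k" using eps by (simp add: cmp_def tns_def ide_def)
        moreover have "mor (\<epsilon> \<cdot> (?k \<odot> ide V b)) \<in> Hom V (a \<otimes> b) c" using k' \<epsilon> eps a b h by (intro mor_in_Hom) simp_all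
        ultimately show ?thesis using eps by (simp add: sub_def unary_def th_def V_simps)
      qed
      have "bij_betw (?\<Theta> \<circ> ?E) (Hom V a h) (mhom C [a, b] c)"
        using bij[OF a] E by (subst bij_betw_cong[where g = "\<lambda>f. msub C [] h [b] [a] c e f"]) (auto simp: V_simps)
      moreover have "bij_betw ?\<Theta> (Hom V (a \<otimes> b) c) (mhom C [a, b] c)"
        using theta_bij[of a b "[]" c] a b c by (simp add: V_simps)
      moreover have "?E ` Hom V a h \<subseteq> Hom V (a \<otimes> b) c" using E by auto
      ultimately show ?thesis using bij_betw_comp_iff2 by blast
    qed
    then show "\<exists>h \<epsilon>. h \<in> mobj C \<and> \<epsilon> \<in> Hom V (h \<otimes> b) c \<and>
      (\<forall>a \<in> mobj C. bij_betw (\<lambda>k. Comp V (a \<otimes> b) (h \<otimes> b) c \<epsilon> (tarr V a h b b k (Id V b))) (Hom V a h) (Hom V (a \<otimes> b) c))"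
      using h(1) arr_mor[OF \<epsilon>] eps by (intro exI[of _ h] exI[of _ "mor \<epsilon>"]) simp
  qed
  then obtain h \<epsilon> where h: "\<And>c. c \<in> mobj C \<Longrightarrow> h c \<in> mobj C" "\<And>c. c \<in> mobj C \<Longrightarrow> \<epsilon> c \<in> Hom V (h c \<otimes> b) c"
    "\<And>a c. \<lbrakk>a \<in> mobj C; c \<in> mobj C\<rbrakk> \<Longrightarrow>
      bij_betw (\<lambda>k. Comp V (a \<otimes> b) (h c \<otimes> b) c (\<epsilon> c) (tarr V a (h c) b b k (Id V b))) (Hom V a (h c)) (Hom V (a \<otimes> b) c)"
    by metis
  show "has_right_adjoint V V (right_tensor V b)"
  proof (rule has_right_adjointI[OF F, where g = h and \<epsilon> = \<epsilon>])
    fix a c assume a: "a \<in> Obj V" "c \<in> Obj V"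
    show "bij_betw (\<lambda>k. Comp V (fobj (right_tensor V b) a) (fobj (right_tensor V b) (h c)) c (\<epsilon> c) (farr (right_tensor V b) a (h c) k))
      (Hom V a (h c)) (Hom V (fobj (right_tensor V b) a) c)"
      using a h(1)[of c] h(3)[of a c] by (subst bij_betw_cong[where g = "\<lambda>k. Comp V (a \<otimes> b) (h c \<otimes> b) c (\<epsilon> c) (tarr V a (h c) b b k (Id V b))"])
        (simp_all add: right_tensor_def)
  qed (use h in \<open>simp_all add: right_tensor_def\<close>)
qed

section \<open>The categories of skew monoidal categories and of multicategories\<close>

lemma lax_monoidal_id:
  assumes "skew_monoidal V"
  shows "lax_monoidal V V (id_lax V)"
proof -
  interpret V: skew_monoidal V by fact
  have fn: "is_functor V V (id_functor V)"
    unfolding id_functor_def by (rule is_functor_mk_functor) (simp_all add: V.is_category_axioms)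
  have app_arr: "app_arr (id_functor V) f = f" if "arr V f" for f
    using that arr_mor[OF that] by (cases f) (simp add: app_arr_def id_functor_def)
  have l2: "lx2 V V (id_lax V) a b = ide V (tobj V a b)" if "a \<in> Obj V" "b \<in> Obj V" for a b
    using that by (simp add: lx2_def id_lax_def id_functor_def ide_def)
  have l0: "lx0 V V (id_lax V) = ide V (tunit V)"
    by (simp add: lx0_def id_lax_def id_functor_def ide_def)
  have ob: "fobj (id_functor V) a = a" if "a \<in> Obj V" for a
    using that by (simp add: id_functor_def)
  have l: "lfun (id_lax V) = id_functor V" by (simp add: id_lax_def)
  show ?thesis
    by (rule lax_monoidalI) (simp_all add: assms fn app_arr l2 l0 ob l arr_ends, auto simp: id_lax_def)
qed

lemma lax_monoidal_comp:
  assumes "lax_monoidal V W F" "lax_monoidal W X G"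
  shows "lax_monoidal V X (comp_lax V W X G F)"
    and "\<And>f. arr V f \<Longrightarrow> app_arr (lfun (comp_lax V W X G F)) f = app_arr (lfun G) (app_arr (lfun F) f)"
proof -
  interpret F: lax_monoidal V W F by fact
  interpret G: lax_monoidal W X G by fact
  let ?H = "comp_lax V W X G F"
  have l: "lfun ?H = comp_functor V (lfun G) (lfun F)" by (simp add: comp_lax_def)
  have fn: "is_functor V X (comp_functor V (lfun G) (lfun F))"
    unfolding comp_functor_def
    by (rule is_functor_mk_functor)
      (simp_all add: F.src.is_category_axioms G.tgt.is_category_axioms F.fn.farr_in_Hom G.fn.farr_in_Hom F.fn.farr_Id G.fn.farr_Id
        F.fn.farr_Comp G.fn.farr_Comp)
  have ob: "fobj (comp_functor V (lfun G) (lfun F)) a = lobj G (lobj F a)" if "a \<in> Obj V" for a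
    using that by simp
  have app_arr: "app_arr (comp_functor V (lfun G) (lfun F)) f = app_arr (lfun G) (app_arr (lfun F) f)" if "arr V f" for f
    using that arr_mor[OF that] by (simp add: app_arr_def arr_ends)
  show "app_arr (lfun ?H) f = app_arr (lfun G) (app_arr (lfun F) f)" if "arr V f" for f
    using app_arr[OF that] l by simp
  have l2: "lx2 V X ?H a b = cmp X (app_arr (lfun G) (lx2 V W F a b)) (lx2 W X G (lobj F a) (lobj F b))" if "a \<in> Obj V" "b \<in> Obj V" for a b
    using that by (simp add: lx2_def comp_lax_def cmp_def app_arr_def)
  have l0: "lx0 V X ?H = cmp X (app_arr (lfun G) (lx0 V W F)) (lx0 W X G)"
    by (simp add: lx0_def comp_lax_def cmp_def app_arr_def)
  note F_al = F.lx2_al and G_al = G.lx2_al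
  let ?g = "app_arr (lfun G)" and ?f = "app_arr (lfun F)"
  show "lax_monoidal V X ?H"
  proof (rule lax_monoidalI)
    show "skew_monoidal V" "skew_monoidal X" by unfold_locales
    show "is_functor V X (lfun ?H)" using fn l by simp
    show "lax2 ?H a b = undefined" if "\<not> (a \<in> Obj V \<and> b \<in> Obj V)" for a b
      using that by (auto simp: comp_lax_def)
    show "arr X (lx0 V X ?H)" by (simp add: l0)
    show "arr X (lx2 V X ?H a b)" if "a \<in> Obj V" "b \<in> Obj V" for a b using that by (simp add: l2)
    show "cmp X (app_arr (lfun ?H) (tns V f h)) (lx2 V X ?H (src f) (src h))
      = cmp X (lx2 V X ?H (tgt f) (tgt h)) (tns X (app_arr (lfun ?H) f) (app_arr (lfun ?H) h))" if "arr V f" "arr V h" for f h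
    proof -
      have "cmp X (?g (?f (tns V f h))) (cmp X (?g (lx2 V W F (src f) (src h))) (lx2 W X G (lobj F (src f)) (lobj F (src h))))
          = cmp X (?g (cmp W (?f (tns V f h)) (lx2 V W F (src f) (src h)))) (lx2 W X G (src (?f f)) (src (?f h)))"
        using that by (simp add: arr_ends G.fn.app_arr_cmp)
      also have "\<dots> = cmp X (?g (lx2 V W F (tgt f) (tgt h))) (cmp X (?g (tns W (?f f) (?f h))) (lx2 W X G (src (?f f)) (src (?f h))))"
        using that by (simp add: arr_ends G.fn.app_arr_cmp F.lx2_nat)
      also have "\<dots> = cmp X (cmp X (?g (lx2 V W F (tgt f) (tgt h))) (lx2 W X G (lobj F (tgt f)) (lobj F (tgt h)))) (tns X (?g (?f f)) (?g (?f h)))"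
        using that by (subst G.lx2_nat) (simp_all add: arr_ends)
      finally show ?thesis using that by (simp add: l app_arr l2 arr_ends)
    qed
    show "cmp X (app_arr (lfun ?H) (al V a b c)) (cmp X (lx2 V X ?H (tobj V a b) c) (tns X (lx2 V X ?H a b) (ide X (lobj ?H c))))
      = cmp X (lx2 V X ?H a (tobj V b c)) (cmp X (tns X (ide X (lobj ?H a)) (lx2 V X ?H b c)) (al X (lobj ?H a) (lobj ?H b) (lobj ?H c)))"
      if o: "a \<in> Obj V" "b \<in> Obj V" "c \<in> Obj V" for a b c
    proof -
      let ?A = "lobj F a" and ?B = "lobj F b" and ?C = "lobj F c"
      let ?ia = "ide W ?A" and ?ic = "ide W ?C"
      let ?l = "?g (?f (al V a b c))" and ?m = "?g (lx2 V W F (tobj V a b) c)"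
      let ?p = "lx2 V W F a b" and ?q = "lx2 V W F b c" and ?r = "lx2 V W F a (tobj V b c)"
      have 1: "cmp X (lx2 W X G (lobj F (tobj V a b)) ?C) (tns X (?g ?p) (ide X (lobj G ?C)))
         = cmp X (?g (tns W ?p ?ic)) (lx2 W X G (tobj W ?A ?B) ?C)"
        using o G.lx2_nat[of ?p ?ic] by simp
      have 2: "cmp X (?g (tns W ?ia ?q)) (lx2 W X G ?A (tobj W ?B ?C))
         = cmp X (lx2 W X G ?A (lobj F (tobj V b c))) (tns X (ide X (lobj G ?A)) (?g ?q))"
        using o G.lx2_nat[of ?ia ?q] by simp
      have "cmp X (app_arr (lfun ?H) (al V a b c)) (cmp X (lx2 V X ?H (tobj V a b) c) (tns X (lx2 V X ?H a b) (ide X (lobj ?H c))))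
         = cmp X ?l (cmp X ?m (cmp X (cmp X (lx2 W X G (lobj F (tobj V a b)) ?C) (tns X (?g ?p) (ide X (lobj G ?C)))) (tns X (lx2 W X G ?A ?B) (ide X (lobj G ?C)))))"
        using o by (simp add: l app_arr l2 G.tgt.tns_ide_cmp)
      also have "\<dots> = cmp X (?g (cmp W (?f (al V a b c)) (cmp W (lx2 V W F (tobj V a b) c) (tns W ?p ?ic))))
            (cmp X (lx2 W X G (tobj W ?A ?B) ?C) (tns X (lx2 W X G ?A ?B) (ide X (lobj G ?C))))"
        using o by (simp add: 1 G.fn.app_arr_cmp)
      also have "cmp W (?f (al V a b c)) (cmp W (lx2 V W F (tobj V a b) c) (tns W ?p ?ic)) = cmp W ?r (cmp W (tns W ?ia ?q) (al W ?A ?B ?C))"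
        using o by (rule F_al)
      also have "cmp X (?g \<dots>) (cmp X (lx2 W X G (tobj W ?A ?B) ?C) (tns X (lx2 W X G ?A ?B) (ide X (lobj G ?C))))
         = cmp X (?g ?r) (cmp X (?g (tns W ?ia ?q)) (cmp X (?g (al W ?A ?B ?C)) (cmp X (lx2 W X G (tobj W ?A ?B) ?C) (tns X (lx2 W X G ?A ?B) (ide X (lobj G ?C))))))"
        using o by (simp add: G.fn.app_arr_cmp)
      also have "\<dots> = cmp X (?g ?r) (cmp X (cmp X (?g (tns W ?ia ?q)) (lx2 W X G ?A (tobj W ?B ?C)))
          (cmp X (tns X (ide X (lobj G ?A)) (lx2 W X G ?B ?C)) (al X (lobj G ?A) (lobj G ?B) (lobj G ?C))))"
        using o by (simp add: G_al)
      also have "\<dots> = cmp X (?g ?r) (cmp X (lx2 W X G ?A (lobj F (tobj V b c))) (cmp X (tns X (ide X (lobj G ?A)) (?g ?q))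
          (cmp X (tns X (ide X (lobj G ?A)) (lx2 W X G ?B ?C)) (al X (lobj G ?A) (lobj G ?B) (lobj G ?C)))))"
        using o by (simp only: 2) simp
      also have "\<dots> = cmp X (lx2 V X ?H a (tobj V b c)) (cmp X (tns X (ide X (lobj ?H a)) (lx2 V X ?H b c)) (al X (lobj ?H a) (lobj ?H b) (lobj ?H c)))"
        using o by (simp add: l l2 G.tgt.ide_tns_cmp)
      finally show ?thesis .
    qed
    fix a assume o: "a \<in> Obj V"
    let ?A = "lobj F a"
    let ?ia = "ide W ?A"
    have 1: "cmp X (lx2 W X G (lobj F (tunit V)) ?A) (tns X (?g (lx0 V W F)) (ide X (lobj G ?A)))
         = cmp X (?g (tns W (lx0 V W F) ?ia)) (lx2 W X G (tunit W) ?A)"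
      using o G.lx2_nat[of "lx0 V W F" ?ia] by simp
    have "cmp X (app_arr (lfun ?H) (la V a)) (cmp X (lx2 V X ?H (tunit V) a) (tns X (lx0 V X ?H) (ide X (lobj ?H a))))
        = cmp X (?g (?f (la V a))) (cmp X (?g (lx2 V W F (tunit V) a)) (cmp X (cmp X (lx2 W X G (lobj F (tunit V)) ?A)
            (tns X (?g (lx0 V W F)) (ide X (lobj G ?A)))) (tns X (lx0 W X G) (ide X (lobj G ?A)))))"
      using o by (simp add: l app_arr l2 l0 G.tgt.tns_ide_cmp)
    also have "\<dots> = cmp X (?g (cmp W (?f (la V a)) (cmp W (lx2 V W F (tunit V) a) (tns W (lx0 V W F) ?ia))))
         (cmp X (lx2 W X G (tunit W) ?A) (tns X (lx0 W X G) (ide X (lobj G ?A))))"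
      using o by (simp add: 1 G.fn.app_arr_cmp)
    also have "\<dots> = la X (lobj ?H a)"
      using o by (simp add: F.lx_la G.lx_la l)
    finally show "cmp X (app_arr (lfun ?H) (la V a)) (cmp X (lx2 V X ?H (tunit V) a) (tns X (lx0 V X ?H) (ide X (lobj ?H a)))) = la X (lobj ?H a)" .
    have 2: "cmp X (lx2 W X G ?A (lobj F (tunit V))) (tns X (ide X (lobj G ?A)) (?g (lx0 V W F)))
         = cmp X (?g (tns W ?ia (lx0 V W F))) (lx2 W X G ?A (tunit W))"
      using o G.lx2_nat[of ?ia "lx0 V W F"] by simp
    have "cmp X (lx2 V X ?H a (tunit V)) (cmp X (tns X (ide X (lobj ?H a)) (lx0 V X ?H)) (ra X (lobj ?H a)))
        = cmp X (?g (lx2 V W F a (tunit V))) (cmp X (cmp X (lx2 W X G ?A (lobj F (tunit V))) (tns X (ide X (lobj G ?A)) (?g (lx0 V W F))))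
            (cmp X (tns X (ide X (lobj G ?A)) (lx0 W X G)) (ra X (lobj G ?A))))"
      using o by (simp add: l l2 l0 G.tgt.ide_tns_cmp)
    also have "\<dots> = cmp X (?g (lx2 V W F a (tunit V))) (cmp X (?g (tns W ?ia (lx0 V W F)))
        (cmp X (lx2 W X G ?A (tunit W)) (cmp X (tns X (ide X (lobj G ?A)) (lx0 W X G)) (ra X (lobj G ?A)))))"
      using o by (simp only: 2) simp
    also have "\<dots> = ?g (cmp W (lx2 V W F a (tunit V)) (cmp W (tns W ?ia (lx0 V W F)) (ra W ?A)))"
      using o by (simp add: G.lx_ra G.fn.app_arr_cmp)
    also have "\<dots> = app_arr (lfun ?H) (ra V a)"
      using o by (simp add: F.lx_ra l app_arr)
    finally show "cmp X (lx2 V X ?H a (tunit V)) (cmp X (tns X (ide X (lobj ?H a)) (lx0 V X ?H)) (ra X (lobj ?H a))) = app_arr (lfun ?H) (ra V a)" .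
  qed
qed

lemma lax_mon_eqI:
  fixes F G :: "('o, 'm) lax_mon"
  assumes "lfun F = lfun G" "lax0 F = lax0 G" "\<And>a b. lax2 F a b = lax2 G a b"
  shows "F = G"
  using assms by (cases F; cases G) (auto simp: fun_eq_iff)

lemma SkMon_ln_simps [simp]:
  "V \<in> Obj SkMon_ln \<longleftrightarrow> skew_monoidal V \<and> left_normal V" "F \<in> Hom SkMon_ln V W \<longleftrightarrow> lax_monoidal V W F"
  "Id SkMon_ln V = id_lax V" "Comp SkMon_ln V W X G F = comp_lax V W X G F"
  by (simp_all add: SkMon_ln_def)

lemma is_category_SkMon_ln: "is_category SkMon_ln"
proof
  fix V W X Y :: "('o, 'm) skew_mon" and F G H
  show "V \<in> Obj SkMon_ln \<Longrightarrow> Id SkMon_ln V \<in> Hom SkMon_ln V V"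
    by (simp add: lax_monoidal_id)
  show "\<lbrakk>F \<in> Hom SkMon_ln V W; G \<in> Hom SkMon_ln W X\<rbrakk> \<Longrightarrow> Comp SkMon_ln V W X G F \<in> Hom SkMon_ln V X"
    by (simp add: lax_monoidal_comp)
  { assume "F \<in> Hom SkMon_ln V W"
    then interpret F: lax_monoidal V W F by simp
    have ext: "mk_functor V (fobj (lfun F)) (farr (lfun F)) = lfun F" using F.fn.extensional by simp
    have "comp_lax V V W F (id_lax V) = F"
    proof (rule lax_mon_eqI)
      have "mk_functor V (\<lambda>a. fobj (lfun F) (fobj (id_functor V) a))
          (\<lambda>a b f. farr (lfun F) (fobj (id_functor V) a) (fobj (id_functor V) b) (farr (id_functor V) a b f)) = lfun F"
        unfolding id_functor_def by (rule trans[OF mk_functor_cong ext]) simp_all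
      then show "lfun (comp_lax V V W F (id_lax V)) = lfun F" by (simp add: comp_lax_def comp_functor_def id_lax_def)
    qed (use F.lax0_in_Hom F.lax2_in_Hom F.lax2_extensional in
        \<open>auto simp: comp_lax_def id_lax_def id_functor_def F.fn.farr_Id F.tgt.Comp_Id_left\<close>)
    then show "Comp SkMon_ln V V W F (Id SkMon_ln V) = F" by simp
    have "comp_lax V W W (id_lax W) F = F"
    proof (rule lax_mon_eqI)
      have "mk_functor V (\<lambda>a. fobj (id_functor W) (fobj (lfun F) a))
          (\<lambda>a b f. farr (id_functor W) (fobj (lfun F) a) (fobj (lfun F) b) (farr (lfun F) a b f)) = lfun F"
        unfolding id_functor_def by (rule trans[OF mk_functor_cong ext]) (simp_all add: F.fn.farr_in_Hom)
      then show "lfun (comp_lax V W W (id_lax W) F) = lfun F" by (simp add: comp_lax_def comp_functor_def id_lax_def)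
    qed (use F.lax0_in_Hom F.lax2_in_Hom F.lax2_extensional in
        \<open>auto simp: comp_lax_def id_lax_def id_functor_def F.tgt.Comp_Id_right\<close>)
    then show "Comp SkMon_ln V W W (Id SkMon_ln W) F = F" by simp }
  { assume "F \<in> Hom SkMon_ln V W" "G \<in> Hom SkMon_ln W X" "H \<in> Hom SkMon_ln X Y"
    then interpret F: lax_monoidal V W F + G: lax_monoidal W X G + H: lax_monoidal X Y H by simp_all
    have "comp_lax V X Y H (comp_lax V W X G F) = comp_lax V W Y (comp_lax W X Y H G) F"
    proof (rule lax_mon_eqI)
      show "lfun (comp_lax V X Y H (comp_lax V W X G F)) = lfun (comp_lax V W Y (comp_lax W X Y H G) F)"
        by (auto simp: comp_lax_def comp_functor_def F.fn.farr_in_Hom intro!: mk_functor_cong)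
    qed (auto simp: comp_lax_def comp_functor_def F.fn.farr_in_Hom F.lax0_in_Hom F.lax2_in_Hom G.lax0_in_Hom G.lax2_in_Hom
        H.lax0_in_Hom H.lax2_in_Hom H.fn.farr_Comp G.fn.farr_in_Hom H.fn.farr_in_Hom H.tgt.Comp_assoc)
    then show "Comp SkMon_ln V X Y H (Comp SkMon_ln V W X G F) = Comp SkMon_ln V W Y (Comp SkMon_ln W X Y H G) F" by simp }
qed

text \<open>
  The common form of the categories of short and of long multicategories.
\<close>

definition mcat :: "bool \<Rightarrow> (('o, 'm) multi \<Rightarrow> bool) \<Rightarrow> (('o, 'm) multi, ('o, 'm) multi_mor) category" where
  "mcat long P =
    \<lparr>Obj = {C. P C},
     Hom = (\<lambda>C D. {F. multi_morphism (arity_ok long) (subst_ok long) C D F}),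
     Id = id_multi_mor (arity_ok long),
     Comp = (\<lambda>C D E. comp_multi_mor (arity_ok long) C)\<rparr>"

lemma mcat_simps [simp]:
  "C \<in> Obj (mcat long P) \<longleftrightarrow> P C" "F \<in> Hom (mcat long P) C D \<longleftrightarrow> multi_morphism (arity_ok long) (subst_ok long) C D F"
  "Id (mcat long P) C = id_multi_mor (arity_ok long) C"
  "Comp (mcat long P) C D E G F = comp_multi_mor (arity_ok long) C G F"
  by (simp_all add: mcat_def)

lemma short_arity: "arity_ok False = (\<lambda>n. n \<le> 4)" "subst_ok False = short_subst"
  and long_arity: "arity_ok True = (\<lambda>_. True)" "subst_ok True = (\<lambda>_ _. True)"
  by (simp_all add: arity_ok_def subst_ok_def fun_eq_iff)

lemma mcat_eqs:
  "ShMulti_lr = mcat False (\<lambda>C. short_multicategory C \<and> short_left_representable C)"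
  "ShMulti_lr_cl = mcat False (\<lambda>C. short_multicategory C \<and> short_left_representable C \<and> short_closed C)"
  "Multi_lr_cl = mcat True (\<lambda>C. multicategory C \<and> left_representable C \<and> closed_multi C)"
  unfolding ShMulti_lr_def ShMulti_lr_cl_def Multi_lr_cl_def full_subcat_def ShMulti_def Multi_def mcat_def
  by (simp_all add: short_arity long_arity)

lemma mfun_mk [simp]: "a \<in> mobj C \<Longrightarrow> mfun (mk_multi_mor A C F0 F1) a = F0 a"
  by (simp add: mk_multi_mor_def)

lemma mmap_mk [simp]: "\<lbrakk>A (length as); set as \<subseteq> mobj C; b \<in> mobj C; f \<in> mhom C as b\<rbrakk>
  \<Longrightarrow> mmap (mk_multi_mor A C F0 F1) as b f = F1 as b f"
  by (simp add: mk_multi_mor_def)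

lemma map_mfun_mk [simp]: "set as \<subseteq> mobj C \<Longrightarrow> map (mfun (mk_multi_mor A C F0 F1)) as = map F0 as"
  by auto

lemma mk_multi_mor_cong:
  assumes "\<And>a. a \<in> mobj C \<Longrightarrow> F0 a = G0 a"
    and "\<And>as b f. \<lbrakk>A (length as); set as \<subseteq> mobj C; b \<in> mobj C; f \<in> mhom C as b\<rbrakk> \<Longrightarrow> F1 as b f = G1 as b f"
  shows "mk_multi_mor A C F0 F1 = mk_multi_mor A C G0 G1"
  using assms by (auto simp: mk_multi_mor_def restrict_def fun_eq_iff)

lemma multi_morphism_id:
  assumes "multi_data (arity_ok long) (subst_ok long) C"
  shows "multi_morphism (arity_ok long) (subst_ok long) C C (id_multi_mor (arity_ok long) C)"
proof -
  interpret C: multi_data "arity_ok long" "subst_ok long" C by fact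
  show ?thesis
    unfolding id_multi_mor_def
  proof
    fix p b s as c g f
    assume *: "subst_ok long (length (p @ [b] @ s)) (length as)" "set (p @ [b] @ s) \<subseteq> mobj C" "set as \<subseteq> mobj C" "c \<in> mobj C"
      "g \<in> mhom C (p @ [b] @ s) c" "f \<in> mhom C as b"
    have "arity_ok long (length (p @ as @ s))" "arity_ok long (length (p @ [b] @ s))" "arity_ok long (length as)"
      using subst_ok_arity[OF *(1)] by (simp_all add: ac_simps)
    with * C.msub_in_mhom[OF *]
    show "mmap (mk_multi_mor (arity_ok long) C (\<lambda>a. a) (\<lambda>as b f. f)) (p @ as @ s) c (msub C p b s as c g f) =
       msub C (map (mfun (mk_multi_mor (arity_ok long) C (\<lambda>a. a) (\<lambda>as b f. f))) p) (mfun (mk_multi_mor (arity_ok long) C (\<lambda>a. a) (\<lambda>as b f. f)) b)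
        (map (mfun (mk_multi_mor (arity_ok long) C (\<lambda>a. a) (\<lambda>as b f. f))) s) (map (mfun (mk_multi_mor (arity_ok long) C (\<lambda>a. a) (\<lambda>as b f. f))) as)
        (mfun (mk_multi_mor (arity_ok long) C (\<lambda>a. a) (\<lambda>as b f. f)) c)
        (mmap (mk_multi_mor (arity_ok long) C (\<lambda>a. a) (\<lambda>as b f. f)) (p @ [b] @ s) c g)
        (mmap (mk_multi_mor (arity_ok long) C (\<lambda>a. a) (\<lambda>as b f. f)) as b f)"
      by simp
  qed (auto simp: C.mid_in_mhom arity_ok_def intro!: mk_multi_mor_cong)
qed

lemma multi_morphism_comp:
  assumes C: "multi_data (arity_ok long) (subst_ok long) C"
    and F: "multi_morphism (arity_ok long) (subst_ok long) C D F"
    and G: "multi_morphism (arity_ok long) (subst_ok long) D E G"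
  shows "multi_morphism (arity_ok long) (subst_ok long) C E (comp_multi_mor (arity_ok long) C G F)"
proof -
  interpret C: multi_data "arity_ok long" "subst_ok long" C by fact
  interpret F: multi_morphism "arity_ok long" "subst_ok long" C D F by fact
  interpret G: multi_morphism "arity_ok long" "subst_ok long" D E G by fact
  have list: "mfun F ` set as \<subseteq> mobj D" if "set as \<subseteq> mobj C" for as using that F.mfun_in_mobj by auto
  let ?H = "mk_multi_mor (arity_ok long) C (\<lambda>a. mfun G (mfun F a)) (\<lambda>as b f. mmap G (map (mfun F) as) (mfun F b) (mmap F as b f))"
  show ?thesis
    unfolding comp_multi_mor_def
  proof
    fix p b s as c g f
    assume *: "subst_ok long (length (p @ [b] @ s)) (length as)" "set (p @ [b] @ s) \<subseteq> mobj C" "set as \<subseteq> mobj C" "c \<in> mobj C"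
      "g \<in> mhom C (p @ [b] @ s) c" "f \<in> mhom C as b"
    have ar: "arity_ok long (length (p @ as @ s))" "arity_ok long (length (p @ [b] @ s))" "arity_ok long (length as)"
      using subst_ok_arity[OF *(1)] by (simp_all add: ac_simps)
    have "mmap ?H (p @ as @ s) c (msub C p b s as c g f) = mmap G (map (mfun F) (p @ as @ s)) (mfun F c) (mmap F (p @ as @ s) c (msub C p b s as c g f))"
      using * C.msub_in_mhom[OF *] ar(1) by (intro mmap_mk) auto
    also have "\<dots> = msub E (map (mfun G) (map (mfun F) p)) (mfun G (mfun F b)) (map (mfun G) (map (mfun F) s)) (map (mfun G) (map (mfun F) as)) (mfun G (mfun F c))
        (mmap G (map (mfun F) (p @ [b] @ s)) (mfun F c) (mmap F (p @ [b] @ s) c g)) (mmap G (map (mfun F) as) (mfun F b) (mmap F as b f))"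
      using * F.mmap_msub[OF *] F.mmap_in_mhom[OF ar(2) *(2,4,5)] F.mmap_in_mhom[OF ar(3) *(3) _ *(6)] list F.mfun_in_mobj
        G.mmap_msub[of "map (mfun F) p" "mfun F b" "map (mfun F) s" "map (mfun F) as" "mfun F c" "mmap F (p @ [b] @ s) c g" "mmap F as b f"]
      by simp
    finally show "mmap ?H (p @ as @ s) c (msub C p b s as c g f) =
       msub E (map (mfun ?H) p) (mfun ?H b) (map (mfun ?H) s) (map (mfun ?H) as) (mfun ?H c) (mmap ?H (p @ [b] @ s) c g) (mmap ?H as b f)"
      using * ar by (simp add: comp_def)
  next
    show "?H = mk_multi_mor (arity_ok long) C (mfun ?H) (mmap ?H)" by (rule mk_multi_mor_cong) simp_all
    show "mmap ?H as b f \<in> mhom E (map (mfun ?H) as) (mfun ?H b)"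
      if "arity_ok long (length as)" "set as \<subseteq> mobj C" "b \<in> mobj C" "f \<in> mhom C as b" for as b f
      using that F.mmap_in_mhom[OF that] G.mmap_in_mhom[of "map (mfun F) as" "mfun F b" "mmap F as b f"] list F.mfun_in_mobj by (simp add: comp_def)
  qed (simp_all add: C.mid_in_mhom F.mfun_in_mobj G.mfun_in_mobj arity_ok_def F.mmap_mid G.mmap_mid)
qed

lemma is_category_mcat:
  assumes P: "\<And>C. P C \<Longrightarrow> multi_data (arity_ok long) (subst_ok long) C"
  shows "is_category (mcat long P)"
proof
  fix C D E B F G H
  show "C \<in> Obj (mcat long P) \<Longrightarrow> Id (mcat long P) C \<in> Hom (mcat long P) C C"
    by (simp add: P multi_morphism_id)
  show "\<lbrakk>C \<in> Obj (mcat long P); F \<in> Hom (mcat long P) C D; G \<in> Hom (mcat long P) D E\<rbrakk> \<Longrightarrow> Comp (mcat long P) C D E G F \<in> Hom (mcat long P) C E"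
    using P multi_morphism_comp by fastforce
  { assume "F \<in> Hom (mcat long P) C D"
    then interpret F: multi_morphism "arity_ok long" "subst_ok long" C D F by simp
    show "Comp (mcat long P) C C D F (Id (mcat long P) C) = F"
      unfolding mcat_simps comp_multi_mor_def id_multi_mor_def
      by (rule trans[OF mk_multi_mor_cong F.extensional[symmetric]]) simp_all
    have list: "mfun F ` set as \<subseteq> mobj D" if "set as \<subseteq> mobj C" for as using that F.mfun_in_mobj by auto
    show "Comp (mcat long P) C D D (Id (mcat long P) D) F = F"
      unfolding mcat_simps comp_multi_mor_def id_multi_mor_def
      by (rule trans[OF mk_multi_mor_cong F.extensional[symmetric]]) (simp_all add: F.mfun_in_mobj list F.mmap_in_mhom)
    show "Comp (mcat long P) C E B H (Comp (mcat long P) C D E G F) = Comp (mcat long P) C D B (Comp (mcat long P) D E B H G) F"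
      unfolding mcat_simps comp_multi_mor_def
      by (rule mk_multi_mor_cong) (simp_all add: F.mfun_in_mobj list F.mmap_in_mhom comp_def) }
qed

section \<open>The functors to skew monoidal categories\<close>

text \<open>
  \<open>lax_of\<close> is functorial because its structure maps are unique solutions of equations that the
  identity, resp. the composite, satisfies.
\<close>

lemma lax_of_id:
  assumes "lr_multi long C t V"
  shows "lax_of C t C t (id_multi_mor (arity_ok long) C) = id_lax V"
proof -
  interpret C: lr_multi long C t V by fact
  let ?I = "id_multi_mor (arity_ok long) C"
  interpret lr_morphism long C t V C t V ?I
    by (intro lr_morphism.intro lr_pair.intro assms multi_morphism_id C.multi_data_axioms)
  have app_mor: "app_mor ?I h = h" if "multimap C h" "arity_ok long (length (src h))" for h
    using that multimap_ends[OF that(1)] multimap_mor[OF that(1)] by (cases h) (simp add: app_mor_def id_multi_mor_def)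
  have ob: "mfun ?I a = a" if "a \<in> mobj C" for a using that by (simp add: id_multi_mor_def)
  have "lax0 (lax_of C t C t ?I) = mor (ide V (tunit V))"
    using ob by (intro lx0_unique) (simp_all add: app_mor arity_ok_def C.idm_sub)
  moreover have "lax2 (lax_of C t C t ?I) a b = mor (ide V (tobj V a b))" if "a \<in> mobj C" "b \<in> mobj C" for a b
    using ob that by (intro lx2_unique) (simp_all add: app_mor arity_ok_def C.idm_sub)
  moreover have "lfun (lax_of C t C t ?I) = id_functor V"
    unfolding id_functor_def lax_of_def C.V_def[symmetric]
    by (simp, rule mk_functor_cong) (simp_all add: ob id_multi_mor_def arity_ok_def C.V_simps)
  ultimately show ?thesis
    by (intro lax_mon_eqI) (auto simp: id_lax_def ide_def lax_of_def)
qed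

lemma lax_of_comp:
  assumes "lr_morphism long C t V D t' W F" "lr_morphism long D t' W E t'' X G"
  shows "lax_of C t E t'' (comp_multi_mor (arity_ok long) C G F) = comp_lax V W X (lax_of D t' E t'' G) (lax_of C t D t' F)"
proof -
  interpret F: lr_morphism long C t V D t' W F by fact
  interpret G: lr_morphism long D t' W E t'' X G by fact
  let ?H = "comp_multi_mor (arity_ok long) C G F"
  interpret H: lr_morphism long C t V E t'' X ?H
    by (intro lr_morphism.intro lr_pair.intro F.C.lr_multi_axioms G.D.lr_multi_axioms multi_morphism_comp[where D = D]
        F.C.multi_data_axioms F.multi_morphism_axioms G.multi_morphism_axioms)
  let ?F = "lax_of C t D t' F" and ?G = "lax_of D t' E t'' G"
  have ob: "mfun ?H a = mfun G (mfun F a)" if "a \<in> mobj C" for a using that by (simp add: comp_multi_mor_def)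
  have obs: "map (mfun ?H) as = map (mfun G) (map (mfun F) as)" if "set as \<subseteq> mobj C" for as using that ob by auto
  have app_mor: "app_mor ?H h = app_mor G (app_mor F h)" if "multimap C h" "arity_ok long (length (src h))" for h
    using that multimap_ends[OF that(1)] multimap_mor[OF that(1)] obs[of "src h"] by (simp add: app_mor_def comp_multi_mor_def)
  have "lax0 H.L = mor (cmp X (app_arr (lfun ?G) (lx0 V W ?F)) (lx0 W X ?G))"
  proof (rule H.lx0_unique)
    have "sub E (unary (cmp X (app_arr (lfun ?G) (lx0 V W ?F)) (lx0 W X ?G))) 0 G.D.uu = sub E (app_mor G (unary (lx0 V W ?F))) 0 (app_mor G F.D.uu)"
      using G.lx_L_pre(1)[of "app_mor G (unary (lx0 V W ?F))" 0] by (simp add: G.D.unary_cmp G.unary_app_arr F.lx0_L arity_ok_def)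
    also have "\<dots> = app_mor G (app_mor F F.C.uu)"
      using F.lx0_L by (subst G.app_mor_sub[symmetric]) (simp_all add: F.C.ok_simps)
    finally show "sub E (unary (cmp X (app_arr (lfun ?G) (lx0 V W ?F)) (lx0 W X ?G))) 0 G.D.uu = app_mor ?H F.C.uu"
      by (simp add: app_mor arity_ok_def)
  qed (simp_all add: F.lx0_L G.lx0_L ob)
  moreover have "lax2 H.L a b = mor (cmp X (app_arr (lfun ?G) (lx2 V W ?F a b)) (lx2 W X ?G (mfun F a) (mfun F b)))"
    if o: "a \<in> mobj C" "b \<in> mobj C" for a b
  proof (rule H.lx2_unique)
    have "sub E (unary (cmp X (app_arr (lfun ?G) (lx2 V W ?F a b)) (lx2 W X ?G (mfun F a) (mfun F b)))) 0 (G.D.th (mfun G (mfun F a)) (mfun G (mfun F b)))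
        = sub E (app_mor G (unary (lx2 V W ?F a b))) 0 (app_mor G (F.D.th (mfun F a) (mfun F b)))"
      using o G.lx_L_pre(2)[of "app_mor G (unary (lx2 V W ?F a b))" 0] by (simp add: G.D.unary_cmp G.unary_app_arr F.lx2_L arity_ok_def)
    also have "\<dots> = app_mor G (app_mor F (F.C.th a b))"
      using o F.lx2_L by (subst G.app_mor_sub[symmetric]) (simp_all add: F.C.ok_simps)
    finally show "sub E (unary (cmp X (app_arr (lfun ?G) (lx2 V W ?F a b)) (lx2 W X ?G (mfun F a) (mfun F b)))) 0 (G.D.th (mfun ?H a) (mfun ?H b)) = app_mor ?H (F.C.th a b)"
      using o by (simp add: app_mor arity_ok_def ob)
  qed (use o in \<open>simp_all add: F.lx2_L G.lx2_L ob\<close>)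
  moreover have "lfun H.L = comp_functor V (lfun ?G) (lfun ?F)"
  proof -
    have "mk_functor V (mfun ?H) (\<lambda>a b f. mmap ?H [a] b f)
        = mk_functor V (\<lambda>a. fobj (lfun ?G) (fobj (lfun ?F) a)) (\<lambda>a b f. farr (lfun ?G) (fobj (lfun ?F) a) (fobj (lfun ?F) b) (farr (lfun ?F) a b f))"
    proof (rule mk_functor_cong)
      fix a b f assume a: "a \<in> Obj V" "b \<in> Obj V" "f \<in> Hom V a b"
      let ?f = "Arrow a b f"
      have "arr V ?f" using a by simp
      then have "app_mor ?H (unary ?f) = unary (app_arr (lfun ?G) (app_arr (lfun ?F) ?f))"
        by (simp add: app_mor arity_ok_def F.unary_app_arr G.unary_app_arr)
      then show "mmap ?H [a] b f = farr (lfun ?G) (fobj (lfun ?F) a) (fobj (lfun ?F) b) (farr (lfun ?F) a b f)"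
        by (simp add: app_mor_def unary_def app_arr_def)
    qed (simp add: ob)
    then show ?thesis by (simp add: lax_of_def comp_functor_def flip: F.C.V_def)
  qed
  ultimately show ?thesis
    by (intro lax_mon_eqI) (auto simp: comp_lax_def lax_of_def[of C t E t''] cmp_def app_arr_def lx0_def lx2_def)
qed

text \<open>
  Functoriality is \<open>lax_of_id\<close> and \<open>lax_of_comp\<close>; full faithfulness is \<open>lax_of_faithful\<close> and \<open>lax_of_F\<close>. The
  flag \<open>long\<close>, the choice \<open>\<tau>\<close> of classifiers and the predicates \<open>P\<close>, \<open>Q\<close> are left open, so that \<open>K\<close>, its closed
  version and \<open>T\<close> are all covered.
\<close>

theorem skew_of_functor:
  assumes lr: "\<And>C. P C \<Longrightarrow> lr_multi long C (\<tau> C) (skew_of C (\<tau> C))"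
    and Q: "\<And>C. P C \<Longrightarrow> Q (skew_of C (\<tau> C))"
  defines "K \<equiv> mk_functor (mcat long P) (\<lambda>C. skew_of C (\<tau> C)) (\<lambda>C D. lax_of C (\<tau> C) D (\<tau> D))"
  shows "is_functor (mcat long P) (full_subcat SkMon_ln Q) K"
    and "fully_faithful (mcat long P) (full_subcat SkMon_ln Q) K"
proof -
  have data: "multi_data (arity_ok long) (subst_ok long) C" if "P C" for C
  proof -
    interpret lr_multi long C "\<tau> C" "skew_of C (\<tau> C)" by (rule lr[OF that])
    show ?thesis by (rule multi_data_axioms)
  qed
  have mor: "lr_morphism long C (\<tau> C) (skew_of C (\<tau> C)) D (\<tau> D) (skew_of D (\<tau> D)) F"
    if "P C" "P D" "multi_morphism (arity_ok long) (subst_ok long) C D F" for C D F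
    using that lr by (intro lr_morphism.intro lr_pair.intro)
  have ln: "left_normal_skew (skew_of C (\<tau> C))" if "P C" for C
  proof -
    interpret lr_multi long C "\<tau> C" "skew_of C (\<tau> C)" by (rule lr[OF that])
    show ?thesis by (rule left_normal_skew_V)
  qed
  show "is_functor (mcat long P) (full_subcat SkMon_ln Q) K"
    unfolding K_def
  proof (rule is_functor_mk_functor)
    show "is_category (mcat long P)" by (rule is_category_mcat[OF data])
    show "is_category (full_subcat SkMon_ln Q)" by (rule is_category_full_subcat[OF is_category_SkMon_ln])
    show "skew_of C (\<tau> C) \<in> Obj (full_subcat SkMon_ln Q)" if "C \<in> Obj (mcat long P)" for C
      using that ln[of C] Q by (simp add: left_normal_skew_def left_normal_skew_axioms_def)
    show "lax_of C (\<tau> C) D (\<tau> D) F \<in> Hom (full_subcat SkMon_ln Q) (skew_of C (\<tau> C)) (skew_of D (\<tau> D))"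
      if "C \<in> Obj (mcat long P)" "D \<in> Obj (mcat long P)" "F \<in> Hom (mcat long P) C D" for C D F
      using that lr_morphism.lax_monoidal_L[OF mor[of C D F]] by simp
  qed (simp_all add: lax_of_id[OF lr] lax_of_comp[OF mor mor])
  show "fully_faithful (mcat long P) (full_subcat SkMon_ln Q) K"
    unfolding fully_faithful_def
  proof (intro ballI)
    fix C D assume "C \<in> Obj (mcat long P)" "D \<in> Obj (mcat long P)"
    then have CD: "P C" "P D" by simp_all
    have "bij_betw (lax_of C (\<tau> C) D (\<tau> D)) {F. multi_morphism (arity_ok long) (subst_ok long) C D F}
        {F. lax_monoidal (skew_of C (\<tau> C)) (skew_of D (\<tau> D)) F}"
      unfolding bij_betw_def
    proof
      show "inj_on (lax_of C (\<tau> C) D (\<tau> D)) {F. multi_morphism (arity_ok long) (subst_ok long) C D F}"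
        using lax_of_faithful mor[OF CD] by (intro inj_onI) blast
      show "lax_of C (\<tau> C) D (\<tau> D) ` {F. multi_morphism (arity_ok long) (subst_ok long) C D F}
          = {F. lax_monoidal (skew_of C (\<tau> C)) (skew_of D (\<tau> D)) F}"
      proof (intro equalityI subsetI)
        fix L assume "L \<in> {F. lax_monoidal (skew_of C (\<tau> C)) (skew_of D (\<tau> D)) F}"
        then have "lr_lax long C (\<tau> C) (skew_of C (\<tau> C)) D (\<tau> D) (skew_of D (\<tau> D)) L"
          using lr CD by (intro lr_lax.intro lr_pair.intro) simp_all
        then show "L \<in> lax_of C (\<tau> C) D (\<tau> D) ` {F. multi_morphism (arity_ok long) (subst_ok long) C D F}"
          using lr_lax.lax_of_F lr_lax.multi_morphism_F by (metis (no_types, lifting) image_eqI mem_Collect_eq)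
      qed (use lr_morphism.lax_monoidal_L[OF mor[OF CD]] in auto)
    qed
    then have "bij_betw (farr K C D) {F. multi_morphism (arity_ok long) (subst_ok long) C D F}
        {F. lax_monoidal (skew_of C (\<tau> C)) (skew_of D (\<tau> D)) F}"
      using CD by (subst bij_betw_cong[where g = "lax_of C (\<tau> C) D (\<tau> D)"]) (simp_all add: K_def)
    moreover have "Hom (mcat long P) C D = {F. multi_morphism (arity_ok long) (subst_ok long) C D F}"
      "Hom (full_subcat SkMon_ln Q) (fobj K C) (fobj K D) = {F. lax_monoidal (skew_of C (\<tau> C)) (skew_of D (\<tau> D)) F}"
      using CD by (auto simp: K_def)
    ultimately show "bij_betw (farr K C D) (Hom (mcat long P) C D) (Hom (full_subcat SkMon_ln Q) (fobj K C) (fobj K D))"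
      by simp
  qed
qed

section \<open>Essential surjectivity\<close>

lemma (in is_category) is_iso_comp:
  assumes "a \<in> Obj C" "b \<in> Obj C" "c \<in> Obj C" "is_iso C a b f" "is_iso C b c g"
  shows "is_iso C a c (Comp C a b c g f)"
proof -
  obtain f' where f: "f \<in> Hom C a b" "f' \<in> Hom C b a" "Comp C a b a f' f = Id C a" "Comp C b a b f f' = Id C b"
    using assms unfolding is_iso_def by blast
  obtain g' where g: "g \<in> Hom C b c" "g' \<in> Hom C c b" "Comp C b c b g' g = Id C b" "Comp C c b c g g' = Id C c"
    using assms unfolding is_iso_def by blast
  have "Comp C a c a (Comp C c b a f' g') (Comp C a b c g f) = Comp C a b a f' (Comp C a b b (Comp C b c b g' g) f)"
    using assms(1-3) f(1,2) g(1,2) by (simp add: Comp_assoc Comp_in_Hom)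
  then have 1: "Comp C a c a (Comp C c b a f' g') (Comp C a b c g f) = Id C a"
    using assms(1-3) f g by (simp add: Comp_Id_left)
  have "Comp C c a c (Comp C a b c g f) (Comp C c b a f' g') = Comp C c b c g (Comp C c b b (Comp C b a b f f') g')"
    using assms(1-3) f(1,2) g(1,2) by (simp add: Comp_assoc Comp_in_Hom)
  then have 2: "Comp C c a c (Comp C a b c g f) (Comp C c b a f' g') = Id C c"
    using assms(1-3) f g by (simp add: Comp_Id_left)
  show ?thesis
    unfolding is_iso_def using 1 2 assms(1-3) f g Comp_in_Hom by blast
qed

lemma is_iso_sym: "is_iso C a b f \<Longrightarrow> \<exists>g. is_iso C b a g"
  unfolding is_iso_def by blast

text \<open>Relabelling of arrows, as a lax monoidal functor whose structure maps are identities.\<close>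

definition strict :: "('o, 'm) skew_mon \<Rightarrow> ('o, 'm) skew_mon \<Rightarrow> ('o \<Rightarrow> 'o \<Rightarrow> 'm \<Rightarrow> 'm) \<Rightarrow> ('o, 'm) lax_mon" where
  "strict V W \<phi> = \<lparr>lfun = mk_functor V (\<lambda>a. a) \<phi>, lax0 = Id W (tunit W),
    lax2 = (\<lambda>a b. if a \<in> Obj V \<and> b \<in> Obj V then Id W (tobj W a b) else undefined)\<rparr>"

lemma lax_monoidal_strict:
  fixes V W :: "('o, 'm) skew_mon" and \<phi>
  defines "\<Phi> \<equiv> app_arr (mk_functor V (\<lambda>a. a) \<phi>)"
  assumes V: "skew_monoidal V" and W: "skew_monoidal W"
    and eqs: "Obj W = Obj V" "tobj W = tobj V" "tunit W = tunit V"
    and F: "is_functor V W (mk_functor V (\<lambda>a. a) \<phi>)"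
    and tns: "\<And>f g. \<lbrakk>arr V f; arr V g\<rbrakk> \<Longrightarrow> \<Phi> (tns V f g) = tns W (\<Phi> f) (\<Phi> g)"
    and al: "\<And>a b c. \<lbrakk>a \<in> Obj V; b \<in> Obj V; c \<in> Obj V\<rbrakk> \<Longrightarrow> \<Phi> (al V a b c) = al W a b c"
    and la: "\<And>a. a \<in> Obj V \<Longrightarrow> \<Phi> (la V a) = la W a"
    and ra: "\<And>a. a \<in> Obj V \<Longrightarrow> \<Phi> (ra V a) = ra W a"
  shows "lax_monoidal V W (strict V W \<phi>)"
proof -
  interpret V: skew_monoidal V by fact
  interpret W: skew_monoidal W by fact
  interpret F: is_functor V W "mk_functor V (\<lambda>a. a) \<phi>" by fact
  have l: "lfun (strict V W \<phi>) = mk_functor V (\<lambda>a. a) \<phi>" by (simp add: strict_def)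
  have l2: "lx2 V W (strict V W \<phi>) a b = ide W (tobj W a b)" if "a \<in> Obj V" "b \<in> Obj V" for a b
    using that eqs by (simp add: lx2_def strict_def ide_def)
  have l0: "lx0 V W (strict V W \<phi>) = ide W (tunit W)"
    using eqs by (simp add: lx0_def strict_def ide_def)
  have ends: "arr W (\<Phi> f)" "src (\<Phi> f) = src f" "tgt (\<Phi> f) = tgt f" if "arr V f" for f
    using that F.arr_app_arr[of f] by (simp_all add: \<Phi>_def arr_ends)
  have obj: "\<And>a b. \<lbrakk>a \<in> Obj V; b \<in> Obj V\<rbrakk> \<Longrightarrow> tobj V a b \<in> Obj V" "tunit V \<in> Obj V"
    using V.tobj_in_Obj V.tunit_in_Obj by auto
  have wobj: "\<And>a. a \<in> Obj V \<Longrightarrow> a \<in> Obj W" using eqs by simp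
  show ?thesis
  proof (rule lax_monoidalI)
    show "lax2 (strict V W \<phi>) a b = undefined" if "\<not> (a \<in> Obj V \<and> b \<in> Obj V)" for a b
      using that by (auto simp: strict_def)
    show "cmp W (app_arr (lfun (strict V W \<phi>)) (tns V f g)) (lx2 V W (strict V W \<phi>) (src f) (src g))
      = cmp W (lx2 V W (strict V W \<phi>) (tgt f) (tgt g)) (tns W (app_arr (lfun (strict V W \<phi>)) f) (app_arr (lfun (strict V W \<phi>)) g))"
      if "arr V f" "arr V g" for f g
      unfolding l \<Phi>_def[symmetric] using that by (simp add: tns l2 arr_ends ends eqs)
    show "cmp W (app_arr (lfun (strict V W \<phi>)) (al V a b c)) (cmp W (lx2 V W (strict V W \<phi>) (tobj V a b) c)
        (tns W (lx2 V W (strict V W \<phi>) a b) (ide W (lobj (strict V W \<phi>) c))))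
      = cmp W (lx2 V W (strict V W \<phi>) a (tobj V b c)) (cmp W (tns W (ide W (lobj (strict V W \<phi>) a)) (lx2 V W (strict V W \<phi>) b c))
        (al W (lobj (strict V W \<phi>) a) (lobj (strict V W \<phi>) b) (lobj (strict V W \<phi>) c)))"
      if "a \<in> Obj V" "b \<in> Obj V" "c \<in> Obj V" for a b c
      unfolding l \<Phi>_def[symmetric] using that W.tns_ide by (simp add: al l2 obj wobj flip: eqs)
    show "cmp W (app_arr (lfun (strict V W \<phi>)) (la V a)) (cmp W (lx2 V W (strict V W \<phi>) (tunit V) a)
        (tns W (lx0 V W (strict V W \<phi>)) (ide W (lobj (strict V W \<phi>) a)))) = la W (lobj (strict V W \<phi>) a)"
      if "a \<in> Obj V" for a
      unfolding l \<Phi>_def[symmetric] using that by (simp add: la l2 l0 obj wobj eqs)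
    show "cmp W (lx2 V W (strict V W \<phi>) a (tunit V)) (cmp W (tns W (ide W (lobj (strict V W \<phi>) a)) (lx0 V W (strict V W \<phi>)))
        (ra W (lobj (strict V W \<phi>) a))) = app_arr (lfun (strict V W \<phi>)) (ra V a)"
      if "a \<in> Obj V" for a
      unfolding l \<Phi>_def[symmetric] using that by (simp add: ra l2 l0 obj wobj eqs)
  qed (use V W F in \<open>simp_all add: l l0 l2 obj wobj eqs\<close>)
qed

lemma comp_strict:
  assumes "skew_monoidal V" "skew_monoidal W" "Obj W = Obj V" "tobj W = tobj V" "tunit W = tunit V"
    and F: "is_functor V W (mk_functor V (\<lambda>a. a) \<phi>)" and G: "is_functor W V (mk_functor W (\<lambda>a. a) \<psi>)"
    and inv: "\<And>a b f. \<lbrakk>a \<in> Obj V; b \<in> Obj V; f \<in> Hom V a b\<rbrakk> \<Longrightarrow> \<psi> a b (\<phi> a b f) = f"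
  shows "comp_lax V W V (strict W V \<psi>) (strict V W \<phi>) = id_lax V"
proof -
  interpret V: skew_monoidal V by fact
  interpret W: skew_monoidal W by fact
  interpret F: is_functor V W "mk_functor V (\<lambda>a. a) \<phi>" by fact
  interpret G: is_functor W V "mk_functor W (\<lambda>a. a) \<psi>" by fact
  have \<psi>_Id: "\<psi> a a (Id W a) = Id V a" if "a \<in> Obj V" for a
    using G.farr_Id[of a] that assms(3) by (simp add: W.Id_in_Hom)
  have \<phi>_in: "\<phi> a b f \<in> Hom W a b" if "a \<in> Obj V" "b \<in> Obj V" "f \<in> Hom V a b" for a b f
    using F.farr_in_Hom[OF that] that by simp
  show ?thesis
  proof (rule lax_mon_eqI)
    show "lfun (comp_lax V W V (strict W V \<psi>) (strict V W \<phi>)) = lfun (id_lax V)"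
      unfolding comp_lax_def strict_def comp_functor_def id_lax_def id_functor_def
      by (simp, rule mk_functor_cong) (simp_all add: assms(3) \<phi>_in inv)
    show "lax0 (comp_lax V W V (strict W V \<psi>) (strict V W \<phi>)) = lax0 (id_lax V)"
      using assms(3-5) W.Id_in_Hom[of "tunit V"] V.tunit_in_Obj
      by (simp add: comp_lax_def strict_def id_lax_def \<psi>_Id V.Comp_Id_left V.Id_in_Hom)
    show "lax2 (comp_lax V W V (strict W V \<psi>) (strict V W \<phi>)) a b = lax2 (id_lax V) a b" for a b
      using assms(3-5) W.Id_in_Hom[of "tobj V a b"] V.tobj_in_Obj[of a b]
      by (simp add: comp_lax_def strict_def id_lax_def \<psi>_Id V.Comp_Id_left V.Id_in_Hom)
  qed
qed

text \<open>
  The inverse of a bijective relabelling preserves whatever the relabelling does.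
\<close>

lemma strict_iso:
  fixes V W :: "('o, 'm) skew_mon" and \<phi>
  defines "\<Phi> \<equiv> app_arr (mk_functor V (\<lambda>a. a) \<phi>)"
  assumes V: "skew_monoidal V" and W: "skew_monoidal W"
    and eqs: "Obj W = Obj V" "tobj W = tobj V" "tunit W = tunit V"
    and F: "is_functor V W (mk_functor V (\<lambda>a. a) \<phi>)"
    and bij: "\<And>a b. \<lbrakk>a \<in> Obj V; b \<in> Obj V\<rbrakk> \<Longrightarrow> bij_betw (\<phi> a b) (Hom V a b) (Hom W a b)"
    and tns: "\<And>f g. \<lbrakk>arr V f; arr V g\<rbrakk> \<Longrightarrow> \<Phi> (tns V f g) = tns W (\<Phi> f) (\<Phi> g)"
    and al: "\<And>a b c. \<lbrakk>a \<in> Obj V; b \<in> Obj V; c \<in> Obj V\<rbrakk> \<Longrightarrow> \<Phi> (al V a b c) = al W a b c"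
    and la: "\<And>a. a \<in> Obj V \<Longrightarrow> \<Phi> (la V a) = la W a"
    and ra: "\<And>a. a \<in> Obj V \<Longrightarrow> \<Phi> (ra V a) = ra W a"
  shows "is_iso SkMon_ln V W (strict V W \<phi>)"
proof -
  interpret V: skew_monoidal V by fact
  interpret W: skew_monoidal W by fact
  interpret F: is_functor V W "mk_functor V (\<lambda>a. a) \<phi>" by fact
  define \<psi> where "\<psi> a b = the_inv_into (Hom V a b) (\<phi> a b)" for a b
  have \<psi>_in: "\<psi> a b k \<in> Hom V a b" and \<phi>\<psi>: "\<phi> a b (\<psi> a b k) = k" if "a \<in> Obj V" "b \<in> Obj V" "k \<in> Hom W a b" for a b k
    using bij[OF that(1,2)] that(3) unfolding \<psi>_def
    by (auto simp: bij_betw_def f_the_inv_into_f the_inv_into_into)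
  have \<psi>\<phi>: "\<psi> a b (\<phi> a b f) = f" if "a \<in> Obj V" "b \<in> Obj V" "f \<in> Hom V a b" for a b f
    using bij[OF that(1,2)] that(3) unfolding \<psi>_def by (auto simp: bij_betw_def the_inv_into_f_f)
  have \<phi>_in: "\<phi> a b f \<in> Hom W a b" if "a \<in> Obj V" "b \<in> Obj V" "f \<in> Hom V a b" for a b f
    using bij[OF that(1,2)] that(3) by (auto simp: bij_betw_def)
  have \<phi>_Id: "\<phi> a a (Id V a) = Id W a" if "a \<in> Obj V" for a
    using F.farr_Id[OF that] that by (simp add: V.Id_in_Hom)
  have \<phi>_Comp: "\<phi> a c (Comp V a b c g f) = Comp W a b c (\<phi> b c g) (\<phi> a b f)"
    if "a \<in> Obj V" "b \<in> Obj V" "c \<in> Obj V" "f \<in> Hom V a b" "g \<in> Hom V b c" for a b c f g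
    using F.farr_Comp[OF that] that by (simp add: V.Comp_in_Hom)
  have G: "is_functor W V (mk_functor W (\<lambda>a. a) \<psi>)"
  proof (rule is_functor_mk_functor)
    show "\<psi> a a (Id W a) = Id V a" if "a \<in> Obj W" for a
      using \<psi>\<phi>[of a a "Id V a"] that eqs by (simp add: \<phi>_Id V.Id_in_Hom)
    show "\<psi> a c (Comp W a b c g f) = Comp V a b c (\<psi> b c g) (\<psi> a b f)"
      if "a \<in> Obj W" "b \<in> Obj W" "c \<in> Obj W" "f \<in> Hom W a b" "g \<in> Hom W b c" for a b c f g
      using \<psi>\<phi>[of a c "Comp V a b c (\<psi> b c g) (\<psi> a b f)"] that eqs by (simp add: \<phi>_Comp \<psi>_in \<phi>\<psi> V.Comp_in_Hom)
  qed (simp_all add: V.is_category_axioms W.is_category_axioms eqs \<psi>_in)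
  interpret G: is_functor W V "mk_functor W (\<lambda>a. a) \<psi>" by (rule G)
  define \<Psi> where "\<Psi> = app_arr (mk_functor W (\<lambda>a. a) \<psi>)"
  have \<Psi>\<Phi>: "\<Psi> (\<Phi> f) = f" if "arr V f" for f
    using that arr_mor[OF that] by (cases f) (simp add: \<Psi>_def \<Phi>_def app_arr_def eqs \<phi>_in \<psi>\<phi>)
  have \<Phi>\<Psi>: "\<Phi> (\<Psi> f) = f" if "arr W f" for f
    using that arr_mor[OF that] by (cases f) (simp add: \<Psi>_def \<Phi>_def app_arr_def eqs \<psi>_in \<phi>\<psi>)
  have \<Psi>_arr: "arr V (\<Psi> f)" if "arr W f" for f using that G.arr_app_arr by (simp add: \<Psi>_def)
  have Fl: "lax_monoidal V W (strict V W \<phi>)"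
    using V W eqs F tns al la ra unfolding \<Phi>_def by (rule lax_monoidal_strict)
  have "\<Psi> (tns W f g) = tns V (\<Psi> f) (\<Psi> g)" if "arr W f" "arr W g" for f g
    using that \<Psi>\<Phi>[of "tns V (\<Psi> f) (\<Psi> g)"] by (simp add: tns \<Psi>_arr \<Phi>\<Psi>)
  moreover have "\<Psi> (al W a b c) = al V a b c" if "a \<in> Obj W" "b \<in> Obj W" "c \<in> Obj W" for a b c
    using that \<Psi>\<Phi>[of "al V a b c"] eqs by (simp add: al)
  moreover have "\<Psi> (la W a) = la V a" "\<Psi> (ra W a) = ra V a" if "a \<in> Obj W" for a
    using that \<Psi>\<Phi>[of "la V a"] \<Psi>\<Phi>[of "ra V a"] eqs by (simp_all add: la ra)
  ultimately have Gl: "lax_monoidal W V (strict W V \<psi>)"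
    using W V eqs G unfolding \<Psi>_def by (intro lax_monoidal_strict) simp_all
  have "comp_lax V W V (strict W V \<psi>) (strict V W \<phi>) = id_lax V"
    by (rule comp_strict) (use V W eqs F G \<psi>\<phi> in simp_all)
  moreover have "comp_lax W V W (strict V W \<phi>) (strict W V \<psi>) = id_lax W"
    by (rule comp_strict) (use V W eqs F G \<phi>\<psi> in simp_all)
  ultimately show ?thesis
    using Fl Gl by (auto simp: is_iso_def)
qed

text \<open>
  Two multimaps out of \<open>as\<close> that classify maps of type \<open>as \<rightarrow> d\<close> differ by an invertible unary map, and
  precomposition with it transfers the universal property for further inputs \<open>ys\<close>.
\<close>

lemma universal_transfer:
  assumes "partial_multi True C"
    and \<theta>: "multimap C \<theta>" "src \<theta> = as" and \<theta>': "multimap C \<theta>'" "src \<theta>' = as"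
    and u: "\<And>ys d. \<lbrakk>set ys \<subseteq> mobj C; d \<in> mobj C\<rbrakk> \<Longrightarrow>
      bij_betw (\<lambda>g. msub C [] (tgt \<theta>) ys as d g (mor \<theta>)) (mhom C (tgt \<theta> # ys) d) (mhom C (as @ ys) d)"
    and u': "\<And>d. d \<in> mobj C \<Longrightarrow>
      bij_betw (\<lambda>g. msub C [] (tgt \<theta>') [] as d g (mor \<theta>')) (mhom C [tgt \<theta>'] d) (mhom C as d)"
    and ys: "set ys \<subseteq> mobj C" and d: "d \<in> mobj C"
  shows "bij_betw (\<lambda>g. msub C [] (tgt \<theta>') ys as d g (mor \<theta>')) (mhom C (tgt \<theta>' # ys) d) (mhom C (as @ ys) d)"
proof -
  interpret partial_multi True C by fact
  note ok = subst_ok_def arity_ok_def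
  let ?m = "tgt \<theta>" and ?n = "tgt \<theta>'"
  have o: "?m \<in> mobj C" "?n \<in> mobj C" "set as \<subseteq> mobj C" using multimap_ends[OF \<theta>(1)] multimap_ends[OF \<theta>'(1)] \<theta>(2) by auto
  have "mor \<theta>' \<in> (\<lambda>g. msub C [] ?m [] as ?n g (mor \<theta>)) ` mhom C [?m] ?n"
    using bij_betw_imp_surj_on[OF u[of "[]" ?n]] multimap_mor[OF \<theta>'(1)] \<theta>'(2) o by simp
  then obtain i0 where "i0 \<in> mhom C [?m] ?n" "msub C [] ?m [] as ?n i0 (mor \<theta>) = mor \<theta>'"
    by (metis (no_types, lifting) imageE)
  then have i: "multimap C (Arrow [?m] ?n i0)" "Arrow [?m] ?n i0 \<bullet>[0] \<theta> = \<theta>'"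
    using o \<theta> \<theta>' by (simp_all add: sub_def)
  have "mor \<theta> \<in> (\<lambda>g. msub C [] ?n [] as ?m g (mor \<theta>')) ` mhom C [?n] ?m"
    using bij_betw_imp_surj_on[OF u'[of ?m]] multimap_mor[OF \<theta>(1)] \<theta>(2) o by simp
  then obtain j0 where "j0 \<in> mhom C [?n] ?m" "msub C [] ?n [] as ?m j0 (mor \<theta>') = mor \<theta>"
    by (metis (no_types, lifting) imageE)
  then have j: "multimap C (Arrow [?n] ?m j0)" "Arrow [?n] ?m j0 \<bullet>[0] \<theta>' = \<theta>"
    using o \<theta> \<theta>' by (simp_all add: sub_def)
  let ?i = "Arrow [?m] ?n i0" and ?j = "Arrow [?n] ?m j0"
  have ij: "?i \<bullet>[0] ?j = idm C ?n"
  proof -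
    have "?i \<bullet>[0] ?j \<bullet>[0] \<theta>' = ?i \<bullet>[0] (?j \<bullet>[0] \<theta>')"
      using i(1) j(1) \<theta>' by (subst sub_seq) (simp_all add: ok)
    also have "\<dots> = idm C ?n \<bullet>[0] \<theta>'"
      using \<theta>' by (simp only: i(2) j(2)) (simp add: idm_sub ok)
    finally have "?i \<bullet>[0] ?j \<bullet>[0] \<theta>' = idm C ?n \<bullet>[0] \<theta>'" .
    then have "mor (?i \<bullet>[0] ?j) = mor (idm C ?n)"
      using bij_betw_imp_inj_on[OF u'[of ?n]] o \<theta>' multimap_mor[OF multimap_sub[OF i(1) j(1)]] multimap_mor[OF multimap_idm[of ?n]]
      by (auto simp: sub_def idm_def ok inj_on_def)
    then show ?thesis by (simp add: sub_def idm_def)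
  qed
  have ji: "?j \<bullet>[0] ?i = idm C ?m"
  proof -
    have "?j \<bullet>[0] ?i \<bullet>[0] \<theta> = ?j \<bullet>[0] (?i \<bullet>[0] \<theta>)"
      using i(1) j(1) \<theta> by (subst sub_seq) (simp_all add: ok)
    also have "\<dots> = idm C ?m \<bullet>[0] \<theta>"
      using \<theta> by (simp only: i(2) j(2)) (simp add: idm_sub ok)
    finally have "?j \<bullet>[0] ?i \<bullet>[0] \<theta> = idm C ?m \<bullet>[0] \<theta>" .
    then have "mor (?j \<bullet>[0] ?i) = mor (idm C ?m)"
      using bij_betw_imp_inj_on[OF u[of "[]" ?m]] o \<theta> multimap_mor[OF multimap_sub[OF j(1) i(1)]] multimap_mor[OF multimap_idm[of ?m]]
      by (auto simp: sub_def idm_def ok inj_on_def)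
    then show ?thesis by (simp add: sub_def idm_def)
  qed
  let ?pre = "\<lambda>g. mor (Arrow (?n # ys) d g \<bullet>[0] ?i)" and ?pre' = "\<lambda>g. mor (Arrow (?m # ys) d g \<bullet>[0] ?j)"
  have G: "Arrow (?m # ys) d (?pre g) = Arrow (?n # ys) d g \<bullet>[0] ?i" for g by (simp add: sub_def)
  have G': "Arrow (?n # ys) d (?pre' g) = Arrow (?m # ys) d g \<bullet>[0] ?j" for g by (simp add: sub_def)
  have "bij_betw ?pre (mhom C (?n # ys) d) (mhom C (?m # ys) d)"
  proof (rule bij_betw_byWitness[where f' = ?pre'])
    show "\<forall>g \<in> mhom C (?n # ys) d. ?pre' (?pre g) = g"
    proof
      fix g assume "g \<in> mhom C (?n # ys) d"
      then have "Arrow (?n # ys) d g \<bullet>[0] ?i \<bullet>[0] ?j = Arrow (?n # ys) d g \<bullet>[0] (?i \<bullet>[0] ?j)"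
        using o ys d i(1) j(1) by (subst sub_seq) (simp_all add: ok)
      also have "\<dots> = Arrow (?n # ys) d g"
        unfolding ij using o ys d \<open>g \<in> mhom C (?n # ys) d\<close> by (simp add: sub_idm ok)
      finally show "?pre' (?pre g) = g" unfolding G by simp
    qed
    show "\<forall>g \<in> mhom C (?m # ys) d. ?pre (?pre' g) = g"
    proof
      fix g assume "g \<in> mhom C (?m # ys) d"
      then have "Arrow (?m # ys) d g \<bullet>[0] ?j \<bullet>[0] ?i = Arrow (?m # ys) d g \<bullet>[0] (?j \<bullet>[0] ?i)"
        using o ys d i(1) j(1) by (subst sub_seq) (simp_all add: ok)
      also have "\<dots> = Arrow (?m # ys) d g"
        unfolding ji using o ys d \<open>g \<in> mhom C (?m # ys) d\<close> by (simp add: sub_idm ok)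
      finally show "?pre (?pre' g) = g" unfolding G' by simp
    qed
    show "?pre ` mhom C (?n # ys) d \<subseteq> mhom C (?m # ys) d"
      using multimap_mor[OF multimap_sub[OF _ i(1), of "Arrow (?n # ys) d g" 0 for g]] o ys d by (auto simp: ok)
    show "?pre' ` mhom C (?m # ys) d \<subseteq> mhom C (?n # ys) d"
      using multimap_mor[OF multimap_sub[OF _ j(1), of "Arrow (?m # ys) d g" 0 for g]] o ys d by (auto simp: ok)
  qed
  then have "bij_betw ((\<lambda>g. msub C [] ?m ys as d g (mor \<theta>)) \<circ> ?pre) (mhom C (?n # ys) d) (mhom C (as @ ys) d)"
    using u[OF ys d] by (rule bij_betw_trans)
  moreover have "((\<lambda>g. msub C [] ?m ys as d g (mor \<theta>)) \<circ> ?pre) g = msub C [] ?n ys as d g (mor \<theta>')"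
    if "g \<in> mhom C (?n # ys) d" for g
  proof -
    have "Arrow (?n # ys) d g \<bullet>[0] ?i \<bullet>[0] \<theta> = Arrow (?n # ys) d g \<bullet>[0] (?i \<bullet>[0] \<theta>)"
      using o ys d i(1) \<theta>(1) that by (subst sub_seq) (simp_all add: ok)
    then have "mor (Arrow (?n # ys) d g \<bullet>[0] ?i \<bullet>[0] \<theta>) = mor (Arrow (?n # ys) d g \<bullet>[0] \<theta>')"
      by (simp only: i(2))
    then show ?thesis using \<theta> \<theta>' by (simp add: sub_def)
  qed
  ultimately show ?thesis by (subst bij_betw_cong[symmetric]) auto
qed

lemma partial_multi_long: "multicategory C \<Longrightarrow> partial_multi True C"
  by (simp add: multicategory_def multicategory_axioms_def partial_multi_def partial_multi_axioms_def long_arity)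

text \<open>
  The given classifiers are universal for at most two further inputs; left representability
  provides universal ones for any number of them.
\<close>

lemma lr_multi_long:
  assumes C: "multicategory C" "left_representable C" and t: "is_classifiers C t"
  shows "lr_multi True C t (skew_of C t)"
proof (intro lr_multi.intro lr_multi_axioms.intro partial_multi_long[OF C(1)] t refl)
  interpret t: is_classifiers C t by fact
  note pm = partial_multi_long[OF C(1)]
  { fix a b xs d assume o: "a \<in> mobj C" "b \<in> mobj C" "set xs \<subseteq> mobj C" "d \<in> mobj C"
    then have ab: "set [a, b] \<subseteq> mobj C" by simp
    obtain m \<theta> where m: "m \<in> mobj C" "\<theta> \<in> mhom C [a, b] m"
      and u: "\<And>ys d. \<lbrakk>set ys \<subseteq> mobj C; d \<in> mobj C\<rbrakk> \<Longrightarrow>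
        bij_betw (\<lambda>g. msub C [] m ys [a, b] d g \<theta>) (mhom C (m # ys) d) (mhom C ([a, b] @ ys) d)"
      using C(2)[unfolded left_representable_def, rule_format, OF ab] by blast
    show "bij_betw (\<lambda>g. msub C [] (ctens t a b) xs [a, b] d g (ctheta t a b)) (mhom C (ctens t a b # xs) d) (mhom C (a # b # xs) d)"
      using universal_transfer[OF pm, of "Arrow [a, b] m \<theta>" "[a, b]" "Arrow [a, b] (ctens t a b) (ctheta t a b)" xs d]
        m u o t.ctens_in_mobj t.ctheta_in_mhom t.ctheta_bij[of a b "[]"] by simp }
  { fix xs d assume o: "set xs \<subseteq> mobj C" "d \<in> mobj C"
    have nil: "set [] \<subseteq> mobj C" by simp
    obtain m \<theta> where m: "m \<in> mobj C" "\<theta> \<in> mhom C [] m"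
      and u: "\<And>ys d. \<lbrakk>set ys \<subseteq> mobj C; d \<in> mobj C\<rbrakk> \<Longrightarrow>
        bij_betw (\<lambda>g. msub C [] m ys [] d g \<theta>) (mhom C (m # ys) d) (mhom C ([] @ ys) d)"
      using C(2)[unfolded left_representable_def, rule_format, OF nil] by blast
    show "bij_betw (\<lambda>g. msub C [] (cunit t) xs [] d g (cu t)) (mhom C (cunit t # xs) d) (mhom C xs d)"
      using universal_transfer[OF pm, of "Arrow [] m \<theta>" "[]" "Arrow [] (cunit t) (cu t)" xs d]
        m u o t.cunit_in_mobj t.cu_in_mhom t.cu_bij[of "[]"] by simp }
qed

lemma proper_substI: "\<lbrakk>2 \<le> n; m \<noteq> 1; n \<le> 4; n + m \<le> 5; n \<le> m + 3\<rbrakk> \<Longrightarrow> (n, m) \<in> proper_subst"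
  unfolding proper_subst_def by simp arith

text \<open>
  If one of the three maps in an associativity law is unary, the law is functoriality or naturality.
  Otherwise the arities admit only the instances in axioms (A) and (B).
\<close>

lemma lr_multi_short:
  assumes C: "short_multicategory C" and t: "is_classifiers C t"
  shows "lr_multi False C t (skew_of C t)"
proof -
  interpret C: short_multicategory C by fact
  interpret t: is_classifiers C t by fact
  note pr = proper_substI
  show ?thesis
  proof (intro lr_multi.intro lr_multi_axioms.intro partial_multi.intro partial_multi_axioms.intro t refl)
    show "multi_data (arity_ok False) (subst_ok False) C"
      using C.multi_data_axioms by (simp add: short_arity)
    fix n m k
    { assume "subst_ok False n m" "subst_ok False m k" "subst_ok False (n + m - 1) k" "subst_ok False n (m + k - 1)"
        and pos: "0 < n" "0 < m"
      then have s: "n \<le> 4" "n + m \<le> 5" "n \<le> m + 3" "m \<le> 4" "m + k \<le> 5" "m \<le> k + 3"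
        "n + m - 1 \<le> 4" "n + m - 1 + k \<le> 5" "n + m - 1 \<le> k + 3"
        by (simp_all add: subst_ok_iff)
      consider "n = 1" "k = 1" | "m = 1" "k = 1" | "n = 1" "m = 1" | "k = 1" "n \<noteq> 1" "m \<noteq> 1" | "m = 1" "n \<noteq> 1" "k \<noteq> 1"
        | "n = 1" "m \<noteq> 1" "k \<noteq> 1" | "n \<noteq> 1" "m \<noteq> 1" "k \<noteq> 1" by blast
      then show "seq_assoc C n m k"
      proof cases
        case 4 then show ?thesis using s pos C.subst_natural[OF pr[of n m]] by simp
      next
        case 5 then show ?thesis using s pos C.subst_natural[OF pr[of n k]] by simp
      next
        case 6 then show ?thesis using s pos C.subst_natural[OF pr[of m k]] by simp
      next
        case 7
        then have "n = 2" "m = 2" "k = 2 \<or> k = 0" using s pos by arith+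
        then show ?thesis using C.axiom_A by auto
      qed (use s C.functor_laws[of n] C.functor_laws[of m] C.functor_laws[of k] in auto) }
    { assume "subst_ok False n m" "subst_ok False n k" "subst_ok False (n + m - 1) k" "subst_ok False (n + k - 1) m"
        and pos: "0 < m \<or> n = 2" "2 \<le> n"
      then have s: "n \<le> 4" "n + m \<le> 5" "n \<le> m + 3" "n + k \<le> 5" "n \<le> k + 3"
        "n + m - 1 \<le> 4" "n + m - 1 + k \<le> 5" "n + m - 1 \<le> k + 3" "n + k - 1 \<le> 4" "n + k - 1 + m \<le> 5" "n + k - 1 \<le> m + 3"
        by (simp_all add: subst_ok_iff)
      consider "m = 1" "k = 1" | "m = 1" "k \<noteq> 1" | "m \<noteq> 1" "k = 1" | "m \<noteq> 1" "k \<noteq> 1" by blast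
      then show "par_assoc C n m k"
      proof cases
        case 1 then show ?thesis using s C.functor_laws[of n] by simp
      next
        case 2 then show ?thesis using s pos C.subst_natural[OF pr[of n k]] by simp
      next
        case 3 then show ?thesis using s pos C.subst_natural[OF pr[of n m]] by simp
      next
        case 4
        then have "n = 2" "m = 2 \<or> m = 0" "k = 2 \<or> k = 0" using s pos by arith+
        then show ?thesis using C.axiom_B by auto
      qed }
  qed (use t.ctheta_bij t.cu_bij in simp_all)
qed

text \<open>
  The identity of \<open>C\<close>, read with one choice of classifiers at its source and another at its target;
  functoriality of \<open>lax_of\<close> makes the two readings inverse to each other.
\<close>

lemma change_classifiers:
  assumes t: "lr_multi long C t V" and s: "lr_multi long C s W"
  shows "is_iso SkMon_ln V W (lax_of C t C s (id_multi_mor (arity_ok long) C))"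
proof -
  interpret t: lr_multi long C t V by fact
  interpret s: lr_multi long C s W by fact
  let ?I = "id_multi_mor (arity_ok long) C"
  have ts: "lr_morphism long C t V C s W ?I" and st: "lr_morphism long C s W C t V ?I"
    using t s multi_morphism_id[OF t.multi_data_axioms] by (auto intro!: lr_morphism.intro lr_pair.intro)
  have II: "comp_multi_mor (arity_ok long) C ?I ?I = ?I"
    unfolding comp_multi_mor_def id_multi_mor_def by (rule mk_multi_mor_cong) simp_all
  have "comp_lax V W V (lax_of C s C t ?I) (lax_of C t C s ?I) = id_lax V"
    using lax_of_comp[OF ts st] lax_of_id[OF t] by (simp add: II)
  moreover have "comp_lax W V W (lax_of C t C s ?I) (lax_of C s C t ?I) = id_lax W"
    using lax_of_comp[OF st ts] lax_of_id[OF s] by (simp add: II)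
  ultimately show ?thesis
    using lr_morphism.lax_monoidal_L[OF ts] lr_morphism.lax_monoidal_L[OF st] by (auto simp: is_iso_def)
qed

context left_normal_skew
begin

text \<open>The arrow \<open>h : \<one> \<lhd> as \<rightarrow> b\<close> as a multimap \<open>as \<rightarrow> b\<close> of \<open>multi_of V\<close>.\<close>

definition as_multimap :: "'a list \<Rightarrow> ('a, 'a, 'b) arrow \<Rightarrow> ('a list, 'a, 'b) arrow" where
  "as_multimap as h = Arrow as (tgt h) (mor h)"

lemma as_multimap_simps [simp]: "src (as_multimap as h) = as" "tgt (as_multimap as h) = tgt h"
  by (simp_all add: as_multimap_def)

lemma sub_as_multimap:
  assumes "src g = \<one> \<lhd> (p @ [tgt f] @ s)" "src f = \<one> \<lhd> as"
  shows "sub (multi_of V) (as_multimap (p @ [tgt f] @ s) g) (length p) (as_multimap as f) = as_multimap (p @ as @ s) (sbs V p s as g f)"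
  using assms by (simp add: sub_def as_multimap_def)

lemma ext_cmp: "\<lbrakk>arr V k; arr V g; tgt g = src k; src g = \<one> \<lhd> as; set as \<subseteq> Obj V; x \<in> Obj V\<rbrakk>
  \<Longrightarrow> ext V as (k \<cdot> g) x = (ide V x \<odot> k) \<cdot> ext V as g x"
  by (simp add: ext_def ide_tns_cmp)

text \<open>
  The linear family of the classifier of \<open>b, c\<close> is \<open>\<alpha>\<close>: this is why \<open>V\<close> can be recovered from its multimaps.
\<close>

lemma ext_two:
  assumes "b \<in> Obj V" "c \<in> Obj V" "x \<in> Obj V"
  shows "ext V [b, c] (la V b \<odot> ide V c) x = al V x b c"
proof -
  let ?u = "ide V x \<odot> la V b" and ?r = "ra V x \<odot> ide V b"
  have "ext V [b, c] (la V b \<odot> ide V c) x = ((ide V x \<odot> (la V b \<odot> ide V c)) \<cdot> al V x (\<one> \<otimes> b) c) \<cdot> (al V x \<one> b \<odot> ide V c) \<cdot> (?r \<odot> ide V c)"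
    using assms by (simp add: ext_def)
  also have "(ide V x \<odot> (la V b \<odot> ide V c)) \<cdot> al V x (\<one> \<otimes> b) c = al V x b c \<cdot> (?u \<odot> ide V c)"
    using assms al_nat[of "ide V x" "la V b" "ide V c"] by simp
  also have "(al V x b c \<cdot> (?u \<odot> ide V c)) \<cdot> (al V x \<one> b \<odot> ide V c) \<cdot> (?r \<odot> ide V c)
      = al V x b c \<cdot> ((?u \<cdot> al V x \<one> b \<cdot> ?r) \<odot> ide V c)"
    using assms by (simp add: tns_ide_cmp)
  finally show ?thesis using assms by (simp add: la_al_ra)
qed

lemma lr_multi_std: "lr_multi True (multi_of V) (std_classifiers V) (skew_of (multi_of V) (std_classifiers V))"
  by (rule lr_multi_long[OF multicategory_multi_of left_representable_multi_of is_classifiers_std])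

text \<open>
  Precomposition with \<open>\<lambda>\<close> identifies \<open>V\<close> with the skew monoidal category of its multicategory: all
  structure maps are determined by equations between multimaps, which are evaluated in \<open>V\<close>.
\<close>

lemma skew_of_multi_of_iso: "\<exists>F. is_iso SkMon_ln V (skew_of (multi_of V) (std_classifiers V)) F"
proof -
  let ?M = "multi_of V" and ?s = "std_classifiers V"
  define W where "W = skew_of ?M ?s"
  interpret X: lr_multi True ?M ?s W using lr_multi_std by (simp add: W_def)
  define \<phi> where "\<phi> a b f = mor (Arrow a b f \<cdot> la V a)" for a b f
  let ?F = "mk_functor V (\<lambda>a. a) \<phi>"
  have W: "Obj W = Obj V" "tobj W = tobj V" "tunit W = tunit V"
    by (simp_all add: W_def skew_of_def Let_def std_classifiers_def)
  have idm: "idm ?M a = as_multimap [a] (la V a)" for a by (simp add: idm_def as_multimap_def la_def)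
  have th: "X.th a b = as_multimap [a, b] (la V a \<odot> ide V b)" for a b
    by (simp add: X.th_def as_multimap_def) (simp add: std_classifiers_def)
  have uu: "X.uu = as_multimap [] (ide V \<one>)"
    by (simp add: X.uu_def as_multimap_def) (simp add: std_classifiers_def ide_def)
  have \<Phi>: "unary (app_arr ?F f) = as_multimap [src f] (f \<cdot> la V (src f))" if "arr V f" for f
    using that arr_mor[OF that] by (simp add: unary_def app_arr_def as_multimap_def \<phi>_def)
  have bmarr: "multimap ?M (as_multimap as h)" if "arr V h" "src h = \<one> \<lhd> as" "set as \<subseteq> Obj V" for as h
    using that arr_mor[OF that(1)] by (simp add: as_multimap_def)
  have \<phi>_in: "\<phi> a b f \<in> Hom W a b" if "a \<in> Obj V" "b \<in> Obj V" "f \<in> Hom V a b" for a b f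
    using that by (auto simp: X.V_simps \<phi>_def intro!: mor_in_Hom)
  \<comment> \<open>substitution into a unary map and into the first and second input of a binary one, in terms of \<open>V\<close>\<close>
  have T1: "sub ?M (unary (app_arr ?F k)) 0 (as_multimap as h) = as_multimap as (k \<cdot> h)"
    if "arr V k" "arr V h" "tgt h = src k" "src h = \<one> \<lhd> as" "set as \<subseteq> Obj V" for k h as
    using that sub_as_multimap[of "k \<cdot> la V (src k)" "[]" h "[]" as] by (simp add: \<Phi> sbs_def ext_one)
  have T2: "sub ?M (as_multimap [b, d] (g \<odot> ide V d)) 0 (as_multimap as h) = as_multimap (as @ [d]) (((g \<cdot> la_inv V b) \<cdot> h) \<odot> ide V d)"
    if "arr V h" "arr V g" "src g = \<one> \<otimes> b" "tgt h = b" "src h = \<one> \<lhd> as" "set as \<subseteq> Obj V" "d \<in> Obj V" for b d g h as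
    using that sub_as_multimap[of "g \<odot> ide V d" "[]" h "[d]" as] arr_ends(2)[OF that(1)] by (simp add: sbs_def ext_one tns_cmp)
  have T3: "sub ?M (as_multimap [x, d] g) 1 (as_multimap as h) = as_multimap (x # as) (g \<cdot> ext V as h (\<one> \<otimes> x))"
    if "arr V h" "tgt h = d" "src h = \<one> \<lhd> as" "src g = (\<one> \<otimes> x) \<otimes> d" for x d g h as
    using that sub_as_multimap[of g "[x]" h "[]" as] by (simp add: sbs_def)
  have F: "is_functor V W ?F"
  proof (rule is_functor_mk_functor)
    show "\<phi> a a (Id V a) = Id W a" if "a \<in> Obj V" for a
      using that cmp_ide_left[of "la V a" a] by (simp add: \<phi>_def X.V_simps ide_def[symmetric]) (simp add: la_def)
    show "\<phi> a c (Comp V a b c g f) = Comp W a b c (\<phi> b c g) (\<phi> a b f)"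
      if "a \<in> Obj V" "b \<in> Obj V" "c \<in> Obj V" "f \<in> Hom V a b" "g \<in> Hom V b c" for a b c f g
    proof -
      let ?f = "Arrow a b f" and ?g = "Arrow b c g"
      have "sub ?M (unary (app_arr ?F ?g)) 0 (unary (app_arr ?F ?f)) = unary (app_arr ?F (?g \<cdot> ?f))"
        using that T1[of ?g "?f \<cdot> la V a" "[a]"] by (simp add: \<Phi>)
      then show ?thesis using that Comp_in_Hom[of a b c f g]
        by (simp add: unary_def app_arr_def sub_def X.V_simps cmp_def)
    qed
  qed (simp_all add: is_category_axioms X.is_category_V W \<phi>_in)
  interpret F: is_functor V W ?F by (rule F)
  have "is_iso SkMon_ln V W (strict V W \<phi>)"
  proof (rule strict_iso)
    show "skew_monoidal V" "skew_monoidal W" by unfold_locales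
    show "bij_betw (\<phi> a b) (Hom V a b) (Hom W a b)" if "a \<in> Obj V" "b \<in> Obj V" for a b
      using bij_betw_precomp_iso[of "la V a" "la_inv V a" b] that by (simp add: \<phi>_def[abs_def] X.V_simps)
    show "app_arr ?F (f \<odot> g) = app_arr ?F f \<odot>\<^bsub>W\<^esub> app_arr ?F g" if fg: "arr V f" "arr V g" for f g
    proof (rule X.cancel2[of _ "src f" "src g"])
      have "sub ?M (unary (app_arr ?F f \<odot>\<^bsub>W\<^esub> app_arr ?F g)) 0 (X.th (src f) (src g))
          = sub ?M (sub ?M (X.th (tgt f) (tgt g)) 0 (unary (app_arr ?F f))) 1 (unary (app_arr ?F g))"
        using X.tns_th(2)[of "app_arr ?F f" "app_arr ?F g"] fg by simp
      also have "sub ?M (X.th (tgt f) (tgt g)) 0 (unary (app_arr ?F f)) = as_multimap [src f, tgt g] ((f \<cdot> la V (src f)) \<odot> ide V (tgt g))"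
        using fg T2[of "f \<cdot> la V (src f)" "la V (tgt f)" "tgt f" "[src f]" "tgt g"] by (simp add: th \<Phi>)
      also have "sub ?M \<dots> 1 (unary (app_arr ?F g)) = as_multimap [src f, src g] (((f \<cdot> la V (src f)) \<odot> ide V (tgt g)) \<cdot> (ide V (\<one> \<otimes> src f) \<odot> g))"
        using fg T3[of "g \<cdot> la V (src g)" "tgt g" "[src g]" "(f \<cdot> la V (src f)) \<odot> ide V (tgt g)" "src f"] by (simp add: \<Phi> ext_cmp)
      also have "((f \<cdot> la V (src f)) \<odot> ide V (tgt g)) \<cdot> (ide V (\<one> \<otimes> src f) \<odot> g) = (f \<odot> g) \<cdot> (la V (src f) \<odot> ide V (src g))"
        using fg by (simp add: tns_cmp)
      also have "as_multimap [src f, src g] \<dots> = sub ?M (unary (app_arr ?F (f \<odot> g))) 0 (X.th (src f) (src g))"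
        using fg T1[of "f \<odot> g" "la V (src f) \<odot> ide V (src g)" "[src f, src g]"] by (simp add: th)
      finally show "sub ?M (unary (app_arr ?F (f \<odot> g))) 0 (X.th (src f) (src g)) = sub ?M (unary (app_arr ?F f \<odot>\<^bsub>W\<^esub> app_arr ?F g)) 0 (X.th (src f) (src g))" ..
    qed (use fg X.tns_th(1)[of "app_arr ?F f" "app_arr ?F g"] in \<open>simp_all add: W\<close>)
    show "app_arr ?F (al V a b c) = al W a b c" if o: "a \<in> Obj V" "b \<in> Obj V" "c \<in> Obj V" for a b c
    proof (rule X.cancel3[of _ a b c])
      have "sub ?M (sub ?M (unary (app_arr ?F (al V a b c))) 0 (X.th (a \<otimes> b) c)) 0 (X.th a b)
          = sub ?M (unary (app_arr ?F (al V a b c))) 0 (sub ?M (X.th (a \<otimes> b) c) 0 (X.th a b))"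
        using o by (subst X.sub_seq) (simp_all add: X.ok_simps W)
      also have "sub ?M (X.th (a \<otimes> b) c) 0 (X.th a b) = as_multimap [a, b, c] ((la V a \<odot> ide V b) \<odot> ide V c)"
        using o T2[of "la V a \<odot> ide V b" "la V (a \<otimes> b)" "a \<otimes> b" "[a, b]" c] by (simp add: th)
      also have "sub ?M (unary (app_arr ?F (al V a b c))) 0 \<dots> = as_multimap [a, b, c] (al V a b c \<cdot> ((la V a \<odot> ide V b) \<odot> ide V c))"
        using o by (intro T1) simp_all
      also have "al V a b c \<cdot> ((la V a \<odot> ide V b) \<odot> ide V c) = (la V a \<odot> ide V (b \<otimes> c)) \<cdot> al V (\<one> \<otimes> a) b c"
        using o al_nat[of "la V a" "ide V b" "ide V c"] by simp
      also have "as_multimap [a, b, c] \<dots> = sub ?M (X.th a (b \<otimes> c)) 1 (X.th b c)"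
        using o T3[of "la V b \<odot> ide V c" "b \<otimes> c" "[b, c]" "la V a \<odot> ide V (b \<otimes> c)" a] by (simp add: th ext_two)
      also have "\<dots> = sub ?M (sub ?M (unary (al W a b c)) 0 (X.th (a \<otimes> b) c)) 0 (X.th a b)"
        using o X.al_th(2)[of a b c] by (simp add: W)
      finally show "sub ?M (sub ?M (unary (app_arr ?F (al V a b c))) 0 (X.th (a \<otimes>\<^bsub>W\<^esub> b) c)) 0 (X.th a b)
        = sub ?M (sub ?M (unary (al W a b c)) 0 (X.th (a \<otimes>\<^bsub>W\<^esub> b) c)) 0 (X.th a b)" by (simp add: W)
    qed (use o in \<open>simp_all add: W\<close>)
    fix a assume o: "a \<in> Obj V"
    show "app_arr ?F (la V a) = la W a"
    proof (rule X.cancel_uu2[of _ a])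
      have "sub ?M (sub ?M (unary (app_arr ?F (la V a))) 0 (X.th \<one> a)) 0 X.uu = sub ?M (unary (app_arr ?F (la V a))) 0 (sub ?M (X.th \<one> a) 0 X.uu)"
        using o by (subst X.sub_seq) (simp_all add: X.ok_simps W)
      also have "sub ?M (X.th \<one> a) 0 X.uu = as_multimap [a] (ide V \<one> \<odot> ide V a)"
        using o T2[of "ide V \<one>" "la V \<one>" \<one> "[]" a] by (simp add: th uu)
      also have "sub ?M (unary (app_arr ?F (la V a))) 0 \<dots> = as_multimap [a] (la V a)"
        using o T1[of "la V a" "ide V \<one> \<odot> ide V a" "[a]"] by simp
      finally show "sub ?M (sub ?M (unary (app_arr ?F (la V a))) 0 (X.th \<one>\<^bsub>W\<^esub> a)) 0 X.uu = sub ?M (sub ?M (unary (la W a)) 0 (X.th \<one>\<^bsub>W\<^esub> a)) 0 X.uu"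
        using o X.la_th(2)[of a] by (simp add: idm W)
    qed (use o in \<open>simp_all add: W\<close>)
    have "ext V [] (ide V \<one>) (\<one> \<otimes> a) = ra V (\<one> \<otimes> a)"
      using o by (simp add: ext_def)
    then have "unary (ra W a) = as_multimap [a] ((la V a \<odot> ide V \<one>) \<cdot> ra V (\<one> \<otimes> a))"
      using o X.ra_th(2)[of a] T3[of "ide V \<one>" \<one> "[]" "la V a \<odot> ide V \<one>" a] by (simp add: th uu W)
    also have "\<dots> = unary (app_arr ?F (ra V a))"
      using o ra_nat[of "la V a"] by (simp add: \<Phi>)
    finally show "app_arr ?F (ra V a) = ra W a" by (simp add: unary_inject)
  qed (simp_all add: W F)
  then show ?thesis by (auto simp: W_def)
qed

lemma multi_of_ess:
  assumes t: "is_classifiers (multi_of V) t"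
  shows "\<exists>F. is_iso SkMon_ln (skew_of (multi_of V) t) V F"
proof -
  have lr: "lr_multi True (multi_of V) t (skew_of (multi_of V) t)"
    by (rule lr_multi_long[OF multicategory_multi_of left_representable_multi_of t])
  interpret T: lr_multi True "multi_of V" t "skew_of (multi_of V) t" by (rule lr)
  interpret S: lr_multi True "multi_of V" "std_classifiers V" "skew_of (multi_of V) (std_classifiers V)" by (rule lr_multi_std)
  interpret S: is_category SkMon_ln by (rule is_category_SkMon_ln)
  obtain F' where "is_iso SkMon_ln V (skew_of (multi_of V) (std_classifiers V)) F'"
    using skew_of_multi_of_iso by blast
  then obtain F where "is_iso SkMon_ln (skew_of (multi_of V) (std_classifiers V)) V F"
    using is_iso_sym[of SkMon_ln V] by metis
  moreover have "skew_of (multi_of V) t \<in> Obj SkMon_ln" "skew_of (multi_of V) (std_classifiers V) \<in> Obj SkMon_ln" "V \<in> Obj SkMon_ln"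
    using T.Vl.left_normal T.Vl.skew_monoidal_axioms S.Vl.left_normal S.Vl.skew_monoidal_axioms left_normal skew_monoidal_axioms by simp_all
  ultimately show ?thesis
    using S.is_iso_comp[OF _ _ _ change_classifiers[OF lr lr_multi_std]] by blast
qed

end

section \<open>The forgetful functor and the theorem\<close>

lemma U_obj_simps [simp]:
  "mobj (U_obj C) = mobj C" "length as \<le> 4 \<Longrightarrow> mhom (U_obj C) as b = mhom C as b" "mid (U_obj C) = mid C"
  by (simp_all add: U_obj_def)

lemma msub_U_obj: "short_subst (length (p @ [b] @ s)) (length as) \<Longrightarrow> msub (U_obj C) p b s as c = msub C p b s as c"
  by (simp add: U_obj_def)

lemma mhom_U_obj: "f \<in> mhom (U_obj C) as b \<longleftrightarrow> length as \<le> 4 \<and> f \<in> mhom C as b"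
  by (simp add: U_obj_def)

text \<open>
  \<open>U_obj\<close> is left undefined on the other substitutions, so that a law survives if all four of its
  substitutions do.
\<close>

lemma seq_assoc_U_obj:
  assumes C: "seq_assoc C n m k" and ok: "short_subst n m" "short_subst m k" "short_subst (n + m - 1) k" "short_subst n (m + k - 1)"
  shows "seq_assoc (U_obj C) n m k"
  unfolding seq_assoc_def
proof (intro allI impI, elim conjE)
  fix p b s q c r as d f g h
  assume l: "length (p @ [b] @ s) = n" "length (q @ [c] @ r) = m" "length as = k"
    and o: "set (p @ [b] @ s) \<subseteq> mobj (U_obj C)" "set (q @ [c] @ r) \<subseteq> mobj (U_obj C)" "set as \<subseteq> mobj (U_obj C)" "d \<in> mobj (U_obj C)"
    and fgh: "f \<in> mhom (U_obj C) (p @ [b] @ s) d" "g \<in> mhom (U_obj C) (q @ [c] @ r) b" "h \<in> mhom (U_obj C) as c"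
  have l': "length (q @ as @ r) = m + k - 1" "length ((p @ q) @ [c] @ (r @ s)) = n + m - 1" using l by auto
  have "msub C p b s (q @ as @ r) d f (msub C q c r as b g h)
     = msub C (p @ q) c (r @ s) as d (msub C p b s (q @ [c] @ r) d f g) h"
    using C[unfolded seq_assoc_def, rule_format, of p b s q c r as d f g h] l o fgh by (simp add: mhom_U_obj)
  moreover have "msub (U_obj C) p b s (q @ as @ r) d = msub C p b s (q @ as @ r) d"
    "msub (U_obj C) q c r as b = msub C q c r as b"
    "msub (U_obj C) (p @ q) c (r @ s) as d = msub C (p @ q) c (r @ s) as d"
    "msub (U_obj C) p b s (q @ [c] @ r) d = msub C p b s (q @ [c] @ r) d"
    by (rule msub_U_obj; simp only: l l' ok)+
  ultimately show "msub (U_obj C) p b s (q @ as @ r) d f (msub (U_obj C) q c r as b g h)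
     = msub (U_obj C) (p @ q) c (r @ s) as d (msub (U_obj C) p b s (q @ [c] @ r) d f g) h"
    by simp
qed

lemma par_assoc_U_obj:
  assumes C: "par_assoc C n m k" and ok: "short_subst n m" "short_subst n k" "short_subst (n + m - 1) k" "short_subst (n + k - 1) m"
  shows "par_assoc (U_obj C) n m k"
  unfolding par_assoc_def
proof (intro allI impI, elim conjE)
  fix p b q c r as bs d f g h
  assume l: "length (p @ [b] @ q @ [c] @ r) = n" "length as = m" "length bs = k"
    and o: "set (p @ [b] @ q @ [c] @ r) \<subseteq> mobj (U_obj C)" "set as \<subseteq> mobj (U_obj C)" "set bs \<subseteq> mobj (U_obj C)" "d \<in> mobj (U_obj C)"
    and fgh: "f \<in> mhom (U_obj C) (p @ [b] @ q @ [c] @ r) d" "g \<in> mhom (U_obj C) as b" "h \<in> mhom (U_obj C) bs c"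
  have l': "length ((p @ as @ q) @ [c] @ r) = n + m - 1" "length (p @ [b] @ (q @ bs @ r)) = n + k - 1"
    "length ((p @ [b] @ q) @ [c] @ r) = n" using l by auto
  have "msub C (p @ as @ q) c r bs d (msub C p b (q @ [c] @ r) as d f g) h
     = msub C p b (q @ bs @ r) as d (msub C (p @ [b] @ q) c r bs d f h) g"
    using C[unfolded par_assoc_def, rule_format, of p b q c r as bs d f g h] l o fgh by (simp add: mhom_U_obj)
  moreover have "msub (U_obj C) (p @ as @ q) c r bs d = msub C (p @ as @ q) c r bs d"
    "msub (U_obj C) p b (q @ [c] @ r) as d = msub C p b (q @ [c] @ r) as d"
    "msub (U_obj C) p b (q @ bs @ r) as d = msub C p b (q @ bs @ r) as d"
    "msub (U_obj C) (p @ [b] @ q) c r bs d = msub C (p @ [b] @ q) c r bs d"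
    by (rule msub_U_obj; simp only: l l' ok)+
  ultimately show "msub (U_obj C) (p @ as @ q) c r bs d (msub (U_obj C) p b (q @ [c] @ r) as d f g) h
     = msub (U_obj C) p b (q @ bs @ r) as d (msub (U_obj C) (p @ [b] @ q) c r bs d f h) g"
    by simp
qed

lemma short_multicategory_U_obj:
  assumes "multicategory C"
  shows "short_multicategory (U_obj C)"
proof -
  interpret C: multicategory C by fact
  have seq: "seq_assoc (U_obj C) n m k"
    if "short_subst n m" "short_subst m k" "short_subst (n + m - 1) k" "short_subst n (m + k - 1)" for n m k
    using seq_assoc_U_obj[OF C.seq_assoc that] .
  have par: "par_assoc (U_obj C) n m k"
    if "short_subst n m" "short_subst n k" "short_subst (n + m - 1) k" "short_subst (n + k - 1) m" for n m k
    using par_assoc_U_obj[OF C.par_assoc that] .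
  show ?thesis
  proof
    show "a \<in> mobj (U_obj C) \<Longrightarrow> mid (U_obj C) a \<in> mhom (U_obj C) [a] a" for a
      using C.mid_in_mhom by simp
    show "msub (U_obj C) p b s as c g f \<in> mhom (U_obj C) (p @ as @ s) c"
      if "short_subst (length (p @ [b] @ s)) (length as)" "set (p @ [b] @ s) \<subseteq> mobj (U_obj C)" "set as \<subseteq> mobj (U_obj C)" "c \<in> mobj (U_obj C)"
        "g \<in> mhom (U_obj C) (p @ [b] @ s) c" "f \<in> mhom (U_obj C) as b" for p b s as c g f
    proof -
      have "length (p @ as @ s) \<le> 4"
        using subst_ok_arity[of False "length (p @ [b] @ s)" "length as"] that(1) by (simp add: short_arity ac_simps)
      then show ?thesis
        using that(2-) C.msub_in_mhom[of p b s as c g f] by (simp add: msub_U_obj[OF that(1)] mhom_U_obj)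
    qed
    show "msub (U_obj C) p b s [b] c g (mid (U_obj C) b) = g"
      if "length (p @ [b] @ s) \<le> 4" "set (p @ [b] @ s) \<subseteq> mobj (U_obj C)" "c \<in> mobj (U_obj C)" "g \<in> mhom (U_obj C) (p @ [b] @ s) c" for p b s c g
      using that C.msub_mid_inner[of p b s c g] by (subst msub_U_obj) (simp_all add: mhom_U_obj short_subst_def)
    show "msub (U_obj C) [] b [] as b (mid (U_obj C) b) f = f"
      if "length as \<le> 4" "set as \<subseteq> mobj (U_obj C)" "b \<in> mobj (U_obj C)" "f \<in> mhom (U_obj C) as b" for as b f
      using that C.msub_mid_outer[of as b f] by (subst msub_U_obj) (simp_all add: mhom_U_obj short_subst_def)
    fix n m k :: nat
    show "seq_assoc (U_obj C) n 1 1 \<and> seq_assoc (U_obj C) 1 1 n \<and> seq_assoc (U_obj C) 1 n 1 \<and> par_assoc (U_obj C) n 1 1" if "n \<le> 4"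
      using that by (intro conjI seq par) (simp_all add: short_subst_def)
    show "seq_assoc (U_obj C) n m 1 \<and> seq_assoc (U_obj C) 1 n m \<and> seq_assoc (U_obj C) n 1 m \<and> par_assoc (U_obj C) n m 1 \<and> par_assoc (U_obj C) n 1 m"
      if "(n, m) \<in> proper_subst"
      using that by (intro conjI seq par) (auto simp: short_subst_def proper_subst_def)
    show "seq_assoc (U_obj C) 2 n k" if "(n, k) \<in> {(2,2), (2,0)}"
      using that by (intro seq) (auto simp: short_subst_def proper_subst_def)
    show "par_assoc (U_obj C) 2 n k" if "(n, k) \<in> {(2,2), (2,0), (0,2), (0,0)}"
      using that by (intro par) (auto simp: short_subst_def proper_subst_def)
  qed
qed

lemma is_classifiers_U_obj:
  fixes C :: "('o, 'm) multi"
  shows "is_classifiers (U_obj C) = is_classifiers C"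
proof
  fix t :: "('o, 'm) classifiers"
  have s: "short_subst (Suc (length xs)) (Suc (Suc 0))" "short_subst (Suc (length xs)) 0" if "length xs \<le> 2" for xs :: "'o list"
  proof -
    have "length xs = 0 \<or> length xs = 1 \<or> length xs = 2" using that by arith
    then show "short_subst (Suc (length xs)) (Suc (Suc 0))" "short_subst (Suc (length xs)) 0"
      by (auto simp: short_subst_def proper_subst_def)
  qed
  have "bij_betw (\<lambda>g. msub (U_obj C) [] (ctens t a b) xs [a, b] d g (ctheta t a b))
            (mhom (U_obj C) (ctens t a b # xs) d) (mhom (U_obj C) (a # b # xs) d)
      = bij_betw (\<lambda>g. msub C [] (ctens t a b) xs [a, b] d g (ctheta t a b)) (mhom C (ctens t a b # xs) d) (mhom C (a # b # xs) d)"
    "bij_betw (\<lambda>g. msub (U_obj C) [] (cunit t) xs [] d g (cu t)) (mhom (U_obj C) (cunit t # xs) d) (mhom (U_obj C) xs d)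
      = bij_betw (\<lambda>g. msub C [] (cunit t) xs [] d g (cu t)) (mhom C (cunit t # xs) d) (mhom C xs d)"
    if "length xs \<le> 2" for a b xs d
    using that s[of xs] by (simp_all add: msub_U_obj)
  then show "is_classifiers (U_obj C) t = is_classifiers C t"
    unfolding is_classifiers_def U_obj_simps(1) by (intro conj_cong) auto
qed

lemma skew_of_U_obj: "skew_of (U_obj C) t = skew_of C t"
  by (simp add: skew_of_def Let_def msub_U_obj short_subst_def proper_subst_def)

lemma left_representable_classifiers:
  assumes "left_representable C"
  shows "\<exists>t. is_classifiers C t"
proof -
  have ex: "\<exists>m \<theta>. m \<in> mobj C \<and> \<theta> \<in> mhom C as m \<and> (\<forall>ys d. set ys \<subseteq> mobj C \<and> d \<in> mobj C \<longrightarrow>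
           bij_betw (\<lambda>g. msub C [] m ys as d g \<theta>) (mhom C (m # ys) d) (mhom C (as @ ys) d))" if "set as \<subseteq> mobj C" for as
    using assms that unfolding left_representable_def by blast
  then obtain m \<theta> where m: "\<And>as. set as \<subseteq> mobj C \<Longrightarrow> m as \<in> mobj C" "\<And>as. set as \<subseteq> mobj C \<Longrightarrow> \<theta> as \<in> mhom C as (m as)"
    "\<And>as ys d. \<lbrakk>set as \<subseteq> mobj C; set ys \<subseteq> mobj C; d \<in> mobj C\<rbrakk> \<Longrightarrow>
           bij_betw (\<lambda>g. msub C [] (m as) ys as d g (\<theta> as)) (mhom C (m as # ys) d) (mhom C (as @ ys) d)"
    by metis
  have "is_classifiers C \<lparr>ctens = \<lambda>a b. m [a, b], ctheta = \<lambda>a b. \<theta> [a, b], cunit = m [], cu = \<theta> []\<rparr>"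
    using m(1,2) m(3)[of "[_, _]"] m(3)[of "[]"] by unfold_locales simp_all
  then show ?thesis by blast
qed

lemma short_closed_U_obj: "closed_multi C \<Longrightarrow> short_closed (U_obj C)"
  unfolding closed_multi_def short_closed_def
proof (intro ballI)
  fix b c assume C: "\<forall>b \<in> mobj C. \<forall>c \<in> mobj C. \<exists>h \<in> mobj C. \<exists>e \<in> mhom C [h, b] c.
       \<forall>xs. set xs \<subseteq> mobj C \<longrightarrow> bij_betw (\<lambda>f. msub C [] h [b] xs c e f) (mhom C xs h) (mhom C (xs @ [b]) c)"
    and bc: "b \<in> mobj (U_obj C)" "c \<in> mobj (U_obj C)"
  then obtain h e where h: "h \<in> mobj C" "e \<in> mhom C [h, b] c"
    and bij: "\<And>xs. set xs \<subseteq> mobj C \<Longrightarrow> bij_betw (msub C [] h [b] xs c e) (mhom C xs h) (mhom C (xs @ [b]) c)"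
    by (metis U_obj_simps(1))
  have "bij_betw (msub (U_obj C) [] h [b] xs c e) (mhom (U_obj C) xs h) (mhom (U_obj C) (xs @ [b]) c)"
    if "set xs \<subseteq> mobj C" "length xs \<le> 3" for xs
  proof -
    have "length xs = 0 \<or> length xs = 1 \<or> length xs = 2 \<or> length xs = 3" using that(2) by arith
    then have "short_subst (length ([] @ [h] @ [b])) (length xs)" by (auto simp: short_subst_def proper_subst_def)
    then show ?thesis using bij[OF that(1)] that(2) by (simp only: msub_U_obj) simp
  qed
  then show "\<exists>h \<in> mobj (U_obj C). \<exists>e \<in> mhom (U_obj C) [h, b] c. \<forall>xs. set xs \<subseteq> mobj (U_obj C) \<and> length xs \<le> 3 \<longrightarrow>
      bij_betw (msub (U_obj C) [] h [b] xs c e) (mhom (U_obj C) xs h) (mhom (U_obj C) (xs @ [b]) c)"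
    using h by (intro bexI[of _ h] bexI[of _ e]) simp_all
qed

definition U_mor :: "('o, 'm) multi \<Rightarrow> ('o, 'm) multi_mor \<Rightarrow> ('o, 'm) multi_mor" where
  "U_mor C F = mk_multi_mor (\<lambda>n. n \<le> 4) C (mfun F) (mmap F)"

lemma mk_multi_mor_U_obj: "mk_multi_mor (\<lambda>n. n \<le> 4) (U_obj C) F0 F1 = mk_multi_mor (\<lambda>n. n \<le> 4) C F0 F1"
  by (auto simp: mk_multi_mor_def mhom_U_obj fun_eq_iff)

lemma is_functor_U: "is_functor Multi_lr_cl ShMulti_lr_cl U_lr_cl"
proof -
  have A: "arity_ok False = (\<lambda>n. n \<le> 4)" "arity_ok True = (\<lambda>_. True)" "subst_ok True = (\<lambda>_ _. True)" "subst_ok False = short_subst"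
    by (simp_all add: short_arity long_arity)
  show ?thesis
    unfolding U_lr_cl_def U_mor_def[symmetric]
  proof (rule is_functor_mk_functor)
    show "is_category Multi_lr_cl"
      unfolding mcat_eqs by (rule is_category_mcat) (simp add: A multicategory_def)
    show "is_category ShMulti_lr_cl"
      unfolding mcat_eqs by (rule is_category_mcat) (simp add: A short_multicategory_def)
    fix C D E :: "('o, 'm) multi" and F G :: "('o, 'm) multi_mor"
    show "U_obj C \<in> Obj ShMulti_lr_cl" if "C \<in> Obj Multi_lr_cl"
      using that short_multicategory_U_obj left_representable_classifiers short_closed_U_obj
      by (auto simp: mcat_eqs short_left_representable_def is_classifiers_U_obj)
    show "U_mor C (Id Multi_lr_cl C) = Id ShMulti_lr_cl (U_obj C)" if "C \<in> Obj Multi_lr_cl"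
      unfolding mcat_eqs mcat_simps A U_mor_def id_multi_mor_def mk_multi_mor_U_obj
      by (rule mk_multi_mor_cong) simp_all
    { assume "F \<in> Hom Multi_lr_cl C D"
      then interpret F: multi_morphism "\<lambda>_. True" "\<lambda>_ _. True" C D F by (simp add: mcat_eqs A)
      have list: "mfun F ` set as \<subseteq> mobj D" if "set as \<subseteq> mobj C" for as using that F.mfun_in_mobj by auto
      have "multi_morphism (\<lambda>n. n \<le> 4) short_subst (U_obj C) (U_obj D) (U_mor C F)" if "multicategory C"
        unfolding U_mor_def
      proof
        interpret C: multicategory C by fact
        fix p b s as c g f
        let ?F = "mk_multi_mor (\<lambda>n. n \<le> 4) C (mfun F) (mmap F)"
        assume s: "short_subst (length (p @ [b] @ s)) (length as)"
          and o: "set (p @ [b] @ s) \<subseteq> mobj (U_obj C)" "set as \<subseteq> mobj (U_obj C)" "c \<in> mobj (U_obj C)"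
          and gf: "g \<in> mhom (U_obj C) (p @ [b] @ s) c" "f \<in> mhom (U_obj C) as b"
        have l: "length (p @ as @ s) \<le> 4" "length (p @ [b] @ s) \<le> 4" "length as \<le> 4"
          using subst_ok_arity[of False "length (p @ [b] @ s)" "length as"] s by (simp_all add: short_arity ac_simps)
        have s': "short_subst (length (map (mfun F) p @ [mfun F b] @ map (mfun F) s)) (length (map (mfun F) as))"
          using s by simp
        have o': "set (p @ [b] @ s) \<subseteq> mobj C" "set as \<subseteq> mobj C" "c \<in> mobj C"
          and gf': "g \<in> mhom C (p @ [b] @ s) c" "f \<in> mhom C as b" using o gf l by (simp_all add: mhom_U_obj)
        have "mmap ?F (p @ as @ s) c (msub C p b s as c g f) = mmap F (p @ as @ s) c (msub C p b s as c g f)"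
          using l o' C.msub_in_mhom[OF _ o' gf'] by (intro mmap_mk) auto
        also have "\<dots> = msub D (map (mfun F) p) (mfun F b) (map (mfun F) s) (map (mfun F) as) (mfun F c) (mmap F (p @ [b] @ s) c g) (mmap F as b f)"
          using o' gf' by (intro F.mmap_msub) auto
        finally show "mmap ?F (p @ as @ s) c (msub (U_obj C) p b s as c g f) = msub (U_obj D) (map (mfun ?F) p) (mfun ?F b) (map (mfun ?F) s)
            (map (mfun ?F) as) (mfun ?F c) (mmap ?F (p @ [b] @ s) c g) (mmap ?F as b f)"
          using o' gf' l by (simp add: msub_U_obj[OF s] msub_U_obj[OF s', simplified])
      next
        let ?F = "mk_multi_mor (\<lambda>n. n \<le> 4) C (mfun F) (mmap F)"
        show "?F = mk_multi_mor (\<lambda>n. n \<le> 4) (U_obj C) (mfun ?F) (mmap ?F)"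
          unfolding mk_multi_mor_U_obj by (rule mk_multi_mor_cong) simp_all
        interpret C: multicategory C by fact
        show "mmap ?F [a] a (mid (U_obj C) a) = mid (U_obj D) (mfun ?F a)" if "a \<in> mobj (U_obj C)" for a
          using that by (simp add: F.mmap_mid C.mid_in_mhom)
      qed (use F.mmap_in_mhom F.mfun_in_mobj in \<open>simp_all add: mhom_U_obj\<close>)
      then show "U_mor C F \<in> Hom ShMulti_lr_cl (U_obj C) (U_obj D)" if "C \<in> Obj Multi_lr_cl"
        using that by (simp add: mcat_eqs A)
      show "U_mor C (Comp Multi_lr_cl C D E G F) = Comp ShMulti_lr_cl (U_obj C) (U_obj D) (U_obj E) (U_mor D G) (U_mor C F)"
        unfolding mcat_eqs mcat_simps A U_mor_def comp_multi_mor_def mk_multi_mor_U_obj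
        by (rule mk_multi_mor_cong) (simp_all add: F.mfun_in_mobj list F.mmap_in_mhom) }
  qed
qed

lemma lax_of_U:
  assumes "multi_morphism (\<lambda>_. True) (\<lambda>_ _. True) C D F" "is_classifiers C t" "is_classifiers D t'"
  shows "lax_of (U_obj C) t (U_obj D) t' (U_mor C F) = lax_of C t D t' F"
proof -
  interpret F: multi_morphism "\<lambda>_. True" "\<lambda>_ _. True" C D F by fact
  interpret t: is_classifiers C t by fact
  have "mk_functor (skew_of C t) (mfun (U_mor C F)) (\<lambda>a b f. mmap (U_mor C F) [a] b f) = mk_functor (skew_of C t) (mfun F) (\<lambda>a b f. mmap F [a] b f)"
    by (rule mk_functor_cong) (simp_all add: U_mor_def skew_of_def Let_def)
  then show ?thesis
    by (auto simp: lax_of_def skew_of_U_obj U_mor_def t.ctheta_in_mhom t.ctens_in_mobj t.cunit_in_mobj t.cu_in_mhom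
      msub_U_obj short_subst_def proper_subst_def fun_eq_iff)
qed

text \<open>
  The universal property of \<open>e\<close> for a single input is an adjunction between \<open>V(ab, c)\<close> and \<open>V(a, [b, c])\<close>.
\<close>

lemma closed_transfer:
  fixes C :: "('o, 'm) multi"
  shows "\<lbrakk>short_closed C; lr_multi long C t V\<rbrakk> \<Longrightarrow> closed_skew_mon V" "\<lbrakk>closed_multi C; lr_multi long C t V\<rbrakk> \<Longrightarrow> closed_skew_mon V"
proof -
  assume "lr_multi long C t V"
  then interpret lr_multi long C t V .
  have *: "closed_skew_mon V" if "\<forall>b \<in> mobj C. \<forall>c \<in> mobj C. \<exists>h \<in> mobj C. \<exists>e \<in> mhom C [h, b] c.
       \<forall>xs. set xs \<subseteq> mobj C \<and> length xs \<le> 3 \<longrightarrow> bij_betw (\<lambda>f. msub C [] h [b] xs c e f) (mhom C xs h) (mhom C (xs @ [b]) c)"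
  proof (rule closed_V)
    fix b c assume "b \<in> mobj C" "c \<in> mobj C"
    with that obtain h e where h: "h \<in> mobj C" "e \<in> mhom C [h, b] c"
      and bij: "\<forall>xs. set xs \<subseteq> mobj C \<and> length xs \<le> 3 \<longrightarrow> bij_betw (msub C [] h [b] xs c e) (mhom C xs h) (mhom C (xs @ [b]) c)"
      by blast
    have "\<forall>a \<in> mobj C. bij_betw (msub C [] h [b] [a] c e) (mhom C [a] h) (mhom C [a, b] c)"
      using bij[rule_format, of "[_]"] by simp
    then show "\<exists>h \<in> mobj C. \<exists>e \<in> mhom C [h, b] c. \<forall>a \<in> mobj C. bij_betw (msub C [] h [b] [a] c e) (mhom C [a] h) (mhom C [a, b] c)"
      using h by blast
  qed
  show "short_closed C \<Longrightarrow> closed_skew_mon V"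
    by (rule *) (simp add: short_closed_def)
  show "closed_multi C \<Longrightarrow> closed_skew_mon V"
    by (rule *) (fastforce simp: closed_multi_def)
qed

lemma full_subcat_True: "full_subcat C (\<lambda>_. True) = C"
  by (simp add: full_subcat_def)

text \<open>
  \<open>K\<close>, its restriction and \<open>T\<close> are instances of \<open>skew_of_functor\<close>. They are essentially surjective
  because a left normal skew monoidal category \<open>V\<close> is isomorphic to that of \<open>multi_of V\<close>, and this in turn is
  that of \<open>U_obj (multi_of V)\<close>. Since \<open>T = K U\<close>, \<open>U\<close> is an equivalence by cancellation.
\<close>

lemma equivalences_of_classifiers:
  fixes ch :: "('o, 'm) multi \<Rightarrow> ('o, 'm) classifiers"
  assumes "\<And>C. C \<in> Obj ShMulti_lr \<Longrightarrow> is_classifiers C (ch C)"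
  shows "is_equivalence ShMulti_lr SkMon_ln (K_lr ch)"
    and "is_equivalence ShMulti_lr_cl SkMon_ln_cl (K_lr_cl ch)"
    and "is_equivalence Multi_lr_cl ShMulti_lr_cl
      (U_lr_cl :: (('o, 'm) multi, ('o, 'm) multi_mor, ('o, 'm) multi, ('o, 'm) multi_mor) cat_functor)"
    and "is_equivalence Multi_lr_cl SkMon_ln_cl (T_lr_cl ch)"
    and "T_lr_cl ch = comp_functor Multi_lr_cl (K_lr_cl ch) U_lr_cl"
proof -
  have cl: "is_classifiers C (ch C)" if "short_multicategory C" "short_left_representable C" for C
    using that assms[of C] by (simp add: mcat_eqs)
  have clU: "is_classifiers C (ch (U_obj C))" if C: "multicategory C" "left_representable C" for C
  proof -
    have "is_classifiers (U_obj C) (ch (U_obj C))"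
      using left_representable_classifiers[OF C(2)]
      by (intro cl short_multicategory_U_obj[OF C(1)]) (auto simp: short_left_representable_def is_classifiers_U_obj)
    then show ?thesis by (simp add: is_classifiers_U_obj)
  qed
  have lr: "lr_multi False C (ch C) (skew_of C (ch C))" if "short_multicategory C" "short_left_representable C" for C
    using lr_multi_short[OF that(1) cl[OF that]] .
  have lrU: "lr_multi True C (ch (U_obj C)) (skew_of C (ch (U_obj C)))" if "multicategory C" "left_representable C" for C
    using lr_multi_long[OF that clU[OF that]] .
  have SkMon_ln_cl: "SkMon_ln_cl = full_subcat SkMon_ln closed_skew_mon" by (simp add: SkMon_ln_cl_def)

  have Kcl_eq: "K_lr_cl ch = mk_functor ShMulti_lr_cl (\<lambda>C. skew_of C (ch C)) (\<lambda>C D. lax_of C (ch C) D (ch D))"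
    unfolding K_lr_cl_def restrict_functor_def K_lr_def
    by (rule mk_functor_cong) (simp_all add: mcat_eqs)
  have K: "is_functor ShMulti_lr SkMon_ln (K_lr ch)" "fully_faithful ShMulti_lr SkMon_ln (K_lr ch)"
    using skew_of_functor[of "\<lambda>C. short_multicategory C \<and> short_left_representable C" False ch "\<lambda>_. True"] lr
    by (simp_all add: K_lr_def mcat_eqs full_subcat_True)
  have Kcl: "is_functor ShMulti_lr_cl SkMon_ln_cl (K_lr_cl ch)" "fully_faithful ShMulti_lr_cl SkMon_ln_cl (K_lr_cl ch)"
    using skew_of_functor[of "\<lambda>C. short_multicategory C \<and> short_left_representable C \<and> short_closed C" False ch closed_skew_mon]
      lr closed_transfer(1)
    unfolding Kcl_eq mcat_eqs SkMon_ln_cl by blast+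
  have T: "is_functor Multi_lr_cl SkMon_ln_cl (T_lr_cl ch)" "fully_faithful Multi_lr_cl SkMon_ln_cl (T_lr_cl ch)"
    using skew_of_functor[of "\<lambda>C. multicategory C \<and> left_representable C \<and> closed_multi C" True "\<lambda>C. ch (U_obj C)" closed_skew_mon]
      lrU closed_transfer(2)
    unfolding T_lr_cl_def mcat_eqs SkMon_ln_cl by blast+

  have ess: "multicategory (multi_of V) \<and> left_representable (multi_of V) \<and>
      (\<exists>F. is_iso SkMon_ln (skew_of (multi_of V) (ch (U_obj (multi_of V)))) V F)"
    if "skew_monoidal V" "left_normal V" for V :: "('o, 'm) skew_mon"
  proof -
    interpret left_normal_skew V using that by (simp add: left_normal_skew_def left_normal_skew_axioms_def)
    show ?thesis
      using multicategory_multi_of left_representable_multi_of multi_of_ess clU by blast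
  qed
  have short: "short_multicategory (U_obj (multi_of V)) \<and> short_left_representable (U_obj (multi_of V))"
    if "skew_monoidal V" "left_normal V" for V :: "('o, 'm) skew_mon"
    using ess[OF that] short_multicategory_U_obj clU unfolding short_left_representable_def is_classifiers_U_obj by blast
  have closed: "closed_multi (multi_of V)" if "skew_monoidal V" "closed_skew_mon V" for V :: "('o, 'm) skew_mon"
    using skew_monoidal.closed_multi_of that by blast
  have iso_cl: "is_iso SkMon_ln_cl V W F \<longleftrightarrow> is_iso SkMon_ln V W F" for V W :: "('o, 'm) skew_mon" and F
    by (simp add: is_iso_def SkMon_ln_cl)
  have esK: "ess_surjective ShMulti_lr SkMon_ln (K_lr ch)"
    unfolding ess_surjective_def
  proof
    fix V :: "('o, 'm) skew_mon" assume "V \<in> Obj SkMon_ln"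
    then have V: "skew_monoidal V" "left_normal V" by simp_all
    then show "\<exists>C \<in> Obj ShMulti_lr. \<exists>F. is_iso SkMon_ln (fobj (K_lr ch) C) V F"
      using ess[OF V] short[OF V] by (intro bexI[of _ "U_obj (multi_of V)"]) (simp_all add: K_lr_def mcat_eqs skew_of_U_obj)
  qed
  have esKcl: "ess_surjective ShMulti_lr_cl SkMon_ln_cl (K_lr_cl ch)"
    unfolding ess_surjective_def
  proof
    fix V :: "('o, 'm) skew_mon" assume "V \<in> Obj SkMon_ln_cl"
    then have V: "skew_monoidal V" "left_normal V" "closed_skew_mon V" by (simp_all add: SkMon_ln_cl)
    then show "\<exists>C \<in> Obj ShMulti_lr_cl. \<exists>F. is_iso SkMon_ln_cl (fobj (K_lr_cl ch) C) V F"
      using ess[OF V(1,2)] short[OF V(1,2)] short_closed_U_obj[OF closed[OF V(1,3)]]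
      by (intro bexI[of _ "U_obj (multi_of V)"]) (simp_all add: Kcl_eq mcat_eqs skew_of_U_obj iso_cl)
  qed
  have esT: "ess_surjective Multi_lr_cl SkMon_ln_cl (T_lr_cl ch)"
    unfolding ess_surjective_def
  proof
    fix V :: "('o, 'm) skew_mon" assume "V \<in> Obj SkMon_ln_cl"
    then have V: "skew_monoidal V" "left_normal V" "closed_skew_mon V" by (simp_all add: SkMon_ln_cl)
    then show "\<exists>C \<in> Obj Multi_lr_cl. \<exists>F. is_iso SkMon_ln_cl (fobj (T_lr_cl ch) C) V F"
      using ess[OF V(1,2)] closed[OF V(1,3)]
      by (intro bexI[of _ "multi_of V"]) (simp_all add: T_lr_cl_def mcat_eqs iso_cl)
  qed
  show TKU: "T_lr_cl ch = comp_functor Multi_lr_cl (K_lr_cl ch) U_lr_cl"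
  proof -
    interpret U: is_functor Multi_lr_cl ShMulti_lr_cl U_lr_cl by (rule is_functor_U)
    have U: "fobj U_lr_cl C = U_obj C" if "C \<in> Obj Multi_lr_cl" for C :: "('o, 'm) multi"
      using that by (simp add: U_lr_cl_def)
    have U1: "farr U_lr_cl C D F = U_mor C F" if "C \<in> Obj Multi_lr_cl" "D \<in> Obj Multi_lr_cl" "F \<in> Hom Multi_lr_cl C D" for C D :: "('o, 'm) multi" and F
      using that by (simp add: U_lr_cl_def U_mor_def)
    show ?thesis
      unfolding T_lr_cl_def comp_functor_def
    proof (rule mk_functor_cong)
      fix C :: "('o, 'm) multi" assume C: "C \<in> Obj Multi_lr_cl"
      then show "skew_of C (ch (U_obj C)) = fobj (K_lr_cl ch) (fobj U_lr_cl C)"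
        using U.fobj_in_Obj[OF C] by (simp add: U Kcl_eq skew_of_U_obj)
      fix D F assume D: "D \<in> Obj Multi_lr_cl" and F: "F \<in> Hom Multi_lr_cl C D"
      have "lax_of (U_obj C) (ch (U_obj C)) (U_obj D) (ch (U_obj D)) (U_mor C F) = lax_of C (ch (U_obj C)) D (ch (U_obj D)) F"
        using C D F clU by (intro lax_of_U) (simp_all add: mcat_eqs long_arity)
      then show "lax_of C (ch (U_obj C)) D (ch (U_obj D)) F
          = farr (K_lr_cl ch) (fobj U_lr_cl C) (fobj U_lr_cl D) (farr U_lr_cl C D F)"
        using U.fobj_in_Obj[OF C] U.fobj_in_Obj[OF D] U.farr_in_Hom[OF C D F] C D F by (simp add: U U1 Kcl_eq)
    qed
  qed
  show "is_equivalence ShMulti_lr SkMon_ln (K_lr ch)" "is_equivalence ShMulti_lr_cl SkMon_ln_cl (K_lr_cl ch)"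
    "is_equivalence Multi_lr_cl SkMon_ln_cl (T_lr_cl ch)"
    using is_equivalenceI[OF K esK] is_equivalenceI[OF Kcl esKcl] is_equivalenceI[OF T esT] by simp_all
  show "is_equivalence Multi_lr_cl ShMulti_lr_cl
      (U_lr_cl :: (('o, 'm) multi, ('o, 'm) multi_mor, ('o, 'm) multi, ('o, 'm) multi_mor) cat_functor)"
    using is_equivalence_cancel_left[OF is_functor_U Kcl] T(2) esT TKU by simp
qed

text \<open>
  Whether \<open>U_lr_cl\<close> is an equivalence does not refer to \<open>ch\<close>, and as a constant its type is independent of that of
  \<open>ch\<close> in the theorem. So a choice of classifiers is made anew.
\<close>

lemma is_equivalence_U: "is_equivalence Multi_lr_cl ShMulti_lr_cl U_lr_cl"
  by (rule equivalences_of_classifiers(3)[where ch = "\<lambda>C. SOME t. is_classifiers C t"])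
    (auto simp: mcat_eqs short_left_representable_def intro: someI_ex)

theorem theorem4p7:
  fixes ch :: "('o, 'm) multi \<Rightarrow> ('o, 'm) classifiers"
  assumes "\<And>C. C \<in> Obj ShMulti_lr \<Longrightarrow> is_classifiers C (ch C)"
  shows "is_equivalence ShMulti_lr SkMon_ln (K_lr ch) \<and>
    is_equivalence ShMulti_lr_cl SkMon_ln_cl (K_lr_cl ch) \<and>
    is_equivalence Multi_lr_cl ShMulti_lr_cl U_lr_cl \<and>
    is_equivalence Multi_lr_cl SkMon_ln_cl (T_lr_cl ch) \<and>
    T_lr_cl ch = comp_functor Multi_lr_cl (K_lr_cl ch) U_lr_cl"
  using equivalences_of_classifiers[OF assms] is_equivalence_U by blast

end
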